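(* Let $(A,\mathfrak{m})$ be a local ring and set $n := \dim A$. Then the following are equivalent: (1) The ring $A$ is Cohen-Macaulay. (2) The natural map $H^n(\mathfrak{a};\,A)\to H^n_{\mathfrak{a}}(A)$ from Koszul cohomology to local cohomology is injective for each $\mathfrak{m}$-primary ideal $\mathfrak{a}$ of $A$. (3) The natural map $H^n(\mathfrak{a};\,A)\to H^n_{\mathfrak{a}}(A)$ is injective for some $\mathfrak{m}$-primary ideal $\mathfrak{a}$ of $A$.
   Context: All rings are commutative and Noetherian; a local ring $(A,\mathfrak{m})$ is a Noetherian ring with a unique maximal ideal $\mathfrak{m}$. For an element $z\in A$, let $K^\bullet(z;A)$ be the complex $0\to A\xrightarrow{\,z\,}A\to 0$ and $C^\bullet(z;A)$ the Čech complex $0\to A\to A_z\to 0$, both in cohomological degrees $0,1$. There is a map of complexes $K^\bullet(z;A)\to C^\bullet(z;A)$ given by the identity in degree $0$ and by $a\mapsto a/z$ in degree $1$. For a sequence $\boldsymbol{z}=z_1,\dots,z_t$ put $K^\bullet(\boldsymbol{z};A):=\bigotimes_i K^\bullet(z_i;A)$ (the cohomological Koszul complex) and $C^\bullet(\boldsymbol{z};A):=\bigotimes_i C^\bullet(z_i;A)$ (the Čech complex, whose cohomology is the local cohomology $H^\bullet_{\boldsymbol{z}A}(A)$). The tensor product of the maps $K^\bullet(z_i;A)\to C^\bullet(z_i;A)$ is a map of complexes $K^\bullet(\boldsymbol{z};A)\to C^\bullet(\boldsymbol{z};A)$; the induced maps $H^m(\boldsymbol{z};A)\to H^m_{\boldsymbol{z}A}(A)$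 on cohomology are called the natural maps. For an ideal $\mathfrak{a}$ of $A$, $K^\bullet(\mathfrak{a};A)$ denotes the cohomological Koszul complex on a minimal set of generators of $\mathfrak{a}$, and $H^\bullet(\mathfrak{a};A)$ denotes its cohomology; the natural map $H^m(\mathfrak{a};A)\to H^m_{\mathfrak{a}}(A)$ is the natural map $H^m(\boldsymbol{z};A)\to H^m_{\boldsymbol{z}A}(A)$ for $\boldsymbol{z}$ such a minimal set of generators. *)

theory Defs
  imports "HOL-Algebra.QuotRing" "HOL-Algebra.Ring_Divisibility" "HOL-Library.Extended_Nat"
begin

section \<open>Local rings, dimension, depth, Cohen-Macaulay rings\<close>

locale local_ring = cring R + noetherian_ring R for R (structure) +
  fixes \<mm> :: "'a set"
  assumes max_ideal: "maximalideal \<mm> R"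
    and max_ideal_unique: "maximalideal J R \<Longrightarrow> J = \<mm>"

definition krull_dim :: "('a, 'm) ring_scheme \<Rightarrow> enat" where
  "krull_dim R =
     Sup {enat k | k. \<exists>P. (\<forall>i\<le>k. primeideal (P i) R) \<and> (\<forall>i<k. P i \<subset> P (Suc i))}"

definition regular_on_quotient :: "('a, 'm) ring_scheme \<Rightarrow> 'a set \<Rightarrow> 'a \<Rightarrow> bool" where
  "regular_on_quotient R J x \<longleftrightarrow>
     (\<forall>c\<in>carrier (R Quot J).
        (J +>\<^bsub>R\<^esub> x) \<otimes>\<^bsub>R Quot J\<^esub> c = \<zero>\<^bsub>R Quot J\<^esub> \<longrightarrow> c = \<zero>\<^bsub>R Quot J\<^esub>)"

definition regular_sequence :: "('a, 'm) ring_scheme \<Rightarrow> 'a list \<Rightarrow> bool" where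
  "regular_sequence R xs \<longleftrightarrow>
     set xs \<subseteq> carrier R \<and>
     (\<forall>i<length xs. regular_on_quotient R (Idl\<^bsub>R\<^esub> (set (take i xs))) (xs ! i)) \<and>
     Idl\<^bsub>R\<^esub> (set xs) \<noteq> carrier R"

definition depth :: "('a, 'm) ring_scheme \<Rightarrow> 'a set \<Rightarrow> enat" where
  "depth R I = Sup {enat (length xs) | xs. regular_sequence R xs \<and> set xs \<subseteq> I}"

text \<open>For a local ring \<open>R\<close> with maximal ideal \<open>\<mm>\<close>.\<close>
definition Cohen_Macaulay :: "('a, 'm) ring_scheme \<Rightarrow> 'a set \<Rightarrow> bool" where
  "Cohen_Macaulay R \<mm> \<longleftrightarrow> depth R \<mm> = krull_dim R"

section \<open>Primary ideals and minimal generators\<close>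

definition radical_ideal :: "('a, 'm) ring_scheme \<Rightarrow> 'a set \<Rightarrow> 'a set" where
  "radical_ideal R I = {x \<in> carrier R. \<exists>k::nat. x [^]\<^bsub>R\<^esub> k \<in> I}"

definition primary_ideal :: "('a, 'm) ring_scheme \<Rightarrow> 'a set \<Rightarrow> bool" where
  "primary_ideal R I \<longleftrightarrow>
     ideal I R \<and> I \<noteq> carrier R \<and>
     (\<forall>x\<in>carrier R. \<forall>y\<in>carrier R. x \<otimes>\<^bsub>R\<^esub> y \<in> I \<longrightarrow> x \<in> I \<or> y \<in> radical_ideal R I)"

text \<open>\<open>P\<close>-primary ideals, for a prime ideal \<open>P\<close>.\<close>
definition primary_to :: "('a, 'm) ring_scheme \<Rightarrow> 'a set \<Rightarrow> 'a set \<Rightarrow> bool" where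
  "primary_to R P I \<longleftrightarrow> primary_ideal R I \<and> radical_ideal R I = P"

definition minimal_generators :: "('a, 'm) ring_scheme \<Rightarrow> 'a set \<Rightarrow> 'a list \<Rightarrow> bool" where
  "minimal_generators R I zs \<longleftrightarrow>
     distinct zs \<and> set zs \<subseteq> carrier R \<and> Idl\<^bsub>R\<^esub> (set zs) = I \<and>
     (\<forall>Y. Y \<subset> set zs \<longrightarrow> Idl\<^bsub>R\<^esub> Y \<noteq> I)"

section \<open>Modules\<close>

text \<open>
  The record type of modules extends that of rings. The fields \<^term>\<open>monoid.mult\<close> and
  \<^term>\<open>one\<close> play no role in the locale \<^locale>\<open>module\<close>; they are left unspecified
  where the module at hand is not an algebra.
\<close>

definition self_module :: "('a, 'm) ring_scheme \<Rightarrow> ('a, 'a) module" where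
  "self_module R = \<lparr>carrier = carrier R, monoid.mult = monoid.mult R, one = one R, zero = zero R,
     add = add R, smult = monoid.mult R\<rparr>"

definition zero_module :: "('a, 'b) module \<Rightarrow> ('a, 'b) module" where
  "zero_module M = M\<lparr>carrier := {\<zero>\<^bsub>M\<^esub>}\<rparr>"

definition quot_module :: "('a, 'b) module \<Rightarrow> 'b set \<Rightarrow> ('a, 'b set) module" where
  "quot_module M N = \<lparr>carrier = a_rcosets\<^bsub>M\<^esub> N, monoid.mult = undefined, one = undefined, zero = N,
     add = set_add M, smult = (\<lambda>r X. \<Union>x\<in>X. N +>\<^bsub>M\<^esub> (r \<odot>\<^bsub>M\<^esub> x))\<rparr>"

definition free_module :: "('a, 'm) ring_scheme \<Rightarrow> 'x set \<Rightarrow> ('a, 'x \<Rightarrow> 'a) module" where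
  "free_module R X =
     \<lparr>carrier = {\<phi>. (\<forall>x. \<phi> x \<in> carrier R) \<and>
                    finite {x. \<phi> x \<noteq> \<zero>\<^bsub>R\<^esub>} \<and> {x. \<phi> x \<noteq> \<zero>\<^bsub>R\<^esub>} \<subseteq> X},
      monoid.mult = undefined, one = undefined, zero = (\<lambda>_. \<zero>\<^bsub>R\<^esub>),
      add = (\<lambda>\<phi> \<psi> x. \<phi> x \<oplus>\<^bsub>R\<^esub> \<psi> x), smult = (\<lambda>r \<phi> x. r \<otimes>\<^bsub>R\<^esub> \<phi> x)\<rparr>"

definition free_basis :: "('a, 'm) ring_scheme \<Rightarrow> 'x \<Rightarrow> 'x \<Rightarrow> 'a" where
  "free_basis R x = (\<lambda>y. if y = x then \<one>\<^bsub>R\<^esub> else \<zero>\<^bsub>R\<^esub>)"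

definition prod_module :: "'j set \<Rightarrow> ('j \<Rightarrow> ('a, 'b) module) \<Rightarrow> ('a, 'j \<Rightarrow> 'b) module" where
  "prod_module J M =
     \<lparr>carrier = (\<Pi>\<^sub>E j\<in>J. carrier (M j)), monoid.mult = undefined, one = undefined,
      zero = (\<lambda>j\<in>J. \<zero>\<^bsub>M j\<^esub>), add = (\<lambda>u v. \<lambda>j\<in>J. u j \<oplus>\<^bsub>M j\<^esub> v j),
      smult = (\<lambda>r u. \<lambda>j\<in>J. r \<odot>\<^bsub>M j\<^esub> u j)\<rparr>"

section \<open>Localization\<close>

text \<open>The fraction \<open>a/s\<close>, for a multiplicatively closed set \<open>S\<close> and \<open>s \<in> S\<close>.\<close>
definition frac :: "('a, 'm) ring_scheme \<Rightarrow> 'a set \<Rightarrow> 'a \<Rightarrow> 'a \<Rightarrow> ('a \<times> 'a) set" where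
  "frac R S a s = {(b, t). b \<in> carrier R \<and> t \<in> S \<and>
     (\<exists>u\<in>S. u \<otimes>\<^bsub>R\<^esub> (t \<otimes>\<^bsub>R\<^esub> a \<ominus>\<^bsub>R\<^esub> s \<otimes>\<^bsub>R\<^esub> b) = \<zero>\<^bsub>R\<^esub>)}"

definition localization :: "('a, 'm) ring_scheme \<Rightarrow> 'a set \<Rightarrow> ('a, ('a \<times> 'a) set) module" where
  "localization R S =
     \<lparr>carrier = {frac R S a s | a s. a \<in> carrier R \<and> s \<in> S},
      monoid.mult = (\<lambda>X Y. the_elem ((\<lambda>((a, s), (b, t)). frac R S (a \<otimes>\<^bsub>R\<^esub> b) (s \<otimes>\<^bsub>R\<^esub> t)) ` (X \<times> Y))),
      one = frac R S \<one>\<^bsub>R\<^esub> \<one>\<^bsub>R\<^esub>, zero = frac R S \<zero>\<^bsub>R\<^esub> \<one>\<^bsub>R\<^esub>,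
      add = (\<lambda>X Y. the_elem ((\<lambda>((a, s), (b, t)).
               frac R S (t \<otimes>\<^bsub>R\<^esub> a \<oplus>\<^bsub>R\<^esub> s \<otimes>\<^bsub>R\<^esub> b) (s \<otimes>\<^bsub>R\<^esub> t)) ` (X \<times> Y))),
      smult = (\<lambda>r X. the_elem ((\<lambda>(a, s). frac R S (r \<otimes>\<^bsub>R\<^esub> a) s) ` X))\<rparr>"

definition powers :: "('a, 'm) ring_scheme \<Rightarrow> 'a \<Rightarrow> 'a set" where
  "powers R z = {z [^]\<^bsub>R\<^esub> k | k::nat. True}"

section \<open>Tensor products of finite families of modules\<close>

text \<open>
  A binary tensor product would change the type of elements, and could not be iterated
  along a sequence of arbitrary length. Hence the tensor product of the family
  \<open>(M i)\<^sub>i\<^sub>\<in>\<^sub>I\<close> is constructed in one step: the free module on the set of families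
  \<open>(x i)\<^sub>i\<^sub>\<in>\<^sub>I\<close> with \<open>x i \<in> M i\<close>, modulo the relations of multilinearity.
\<close>

definition tensor_free ::
  "('a, 'm) ring_scheme \<Rightarrow> 'i set \<Rightarrow> ('i \<Rightarrow> ('a, 'b) module) \<Rightarrow> ('a, ('i \<Rightarrow> 'b) \<Rightarrow> 'a) module" where
  "tensor_free R I M = free_module R (\<Pi>\<^sub>E i\<in>I. carrier (M i))"

definition tensor_relations ::
  "('a, 'm) ring_scheme \<Rightarrow> 'i set \<Rightarrow> ('i \<Rightarrow> ('a, 'b) module) \<Rightarrow> (('i \<Rightarrow> 'b) \<Rightarrow> 'a) set" where
  "tensor_relations R I M =
     (let F = tensor_free R I M; X = (\<Pi>\<^sub>E i\<in>I. carrier (M i)) in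
      {free_basis R (x(i := u \<oplus>\<^bsub>M i\<^esub> v))
         \<ominus>\<^bsub>F\<^esub> (free_basis R (x(i := u)) \<oplus>\<^bsub>F\<^esub> free_basis R (x(i := v)))
       | x i u v. x \<in> X \<and> i \<in> I \<and> u \<in> carrier (M i) \<and> v \<in> carrier (M i)} \<union>
      {free_basis R (x(i := r \<odot>\<^bsub>M i\<^esub> u)) \<ominus>\<^bsub>F\<^esub> (r \<odot>\<^bsub>F\<^esub> free_basis R (x(i := u)))
       | x i r u. x \<in> X \<and> i \<in> I \<and> r \<in> carrier R \<and> u \<in> carrier (M i)})"

definition tensor_rel_module ::
  "('a, 'm) ring_scheme \<Rightarrow> 'i set \<Rightarrow> ('i \<Rightarrow> ('a, 'b) module) \<Rightarrow> (('i \<Rightarrow> 'b) \<Rightarrow> 'a) set" where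
  "tensor_rel_module R I M =
     \<Inter>{H. submodule H R (tensor_free R I M) \<and> tensor_relations R I M \<subseteq> H}"

definition tensor ::
  "('a, 'm) ring_scheme \<Rightarrow> 'i set \<Rightarrow> ('i \<Rightarrow> ('a, 'b) module) \<Rightarrow> ('a, (('i \<Rightarrow> 'b) \<Rightarrow> 'a) set) module" where
  "tensor R I M = quot_module (tensor_free R I M) (tensor_rel_module R I M)"

definition pure_tensor ::
  "('a, 'm) ring_scheme \<Rightarrow> 'i set \<Rightarrow> ('i \<Rightarrow> ('a, 'b) module) \<Rightarrow> ('i \<Rightarrow> 'b) \<Rightarrow> (('i \<Rightarrow> 'b) \<Rightarrow> 'a) set" where
  "pure_tensor R I M x = tensor_rel_module R I M +>\<^bsub>tensor_free R I M\<^esub> free_basis R x"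

text \<open>The linear map on the tensor product that is induced by a multilinear map \<open>g\<close> into \<open>N\<close>.\<close>
definition tensor_lift ::
  "('a, 'm) ring_scheme \<Rightarrow> ('a, 'c) module \<Rightarrow> (('i \<Rightarrow> 'b) \<Rightarrow> 'c) \<Rightarrow> (('i \<Rightarrow> 'b) \<Rightarrow> 'a) set \<Rightarrow> 'c" where
  "tensor_lift R N g X =
     the_elem ((\<lambda>\<phi>. \<Oplus>\<^bsub>N\<^esub>x\<in>{x. \<phi> x \<noteq> \<zero>\<^bsub>R\<^esub>}. \<phi> x \<odot>\<^bsub>N\<^esub> g x) ` X)"

text \<open>The tensor product of linear maps \<open>h i\<close> into \<open>N i\<close>.\<close>
definition tensor_map ::
  "('a, 'm) ring_scheme \<Rightarrow> 'i set \<Rightarrow> ('i \<Rightarrow> ('a, 'c) module) \<Rightarrow> ('i \<Rightarrow> 'b \<Rightarrow> 'c) \<Rightarrow>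
     (('i \<Rightarrow> 'b) \<Rightarrow> 'a) set \<Rightarrow> (('i \<Rightarrow> 'c) \<Rightarrow> 'a) set" where
  "tensor_map R I N h =
     tensor_lift R (tensor R I N) (\<lambda>x. pure_tensor R I N (\<lambda>i\<in>I. h i (x i)))"

section \<open>Cochain complexes\<close>

record ('a, 'b) cochain =
  cterm :: "nat \<Rightarrow> ('a, 'b) module"
  cdiff :: "nat \<Rightarrow> 'b \<Rightarrow> 'b"

definition cocycles :: "('a, 'b) cochain \<Rightarrow> nat \<Rightarrow> 'b set" where
  "cocycles C m = {x \<in> carrier (cterm C m). cdiff C m x = \<zero>\<^bsub>cterm C (Suc m)\<^esub>}"

definition coboundaries :: "('a, 'b) cochain \<Rightarrow> nat \<Rightarrow> 'b set" where
  "coboundaries C m =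
     (case m of 0 \<Rightarrow> {\<zero>\<^bsub>cterm C 0\<^esub>} | Suc k \<Rightarrow> cdiff C k ` carrier (cterm C k))"

definition cohomology :: "('a, 'b) cochain \<Rightarrow> nat \<Rightarrow> ('a, 'b set) module" where
  "cohomology C m = quot_module ((cterm C m)\<lparr>carrier := cocycles C m\<rparr>) (coboundaries C m)"

text \<open>The map on cohomology in degree \<open>m\<close> that is induced by a map of complexes
  \<open>\<phi>\<close> with target \<open>D\<close>.\<close>
definition cohomology_map ::
  "('a, 'c) cochain \<Rightarrow> (nat \<Rightarrow> 'b \<Rightarrow> 'c) \<Rightarrow> nat \<Rightarrow> 'b set \<Rightarrow> 'c set" where
  "cohomology_map D \<phi> m X =
     the_elem ((\<lambda>x. coboundaries D m +>\<^bsub>cterm D m\<^esub> \<phi> m x) ` X)"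

text \<open>
  The tensor product of complexes \<open>C 0, \<dots>, C (t - 1)\<close>. In degree \<open>m\<close> it is the direct sum,
  over all \<open>(f 0, \<dots>, f (t - 1))\<close> with sum \<open>m\<close>, of the tensor products of the modules
  \<open>C i\<^bsup>f i\<^esup>\<close>. The differential maps \<open>x 0 \<otimes> \<dots> \<otimes> x (t - 1)\<close>, with \<open>x i\<close> of degree \<open>f i\<close>, to the
  sum of all \<open>(-1)\<^bsup>f 0 + \<dots> + f (i - 1)\<^esup> x 0 \<otimes> \<dots> \<otimes> d (x i) \<otimes> \<dots> \<otimes> x (t - 1)\<close>. It is given below
  by its components at the multidegrees \<open>g\<close>, where the summand for \<open>i\<close> comes from the
  multidegree \<open>f = g(i := g i - 1)\<close>, which agrees with \<open>g\<close> below \<open>i\<close>.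
\<close>

definition multidegrees :: "nat \<Rightarrow> nat \<Rightarrow> (nat \<Rightarrow> nat) set" where
  "multidegrees t m = {f \<in> {..<t} \<rightarrow>\<^sub>E UNIV. (\<Sum>i<t. f i) = m}"

definition tensor_term ::
  "('a, 'm) ring_scheme \<Rightarrow> nat \<Rightarrow> (nat \<Rightarrow> ('a, 'b) cochain) \<Rightarrow> (nat \<Rightarrow> nat) \<Rightarrow>
     ('a, ((nat \<Rightarrow> 'b) \<Rightarrow> 'a) set) module" where
  "tensor_term R t C f = tensor R {..<t} (\<lambda>i. cterm (C i) (f i))"

definition tensor_diff ::
  "('a, 'm) ring_scheme \<Rightarrow> nat \<Rightarrow> (nat \<Rightarrow> ('a, 'b) cochain) \<Rightarrow> nat \<Rightarrow>
     ((nat \<Rightarrow> nat) \<Rightarrow> ((nat \<Rightarrow> 'b) \<Rightarrow> 'a) set) \<Rightarrow> (nat \<Rightarrow> nat) \<Rightarrow> ((nat \<Rightarrow> 'b) \<Rightarrow> 'a) set" where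
  "tensor_diff R t C m \<omega> = (\<lambda>g\<in>multidegrees t (Suc m).
     \<Oplus>\<^bsub>tensor_term R t C g\<^esub>i\<in>{i. i < t \<and> 0 < g i}.
       ((\<ominus>\<^bsub>R\<^esub> \<one>\<^bsub>R\<^esub>) [^]\<^bsub>R\<^esub> (\<Sum>j<i. g j)) \<odot>\<^bsub>tensor_term R t C g\<^esub>
       tensor_map R {..<t} (\<lambda>j. cterm (C j) (g j))
         (\<lambda>j. if j = i then cdiff (C i) (g i - 1) else id) (\<omega> (g(i := g i - 1))))"

definition tensor_complex ::
  "('a, 'm) ring_scheme \<Rightarrow> nat \<Rightarrow> (nat \<Rightarrow> ('a, 'b) cochain) \<Rightarrow>
     ('a, (nat \<Rightarrow> nat) \<Rightarrow> ((nat \<Rightarrow> 'b) \<Rightarrow> 'a) set) cochain" where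
  "tensor_complex R t C =
     \<lparr>cterm = (\<lambda>m. prod_module (multidegrees t m) (tensor_term R t C)),
      cdiff = tensor_diff R t C\<rparr>"

text \<open>The tensor product of maps of complexes \<open>\<phi> i\<close> into \<open>D i\<close>.\<close>
definition tensor_complex_map ::
  "('a, 'm) ring_scheme \<Rightarrow> nat \<Rightarrow> (nat \<Rightarrow> ('a, 'c) cochain) \<Rightarrow> (nat \<Rightarrow> nat \<Rightarrow> 'b \<Rightarrow> 'c) \<Rightarrow> nat \<Rightarrow>
     ((nat \<Rightarrow> nat) \<Rightarrow> ((nat \<Rightarrow> 'b) \<Rightarrow> 'a) set) \<Rightarrow> (nat \<Rightarrow> nat) \<Rightarrow> ((nat \<Rightarrow> 'c) \<Rightarrow> 'a) set" where
  "tensor_complex_map R t D \<phi> m \<omega> = (\<lambda>f\<in>multidegrees t m.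
     tensor_map R {..<t} (\<lambda>i. cterm (D i) (f i)) (\<lambda>i. \<phi> i (f i)) (\<omega> f))"

section \<open>Koszul and Cech complexes\<close>

definition koszul1 :: "('a, 'm) ring_scheme \<Rightarrow> 'a \<Rightarrow> ('a, 'a) cochain" where
  "koszul1 R z =
     \<lparr>cterm = (\<lambda>p. if p \<le> 1 then self_module R else zero_module (self_module R)),
      cdiff = (\<lambda>p x. if p = 0 then z \<otimes>\<^bsub>R\<^esub> x else \<zero>\<^bsub>R\<^esub>)\<rparr>"

text \<open>
  For all terms of this complex to have the same type, the term in degree 0 is the ring
  of fractions \<open>{1}\<^sup>-\<^sup>1R\<close>, which is a copy of \<open>R\<close>: the fraction \<open>a/1\<close> is the singleton of
  \<open>(a, 1)\<close>.
\<close>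
definition cech_denoms :: "('a, 'm) ring_scheme \<Rightarrow> 'a \<Rightarrow> nat \<Rightarrow> 'a set" where
  "cech_denoms R z p = (if p = 0 then {\<one>\<^bsub>R\<^esub>} else powers R z)"

definition cech1 :: "('a, 'm) ring_scheme \<Rightarrow> 'a \<Rightarrow> ('a, ('a \<times> 'a) set) cochain" where
  "cech1 R z =
     \<lparr>cterm = (\<lambda>p. if p \<le> 1 then localization R (cech_denoms R z p)
                   else zero_module (localization R (cech_denoms R z p))),
      cdiff = (\<lambda>p X. if p = 0 then the_elem ((\<lambda>(a, s). frac R (powers R z) a s) ` X)
                     else \<zero>\<^bsub>localization R (powers R z)\<^esub>)\<rparr>"

definition koszul1_to_cech1 :: "('a, 'm) ring_scheme \<Rightarrow> 'a \<Rightarrow> nat \<Rightarrow> 'a \<Rightarrow> ('a \<times> 'a) set" where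
  "koszul1_to_cech1 R z p a =
     (if p = 0 then frac R {\<one>\<^bsub>R\<^esub>} a \<one>\<^bsub>R\<^esub>
      else if p = 1 then frac R (powers R z) a z
      else \<zero>\<^bsub>localization R (powers R z)\<^esub>)"

definition koszul_complex ::
  "('a, 'm) ring_scheme \<Rightarrow> 'a list \<Rightarrow> 
     ('a, (nat \<Rightarrow> nat) \<Rightarrow> ((nat \<Rightarrow> 'a) \<Rightarrow> 'a) set) cochain" where
  "koszul_complex R zs = tensor_complex R (length zs) (\<lambda>i. koszul1 R (zs ! i))"

definition cech_complex ::
  "('a, 'm) ring_scheme \<Rightarrow> 'a list \<Rightarrow> 
     ('a, (nat \<Rightarrow> nat) \<Rightarrow> ((nat \<Rightarrow> ('a \<times> 'a) set) \<Rightarrow> 'a) set) cochain" where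
  "cech_complex R zs = tensor_complex R (length zs) (\<lambda>i. cech1 R (zs ! i))"

definition koszul_to_cech ::
  "('a, 'm) ring_scheme \<Rightarrow> 'a list \<Rightarrow> nat \<Rightarrow>
     ((nat \<Rightarrow> nat) \<Rightarrow> ((nat \<Rightarrow> 'a) \<Rightarrow> 'a) set) \<Rightarrow>
     ((nat \<Rightarrow> nat) \<Rightarrow> ((nat \<Rightarrow> ('a \<times> 'a) set) \<Rightarrow> 'a) set)" where
  "koszul_to_cech R zs =
     tensor_complex_map R (length zs) (\<lambda>i. cech1 R (zs ! i)) (\<lambda>i. koszul1_to_cech1 R (zs ! i))"

definition koszul_cohomology ::
  "('a, 'm) ring_scheme \<Rightarrow> 'a list \<Rightarrow> nat \<Rightarrow>
     ('a, ((nat \<Rightarrow> nat) \<Rightarrow> ((nat \<Rightarrow> 'a) \<Rightarrow> 'a) set) set) module" where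
  "koszul_cohomology R zs m = cohomology (koszul_complex R zs) m"

text \<open>The local cohomology of \<open>R\<close> with support in the ideal generated by \<open>zs\<close> is the cohomology
  of \<^term>\<open>cech_complex R zs\<close>.\<close>
definition natural_map ::
  "('a, 'm) ring_scheme \<Rightarrow> 'a list \<Rightarrow> nat \<Rightarrow>
     ((nat \<Rightarrow> nat) \<Rightarrow> ((nat \<Rightarrow> 'a) \<Rightarrow> 'a) set) set \<Rightarrow>
     ((nat \<Rightarrow> nat) \<Rightarrow> ((nat \<Rightarrow> ('a \<times> 'a) set) \<Rightarrow> 'a) set) set" where
  "natural_map R zs m = cohomology_map (cech_complex R zs) (koszul_to_cech R zs) m"

end

theory Submission
  imports Defs
begin

text \<open>
  Let \<open>z\<close> be a sequence of \<open>t\<close> elements that generates an \<open>\<mm>\<close>-primary ideal, and let \<open>n\<close> be the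
  dimension. The Koszul complex is free of rank one in each squarefree multidegree and zero in the others, so a
  Koszul cochain is a family \<open>c\<close> of ring elements indexed by the subsets \<open>S\<close> of \<open>{..<t}\<close>. The term of the Cech
  complex at \<open>S\<close> is the localization at the product \<open>z\<^sub>S\<close> of the \<open>z i\<close> with \<open>i \<in> S\<close>, so a Cech cochain
  has components \<open>c S / z\<^sub>S\<^sup>k\<close>, with one \<open>k\<close> for all \<open>S\<close>. After clearing denominators, a Koszul cocycle
  \<open>c\<close> maps to a Cech coboundary if and only if, for some \<open>k\<close>, the cochain \<open>z\<^sub>S\<^sup>k c S\<close> is a coboundary
  in the Koszul complex of the sequence of powers \<open>(z i)\<^sup>k\<^sup>+\<^sup>1\<close> (lemma \<open>natural_map_inj_iff\<close>). The theorem
  becomes the statement \<open>Cohen_Macaulay_iff_koszul_injective\<close> on families of ring elements.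

  If the ring is Cohen-Macaulay, take a regular sequence \<open>x\<close> of length \<open>n\<close> in \<open>\<mm>\<close>. A power of every
  \<open>x r\<close> lies in the ideal of the \<open>z i\<close> and therefore kills Koszul cohomology. Dividing a
  cochain by \<open>x r\<close> trades one degree for one more element of the regular sequence that is factored
  out. This proves the vanishing below the depth (\<open>koszul_vanishing\<close>), and, in degree \<open>n\<close>, reduces
  injectivity to degree 0, where there is nothing to prove (\<open>koszul_injective_mod\<close>).

  For the converse the generators have to be replaced by better ones. Local cohomology does not depend on
  generators, but Koszul cohomology does, so two systems of generators are compared on the level of
  cocycles. This is the purpose of the condition \<open>zigzag_injective\<close>. Let \<open>y\<close> be a sequence indexed by the disjoint union of \<open>U\<close> and \<open>W\<close>,
  such that the elements with index in \<open>U\<close> and those with index in \<open>W\<close> generate ideals with the same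
  radical. Then the Cech complexes on \<open>U\<close>, on \<open>W\<close> and on \<open>U \<union> W\<close> compute the same
  cohomology, so a Koszul cocycle on \<open>U \<union> W\<close> restricts to classes on \<open>U\<close> and on \<open>W\<close>
  with the same image in local cohomology. The condition says that the class on \<open>U\<close> vanishes whenever the class on \<open>W\<close>
  does. It follows from injectivity of the natural map for \<open>U\<close> (\<open>koszul_injective_zigzag\<close>), it is preserved by
  elementary operations on the generators with index in \<open>U\<close> (\<open>zigzag_injective_elementary\<close>), and a
  generator that lies in the radical of the others can be dropped (\<open>zigzag_injective_remove\<close>).
  By prime avoidance and Krull's height theorem, elementary operations reach a sequence whose first
  \<open>n\<close> elements already generate an \<open>\<mm>\<close>-primary ideal (\<open>general_position\<close>), and all others are
  dropped. For \<open>n\<close> elements \<open>x\<close> the condition, applied to a sequence with the powers \<open>(x i)\<^sup>k\<^sup>+\<^sup>1\<close> on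
  \<open>W\<close>, says that \<open>r (x 0 \<dots> x (n - 1))\<^sup>k \<in> ((x i)\<^sup>k\<^sup>+\<^sup>1)\<close> implies \<open>r \<in> (x i)\<close>
  (\<open>zigzag_injective_limit_closed\<close>). By a monomial argument and Krull's intersection theorem such
  a sequence is regular (\<open>limit_closed_regular_sequence\<close>), so the depth is \<open>n\<close>.
\<close>

section \<open>Ideals and primes of a Noetherian ring\<close>

locale noetherian_cring = cring R + noetherian_ring R for R (structure)

context cring begin

definition adjoin :: "'a set \<Rightarrow> 'a \<Rightarrow> 'a set" where
  "adjoin I x = {a \<oplus> b \<otimes> x | a b. a \<in> I \<and> b \<in> carrier R}"

lemma ideal_subset: "ideal I R \<Longrightarrow> I \<subseteq> carrier R"
  using ideal.Icarr by fastforce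

lemma ideal_add: "ideal I R \<Longrightarrow> a \<in> I \<Longrightarrow> b \<in> I \<Longrightarrow> a \<oplus> b \<in> I"
  by (intro additive_subgroup.a_closed) (auto intro: ideal.axioms(1))

lemma ideal_minus: "ideal I R \<Longrightarrow> a \<in> I \<Longrightarrow> b \<in> I \<Longrightarrow> a \<ominus> b \<in> I"
  unfolding a_minus_def by (intro additive_subgroup.a_closed additive_subgroup.a_inv_closed) (auto intro: ideal.axioms(1))

lemma ideal_lmult: "ideal I R \<Longrightarrow> a \<in> I \<Longrightarrow> r \<in> carrier R \<Longrightarrow> r \<otimes> a \<in> I"
  by (simp add: ideal.I_l_closed)

lemma ideal_rmult: "ideal I R \<Longrightarrow> a \<in> I \<Longrightarrow> r \<in> carrier R \<Longrightarrow> a \<otimes> r \<in> I"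
  by (simp add: ideal.I_r_closed)

lemma ideal_zero: "ideal I R \<Longrightarrow> \<zero> \<in> I"
  by (intro additive_subgroup.zero_closed) (auto intro: ideal.axioms(1))

lemma idealI_closed:
  assumes "I \<subseteq> carrier R" "\<zero> \<in> I" "\<And>a b. a \<in> I \<Longrightarrow> b \<in> I \<Longrightarrow> a \<oplus> b \<in> I"
    "\<And>a r. a \<in> I \<Longrightarrow> r \<in> carrier R \<Longrightarrow> r \<otimes> a \<in> I"
  shows "ideal I R"
proof (rule idealI[OF ring_axioms])
  show "subgroup I (add_monoid R)"
  proof (rule group.subgroupI[OF a_group])
    show "I \<noteq> {}" using assms(2) by auto
    fix a assume a: "a \<in> I"
    have "\<ominus> \<one> \<otimes> a \<in> I" using a assms(4) by simp
    moreover have "\<ominus> \<one> \<otimes> a = \<ominus> a" using a assms(1) l_minus by auto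
    ultimately show "inv\<^bsub>add_monoid R\<^esub> a \<in> I" by (simp add: a_inv_def)
  qed (use assms in auto)
  fix a x assume "a \<in> I" "x \<in> carrier R"
  then show "x \<otimes> a \<in> I" "a \<otimes> x \<in> I" using assms(1,4) m_comm by (auto simp: subset_iff)
qed

lemma adjoin_ideal:
  assumes I: "ideal I R" and x: "x \<in> carrier R"
  shows "ideal (adjoin I x) R"
proof (rule idealI_closed)
  note Ic = ideal.Icarr[OF I]
  show "adjoin I x \<subseteq> carrier R" using Ic x by (auto simp: adjoin_def)
  have "\<zero> = \<zero> \<oplus> \<zero> \<otimes> x" using x by simp
  then show "\<zero> \<in> adjoin I x" unfolding adjoin_def using ideal_zero[OF I] by blast
  fix a b assume "a \<in> adjoin I x" "b \<in> adjoin I x"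
  then obtain a1 a2 b1 b2 where ab: "a = a1 \<oplus> a2 \<otimes> x" "b = b1 \<oplus> b2 \<otimes> x" "a1 \<in> I" "b1 \<in> I" "a2 \<in> carrier R" "b2 \<in> carrier R"
    by (auto simp: adjoin_def)
  have "a \<oplus> b = (a1 \<oplus> b1) \<oplus> (a2 \<oplus> b2) \<otimes> x" using ab Ic x by algebra
  then show "a \<oplus> b \<in> adjoin I x" unfolding adjoin_def using ab ideal_add[OF I] by blast
next
  note Ic = ideal.Icarr[OF I]
  fix a r assume "a \<in> adjoin I x" and r: "r \<in> carrier R"
  then obtain a1 a2 where ab: "a = a1 \<oplus> a2 \<otimes> x" "a1 \<in> I" "a2 \<in> carrier R"
    by (auto simp: adjoin_def)
  have "r \<otimes> a = (r \<otimes> a1) \<oplus> (r \<otimes> a2) \<otimes> x" using ab Ic x r by algebra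
  then show "r \<otimes> a \<in> adjoin I x" unfolding adjoin_def using ab ideal_lmult[OF I] r by blast
qed

lemma adjoin_superset: "ideal I R \<Longrightarrow> x \<in> carrier R \<Longrightarrow> I \<subseteq> adjoin I x"
proof
  fix a assume I: "ideal I R" "x \<in> carrier R" "a \<in> I"
  then have "a = a \<oplus> \<zero> \<otimes> x" by (simp add: ideal.Icarr)
  then show "a \<in> adjoin I x" unfolding adjoin_def using I by blast
qed

lemma adjoin_self: "ideal I R \<Longrightarrow> x \<in> carrier R \<Longrightarrow> x \<in> adjoin I x"
proof -
  assume I: "ideal I R" "x \<in> carrier R"
  then have "x = \<zero> \<oplus> \<one> \<otimes> x" by simp
  then show "x \<in> adjoin I x" unfolding adjoin_def using I ideal_zero by blast
qed

lemma adjoin_minimal: "ideal J R \<Longrightarrow> I \<subseteq> J \<Longrightarrow> x \<in> J \<Longrightarrow> adjoin I x \<subseteq> J"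
  by (auto simp: adjoin_def intro!: ideal_add ideal_lmult)

lemma adjoin_mono: "I \<subseteq> J \<Longrightarrow> adjoin I x \<subseteq> adjoin J x"
  by (auto simp: adjoin_def)

lemma Idl_insert:
  assumes "X \<subseteq> carrier R" "x \<in> carrier R"
  shows "Idl (insert x X) = adjoin (Idl X) x"
proof
  have i: "ideal (Idl X) R" by (rule genideal_ideal[OF assms(1)])
  have "X \<subseteq> Idl X" by (rule genideal_self[OF assms(1)])
  then show "Idl (insert x X) \<subseteq> adjoin (Idl X) x"
    using adjoin_superset[OF i assms(2)] adjoin_self[OF i assms(2)]
    by (intro genideal_minimal adjoin_ideal i assms) blast
  have i2: "ideal (Idl (insert x X)) R" using assms by (intro genideal_ideal) auto
  have s: "insert x X \<subseteq> Idl (insert x X)" using assms by (intro genideal_self) auto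
  show "adjoin (Idl X) x \<subseteq> Idl (insert x X)"
    by (rule adjoin_minimal[OF i2 genideal_minimal[OF i2]]) (use s in auto)
qed

lemma Idl_empty: "Idl {} = {\<zero>}"
proof
  show "Idl {} \<subseteq> {\<zero>}" by (rule genideal_minimal[OF zeroideal]) auto
  show "{\<zero>} \<subseteq> Idl {}" using ideal_zero[OF genideal_ideal[of "{}"]] by auto
qed

lemma prime_pow:
  assumes "primeideal P R" "x \<in> carrier R" "x [^] (k::nat) \<in> P" shows "x \<in> P"
  using assms(3)
proof (induction k)
  case 0
  then show ?case using primeideal.I_notcarr[OF assms(1)] ideal.one_imp_carrier[OF primeideal.axioms(1)[OF assms(1)]] by simp
next
  case (Suc k)
  then show ?case using primeideal.I_prime[OF assms(1), of "x [^] k" x] assms(2) by auto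
qed

lemma prime_ideal: "primeideal P R \<Longrightarrow> ideal P R" by (rule primeideal.axioms(1))

lemma prime_one: "primeideal P R \<Longrightarrow> \<one> \<notin> P"
  using primeideal.I_notcarr ideal.one_imp_carrier prime_ideal by metis

end

context noetherian_cring begin

lemma ideals_have_maximal:
  assumes "A \<noteq> {}" "\<And>I. I \<in> A \<Longrightarrow> ideal I R"
  shows "\<exists>M\<in>A. \<forall>N\<in>A. M \<subseteq> N \<longrightarrow> N = M"
proof (rule subset_Zorn_nonempty[OF assms(1)])
  fix C assume C: "C \<noteq> {}" "subset.chain A C"
  then have "subset.chain {I. ideal I R} C" using assms(2) by (auto simp: pred_on.chain_def)
  then have "\<Union>C \<in> C" using ideal_chain_is_trivial C by blast
  then show "\<Union>C \<in> A" using C by (auto simp: pred_on.chain_def)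
qed

lemma ideal_noetherian_induct:
  assumes "ideal I R" and step: "\<And>I. ideal I R \<Longrightarrow> (\<And>J. ideal J R \<Longrightarrow> I \<subset> J \<Longrightarrow> Q J) \<Longrightarrow> Q I"
  shows "Q I"
proof (rule ccontr)
  assume "\<not> Q I"
  then have "\<exists>M\<in>{J. ideal J R \<and> \<not> Q J}. \<forall>N\<in>{J. ideal J R \<and> \<not> Q J}. M \<subseteq> N \<longrightarrow> N = M"
    using assms(1) by (intro ideals_have_maximal) auto
  then obtain M where "ideal M R" "\<not> Q M" "\<And>N. ideal N R \<Longrightarrow> \<not> Q N \<Longrightarrow> M \<subseteq> N \<Longrightarrow> N = M" by blast
  then show False using step[of M] by blast
qed

text \<open>
  An ideal that is maximal among those containing \<open>I\<close> and missing \<open>S\<close> is prime: if neither \<open>a\<close> nor \<open>b\<close> belonged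
  to it, then both enlarged ideals would meet \<open>S\<close>, and so would the product of the two.
\<close>

lemma exists_prime_avoiding:
  assumes I: "ideal I R" and S: "S \<subseteq> carrier R" "S \<noteq> {}" "\<And>a b. a \<in> S \<Longrightarrow> b \<in> S \<Longrightarrow> a \<otimes> b \<in> S"
    and disj: "I \<inter> S = {}"
  shows "\<exists>P. primeideal P R \<and> I \<subseteq> P \<and> P \<inter> S = {}"
proof -
  let ?A = "{J. ideal J R \<and> I \<subseteq> J \<and> J \<inter> S = {}}"
  have "\<exists>M\<in>?A. \<forall>N\<in>?A. M \<subseteq> N \<longrightarrow> N = M" by (rule ideals_have_maximal) (use I disj in auto)
  then obtain M where MA: "M \<in> ?A" and mx': "\<forall>N\<in>?A. M \<subseteq> N \<longrightarrow> N = M" by (elim bexE)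
  have M: "ideal M R" "I \<subseteq> M" "M \<inter> S = {}" using MA by auto
  have mx: "N = M" if "ideal N R" "I \<subseteq> N" "N \<inter> S = {}" "M \<subseteq> N" for N
    using mx' that by auto
  note Mc = ideal.Icarr[OF M(1)]
  have hit: "\<exists>s\<in>S. s \<in> adjoin M a" if "a \<in> carrier R" "a \<notin> M" for a
    using mx[OF adjoin_ideal[OF M(1) that(1)]] adjoin_superset[OF M(1) that(1)] adjoin_self[OF M(1) that(1)] M(2) that(2)
    by blast
  have "primeideal M R"
  proof (rule primeidealI[OF M(1) is_cring])
    show "carrier R \<noteq> M" using S M(3) by auto
    fix a b assume ab: "a \<in> carrier R" "b \<in> carrier R" "a \<otimes> b \<in> M"
    show "a \<in> M \<or> b \<in> M"
    proof (rule ccontr)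
      assume "\<not> (a \<in> M \<or> b \<in> M)"
      then obtain s t where st: "s \<in> S" "s \<in> adjoin M a" "t \<in> S" "t \<in> adjoin M b" using hit ab by blast
      obtain m r m' r' where e: "s = m \<oplus> r \<otimes> a" "t = m' \<oplus> r' \<otimes> b" "m \<in> M" "m' \<in> M" "r \<in> carrier R" "r' \<in> carrier R"
        using st by (auto simp: adjoin_def)
      have "s \<otimes> t = (m' \<oplus> r' \<otimes> b) \<otimes> m \<oplus> (r \<otimes> a) \<otimes> m' \<oplus> (r \<otimes> r') \<otimes> (a \<otimes> b)"
        using e(1,2,5,6) ab(1,2) Mc[OF e(3)] Mc[OF e(4)] by algebra
      also have "\<dots> \<in> M"
        using e ab Mc ideal_lmult[OF M(1) ab(3)] ideal_lmult[OF M(1) e(3)] ideal_lmult[OF M(1) e(4)]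
        by (intro ideal_add[OF M(1)]) auto
      finally show False using st S M(3) by auto
    qed
  qed
  then show ?thesis using M by blast
qed

lemma radical_by_primes:
  assumes I: "ideal I R" and y: "y \<in> carrier R" and all: "\<And>P. primeideal P R \<Longrightarrow> I \<subseteq> P \<Longrightarrow> y \<in> P"
  shows "\<exists>k::nat. y [^] k \<in> I"
proof (rule ccontr)
  assume *: "\<not> ?thesis"
  let ?S = "{y [^] k | k::nat. True}"
  have "\<exists>P. primeideal P R \<and> I \<subseteq> P \<and> P \<inter> ?S = {}"
    by (rule exists_prime_avoiding[OF I]) (use y * nat_pow_mult in auto)
  then obtain P where P: "primeideal P R" "I \<subseteq> P" "P \<inter> ?S = {}" by blast
  have "y [^] (1::nat) = y" using y by simp
  then have "y \<in> ?S" by (metis (mono_tags, lifting) mem_Collect_eq)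
  then show False using all P by blast
qed

lemma proper_ideal_in_prime:
  assumes "ideal I R" "I \<noteq> carrier R" shows "\<exists>P. primeideal P R \<and> I \<subseteq> P"
  using exists_prime_avoiding[of I "{\<one>}"] assms ideal.one_imp_carrier by auto

text \<open>
  Noetherian induction. If \<open>a \<otimes> b \<in> I\<close> with \<open>a\<close> and \<open>b\<close> outside \<open>I\<close>, then every prime above \<open>I\<close> lies above one of the
  larger ideals \<open>I + Ra\<close> and \<open>I + Rb\<close>, so the union of the finite sets for these two serves for \<open>I\<close>.
\<close>

lemma finitely_many_primes_below:
  assumes "ideal I R"
  shows "\<exists>A. finite A \<and> (\<forall>Q\<in>A. primeideal Q R \<and> I \<subseteq> Q) \<and> (\<forall>P. primeideal P R \<and> I \<subseteq> P \<longrightarrow> (\<exists>Q\<in>A. Q \<subseteq> P))"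
  using assms
proof (rule ideal_noetherian_induct)
  fix I assume I: "ideal I R"
    and IH: "\<And>J. ideal J R \<Longrightarrow> I \<subset> J \<Longrightarrow> \<exists>A. finite A \<and> (\<forall>Q\<in>A. primeideal Q R \<and> J \<subseteq> Q) \<and> (\<forall>P. primeideal P R \<and> J \<subseteq> P \<longrightarrow> (\<exists>Q\<in>A. Q \<subseteq> P))"
  show "\<exists>A. finite A \<and> (\<forall>Q\<in>A. primeideal Q R \<and> I \<subseteq> Q) \<and> (\<forall>P. primeideal P R \<and> I \<subseteq> P \<longrightarrow> (\<exists>Q\<in>A. Q \<subseteq> P))"
  proof (cases "primeideal I R \<or> I = carrier R")
    case True
    then show ?thesis
    proof
      assume "primeideal I R" then show ?thesis by (intro exI[of _ "{I}"]) auto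
    next
      assume "I = carrier R"
      then have "\<not> (primeideal P R \<and> I \<subseteq> P)" for P using prime_one by auto
      then show ?thesis by (intro exI[of _ "{}"]) auto
    qed
  next
    case False
    have "\<exists>a b. a \<in> carrier R \<and> b \<in> carrier R \<and> a \<otimes> b \<in> I \<and> a \<notin> I \<and> b \<notin> I"
    proof (rule ccontr)
      assume "\<nexists>a b. a \<in> carrier R \<and> b \<in> carrier R \<and> a \<otimes> b \<in> I \<and> a \<notin> I \<and> b \<notin> I"
      then have "primeideal I R" by (intro primeidealI[OF I is_cring]) (use False in auto)
      then show False using False by simp
    qed
    then obtain a b where ab: "a \<in> carrier R" "b \<in> carrier R" "a \<otimes> b \<in> I" "a \<notin> I" "b \<notin> I" by blast
    have ex: "\<exists>A. finite A \<and> (\<forall>Q\<in>A. primeideal Q R \<and> adjoin I c \<subseteq> Q) \<and> (\<forall>P. primeideal P R \<and> adjoin I c \<subseteq> P \<longrightarrow> (\<exists>Q\<in>A. Q \<subseteq> P))"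
      if "c \<in> carrier R" "c \<notin> I" for c
      using IH[OF adjoin_ideal[OF I that(1)]] adjoin_superset[OF I that(1)] adjoin_self[OF I that(1)] that(2) by blast
    obtain A where A: "finite A" "\<forall>Q\<in>A. primeideal Q R \<and> adjoin I a \<subseteq> Q" "\<forall>P. primeideal P R \<and> adjoin I a \<subseteq> P \<longrightarrow> (\<exists>Q\<in>A. Q \<subseteq> P)"
      using ex ab by meson
    obtain B where B: "finite B" "\<forall>Q\<in>B. primeideal Q R \<and> adjoin I b \<subseteq> Q" "\<forall>P. primeideal P R \<and> adjoin I b \<subseteq> P \<longrightarrow> (\<exists>Q\<in>B. Q \<subseteq> P)"
      using ex ab by meson
    show ?thesis
    proof (intro exI[of _ "A \<union> B"] conjI allI impI ballI)
      show "finite (A \<union> B)" using A B by simp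
      show "primeideal Q R" if "Q \<in> A \<union> B" for Q using that A B by auto
      show "I \<subseteq> Q" if "Q \<in> A \<union> B" for Q
        using that A(2) B(2) adjoin_superset[OF I ab(1)] adjoin_superset[OF I ab(2)] by (meson UnE subset_trans)
      fix P assume P: "primeideal P R \<and> I \<subseteq> P"
      then have "a \<in> P \<or> b \<in> P" using primeideal.I_prime[of P R a b] ab by auto
      then show "\<exists>Q\<in>A \<union> B. Q \<subseteq> P"
        using A(3) B(3) P adjoin_minimal[OF prime_ideal, of P I] by (metis UnI1 UnI2)
    qed
  qed
qed

lemma finitely_many_minimal_primes:
  assumes I: "ideal I R"
  obtains A where "finite A" "\<And>Q. Q \<in> A \<Longrightarrow> primeideal Q R" "\<And>Q. Q \<in> A \<Longrightarrow> I \<subseteq> Q"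
    "\<And>P. primeideal P R \<Longrightarrow> I \<subseteq> P \<Longrightarrow> \<exists>Q\<in>A. Q \<subseteq> P" "\<And>Q Q'. Q \<in> A \<Longrightarrow> Q' \<in> A \<Longrightarrow> Q \<subseteq> Q' \<Longrightarrow> Q = Q'"
proof -
  obtain A where A: "finite A" "\<forall>Q\<in>A. primeideal Q R \<and> I \<subseteq> Q" "\<forall>P. primeideal P R \<and> I \<subseteq> P \<longrightarrow> (\<exists>Q\<in>A. Q \<subseteq> P)"
    using finitely_many_primes_below[OF I] by blast
  define B where "B = {Q \<in> A. \<forall>Q'\<in>A. Q' \<subseteq> Q \<longrightarrow> Q' = Q}"
  show ?thesis
  proof (rule that[of B])
    fix P assume P: "primeideal P R" "I \<subseteq> P"
    then obtain Q where Q: "Q \<in> A" "Q \<subseteq> P" using A by blast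
    have "finite {Q' \<in> A. Q' \<subseteq> Q}" "{Q' \<in> A. Q' \<subseteq> Q} \<noteq> {}" using A Q by auto
    then obtain M where M: "M \<in> {Q' \<in> A. Q' \<subseteq> Q}" "\<forall>b\<in>{Q' \<in> A. Q' \<subseteq> Q}. b \<subseteq> M \<longrightarrow> M = b"
      using finite_has_minimal[of "{Q' \<in> A. Q' \<subseteq> Q}"] by blast
    have "M \<in> B" unfolding B_def
    proof (intro CollectI conjI ballI impI)
      show "M \<in> A" using M by simp
      fix Q' assume "Q' \<in> A" "Q' \<subseteq> M"
      then show "Q' = M" using M by auto
    qed
    then show "\<exists>Q\<in>B. Q \<subseteq> P" using M Q by blast
  next
    show "Q = Q'" if "Q \<in> B" "Q' \<in> B" "Q \<subseteq> Q'" for Q Q' using that by (simp add: B_def)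
  qed (use A in \<open>simp_all add: B_def\<close>)
qed

end

section \<open>Prime avoidance and chains of primes\<close>

context cring begin

lemma ideal_prod_avoid:
  assumes "finite A" "\<And>Q. Q \<in> A \<Longrightarrow> primeideal Q R" "primeideal P R" "\<And>Q. Q \<in> A \<Longrightarrow> \<not> Q \<subseteq> P"
    and I: "ideal I R" "\<not> I \<subseteq> P"
  shows "\<exists>v\<in>I. v \<notin> P \<and> (\<forall>Q\<in>A. v \<in> Q)"
  using assms(1,2,4)
proof (induction A)
  case empty
  then show ?case using I by auto
next
  case (insert Q A)
  then obtain v where v: "v \<in> I" "v \<notin> P" "\<forall>Q\<in>A. v \<in> Q" by auto
  obtain q where q: "q \<in> Q" "q \<notin> P" using insert.prems by blast
  have Q: "ideal Q R" using insert.prems prime_ideal by simp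
  have c: "v \<in> carrier R" "q \<in> carrier R" using ideal.Icarr[OF I(1)] ideal.Icarr[OF Q] v q by auto
  have "q \<otimes> v \<notin> P" using primeideal.I_prime[OF assms(3)] c q v by blast
  moreover have "q \<otimes> v \<in> I" using ideal_lmult I v c by auto
  moreover have "\<forall>Q'\<in>insert Q A. q \<otimes> v \<in> Q'"
    using ideal_rmult[OF Q q(1)] c v ideal_lmult prime_ideal insert.prems by auto
  ultimately show ?case by blast
qed

text \<open>
  Prime avoidance for a coset \<open>x + I\<close>. The primes are treated one at a time. If the current \<open>x \<oplus> w\<close> lies in the new
  prime \<open>P\<close>, it is corrected by an element of \<open>I\<close> that lies in all earlier primes but not in \<open>P\<close>; such an
  element exists because the primes are incomparable.
\<close>

lemma coset_prime_avoidance: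
  assumes "finite A" "\<And>Q. Q \<in> A \<Longrightarrow> primeideal Q R" "\<And>Q Q'. Q \<in> A \<Longrightarrow> Q' \<in> A \<Longrightarrow> Q \<subseteq> Q' \<Longrightarrow> Q = Q'"
    and x: "x \<in> carrier R" and I: "ideal I R"
    and "\<And>Q. Q \<in> A \<Longrightarrow> \<not> (I \<subseteq> Q \<and> x \<in> Q)"
  shows "\<exists>w\<in>I. \<forall>Q\<in>A. x \<oplus> w \<notin> Q"
  using assms(1-3,6)
proof (induction A)
  case empty
  then show ?case using ideal_zero[OF I] by auto
next
  case (insert P A)
  obtain w where w: "w \<in> I" "\<forall>Q\<in>A. x \<oplus> w \<notin> Q" using insert.IH insert.prems by (metis insertI2)
  have wc: "w \<in> carrier R" using ideal.Icarr[OF I w(1)] .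
  have P: "primeideal P R" "ideal P R" using insert.prems prime_ideal by auto
  show ?case
  proof (cases "x \<oplus> w \<in> P")
    case False
    then show ?thesis using w by auto
  next
    case True
    have "\<not> I \<subseteq> P"
    proof
      assume IP: "I \<subseteq> P"
      then have "(x \<oplus> w) \<ominus> w \<in> P" using ideal_minus[OF P(2)] True w by auto
      moreover have "(x \<oplus> w) \<ominus> w = x" using x wc by algebra
      ultimately show False using insert.prems IP by auto
    qed
    moreover have "\<not> Q \<subseteq> P" if "Q \<in> A" for Q using insert that by auto
    ultimately obtain v where v: "v \<in> I" "v \<notin> P" "\<forall>Q\<in>A. v \<in> Q"
      using ideal_prod_avoid[of A P I] insert P I by (metis insertI2)
    have vc: "v \<in> carrier R" using ideal.Icarr[OF I v(1)] .
    have "x \<oplus> (w \<oplus> v) \<notin> P"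
    proof
      assume "x \<oplus> (w \<oplus> v) \<in> P"
      then have "(x \<oplus> (w \<oplus> v)) \<ominus> (x \<oplus> w) \<in> P" using ideal_minus[OF P(2)] True v w by auto
      moreover have "(x \<oplus> (w \<oplus> v)) \<ominus> (x \<oplus> w) = v" using x wc vc by algebra
      ultimately show False using v by simp
    qed
    moreover have "x \<oplus> (w \<oplus> v) \<notin> Q" if Q: "Q \<in> A" for Q
    proof
      assume "x \<oplus> (w \<oplus> v) \<in> Q"
      then have "(x \<oplus> (w \<oplus> v)) \<ominus> v \<in> Q" using ideal_minus[OF prime_ideal[OF insert.prems(1)]] v Q by auto
      moreover have "(x \<oplus> (w \<oplus> v)) \<ominus> v = x \<oplus> w" using x wc vc by algebra
      ultimately show False using w Q by simp
    qed
    ultimately show ?thesis using ideal_add[OF I w(1) v(1)] by (intro bexI[of _ "w \<oplus> v"]) auto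
  qed
qed

text \<open>
  The height of \<open>P\<close> is at least \<open>k\<close>.
\<close>

definition prime_chain_to :: "'a set \<Rightarrow> nat \<Rightarrow> bool" where
  "prime_chain_to P k \<longleftrightarrow> (\<exists>p. (\<forall>i\<le>k. primeideal (p i) R) \<and> (\<forall>i<k. p i \<subset> p (Suc i)) \<and> p k = P)"

lemma prime_chain_to_0: "primeideal P R \<Longrightarrow> prime_chain_to P 0"
  by (auto simp: prime_chain_to_def)

lemma prime_chain_to_prime: "prime_chain_to P k \<Longrightarrow> primeideal P R"
  by (auto simp: prime_chain_to_def)

lemma prime_chain_to_Suc:
  assumes "prime_chain_to Q k" "primeideal P R" "Q \<subset> P" shows "prime_chain_to P (Suc k)"
proof -
  obtain p where p: "\<forall>i\<le>k. primeideal (p i) R" "\<forall>i<k. p i \<subset> p (Suc i)" "p k = Q"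
    using assms by (auto simp: prime_chain_to_def)
  show ?thesis unfolding prime_chain_to_def
    by (rule exI[of _ "p(Suc k := P)"]) (use p assms in \<open>auto simp: less_Suc_eq le_Suc_eq\<close>)
qed

lemma prime_chain_to_SucE:
  assumes "prime_chain_to P (Suc k)" obtains Q where "prime_chain_to Q k" "Q \<subset> P"
proof -
  obtain p where p: "\<forall>i\<le>Suc k. primeideal (p i) R" "\<forall>i<Suc k. p i \<subset> p (Suc i)" "p (Suc k) = P"
    using assms by (auto simp: prime_chain_to_def)
  have "prime_chain_to (p k) k" unfolding prime_chain_to_def by (rule exI[of _ p]) (use p in auto)
  moreover have "p k \<subset> P" using p by auto
  ultimately show ?thesis using that by blast
qed

lemma prime_chain_to_mono:
  assumes "prime_chain_to Q k" "primeideal P R" "Q \<subseteq> P" shows "prime_chain_to P k"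
proof (cases k)
  case 0 then show ?thesis using prime_chain_to_0 assms by simp
next
  case (Suc j)
  then obtain Q' where "prime_chain_to Q' j" "Q' \<subset> Q" using prime_chain_to_SucE assms by metis
  then show ?thesis using prime_chain_to_Suc[of Q' j P] assms Suc by auto
qed

lemma prime_chain_to_le:
  assumes "prime_chain_to P k" "j \<le> k" shows "prime_chain_to P j"
  using assms
proof (induction k arbitrary: P)
  case 0 then show ?case by simp
next
  case (Suc k)
  show ?case
  proof (cases "j = Suc k")
    case True then show ?thesis using Suc by simp
  next
    case False
    obtain Q where Q: "prime_chain_to Q k" "Q \<subset> P" using prime_chain_to_SucE Suc.prems by metis
    then show ?thesis using prime_chain_to_mono[of Q j P] Suc.IH[of Q] False Suc.prems prime_chain_to_prime[OF Suc.prems(1)] by auto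
  qed
qed

end

section \<open>Krull's height theorem\<close>

context cring begin

text \<open>
  The contraction to the ring of the extension of \<open>J\<close> to the localization at \<open>P\<close>. Working with saturated ideals
  replaces working in the local ring at \<open>P\<close>.
\<close>

definition sat :: "'a set \<Rightarrow> 'a set \<Rightarrow> 'a set" where
  "sat P J = {a \<in> carrier R. \<exists>s\<in>carrier R. s \<notin> P \<and> s \<otimes> a \<in> J}"

lemma prime_complement_mult:
  assumes "primeideal P R" "s \<in> carrier R" "t \<in> carrier R" "s \<notin> P" "t \<notin> P" shows "s \<otimes> t \<notin> P"
  using primeideal.I_prime[OF assms(1-3)] assms(4,5) by auto

lemma satI: "s \<in> carrier R \<Longrightarrow> s \<notin> P \<Longrightarrow> s \<otimes> a \<in> J \<Longrightarrow> a \<in> carrier R \<Longrightarrow> a \<in> sat P J"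
  by (auto simp: sat_def)

lemma sat_ideal:
  assumes P: "primeideal P R" and J: "ideal J R" shows "ideal (sat P J) R"
proof (rule idealI_closed)
  show "sat P J \<subseteq> carrier R" by (auto simp: sat_def)
  show "\<zero> \<in> sat P J" by (rule satI[of \<one>]) (use prime_one[OF P] ideal_zero[OF J] in auto)
  fix a b assume "a \<in> sat P J" "b \<in> sat P J"
  then obtain s t where st: "s \<in> carrier R" "s \<notin> P" "s \<otimes> a \<in> J" "t \<in> carrier R" "t \<notin> P" "t \<otimes> b \<in> J"
    and c: "a \<in> carrier R" "b \<in> carrier R" by (auto simp: sat_def)
  have "(s \<otimes> t) \<otimes> (a \<oplus> b) = t \<otimes> (s \<otimes> a) \<oplus> s \<otimes> (t \<otimes> b)" using st(1,4) c by algebra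
  also have "\<dots> \<in> J" using ideal_add[OF J] ideal_lmult[OF J] st by auto
  finally show "a \<oplus> b \<in> sat P J"
    by (intro satI[of "s \<otimes> t"] prime_complement_mult[OF P]) (use st c in auto)
next
  fix a r assume "a \<in> sat P J" and r: "r \<in> carrier R"
  then obtain s where st: "s \<in> carrier R" "s \<notin> P" "s \<otimes> a \<in> J"
    and c: "a \<in> carrier R" by (auto simp: sat_def)
  have "s \<otimes> (r \<otimes> a) = r \<otimes> (s \<otimes> a)" using st(1) c r by algebra
  then show "r \<otimes> a \<in> sat P J" by (intro satI[of s]) (use st c r ideal_lmult[OF J] in auto)
qed

lemma sat_superset:
  assumes P: "primeideal P R" and J: "J \<subseteq> carrier R" shows "J \<subseteq> sat P J"
  using prime_one[OF P] J by (auto intro!: satI[of \<one>])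

lemma sat_mono: "I \<subseteq> J \<Longrightarrow> sat P I \<subseteq> sat P J"
  by (auto simp: sat_def)

lemma sat_sat:
  assumes P: "primeideal P R" shows "sat P (sat P J) \<subseteq> sat P J"
proof
  fix a assume "a \<in> sat P (sat P J)"
  then obtain s t where st: "s \<in> carrier R" "s \<notin> P" "t \<in> carrier R" "t \<notin> P" "t \<otimes> (s \<otimes> a) \<in> J" "a \<in> carrier R"
    by (auto simp: sat_def)
  then show "a \<in> sat P J"
    by (intro satI[of "t \<otimes> s"] prime_complement_mult[OF P]) (auto simp: m_assoc)
qed

lemma sat_antimono: "P \<subseteq> P' \<Longrightarrow> sat P' J \<subseteq> sat P J"
  by (auto simp: sat_def)

end

context noetherian_cring begin

text \<open>
  An associated prime of \<open>R/I\<close>: a maximal element among the annihilators of nonzero elements of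
  \<open>R/I\<close> is prime.
\<close>

lemma associated_prime:
  assumes I: "ideal I R" "I \<noteq> carrier R"
  obtains e where "e \<in> carrier R" "e \<notin> I" "primeideal {r \<in> carrier R. r \<otimes> e \<in> I} R"
proof -
  let ?c = "\<lambda>e. {r \<in> carrier R. r \<otimes> e \<in> I}"
  let ?A = "{?c e | e. e \<in> carrier R \<and> e \<notin> I}"
  have ci: "ideal (?c e) R" if e: "e \<in> carrier R" for e
  proof (rule idealI_closed)
    show "\<zero> \<in> ?c e" using e ideal_zero[OF I(1)] by simp
    show "a \<oplus> b \<in> ?c e" if "a \<in> ?c e" "b \<in> ?c e" for a b
      using that e ideal_add[OF I(1)] by (simp add: l_distr)
    show "r \<otimes> a \<in> ?c e" if "a \<in> ?c e" "r \<in> carrier R" for a r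
      using that e ideal_lmult[OF I(1)] by (simp add: m_assoc)
  qed auto
  have "\<exists>M\<in>?A. \<forall>N\<in>?A. M \<subseteq> N \<longrightarrow> N = M"
    by (rule ideals_have_maximal) (use I ideal_subset[OF I(1)] ci in auto)
  then obtain M where MA: "M \<in> ?A" and mx: "\<forall>N\<in>?A. M \<subseteq> N \<longrightarrow> N = M" by (elim bexE)
  then obtain e where e: "e \<in> carrier R" "e \<notin> I" "M = ?c e" by auto
  have "primeideal (?c e) R"
  proof (rule primeidealI[OF ci[OF e(1)] is_cring])
    have "\<one> \<notin> ?c e" using e by simp
    then show "carrier R \<noteq> ?c e" by blast
    fix a b assume ab: "a \<in> carrier R" "b \<in> carrier R" "a \<otimes> b \<in> ?c e"
    show "a \<in> ?c e \<or> b \<in> ?c e"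
    proof (cases "b \<otimes> e \<in> I")
      case False
      have "?c (b \<otimes> e) \<in> ?A" using False ab e by auto
      moreover have "M \<subseteq> ?c (b \<otimes> e)"
      proof
        fix r assume "r \<in> M"
        then have r: "r \<in> carrier R" "r \<otimes> e \<in> I" using e by auto
        have "r \<otimes> (b \<otimes> e) = b \<otimes> (r \<otimes> e)" using r(1) ab(2) e(1) by algebra
        then show "r \<in> ?c (b \<otimes> e)" using r ideal_lmult[OF I(1)] ab by auto
      qed
      ultimately have "?c (b \<otimes> e) = ?c e" using mx e(3) by (metis (no_types, lifting))
      moreover have "a \<in> ?c (b \<otimes> e)" using ab e by (simp add: m_assoc)
      ultimately have "a \<in> ?c e" by (rule subst)
      then show ?thesis by simp
    qed (use ab in auto)
  qed
  then show ?thesis using that e by blast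
qed

text \<open>
  If \<open>P\<close> is minimal over \<open>B\<close>, then the localization of \<open>R/B\<close> at \<open>P\<close> has finite length. What is needed of this is
  the descending chain condition on \<open>P\<close>-saturated ideals that contain \<open>B\<close>. It is proved by
  Noetherian induction on a saturated lower bound \<open>I\<close> of the chain. The associated prime found for \<open>I\<close>
  must be \<open>P\<close>, so there is an \<open>e\<close> outside \<open>I\<close> with \<open>P e \<subseteq> I\<close>. The chain of the ideals
  \<open>E j + Re\<close>, saturated, becomes stationary by the induction hypothesis. Since \<open>(I + Re)/I\<close> is
  a simple module after localization, the chain \<open>E\<close> itself becomes stationary.
\<close>

lemma saturated_dcc:
  assumes P: "primeideal P R" and B: "B \<subseteq> P"
    and minP: "\<And>P'. primeideal P' R \<Longrightarrow> B \<subseteq> P' \<Longrightarrow> P' \<subseteq> P \<Longrightarrow> P' = P"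
    and I: "ideal I R"
  shows "B \<subseteq> I \<longrightarrow> sat P I \<subseteq> I \<longrightarrow>
    (\<forall>E. (\<forall>j. ideal (E j) R \<and> I \<subseteq> E j \<and> sat P (E j) \<subseteq> E j \<and> E (Suc j) \<subseteq> E j) \<longrightarrow> (\<exists>N::nat. \<forall>j\<ge>N. E j = E N))"
  using I
proof (rule ideal_noetherian_induct)
  fix I assume I: "ideal I R" and IH: "\<And>J. ideal J R \<Longrightarrow> I \<subset> J \<Longrightarrow> B \<subseteq> J \<longrightarrow> sat P J \<subseteq> J \<longrightarrow>
    (\<forall>E. (\<forall>j. ideal (E j) R \<and> J \<subseteq> E j \<and> sat P (E j) \<subseteq> E j \<and> E (Suc j) \<subseteq> E j) \<longrightarrow> (\<exists>N::nat. \<forall>j\<ge>N. E j = E N))"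
  show "B \<subseteq> I \<longrightarrow> sat P I \<subseteq> I \<longrightarrow>
    (\<forall>E. (\<forall>j. ideal (E j) R \<and> I \<subseteq> E j \<and> sat P (E j) \<subseteq> E j \<and> E (Suc j) \<subseteq> E j) \<longrightarrow> (\<exists>N::nat. \<forall>j\<ge>N. E j = E N))"
  proof (intro impI allI)
    fix E :: "nat \<Rightarrow> 'a set"
    assume BI: "B \<subseteq> I" and satI': "sat P I \<subseteq> I"
      and E: "\<forall>j. ideal (E j) R \<and> I \<subseteq> E j \<and> sat P (E j) \<subseteq> E j \<and> E (Suc j) \<subseteq> E j"
    have Ei: "ideal (E j) R" "I \<subseteq> E j" "sat P (E j) \<subseteq> E j" for j using E by auto
    have dec: "E j \<subseteq> E i" if "i \<le> j" for i j
      by (rule lift_Suc_antimono_le[OF _ that]) (use E in auto)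
    show "\<exists>N. \<forall>j\<ge>N. E j = E N"
    proof (cases "I = carrier R")
      case True
      then have "E j = carrier R" for j using Ei[of j] ideal_subset[of "E j"] by auto
      then show ?thesis by auto
    next
      case False
      obtain e where e: "e \<in> carrier R" "e \<notin> I" and pr: "primeideal {r \<in> carrier R. r \<otimes> e \<in> I} R"
        using associated_prime[OF I False] .
      have "{r \<in> carrier R. r \<otimes> e \<in> I} = P"
      proof (rule minP[OF pr])
        show "B \<subseteq> {r \<in> carrier R. r \<otimes> e \<in> I}" using BI ideal_rmult[OF I] ideal_subset[OF I] e by auto
        show "{r \<in> carrier R. r \<otimes> e \<in> I} \<subseteq> P"
        proof (rule subsetI, rule ccontr)
          fix r assume "r \<in> {r \<in> carrier R. r \<otimes> e \<in> I}" "r \<notin> P"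
          then have "e \<in> sat P I" using e by (auto simp: sat_def)
          then show False using e satI' by auto
        qed
      qed
      then have Pe: "r \<otimes> e \<in> I" if "r \<in> P" for r using that by auto
      define I' where "I' = sat P (adjoin I e)"
      define F where "F j = sat P (adjoin (E j) e)" for j
      have I': "ideal I' R" unfolding I'_def by (intro sat_ideal P adjoin_ideal I e)
      have II': "adjoin I e \<subseteq> I'" unfolding I'_def by (intro sat_superset P ideal_subset adjoin_ideal I e)
      have sub: "I \<subset> I'" using II' adjoin_superset[OF I e(1)] adjoin_self[OF I e(1)] e(2) by auto
      have Fi: "ideal (F j) R \<and> I' \<subseteq> F j \<and> sat P (F j) \<subseteq> F j \<and> F (Suc j) \<subseteq> F j" for j
        unfolding F_def I'_def using E
        by (intro conjI sat_ideal P adjoin_ideal sat_mono adjoin_mono sat_sat e) auto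
      have "B \<subseteq> I'" using BI sub by auto
      moreover have "sat P I' \<subseteq> I'" unfolding I'_def by (rule sat_sat[OF P])
      ultimately have "\<exists>N. \<forall>j\<ge>N. F j = F N" using IH[OF I' sub] Fi by blast
      then obtain N where N: "\<And>j. j \<ge> N \<Longrightarrow> F j = F N" by blast
      have EF: "E j \<subseteq> F j" for j unfolding F_def
        using sat_superset[OF P ideal_subset[OF adjoin_ideal[OF Ei(1) e(1)]]] adjoin_superset[OF Ei(1) e(1)] by blast
      (* Either e lies in every E j, so that F j = E j, or it eventually does not lie in E j,
         and then E j is recovered from F j. *)
      show ?thesis
      proof (cases "\<forall>j. e \<in> E j")
        case True
        have "F j \<subseteq> E j" for j unfolding F_def
          using sat_mono[OF adjoin_minimal[OF Ei(1) order_refl]] True Ei(3)[of j] by blast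
        then have "F j = E j" for j using EF by blast
        then show ?thesis using N by auto
      next
        case False
        then obtain M where M: "e \<notin> E M" by blast
        let ?N = "max M N"
        have "E ?N \<subseteq> E j" if j: "j \<ge> ?N" for j
        proof
          fix x assume x: "x \<in> E ?N"
          then have "x \<in> F j" using EF N[of ?N] N[of j] j by auto
          then obtain s a r where s: "s \<in> carrier R" "s \<notin> P" "x \<in> carrier R" "s \<otimes> x = a \<oplus> r \<otimes> e" "a \<in> E j" "r \<in> carrier R"
            by (auto simp: F_def sat_def adjoin_def)
          have ac: "a \<in> carrier R" using ideal.Icarr[OF Ei(1) s(5)] .
          have "a \<in> E ?N" using dec[OF j] s by auto
          then have "(s \<otimes> x) \<ominus> a \<in> E ?N" by (intro ideal_minus[OF Ei(1)] ideal_lmult[OF Ei(1)] x s(1))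
          moreover have "(s \<otimes> x) \<ominus> a = r \<otimes> e" unfolding s(4) using ac s(6) e(1) by algebra
          ultimately have re: "r \<otimes> e \<in> E ?N" by simp
          have "r \<in> P"
          proof (rule ccontr)
            assume "r \<notin> P"
            then have "e \<in> sat P (E ?N)" using re s e by (intro satI[of r]) auto
            then have "e \<in> E M" using Ei(3)[of ?N] dec[of M ?N] by auto
            then show False using M by simp
          qed
          then have "r \<otimes> e \<in> E j" using Pe Ei(2) by auto
          then have "s \<otimes> x \<in> E j" using s ideal_add[OF Ei(1)] by auto
          then have "x \<in> sat P (E j)" using s by (intro satI[of s]) auto
          then show "x \<in> E j" using Ei(3) by auto
        qed
        then show ?thesis using dec by (intro exI[of _ ?N]) blast
      qed
    qed
  qed
qed

lemma finite_subset_generators: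
  assumes "ideal F R" obtains X where "finite X" "X \<subseteq> carrier R" "X \<subseteq> F" "F = Idl X"
  using finetely_gen[OF assms] genideal_self by metis

text \<open>
  Nakayama's lemma at \<open>P\<close>: if \<open>F \<subseteq> G + u F\<close> holds after localizing at \<open>P\<close>, then so does \<open>F \<subseteq> G\<close>. The finitely many
  generators of \<open>F\<close> are eliminated one at a time; the coefficient \<open>t \<otimes> s \<ominus> u \<otimes> r\<close> that arises is
  outside \<open>P\<close> because \<open>t \<otimes> s\<close> is and \<open>u\<close> lies in \<open>P\<close>.
\<close>

lemma nakayama_saturated:
  assumes P: "primeideal P R" and F: "ideal F R" and G: "ideal G R" and u: "u \<in> P"
    and sub: "\<And>f. f \<in> F \<Longrightarrow> \<exists>s\<in>carrier R. s \<notin> P \<and> (\<exists>g\<in>G. \<exists>f'\<in>F. s \<otimes> f = g \<oplus> u \<otimes> f')"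
  shows "F \<subseteq> sat P G"
proof -
  have uc: "u \<in> carrier R" using ideal.Icarr[OF prime_ideal[OF P] u] .
  note Fc = ideal.Icarr[OF F] and Gc = ideal.Icarr[OF G]
  obtain X where X: "finite X" "X \<subseteq> carrier R" "X \<subseteq> F" "F = Idl X" using finite_subset_generators[OF F] .
  have "X \<subseteq> F \<Longrightarrow> F \<subseteq> sat P (Idl (G \<union> X)) \<Longrightarrow> F \<subseteq> sat P G" if "finite X" for X
    using that
  proof (induction X)
    case empty
    have "Idl G \<subseteq> G" by (rule genideal_minimal[OF G]) auto
    then show ?case using empty sat_mono[of "Idl G" G P] by auto
  next
    case (insert x X)
    have xF: "x \<in> F" and xc: "x \<in> carrier R" using insert Fc by auto
    have GX: "G \<union> X \<subseteq> carrier R" using Gc Fc insert by auto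
    let ?J = "Idl (G \<union> X)"
    have J: "ideal ?J R" and GJ: "G \<subseteq> ?J" using genideal_ideal[OF GX] genideal_self[OF GX] by auto
    note Jc = ideal.Icarr[OF J]
    have e: "Idl (G \<union> insert x X) = adjoin ?J x" using Idl_insert[OF GX xc] by simp
    obtain s g f' where s: "s \<in> carrier R" "s \<notin> P" "g \<in> G" "f' \<in> F" "s \<otimes> x = g \<oplus> u \<otimes> f'" using sub[OF xF] by blast
    have "f' \<in> sat P (adjoin ?J x)" using insert.prems e s by auto
    then obtain t a r where t: "t \<in> carrier R" "t \<notin> P" "t \<otimes> f' = a \<oplus> r \<otimes> x" "a \<in> ?J" "r \<in> carrier R"
      by (auto simp: sat_def adjoin_def)
    have c: "g \<in> carrier R" "f' \<in> carrier R" "a \<in> carrier R" using Gc[OF s(3)] Fc[OF s(4)] Jc[OF t(4)] .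
    have "(t \<otimes> s \<ominus> u \<otimes> r) \<otimes> x = t \<otimes> (s \<otimes> x) \<ominus> u \<otimes> (r \<otimes> x)" using c s(1) t(1,5) xc uc by algebra
    also have "\<dots> = t \<otimes> g \<oplus> u \<otimes> (t \<otimes> f') \<ominus> u \<otimes> (r \<otimes> x)" unfolding s(5) using c s(1) t(1,5) xc uc by algebra
    also have "\<dots> = t \<otimes> g \<oplus> u \<otimes> a" unfolding t(3) using c s(1) t(1,5) xc uc by algebra
    also have "\<dots> \<in> ?J" using GJ s(3) t uc by (intro ideal_add[OF J] ideal_lmult[OF J]) auto
    finally have 1: "(t \<otimes> s \<ominus> u \<otimes> r) \<otimes> x \<in> ?J" .
    have 2: "t \<otimes> s \<ominus> u \<otimes> r \<notin> P"
    proof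
      assume "t \<otimes> s \<ominus> u \<otimes> r \<in> P"
      then have "(t \<otimes> s \<ominus> u \<otimes> r) \<oplus> u \<otimes> r \<in> P"
        using ideal_add[OF prime_ideal[OF P]] ideal_rmult[OF prime_ideal[OF P] u t(5)] by simp
      moreover have "(t \<otimes> s \<ominus> u \<otimes> r) \<oplus> u \<otimes> r = t \<otimes> s" using t(1,5) s(1) uc by algebra
      ultimately show False using prime_complement_mult[OF P t(1) s(1) t(2) s(2)] by simp
    qed
    have "x \<in> sat P ?J" by (rule satI[OF _ 2 1 xc]) (use t s uc in auto)
    then have "adjoin ?J x \<subseteq> sat P ?J"
      by (intro adjoin_minimal sat_ideal P J sat_superset ideal_subset)
    then have "sat P (adjoin ?J x) \<subseteq> sat P ?J" using sat_mono sat_sat[OF P] by blast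
    then show ?case using insert e by auto
  qed
  moreover have "F \<subseteq> sat P (Idl (G \<union> X))"
  proof -
    have GX: "G \<union> X \<subseteq> carrier R" using X Gc by auto
    have "Idl X \<subseteq> Idl (G \<union> X)" using GX genideal_self[OF GX] by (intro genideal_minimal genideal_ideal) auto
    then show ?thesis using X sat_superset[OF P ideal_subset[OF genideal_ideal[OF GX]]] by auto
  qed
  ultimately show ?thesis using X by auto
qed

text \<open>
  Krull's principal ideal theorem modulo the prime \<open>Q0\<close>: a prime that is minimal over \<open>Q0 + Ru\<close> is not the top of
  a chain \<open>Q0 \<subset> Q \<subset> P\<close>. As in the usual proof, the symbolic powers of \<open>Q\<close> are compared modulo \<open>u\<close>. Here
  the descending chain \<open>F j\<close>, the \<open>Q\<close>-saturation of \<open>Q0 + R y\<^sup>j\<close> for a \<open>y\<close> in \<open>Q\<close> outside \<open>Q0\<close>, takes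
  their place. It becomes stationary modulo \<open>u\<close> by the descending chain condition above, hence
  stationary by Nakayama's lemma, so that \<open>v y\<^sup>N \<in> Q0 + R y\<^sup>N\<^sup>+\<^sup>1\<close> for some
  \<open>v\<close> outside \<open>Q\<close>. Cancelling \<open>y\<^sup>N\<close> modulo \<open>Q0\<close> gives \<open>v \<in> Q\<close>, a contradiction.
\<close>

lemma krull_principal_ideal:
  assumes Q0: "primeideal Q0 R" and Q: "primeideal Q R" and P: "primeideal P R"
    and lt: "Q0 \<subset> Q" "Q \<subset> P" and u: "u \<in> P"
    and minP: "\<And>P'. primeideal P' R \<Longrightarrow> Q0 \<subseteq> P' \<Longrightarrow> u \<in> P' \<Longrightarrow> P' \<subseteq> P \<Longrightarrow> P' = P"
  shows False
proof -
  have uc: "u \<in> carrier R" using ideal.Icarr[OF prime_ideal[OF P] u] .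
  have uQ: "u \<notin> Q" using minP[OF Q] lt by auto
  obtain y where y: "y \<in> Q" "y \<notin> Q0" using lt by auto
  have yc: "y \<in> carrier R" using ideal.Icarr[OF prime_ideal[OF Q] y(1)] .
  note Q0i = prime_ideal[OF Q0]
  define A where "A j = adjoin Q0 (y [^] (j::nat))" for j
  define F where "F j = sat Q (A j)" for j
  define E where "E j = sat P (adjoin (F j) u)" for j
  have Ai: "ideal (A j) R" for j unfolding A_def using adjoin_ideal[OF Q0i] yc by simp
  have Fi: "ideal (F j) R" for j unfolding F_def by (rule sat_ideal[OF Q Ai])
  have Ei: "ideal (E j) R" for j unfolding E_def by (rule sat_ideal[OF P adjoin_ideal[OF Fi uc]])
  have Adec: "A (Suc j) \<subseteq> A j" for j
  proof -
    have "y [^] Suc j \<in> A j" unfolding A_def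
      using ideal_rmult[OF adjoin_ideal[OF Q0i] adjoin_self[OF Q0i]] yc by simp
    then show ?thesis unfolding A_def[of "Suc j"]
      by (intro adjoin_minimal Ai) (use adjoin_superset[OF Q0i] yc in \<open>auto simp: A_def\<close>)
  qed
  have Fdec: "F (Suc j) \<subseteq> F j" for j unfolding F_def by (rule sat_mono[OF Adec])
  have Edec: "E (Suc j) \<subseteq> E j" for j unfolding E_def by (intro sat_mono adjoin_mono Fdec)
  have QF: "Q0 \<subseteq> F j" for j
  proof -
    have "Q0 \<subseteq> A j" unfolding A_def using adjoin_superset[OF Q0i] yc by simp
    then show ?thesis unfolding F_def using sat_superset[OF Q ideal_subset[OF Ai]] by blast
  qed
  define B where "B = adjoin Q0 u"
  have Bi: "ideal B R" unfolding B_def by (rule adjoin_ideal[OF Q0i uc])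
  have BP: "B \<subseteq> P" unfolding B_def using lt u by (intro adjoin_minimal prime_ideal[OF P]) auto
  have BE: "B \<subseteq> E j" for j
    unfolding B_def E_def using sat_superset[OF P ideal_subset[OF adjoin_ideal[OF Fi uc]]] adjoin_mono[OF QF] by blast
  have "\<exists>N. \<forall>j\<ge>N. E j = E N"
  proof -
    have "B \<subseteq> sat P B \<longrightarrow> sat P (sat P B) \<subseteq> sat P B \<longrightarrow>
    (\<forall>E. (\<forall>j. ideal (E j) R \<and> sat P B \<subseteq> E j \<and> sat P (E j) \<subseteq> E j \<and> E (Suc j) \<subseteq> E j) \<longrightarrow> (\<exists>N::nat. \<forall>j\<ge>N. E j = E N))"
    proof (rule saturated_dcc[OF P BP])
      fix P' assume "primeideal P' R" "B \<subseteq> P'" "P' \<subseteq> P"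
      then show "P' = P" using minP adjoin_superset[OF Q0i uc] adjoin_self[OF Q0i uc] unfolding B_def by blast
    qed (rule sat_ideal[OF P Bi])
    moreover have "B \<subseteq> sat P B" by (rule sat_superset[OF P ideal_subset[OF Bi]])
    moreover have "sat P (sat P B) \<subseteq> sat P B" by (rule sat_sat[OF P])
    moreover have "sat P (E j) \<subseteq> E j" for j unfolding E_def by (rule sat_sat[OF P])
    moreover have "sat P B \<subseteq> E j" for j using sat_mono[OF BE] calculation(4) by blast
    ultimately show ?thesis using Ei Edec by blast
  qed
  then obtain N where N: "E (Suc N) = E N" by (metis le_Suc_eq order_refl)
  have "F N \<subseteq> sat P (F (Suc N))"
  proof (rule nakayama_saturated[OF P Fi Fi u])
    fix f assume f: "f \<in> F N"
    have fc: "f \<in> carrier R" by (rule ideal.Icarr[OF Fi f])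
    have "f \<in> E N" unfolding E_def
      using f sat_superset[OF P ideal_subset[OF adjoin_ideal[OF Fi uc]]] adjoin_superset[OF Fi uc] by blast
    then have "f \<in> E (Suc N)" using N by simp
    then obtain s b r where s: "s \<in> carrier R" "s \<notin> P" "s \<otimes> f = b \<oplus> r \<otimes> u" "b \<in> F (Suc N)" "r \<in> carrier R"
      by (auto simp: E_def sat_def adjoin_def)
    have bc: "b \<in> carrier R" using ideal.Icarr[OF Fi s(4)] .
    have "s \<otimes> f \<ominus> b \<in> F N" using ideal_minus[OF Fi] ideal_lmult[OF Fi f s(1)] Fdec s(4) by blast
    moreover have "s \<otimes> f \<ominus> b = u \<otimes> r" unfolding s(3) using bc s(5) uc by algebra
    ultimately have "u \<otimes> r \<in> F N" by simp
    (* u is outside Q, so the factor u can be cancelled from elements of the Q-saturated F N. *)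
    then have "r \<in> sat Q (F N)" using uQ uc s by (intro satI[of u]) auto
    then have rF: "r \<in> F N" unfolding F_def using sat_sat[OF Q] by blast
    have "s \<otimes> f = b \<oplus> u \<otimes> r" unfolding s(3) using bc s(5) uc by algebra
    then show "\<exists>s\<in>carrier R. s \<notin> P \<and> (\<exists>g\<in>F (Suc N). \<exists>f'\<in>F N. s \<otimes> f = g \<oplus> u \<otimes> f')"
      using s rF by blast
  qed
  also have "\<dots> \<subseteq> sat Q (F (Suc N))" using lt by (intro sat_antimono) auto
  also have "\<dots> \<subseteq> F (Suc N)" unfolding F_def by (rule sat_sat[OF Q])
  finally have FF: "F N \<subseteq> F (Suc N)" .
  have "y [^] N \<in> A N" unfolding A_def using adjoin_self[OF Q0i] yc by simp
  then have "y [^] N \<in> F N" unfolding F_def using sat_superset[OF Q ideal_subset[OF Ai]] by blast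
  then have "y [^] N \<in> F (Suc N)" using FF by auto
  then obtain v q r where v: "v \<in> carrier R" "v \<notin> Q" "v \<otimes> y [^] N = q \<oplus> r \<otimes> (y [^] Suc N)" "q \<in> Q0" "r \<in> carrier R"
    unfolding F_def sat_def A_def adjoin_def by blast
  have qc: "q \<in> carrier R" using ideal.Icarr[OF Q0i v(4)] .
  have pc: "y [^] N \<in> carrier R" using yc by simp
  have "(v \<ominus> r \<otimes> y) \<otimes> y [^] N = v \<otimes> y [^] N \<ominus> r \<otimes> (y [^] N \<otimes> y)" using v(1,5) yc pc by algebra
  also have "\<dots> = q \<oplus> r \<otimes> (y [^] Suc N) \<ominus> r \<otimes> (y [^] N \<otimes> y)" unfolding v(3) ..
  also have "\<dots> = q" using v(1,5) yc qc pc unfolding nat_pow_Suc by algebra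
  finally have "(v \<ominus> r \<otimes> y) \<otimes> y [^] N \<in> Q0" using v by simp
  moreover have "v \<ominus> r \<otimes> y \<in> carrier R" using v yc by simp
  ultimately have "v \<ominus> r \<otimes> y \<in> Q0 \<or> y [^] N \<in> Q0" using primeideal.I_prime[OF Q0] pc by blast
  then have "v \<ominus> r \<otimes> y \<in> Q" using prime_pow[OF Q0 yc] y lt by auto
  then have "(v \<ominus> r \<otimes> y) \<oplus> r \<otimes> y \<in> Q" 
    using ideal_add[OF prime_ideal[OF Q]] ideal_lmult[OF prime_ideal[OF Q] y(1) v(5)] by simp
  moreover have "(v \<ominus> r \<otimes> y) \<oplus> r \<otimes> y = v" using v(1,5) yc by algebra
  ultimately show False using v by simp
qed

text \<open>
  The description of the radical of \<open>J\<close> by primes, in the localization at \<open>P\<close>.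
\<close>

lemma local_radical:
  assumes P: "primeideal P R" and J: "ideal J R" and p: "p \<in> carrier R"
    and all: "\<And>P'. primeideal P' R \<Longrightarrow> J \<subseteq> P' \<Longrightarrow> P' \<subseteq> P \<Longrightarrow> p \<in> P'"
  shows "\<exists>s\<in>carrier R. s \<notin> P \<and> (\<exists>k::nat. s \<otimes> p [^] k \<in> J)"
proof (rule ccontr)
  assume no: "\<not> ?thesis"
  let ?S = "{s \<otimes> p [^] (k::nat) | s k. s \<in> carrier R \<and> s \<notin> P}"
  have "\<exists>P'. primeideal P' R \<and> J \<subseteq> P' \<and> P' \<inter> ?S = {}"
  proof (rule exists_prime_avoiding[OF J])
    show "?S \<subseteq> carrier R" using p by auto
    have "\<one> \<otimes> p [^] (0::nat) \<in> ?S" using prime_one[OF P] by blast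
    then show "?S \<noteq> {}" by blast
    show "J \<inter> ?S = {}" using no by blast
    fix a b assume "a \<in> ?S" "b \<in> ?S"
    then obtain s k t l where st: "a = s \<otimes> p [^] (k::nat)" "b = t \<otimes> p [^] (l::nat)" "s \<in> carrier R" "s \<notin> P" "t \<in> carrier R" "t \<notin> P"
      by blast
    have pc: "p [^] k \<in> carrier R" "p [^] l \<in> carrier R" using p by auto
    have "a \<otimes> b = (s \<otimes> t) \<otimes> (p [^] k \<otimes> p [^] l)" unfolding st using st(3,5) pc by algebra
    also have "\<dots> = (s \<otimes> t) \<otimes> p [^] (k + l)" using p by (simp add: nat_pow_mult)
    finally show "a \<otimes> b \<in> ?S" using prime_complement_mult[OF P st(3,5,4,6)] st(3,5) by blast
  qed
  then obtain P' where P': "primeideal P' R" "J \<subseteq> P'" "P' \<inter> ?S = {}" by blast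
  have "P' \<subseteq> P"
  proof (rule subsetI, rule ccontr)
    fix s assume s: "s \<in> P'" "s \<notin> P"
    have sc: "s \<in> carrier R" by (rule ideal.Icarr[OF prime_ideal[OF P'(1)] s(1)])
    have "s \<in> ?S" by (rule CollectI, rule exI[of _ s], rule exI[of _ 0]) (use sc s in simp)
    then show False using P' s by blast
  qed
  then have "p \<in> P'" using all P' by blast
  moreover have "p \<in> ?S" by (rule CollectI, rule exI[of _ \<one>], rule exI[of _ 1]) (use p prime_one[OF P] in simp)
  ultimately show False using P' by blast
qed

text \<open>
  Induction on the number of elements. Given a chain of length \<open>card U + 1\<close> below \<open>P\<close>, enlarge its second largest
  member to a prime \<open>Q\<close> that is maximal below \<open>P\<close>. Some \<open>z i\<close> is outside \<open>Q\<close>, so \<open>P\<close> is the only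
  prime between \<open>Q + R (z i)\<close> and itself, and every \<open>z j\<close> is, up to powers and units at \<open>P\<close>, congruent
  modulo \<open>z i\<close> to an element \<open>y j\<close> of \<open>Q\<close>. By the principal ideal theorem \<open>Q\<close> is minimal
  over the \<open>y j\<close> with \<open>j \<noteq> i\<close>, and the induction hypothesis applies to \<open>Q\<close>.
\<close>

theorem krull_height:
  assumes "finite U" "z ` U \<subseteq> P" "primeideal P R"
    and minP: "\<And>P'. primeideal P' R \<Longrightarrow> z ` U \<subseteq> P' \<Longrightarrow> P' \<subseteq> P \<Longrightarrow> P' = P"
  shows "\<not> prime_chain_to P (Suc (card U))"
  using assms
proof (induction "card U" arbitrary: U z P)
  case 0
  then have U: "U = {}" by simp
  show ?case
  proof
    assume "prime_chain_to P (Suc (card U))"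
    then have "prime_chain_to P (Suc 0)" using U by simp
    then obtain Q where "prime_chain_to Q 0" "Q \<subset> P" by (rule prime_chain_to_SucE)
    then show False using 0(5)[of Q] U prime_chain_to_prime by auto
  qed
next
  case (Suc n)
  note P = Suc.prems(3) and minP = Suc.prems(4)
  show ?case
  proof
    assume "prime_chain_to P (Suc (card U))"
    then obtain P1 where P1: "prime_chain_to P1 (Suc n)" "P1 \<subset> P" using prime_chain_to_SucE[of P "Suc n"] Suc(2) by auto
    let ?A = "{Q. primeideal Q R \<and> P1 \<subseteq> Q \<and> Q \<subset> P}"
    have "\<exists>M\<in>?A. \<forall>N\<in>?A. M \<subseteq> N \<longrightarrow> N = M"
      by (rule ideals_have_maximal) (use P1 prime_chain_to_prime[OF P1(1)] prime_ideal in auto)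
    then obtain Q where QA: "Q \<in> ?A" and mx: "\<forall>N\<in>?A. Q \<subseteq> N \<longrightarrow> N = Q" by (elim bexE)
    have Q: "primeideal Q R" "P1 \<subseteq> Q" "Q \<subset> P" using QA by auto
    have "\<not> z ` U \<subseteq> Q" using minP[OF Q(1)] Q(3) by auto
    then obtain i where i: "i \<in> U" "z i \<notin> Q" by auto
    have zc: "z j \<in> carrier R" if "j \<in> U" for j 
      using ideal.Icarr[OF prime_ideal[OF P], of "z j"] that Suc.prems(2) by auto
    have Qi: "ideal Q R" by (rule prime_ideal[OF Q(1)])
    have step: "\<exists>y. y \<in> Q \<and> (\<exists>s\<in>carrier R. s \<notin> P \<and> (\<exists>k::nat. \<exists>r\<in>carrier R. s \<otimes> z j [^] k = y \<oplus> r \<otimes> z i))" if j: "j \<in> U" for j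
    proof -
      have "\<exists>s\<in>carrier R. s \<notin> P \<and> (\<exists>k::nat. s \<otimes> z j [^] k \<in> adjoin Q (z i))"
      proof (rule local_radical[OF P adjoin_ideal[OF Qi zc[OF i(1)]] zc[OF j]])
        fix P' assume P': "primeideal P' R" "adjoin Q (z i) \<subseteq> P'" "P' \<subseteq> P"
        have "P' = P"
        proof (rule ccontr)
          assume "P' \<noteq> P"
          then have "P' \<in> ?A" using P' Q adjoin_superset[OF Qi zc[OF i(1)]] by auto
          then have "P' = Q" using mx P' adjoin_superset[OF Qi zc[OF i(1)]] by auto
          then show False using i adjoin_self[OF Qi zc[OF i(1)]] P' by auto
        qed
        then show "z j \<in> P'" using Suc.prems(2) j by auto
      qed
      then show ?thesis unfolding adjoin_def by blast
    qed
    then have "\<exists>y. \<forall>j\<in>U. y j \<in> Q \<and> (\<exists>s\<in>carrier R. s \<notin> P \<and> (\<exists>k::nat. \<exists>r\<in>carrier R. s \<otimes> z j [^] k = y j \<oplus> r \<otimes> z i))"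
      by (intro bchoice) blast
    then obtain y where y: "\<And>j. j \<in> U \<Longrightarrow> y j \<in> Q"
      "\<And>j. j \<in> U \<Longrightarrow> \<exists>s\<in>carrier R. s \<notin> P \<and> (\<exists>k::nat. \<exists>r\<in>carrier R. s \<otimes> z j [^] k = y j \<oplus> r \<otimes> z i)" by blast
    let ?U = "U - {i}"
    have cU: "n = card ?U" using Suc(2) i Suc.prems(1) by simp
    have "\<not> prime_chain_to Q (Suc (card ?U))"
    proof (rule Suc.hyps(1)[OF cU])
      show "finite ?U" using Suc.prems by simp
      show "y ` ?U \<subseteq> Q" using y by auto
      show "primeideal Q R" by fact
      fix Q' assume Q': "primeideal Q' R" "y ` ?U \<subseteq> Q'" "Q' \<subseteq> Q"
      show "Q' = Q"
      proof (rule ccontr)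
        assume "Q' \<noteq> Q"
        then have lt: "Q' \<subset> Q" using Q' by auto
        show False
        proof (rule krull_principal_ideal[OF Q'(1) Q(1) P lt Q(3), of "z i"])
          show "z i \<in> P" using Suc.prems(2) i by auto
          fix P' assume P': "primeideal P' R" "Q' \<subseteq> P'" "z i \<in> P'" "P' \<subseteq> P"
          have Pi: "ideal P' R" by (rule prime_ideal[OF P'(1)])
          have "z j \<in> P'" if j: "j \<in> U" for j
          proof (cases "j = i")
            case False
            obtain s k r where s: "s \<in> carrier R" "s \<notin> P" "r \<in> carrier R" "s \<otimes> z j [^] (k::nat) = y j \<oplus> r \<otimes> z i"
              using y(2)[OF j] by blast
            have "y j \<in> P'" using Q' P' j False by auto
            then have "s \<otimes> z j [^] k \<in> P'" unfolding s(4) using ideal_add[OF Pi] ideal_lmult[OF Pi P'(3) s(3)] by simp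
            then have "s \<in> P' \<or> z j [^] k \<in> P'" using primeideal.I_prime[OF P'(1) s(1)] zc[OF j] by simp
            then show ?thesis using prime_pow[OF P'(1) zc[OF j]] s P' by auto
          qed (use P' in simp)
          then show "P' = P" using minP[OF P'(1)] P' by auto
        qed
      qed
    qed
    moreover have "prime_chain_to Q (Suc n)" by (rule prime_chain_to_mono[OF P1(1) Q(1,2)])
    ultimately show False using cU by simp
  qed
qed

end

section \<open>Regular sequences and chains of primes\<close>

sublocale local_ring \<subseteq> noetherian_cring ..

context cring begin

text \<open>
  Regularity on \<open>R/J\<close> in terms of elements of the ring, which avoids computing with cosets.
\<close>

definition regular_mod :: "'a set \<Rightarrow> 'a \<Rightarrow> bool" where
  "regular_mod J x \<longleftrightarrow> (\<forall>a\<in>carrier R. x \<otimes> a \<in> J \<longrightarrow> a \<in> J)"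

lemma regular_on_quotient_iff:
  assumes J: "ideal J R" and x: "x \<in> carrier R"
  shows "regular_on_quotient R J x \<longleftrightarrow> regular_mod J x"
proof -
  have z: "J +> a = J \<longleftrightarrow> a \<in> J" if a: "a \<in> carrier R" for a
    using a_rcos_zero[OF J] ideal.rcos_const_imp_mem[OF J a] by auto
  have m: "(J +> x) \<otimes>\<^bsub>R Quot J\<^esub> (J +> a) = J +> (x \<otimes> a)" if "a \<in> carrier R" for a
    using ideal.rcoset_mult_add[OF J x that] by (simp add: FactRing_def)
  have c: "carrier (R Quot J) = (\<lambda>a. J +> a) ` carrier R"
    by (auto simp: FactRing_def A_RCOSETS_def' a_r_coset_def)
  have 0: "\<zero>\<^bsub>R Quot J\<^esub> = J" by (simp add: FactRing_def)
  show ?thesis unfolding regular_on_quotient_def regular_mod_def c 0 using m z x by auto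
qed

lemma ideal_finsum:
  assumes I: "ideal I R" and "\<And>i. i \<in> F \<Longrightarrow> f i \<in> I"
  shows "finsum R f F \<in> I"
proof (cases "finite F")
  case True
  then show ?thesis using assms(2)
  proof (induction F)
    case empty then show ?case using ideal_zero[OF I] by simp
  next
    case (insert x F)
    then have "f \<in> F \<rightarrow> carrier R" "f x \<in> carrier R" using ideal.Icarr[OF I] by auto
    then show ?case using insert by (simp add: ideal_add[OF I])
  qed
next
  case False then show ?thesis using ideal_zero[OF I] by (simp add: finsum_infinite)
qed

lemma Idl_union_image_combination:
  assumes I: "ideal I R" and F: "finite F" and g: "g \<in> F \<rightarrow> carrier R" and a: "a \<in> Idl (I \<union> g ` F)"
  shows "\<exists>e\<in>I. \<exists>c\<in>F \<rightarrow> carrier R. a = e \<oplus> (\<Oplus>i\<in>F. c i \<otimes> g i)"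
  using F g a
proof (induction F arbitrary: a)
  case empty
  have "Idl I \<subseteq> I" by (rule genideal_minimal[OF I]) auto
  then show ?case using empty ideal.Icarr[OF I] by auto
next
  case (insert x F)
  have G: "I \<union> g ` F \<subseteq> carrier R" "g x \<in> carrier R" "g \<in> F \<rightarrow> carrier R" using insert ideal_subset[OF I] by auto
  have "a \<in> adjoin (Idl (I \<union> g ` F)) (g x)" using Idl_insert[OF G(1,2)] insert by simp
  then obtain b r where b: "b \<in> Idl (I \<union> g ` F)" "r \<in> carrier R" "a = b \<oplus> r \<otimes> g x" by (auto simp: adjoin_def)
  obtain e c where e: "e \<in> I" "c \<in> F \<rightarrow> carrier R" "b = e \<oplus> (\<Oplus>i\<in>F. c i \<otimes> g i)" using insert.IH[OF G(3) b(1)] by blast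
  let ?c = "c(x := r)"
  have ec: "e \<in> carrier R" using ideal.Icarr[OF I e(1)] .
  have fc: "finsum R (\<lambda>i. c i \<otimes> g i) F \<in> carrier R" using e G by (intro finsum_closed) auto
  have "(\<Oplus>i\<in>insert x F. ?c i \<otimes> g i) = r \<otimes> g x \<oplus> (\<Oplus>i\<in>F. ?c i \<otimes> g i)"
    using insert.hyps e G b by (subst finsum_insert) (auto simp: Pi_iff)
  also have "(\<Oplus>i\<in>F. ?c i \<otimes> g i) = (\<Oplus>i\<in>F. c i \<otimes> g i)"
    by (rule finsum_cong') (use insert.hyps e G in \<open>auto simp: Pi_iff\<close>)
  finally have "a = e \<oplus> (\<Oplus>i\<in>insert x F. ?c i \<otimes> g i)"
    unfolding b(3) e(3) using ec fc b(2) G(2) by (simp add: a_ac)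
  moreover have "?c \<in> insert x F \<rightarrow> carrier R" using e b by auto
  ultimately show ?case using e(1) by blast
qed

text \<open>
  The existence of a prime matters: the supremum of the empty set is 0 in the extended natural numbers.
\<close>

lemma prime_chain_krull_dim:
  assumes "krull_dim R = enat n" and P0: "primeideal P0 R"
  shows "\<exists>P. prime_chain_to P n" "\<not> prime_chain_to P (Suc n)"
proof -
  let ?A = "{enat k | k. \<exists>P. (\<forall>i\<le>k. primeideal (P i) R) \<and> (\<forall>i<k. P i \<subset> P (Suc i))}"
  have eq: "?A = {enat k | k. \<exists>P. prime_chain_to P k}" by (auto simp: prime_chain_to_def)
  have S: "Sup ?A = enat n" using assms by (simp add: krull_dim_def)
  have le: "k \<le> n" if "prime_chain_to P k" for P k
  proof -
    have "enat k \<in> ?A" unfolding eq using that by blast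
    then have "enat k \<le> enat n" unfolding S[symmetric] by (rule Sup_upper)
    then show ?thesis by simp
  qed
  then show "\<not> prime_chain_to P (Suc n)" by (metis Suc_n_not_le_n)
  have fin: "finite ?A" by (rule finite_subset[of _ "enat ` {..n}"]) (use le in \<open>auto simp: eq\<close>)
  show "\<exists>P. prime_chain_to P n"
  proof (cases "?A = {}")
    case True
    then show ?thesis using prime_chain_to_0[OF P0] unfolding eq by blast
  next
    case False
    then have "Sup ?A \<in> ?A" using fin by (metis (no_types, lifting) Max_in Sup_enat_def)
    then have "enat n \<in> ?A" by (simp only: S)
    then show ?thesis unfolding eq by auto
  qed
qed
end

context noetherian_cring begin

text \<open>
  A regular element lies in no minimal prime of the ideal. The elements \<open>s \<otimes> x [^] k\<close> with \<open>s \<notin> P\<close> form a multiplicative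
  set that misses \<open>I\<close>, since a power of \<open>x\<close> could be cancelled, which leaves \<open>s \<in> I \<subseteq> P\<close>.
\<close>

lemma regular_descends_prime:
  assumes I: "ideal I R" and x: "regular_mod I x" and P: "primeideal P R" "I \<subseteq> P" "x \<in> P"
  shows "\<exists>Q. primeideal Q R \<and> I \<subseteq> Q \<and> Q \<subset> P"
proof -
  have xc: "x \<in> carrier R" using ideal.Icarr[OF prime_ideal[OF P(1)] P(3)] .
  have reg: "a \<in> I" if "x [^] (k::nat) \<otimes> a \<in> I" "a \<in> carrier R" for a k
    using that
  proof (induction k arbitrary: a)
    case (Suc k)
    have "x [^] k \<otimes> (x \<otimes> a) \<in> I" using Suc xc by (simp add: m_assoc)
    then have "x \<otimes> a \<in> I" using Suc xc by auto
    then show ?case using x Suc by (auto simp: regular_mod_def)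
  qed simp
  have no: "\<not> (\<exists>s\<in>carrier R. s \<notin> P \<and> (\<exists>k::nat. s \<otimes> x [^] k \<in> I))"
    using reg m_comm xc P(2) by (metis nat_pow_closed subsetD)
  have "\<exists>Q. primeideal Q R \<and> I \<subseteq> Q \<and> Q \<subseteq> P \<and> x \<notin> Q"
    using local_radical[OF P(1) I xc] no by blast
  then show ?thesis using P(3) by blast
qed

lemma regular_sequence_prime_chain:
  assumes "regular_sequence R xs"
  shows "\<exists>P. prime_chain_to P (length xs)"
proof -
  have xs: "set xs \<subseteq> carrier R" "Idl (set xs) \<noteq> carrier R"
    and reg: "\<And>i. i < length xs \<Longrightarrow> regular_on_quotient R (Idl (set (take i xs))) (xs ! i)"
    using assms by (auto simp: regular_sequence_def)
  have tk: "set (take i xs) \<subseteq> carrier R" for i using xs(1) set_take_subset by (rule subset_trans[rotated])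
  have "prime_chain_to P i" if "primeideal P R" "Idl (set (take i xs)) \<subseteq> P" "i \<le> length xs" for P i
    using that
  proof (induction i arbitrary: P)
    case 0
    then show ?case by (simp add: prime_chain_to_0)
  next
    case (Suc i)
    have i: "i < length xs" using Suc by simp
    have xi: "xs ! i \<in> carrier R" using xs(1) nth_mem[OF i] by blast
    have set: "set (take (Suc i) xs) = insert (xs ! i) (set (take i xs))" using i by (simp add: take_Suc_conv_app_nth)
    have sub: "set (take (Suc i) xs) \<subseteq> P" using genideal_self[OF tk] Suc.prems by blast
    have 1: "regular_mod (Idl (set (take i xs))) (xs ! i)"
      using reg[OF i] regular_on_quotient_iff[OF genideal_ideal[OF tk] xi] by simp
    have 2: "Idl (set (take i xs)) \<subseteq> P" using sub set by (intro genideal_minimal prime_ideal Suc.prems) auto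
    have 3: "xs ! i \<in> P" using sub set by auto
    obtain Q where Q: "primeideal Q R" "Idl (set (take i xs)) \<subseteq> Q" "Q \<subset> P"
      using regular_descends_prime[OF genideal_ideal[OF tk] 1 Suc.prems(1) 2 3] by blast
    then show ?case using Suc.IH[OF Q(1,2)] i prime_chain_to_Suc[OF _ Suc.prems(1) Q(3)] by simp
  qed
  moreover obtain P where "primeideal P R" "Idl (set xs) \<subseteq> P"
    using proper_ideal_in_prime[OF genideal_ideal[OF xs(1)] xs(2)] by blast
  ultimately show ?thesis by (metis order_refl take_all)
qed

end

section \<open>Local rings and Krull's intersection theorem\<close>

context local_ring begin

lemma max_prime: "primeideal \<mm> R"
  by (rule maximalideal_prime[OF max_ideal])

lemma max_closed: "ideal \<mm> R" by (rule prime_ideal[OF max_prime])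

lemma proper_ideal_in_max:
  assumes I: "ideal I R" "I \<noteq> carrier R" shows "I \<subseteq> \<mm>"
proof -
  let ?A = "{J. ideal J R \<and> I \<subseteq> J \<and> J \<noteq> carrier R}"
  have "\<exists>M\<in>?A. \<forall>N\<in>?A. M \<subseteq> N \<longrightarrow> N = M" by (rule ideals_have_maximal) (use I in auto)
  then obtain M where MA: "M \<in> ?A" and mx: "\<forall>N\<in>?A. M \<subseteq> N \<longrightarrow> N = M" by (elim bexE)
  have "maximalideal M R"
  proof (rule maximalidealI)
    show "ideal M R" "carrier R \<noteq> M" using MA by auto
    fix J assume J: "ideal J R" "M \<subseteq> J" "J \<subseteq> carrier R"
    then show "J = M \<or> J = carrier R" using mx MA by blast
  qed
  then show ?thesis using max_ideal_unique MA by auto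
qed

lemma prime_in_max: "primeideal P R \<Longrightarrow> P \<subseteq> \<mm>"
  using proper_ideal_in_max prime_ideal primeideal.I_notcarr by metis

lemma outside_max_cancel:
  assumes "u \<in> carrier R" "u \<notin> \<mm>" "ideal I R" "a \<in> carrier R" "u \<otimes> a \<in> I" shows "a \<in> I"
proof -
  have i: "ideal (PIdl u) R" by (rule cgenideal_ideal[OF assms(1)])
  have "PIdl u = carrier R" using proper_ideal_in_max[OF i] cgenideal_self[OF assms(1)] assms(2) by auto
  then obtain v where v: "v \<in> carrier R" "\<one> = v \<otimes> u" unfolding cgenideal_def using one_closed by blast
  have "a = \<one> \<otimes> a" using assms by simp
  also have "\<dots> = v \<otimes> (u \<otimes> a)" unfolding v using v(1) assms by (simp add: m_assoc)
  also have "\<dots> \<in> I" by (rule ideal_lmult[OF assms(3,5) v(1)])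
  finally show ?thesis .
qed

text \<open>
  The intersection of all ideals \<open>L\<close> that contain \<open>I\<close> and a power of every \<open>y i\<close> is \<open>I\<close>. The proof avoids
  the Artin-Rees lemma. Let \<open>C = I + \<mm> a\<close> and let \<open>L\<close> be an ideal that is maximal among those
  with \<open>C \<subseteq> L\<close> and \<open>L \<inter> R a \<subseteq> C\<close>. Since \<open>y i\<close> multiplies \<open>a\<close> into
  \<open>C\<close>, maximality forces a power of \<open>y i\<close> into \<open>L\<close>. Hence \<open>a \<in> L \<inter> R a \<subseteq> I + \<mm> a\<close>, and
  Nakayama's lemma gives \<open>a \<in> I\<close>.
\<close>

lemma krull_intersection:
  assumes I: "ideal I R" and U: "finite U" "\<And>i. i \<in> U \<Longrightarrow> y i \<in> \<mm>" and a: "a \<in> carrier R"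
    and all: "\<And>L. ideal L R \<Longrightarrow> I \<subseteq> L \<Longrightarrow> (\<forall>i\<in>U. \<exists>k::nat. y i [^] k \<in> L) \<Longrightarrow> a \<in> L"
  shows "a \<in> I"
proof -
  define C where "C = {e \<oplus> j \<otimes> a | e j. e \<in> I \<and> j \<in> \<mm>}"
  note Ic = ideal.Icarr[OF I] and mc = ideal.Icarr[OF max_closed]
  have C: "ideal C R"
  proof (rule idealI_closed)
    show "C \<subseteq> carrier R" using Ic mc a by (auto simp: C_def)
    have "\<zero> = \<zero> \<oplus> \<zero> \<otimes> a" using a by simp
    then show "\<zero> \<in> C" unfolding C_def using ideal_zero[OF I] ideal_zero[OF max_closed] by blast
    fix u v assume "u \<in> C" "v \<in> C"
    then obtain e j e' j' where c: "u = e \<oplus> j \<otimes> a" "v = e' \<oplus> j' \<otimes> a" "e \<in> I" "e' \<in> I" "j \<in> \<mm>" "j' \<in> \<mm>"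
      by (auto simp: C_def)
    have "u \<oplus> v = (e \<oplus> e') \<oplus> (j \<oplus> j') \<otimes> a" unfolding c(1,2) using Ic[OF c(3)] Ic[OF c(4)] mc[OF c(5)] mc[OF c(6)] a by algebra
    then show "u \<oplus> v \<in> C" unfolding C_def using ideal_add[OF I c(3,4)] ideal_add[OF max_closed c(5,6)] by blast
  next
    fix u r assume "u \<in> C" and r: "r \<in> carrier R"
    then obtain e j where c: "u = e \<oplus> j \<otimes> a" "e \<in> I" "j \<in> \<mm>" by (auto simp: C_def)
    have "r \<otimes> u = (r \<otimes> e) \<oplus> (r \<otimes> j) \<otimes> a" unfolding c(1) using Ic[OF c(2)] mc[OF c(3)] a r by algebra
    then show "r \<otimes> u \<in> C" unfolding C_def using ideal_lmult[OF I c(2) r] ideal_lmult[OF max_closed c(3) r] by blast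
  qed
  have IC: "I \<subseteq> C"
  proof
    fix e assume e: "e \<in> I"
    then have "e = e \<oplus> \<zero> \<otimes> a" using Ic a by simp
    then show "e \<in> C" unfolding C_def using e ideal_zero[OF max_closed] by blast
  qed
  have maC: "j \<otimes> a \<in> C" if j: "j \<in> \<mm>" for j
  proof -
    have "j \<otimes> a = \<zero> \<oplus> j \<otimes> a" using mc[OF j] a by simp
    then show ?thesis unfolding C_def using j ideal_zero[OF I] by blast
  qed
  let ?A = "{L. ideal L R \<and> C \<subseteq> L \<and> (\<forall>s\<in>carrier R. s \<otimes> a \<in> L \<longrightarrow> s \<otimes> a \<in> C)}"
  have "\<exists>M\<in>?A. \<forall>N\<in>?A. M \<subseteq> N \<longrightarrow> N = M" by (rule ideals_have_maximal) (use C in auto)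
  then obtain L where LA: "L \<in> ?A" and mx: "\<forall>N\<in>?A. L \<subseteq> N \<longrightarrow> N = L" by (elim bexE)
  have L: "ideal L R" "C \<subseteq> L" and LC: "\<And>s. s \<in> carrier R \<Longrightarrow> s \<otimes> a \<in> L \<Longrightarrow> s \<otimes> a \<in> C" using LA by auto
  have "\<exists>k::nat. y i [^] k \<in> L" if i: "i \<in> U" for i
  proof -
    let ?y = "y i"
    have ym: "?y \<in> \<mm>" and yc: "?y \<in> carrier R" using U(2)[OF i] mc by auto
    (* The colon ideals (L : y^k) increase with k; k is chosen where they become stationary. *)
    let ?c = "\<lambda>k::nat. {r \<in> carrier R. ?y [^] k \<otimes> r \<in> L}"
    have ci: "ideal (?c k) R" for k
    proof (rule idealI_closed)
      show "\<zero> \<in> ?c k" using yc ideal_zero[OF L(1)] by simp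
      show "a \<oplus> b \<in> ?c k" if "a \<in> ?c k" "b \<in> ?c k" for a b
        using that yc ideal_add[OF L(1)] by (simp add: r_distr)
      show "r \<otimes> a \<in> ?c k" if "a \<in> ?c k" "r \<in> carrier R" for a r
        using that yc ideal_lmult[OF L(1), of "?y [^] k \<otimes> a" r] by (simp add: m_lcomm)
    qed auto
    have "\<exists>M\<in>range ?c. \<forall>N\<in>range ?c. M \<subseteq> N \<longrightarrow> N = M" by (rule ideals_have_maximal) (use ci in auto)
    then obtain k where k: "\<forall>N\<in>range ?c. ?c k \<subseteq> N \<longrightarrow> N = ?c k" by auto
    have sub: "?c k \<subseteq> ?c (Suc k)"
    proof
      fix r assume r: "r \<in> ?c k"
      have "?y [^] Suc k \<otimes> r = ?y \<otimes> (?y [^] k \<otimes> r)" using r yc by (simp add: m_ac)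
      then show "r \<in> ?c (Suc k)" using r ideal_lmult[OF L(1) _ yc] by auto
    qed
    then have st: "?c (Suc k) = ?c k" using k by blast
    let ?L = "adjoin L (?y [^] k)"
    have pc: "?y [^] k \<in> carrier R" using yc by simp
    have "?L \<in> ?A"
    proof (intro CollectI conjI ballI impI)
      show "ideal ?L R" by (rule adjoin_ideal[OF L(1) pc])
      show "C \<subseteq> ?L" using L(2) adjoin_superset[OF L(1) pc] by blast
      fix s assume s: "s \<in> carrier R" "s \<otimes> a \<in> ?L"
      then obtain l r where l: "s \<otimes> a = l \<oplus> r \<otimes> ?y [^] k" "l \<in> L" "r \<in> carrier R" by (auto simp: adjoin_def)
      have lc: "l \<in> carrier R" using ideal.Icarr[OF L(1) l(2)] .
      have "s \<otimes> (?y \<otimes> a) \<in> L" using ideal_lmult[OF L(1) _ s(1)] maC[OF ym] L(2) by blast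
      then have "s \<otimes> (?y \<otimes> a) \<ominus> ?y \<otimes> l \<in> L" using ideal_minus[OF L(1)] ideal_lmult[OF L(1) l(2) yc] by blast
      moreover have "s \<otimes> (?y \<otimes> a) \<ominus> ?y \<otimes> l = ?y \<otimes> (s \<otimes> a) \<ominus> ?y \<otimes> l" using s(1) yc a lc by algebra
      moreover have "\<dots> = (?y [^] k \<otimes> ?y) \<otimes> r" unfolding l(1) using yc pc lc l(3) by algebra
      ultimately have "r \<in> ?c (Suc k)" using l(3) by simp
      then have "?y [^] k \<otimes> r \<in> L" using st by auto
      then have "s \<otimes> a \<in> L" unfolding l(1) using ideal_add[OF L(1) l(2)] l(3) pc by (simp add: m_comm)
      then show "s \<otimes> a \<in> C" using LC s(1) by blast
    qed
    then have "?L = L" using mx adjoin_superset[OF L(1) pc] by blast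
    then show ?thesis using adjoin_self[OF L(1) pc] by blast
  qed
  then have "a \<in> L" using all[OF L(1)] L(2) IC by blast
  then have "a \<in> C" using LC[of \<one>] a by simp
  then obtain e j where e: "a = e \<oplus> j \<otimes> a" "e \<in> I" "j \<in> \<mm>" unfolding C_def by blast
  have jc: "j \<in> carrier R" and ec: "e \<in> carrier R" using mc[OF e(3)] Ic[OF e(2)] .
  have "(\<one> \<ominus> j) \<otimes> a = a \<ominus> j \<otimes> a" using jc a by algebra
  also have "\<dots> = (e \<oplus> j \<otimes> a) \<ominus> j \<otimes> a" using e(1) by simp
  also have "\<dots> = e" using ec jc a by algebra
  finally have "(\<one> \<ominus> j) \<otimes> a \<in> I" using e by simp
  moreover have "\<one> \<ominus> j \<notin> \<mm>"
  proof
    assume "\<one> \<ominus> j \<in> \<mm>"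
    then have "(\<one> \<ominus> j) \<oplus> j \<in> \<mm>" using ideal_add[OF max_closed] e(3) by blast
    moreover have "(\<one> \<ominus> j) \<oplus> j = \<one>" using jc by algebra
    ultimately show False using prime_one[OF max_prime] by simp
  qed
  ultimately show ?thesis using outside_max_cancel[OF _ _ I a] jc by blast
qed

section \<open>Limit closed sequences\<close>

text \<open>
  For \<open>I = 0\<close> this says that the maps \<open>R/(x i) \<rightarrow> R/((x i)\<^sup>k\<^sup>+\<^sup>1)\<close>, multiplication by the \<open>k\<close>-th power of the product
  of the \<open>x i\<close>, are injective. The direct limit of the quotients is the top local cohomology.
\<close>

definition limit_closed :: "'a set \<Rightarrow> nat set \<Rightarrow> (nat \<Rightarrow> 'a) \<Rightarrow> bool" where
  "limit_closed I U x \<longleftrightarrow> (\<forall>k::nat. \<forall>r\<in>carrier R.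
     r \<otimes> (\<Otimes>i\<in>U. x i [^] k) \<in> Idl (I \<union> (\<lambda>i. x i [^] Suc k) ` U) \<longrightarrow> r \<in> Idl (I \<union> x ` U))"

text \<open>
  Suppose \<open>x j \<otimes> a \<in> I\<close>. Then \<open>a\<close> lies in \<open>M d\<close> for every \<open>d\<close>, where \<open>M d\<close> is generated by \<open>I\<close> and the monomials of
  degree \<open>d\<close>, and Krull's intersection theorem gives \<open>a \<in> I\<close>. To pass from \<open>d\<close> to \<open>d + 1\<close>, write \<open>a\<close> modulo
  \<open>I\<close> as a combination of monomials \<open>mon \<alpha>\<close> with coefficients \<open>c \<alpha>\<close>, fix one \<open>\<beta>\<close>, and multiply by
  \<open>x j \<otimes> mon \<gamma>\<close> with \<open>\<gamma>\<close> chosen to complete \<open>x j \<otimes> mon \<beta>\<close> to the product of all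
  \<open>(x i)\<^sup>d\<^sup>+\<^sup>1\<close>. Every other monomial of degree \<open>d\<close> exceeds \<open>\<beta>\<close> in some exponent and so
  ends up in the ideal of the \<open>(x i)\<^sup>d\<^sup>+\<^sup>2\<close>. Limit closedness puts \<open>c \<beta>\<close> into
  \<open>I + (x i)\<close>, and hence \<open>c \<beta> \<otimes> mon \<beta>\<close> into \<open>M (d + 1)\<close>.
\<close>

lemma limit_closed_regular:
  assumes I: "ideal I R" and U: "finite U" "\<And>i. i \<in> U \<Longrightarrow> x i \<in> \<mm>" and lc: "limit_closed I U x" and j: "j \<in> U"
  shows "regular_mod I (x j)"
  unfolding regular_mod_def
proof (intro ballI impI)
  fix a assume a: "a \<in> carrier R" and xa: "x j \<otimes> a \<in> I"
  have xc: "x i \<in> carrier R" if "i \<in> U" for i using U(2)[OF that] ideal.Icarr[OF max_closed] by simp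
  define mon where "mon \<alpha> = (\<Otimes>i\<in>U. x i [^] (\<alpha> i :: nat))" for \<alpha>
  have monc: "mon \<alpha> \<in> carrier R" for \<alpha> unfolding mon_def using xc by (intro finprod_closed) auto
  have mon_mult: "mon \<alpha> \<otimes> mon \<beta> = mon (\<lambda>i. \<alpha> i + \<beta> i)" for \<alpha> \<beta>
  proof -
    have "mon (\<lambda>i. \<alpha> i + \<beta> i) = (\<Otimes>i\<in>U. x i [^] \<alpha> i \<otimes> x i [^] \<beta> i)" unfolding mon_def
      by (rule finprod_cong') (use xc in \<open>auto simp: nat_pow_mult\<close>)
    also have "\<dots> = mon \<alpha> \<otimes> mon \<beta>" unfolding mon_def using xc by (intro finprod_multf) auto
    finally show ?thesis by simp
  qed
  have mon_split: "mon \<alpha> = x i [^] \<alpha> i \<otimes> (\<Otimes>i\<in>U-{i}. x i [^] \<alpha> i)" if "i \<in> U" for \<alpha> i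
  proof -
    have "mon \<alpha> = (\<Otimes>i\<in>insert i (U - {i}). x i [^] \<alpha> i)" unfolding mon_def using that by (simp add: insert_absorb)
    also have "\<dots> = x i [^] \<alpha> i \<otimes> (\<Otimes>i\<in>U-{i}. x i [^] \<alpha> i)" using xc U that by (subst finprod_insert) auto
    finally show ?thesis .
  qed
  have restc: "(\<Otimes>i\<in>U-{i}. x i [^] (\<alpha> i :: nat)) \<in> carrier R" for \<alpha> i using xc by (intro finprod_closed) auto
  have mon_in: "mon \<alpha> \<in> L" if L: "ideal L R" and i: "i \<in> U" "\<alpha> i \<ge> k" "x i [^] k \<in> L" for \<alpha> i k L
  proof -
    have "x i [^] \<alpha> i = x i [^] k \<otimes> x i [^] (\<alpha> i - k)" using xc[OF i(1)] i(2) by (simp add: nat_pow_mult)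
    then have "x i [^] \<alpha> i \<in> L" using ideal_rmult[OF L i(3)] xc[OF i(1)] by simp
    then show ?thesis unfolding mon_split[OF i(1)] by (rule ideal_rmult[OF L _ restc])
  qed
  define T where "T d = {\<alpha> \<in> U \<rightarrow>\<^sub>E UNIV. (\<Sum>i\<in>U. \<alpha> i) = (d::nat)}" for d
  have Tle: "\<alpha> i \<le> d" if "\<alpha> \<in> T d" "i \<in> U" for \<alpha> i d
    using that member_le_sum[of i U \<alpha>] U(1) by (auto simp: T_def)
  have Tfin: "finite (T d)" for d
    by (rule finite_subset[OF _ finite_PiE[OF U(1), of "\<lambda>_. {..d}"]]) (use Tle in \<open>auto simp: T_def PiE_iff extensional_def\<close>)
  define M where "M d = Idl (I \<union> mon ` T d)" for d
  have Msub: "I \<union> mon ` T d \<subseteq> carrier R" for d using ideal_subset[OF I] monc by auto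
  have Mi: "ideal (M d) R" for d unfolding M_def by (rule genideal_ideal[OF Msub])
  have Mself: "I \<subseteq> M d" "\<alpha> \<in> T d \<Longrightarrow> mon \<alpha> \<in> M d" for d \<alpha> unfolding M_def using genideal_self[OF Msub] by auto
  have Kc: "I \<union> x ` U \<subseteq> carrier R" using ideal_subset[OF I] xc by auto
  have step: "a \<in> M (Suc d)" if ad: "a \<in> M d" for d
  proof -
    obtain e c where ec: "e \<in> I" "c \<in> T d \<rightarrow> carrier R" and ae: "a = e \<oplus> (\<Oplus>\<alpha>\<in>T d. c \<alpha> \<otimes> mon \<alpha>)"
      using Idl_union_image_combination[OF I Tfin, of mon d a] ad monc unfolding M_def by auto
    have ecar: "e \<in> carrier R" using ideal.Icarr[OF I ec(1)] .
    have cc: "c \<alpha> \<in> carrier R" if "\<alpha> \<in> T d" for \<alpha> using ec that by auto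
    have "c \<beta> \<otimes> mon \<beta> \<in> M (Suc d)" if \<beta>: "\<beta> \<in> T d" for \<beta>
    proof -
      let ?N = "Idl (I \<union> (\<lambda>i. x i [^] Suc (Suc d)) ` U)"
      have Nsub: "I \<union> (\<lambda>i. x i [^] Suc (Suc d)) ` U \<subseteq> carrier R" using ideal_subset[OF I] xc by auto
      have N: "ideal ?N R" by (rule genideal_ideal[OF Nsub])
      have Nself: "I \<subseteq> ?N" "i \<in> U \<Longrightarrow> x i [^] Suc (Suc d) \<in> ?N" for i using genideal_self[OF Nsub] by auto
      (* Exponents of the complementary monomial; beta i is at most d, so the truncated
         subtraction is exact, also for i = j. *)
      define \<gamma> where "\<gamma> i = Suc d - (if i = j then Suc (\<beta> i) else \<beta> i)" for i
      define \<delta> where "\<delta> i = (if i = j then 1 else 0 :: nat)" for i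
      have md: "mon \<delta> = x j"
      proof -
        have "(\<Otimes>i\<in>U-{j}. x i [^] \<delta> i) = (\<Otimes>i\<in>U-{j}. \<one>)" by (rule finprod_cong') (auto simp: \<delta>_def)
        then show ?thesis unfolding mon_split[OF j] using xc[OF j] by (simp add: \<delta>_def)
      qed
      define h where "h \<alpha> = x j \<otimes> mon \<alpha> \<otimes> mon \<gamma>" for \<alpha>
      have h: "h \<alpha> = mon (\<lambda>i. \<delta> i + \<alpha> i + \<gamma> i)" for \<alpha> unfolding h_def md[symmetric] mon_mult ..
      have hc: "h \<alpha> \<in> carrier R" for \<alpha> unfolding h using monc .
      have h\<beta>: "h \<beta> = (\<Otimes>i\<in>U. x i [^] Suc d)"
      proof -
        have "\<delta> i + \<beta> i + \<gamma> i = Suc d" if "i \<in> U" for i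
          using Tle[OF \<beta> that] by (auto simp: \<delta>_def \<gamma>_def)
        then show ?thesis unfolding h mon_def by (intro finprod_cong') (use xc in auto)
      qed
      have h\<alpha>: "h \<alpha> \<in> ?N" if \<alpha>: "\<alpha> \<in> T d" "\<alpha> \<noteq> \<beta>" for \<alpha>
      proof -
        have "\<exists>i\<in>U. \<alpha> i > \<beta> i"
        proof (rule ccontr)
          assume "\<not> (\<exists>i\<in>U. \<alpha> i > \<beta> i)"
          then have le: "\<forall>i\<in>U. \<alpha> i \<le> \<beta> i" by auto
          have "\<exists>i\<in>U. \<alpha> i < \<beta> i"
          proof (rule ccontr)
            assume "\<not> (\<exists>i\<in>U. \<alpha> i < \<beta> i)"
            then have "\<alpha> = \<beta>" using le \<alpha> \<beta> by (intro PiE_ext[of _ U "\<lambda>_. UNIV"]) (auto simp: T_def not_less intro: le_antisym)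
            then show False using \<alpha> by simp
          qed
          then have "(\<Sum>i\<in>U. \<alpha> i) < (\<Sum>i\<in>U. \<beta> i)" using le U(1) by (intro sum_strict_mono_ex1) auto
          then show False using \<alpha> \<beta> by (simp add: T_def)
        qed
        then obtain i where i: "i \<in> U" "\<alpha> i > \<beta> i" by blast
        show ?thesis unfolding h
          by (rule mon_in[OF N i(1) _ Nself(2)[OF i(1)]]) (use i Tle[OF \<beta> i(1)] in \<open>auto simp: \<delta>_def \<gamma>_def\<close>)
      qed
      have "c \<beta> \<otimes> h \<beta> \<in> ?N"
      proof -
        define s where "s = (\<Oplus>\<alpha>\<in>T d - {\<beta>}. c \<alpha> \<otimes> mon \<alpha>)"
        have sc: "s \<in> carrier R" unfolding s_def using cc monc by (intro finsum_closed) auto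
        have "(\<Oplus>\<alpha>\<in>T d. c \<alpha> \<otimes> mon \<alpha>) = (\<Oplus>\<alpha>\<in>insert \<beta> (T d - {\<beta>}). c \<alpha> \<otimes> mon \<alpha>)" using \<beta> by (simp add: insert_absorb)
        also have "\<dots> = c \<beta> \<otimes> mon \<beta> \<oplus> s" unfolding s_def using cc monc \<beta> Tfin by (subst finsum_insert) auto
        finally have a2: "a = e \<oplus> (c \<beta> \<otimes> mon \<beta> \<oplus> s)" using ae by simp
        have "(x j \<otimes> mon \<gamma>) \<otimes> s = (\<Oplus>\<alpha>\<in>T d - {\<beta>}. (x j \<otimes> mon \<gamma>) \<otimes> (c \<alpha> \<otimes> mon \<alpha>))"
          unfolding s_def using cc monc xc[OF j] Tfin by (intro finsum_rdistr) auto
        also have "\<dots> = (\<Oplus>\<alpha>\<in>T d - {\<beta>}. c \<alpha> \<otimes> h \<alpha>)"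
          by (rule finsum_cong') (use cc monc xc[OF j] hc in \<open>auto simp: h_def m_ac\<close>)
        also have "\<dots> \<in> ?N" using cc h\<alpha> by (intro ideal_finsum[OF N] ideal_lmult[OF N]) auto
        finally have 1: "(x j \<otimes> mon \<gamma>) \<otimes> s \<in> ?N" .
        have 2: "mon \<gamma> \<otimes> (x j \<otimes> a) \<in> ?N" using ideal_lmult[OF N _ monc] xa Nself(1) by blast
        have 3: "(x j \<otimes> mon \<gamma>) \<otimes> e \<in> ?N" using ideal_lmult[OF N] monc xc[OF j] ec(1) Nself(1) by blast
        have "c \<beta> \<otimes> h \<beta> = mon \<gamma> \<otimes> (x j \<otimes> a) \<ominus> (x j \<otimes> mon \<gamma>) \<otimes> e \<ominus> (x j \<otimes> mon \<gamma>) \<otimes> s"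
          unfolding a2 h_def using monc[of \<gamma>] monc[of \<beta>] xc[OF j] cc[OF \<beta>] ecar sc by algebra
        then show ?thesis using 1 2 3 ideal_minus[OF N] by simp
      qed
      then have cK: "c \<beta> \<in> Idl (I \<union> x ` U)"
        using lc cc[OF \<beta>] unfolding limit_closed_def h\<beta> by blast
      have "ideal {r \<in> carrier R. r \<otimes> mon \<beta> \<in> M (Suc d)} R"
      proof (rule idealI_closed)
        show "\<zero> \<in> {r \<in> carrier R. r \<otimes> mon \<beta> \<in> M (Suc d)}" using monc ideal_zero[OF Mi] by simp
      qed (use monc ideal_add[OF Mi] ideal_lmult[OF Mi] in \<open>auto simp: l_distr m_assoc\<close>)
      moreover have "I \<union> x ` U \<subseteq> {r \<in> carrier R. r \<otimes> mon \<beta> \<in> M (Suc d)}"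
      proof (intro Un_least subsetI CollectI conjI)
        show "r \<in> carrier R" if "r \<in> I" for r using ideal.Icarr[OF I that] .
        show "r \<otimes> mon \<beta> \<in> M (Suc d)" if "r \<in> I" for r using ideal_rmult[OF Mi _ monc] Mself(1) that by blast
        fix r assume "r \<in> x ` U"
        then obtain i where i: "i \<in> U" "r = x i" by auto
        show "r \<in> carrier R" using i xc by simp
        let ?\<beta> = "\<beta>(i := Suc (\<beta> i))"
        have "(\<Sum>l\<in>U. ?\<beta> l) = Suc (\<Sum>l\<in>U. \<beta> l)" using U(1) i(1) by (simp add: sum.remove)
        then have "?\<beta> \<in> T (Suc d)" using \<beta> i by (auto simp: T_def PiE_iff extensional_def)
        moreover have "mon ?\<beta> = r \<otimes> mon \<beta>"
        proof -
          have "(\<Otimes>l\<in>U-{i}. x l [^] ?\<beta> l) = (\<Otimes>l\<in>U-{i}. x l [^] \<beta> l)" by (rule finprod_cong') (use xc in auto)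
          then show ?thesis unfolding mon_split[OF i(1)] i(2) using xc[OF i(1)] restc by (simp add: m_ac)
        qed
        ultimately show "r \<otimes> mon \<beta> \<in> M (Suc d)" using Mself(2) by metis
      qed
      ultimately have "Idl (I \<union> x ` U) \<subseteq> {r \<in> carrier R. r \<otimes> mon \<beta> \<in> M (Suc d)}" by (rule genideal_minimal)
      then show ?thesis using cK by blast
    qed
    then have "(\<Oplus>\<alpha>\<in>T d. c \<alpha> \<otimes> mon \<alpha>) \<in> M (Suc d)" by (intro ideal_finsum[OF Mi])
    then show ?thesis unfolding ae using ideal_add[OF Mi] ec(1) Mself(1) by blast
  qed
  have aM: "a \<in> M d" for d
  proof (induction d)
    case 0
    have "(\<lambda>i\<in>U. 0) \<in> T 0" by (auto simp: T_def)
    moreover have "mon (\<lambda>i\<in>U. 0) = \<one>"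
    proof -
      have "mon (\<lambda>i\<in>U. 0) = (\<Otimes>i\<in>U. \<one>)" unfolding mon_def by (rule finprod_cong') auto
      then show ?thesis by simp
    qed
    ultimately have "\<one> \<in> M 0" using Mself(2) by metis
    then show ?case using ideal_lmult[OF Mi _ a] a by fastforce
  qed (rule step)
  show "a \<in> I"
  proof (rule krull_intersection[OF I U a])
    fix L assume L: "ideal L R" "I \<subseteq> L" "\<forall>i\<in>U. \<exists>k::nat. x i [^] k \<in> L"
    then obtain k where k: "\<And>i. i \<in> U \<Longrightarrow> x i [^] (k i :: nat) \<in> L" by metis
    (* A monomial of degree k 1 + ... + k n has some exponent i that is at least k i. *)
    let ?d = "\<Sum>i\<in>U. k i"
    have "mon \<alpha> \<in> L" if \<alpha>: "\<alpha> \<in> T ?d" for \<alpha>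
    proof -
      have "\<exists>i\<in>U. k i \<le> \<alpha> i"
      proof (rule ccontr)
        assume "\<not> ?thesis"
        then have "(\<Sum>i\<in>U. \<alpha> i) < ?d" using U(1) j by (intro sum_strict_mono) auto
        then show False using \<alpha> by (simp add: T_def)
      qed
      then show ?thesis using mon_in[OF L(1)] k by blast
    qed
    then have "M ?d \<subseteq> L" unfolding M_def using L by (intro genideal_minimal) auto
    then show "a \<in> L" using aM by blast
  qed
qed

text \<open>
  Multiply a relation for the shorter sequence by the \<open>k\<close>-th power of \<open>x j\<close>.
\<close>

lemma limit_closed_descend:
  assumes I: "ideal I R" and U: "finite U" "\<And>i. i \<in> U \<Longrightarrow> x i \<in> carrier R" and lc: "limit_closed I U x" and j: "j \<in> U"
  shows "limit_closed (Idl (insert (x j) I)) (U - {j}) x"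
  unfolding limit_closed_def
proof (intro allI ballI impI)
  fix k r
  let ?I = "Idl (insert (x j) I)"
  assume r: "r \<in> carrier R"
    and rk: "r \<otimes> (\<Otimes>i\<in>U - {j}. x i [^] k) \<in> Idl (?I \<union> (\<lambda>i. x i [^] Suc k) ` (U - {j}))"
  have s1: "insert (x j) I \<subseteq> carrier R" using ideal_subset[OF I] U j by auto
  note I1 = genideal_ideal[OF s1] and I1s = genideal_self[OF s1]
  have s2: "?I \<union> x ` (U - {j}) \<subseteq> carrier R" using ideal_subset[OF I1] U by auto
  note I2 = genideal_ideal[OF s2] and I2s = genideal_self[OF s2]
  have s3: "I \<union> (\<lambda>i. x i [^] Suc k) ` U \<subseteq> carrier R" using ideal_subset[OF I] U by auto
  note I3 = genideal_ideal[OF s3] and I3s = genideal_self[OF s3]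
  let ?N = "Idl (I \<union> (\<lambda>i. x i [^] Suc k) ` U)"
  let ?p = "\<Otimes>i\<in>U - {j}. x i [^] k"
  have xj: "x j \<in> carrier R" "x j [^] k \<in> carrier R" using U j by auto
  have pc: "?p \<in> carrier R" using U by (intro finprod_closed) auto
  let ?C = "{s \<in> carrier R. s \<otimes> x j [^] k \<in> ?N}"
  have C: "ideal ?C R"
  proof (rule idealI_closed)
    show "\<zero> \<in> ?C" using xj ideal_zero[OF I3] by simp
  qed (use xj ideal_add[OF I3] ideal_lmult[OF I3] in \<open>auto simp: l_distr m_assoc\<close>)
  have "?I \<subseteq> ?C"
  proof (rule genideal_minimal[OF C], intro insert_subsetI subsetI CollectI conjI)
    show "x j \<otimes> x j [^] k \<in> ?N" using I3s j xj by (auto simp: m_comm)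
    show "s \<otimes> x j [^] k \<in> ?N" if "s \<in> I" for s using ideal_rmult[OF I3 _ xj(2)] I3s that by blast
  qed (use xj ideal_subset[OF I] in auto)
  moreover have "(\<lambda>i. x i [^] Suc k) ` (U - {j}) \<subseteq> ?C"
  proof
    fix s assume "s \<in> (\<lambda>i. x i [^] Suc k) ` (U - {j})"
    then have "s \<in> (\<lambda>i. x i [^] Suc k) ` U" by auto
    then have "s \<in> ?N" using I3s by auto
    then show "s \<in> ?C" using ideal_rmult[OF I3 _ xj(2)] ideal.Icarr[OF I3] by simp
  qed
  ultimately have "Idl (?I \<union> (\<lambda>i. x i [^] Suc k) ` (U - {j})) \<subseteq> ?C" by (intro genideal_minimal[OF C]) auto
  then have "(r \<otimes> ?p) \<otimes> x j [^] k \<in> ?N" using rk by blast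
  moreover have "(\<Otimes>i\<in>U. x i [^] k) = x j [^] k \<otimes> ?p"
  proof -
    have "(\<Otimes>i\<in>U. x i [^] k) = (\<Otimes>i\<in>insert j (U - {j}). x i [^] k)" using j by (simp add: insert_absorb)
    also have "\<dots> = x j [^] k \<otimes> ?p" using U j by (subst finprod_insert) auto
    finally show ?thesis .
  qed
  ultimately have "r \<otimes> (\<Otimes>i\<in>U. x i [^] k) \<in> ?N" using r pc xj by (simp add: m_ac)
  then have "r \<in> Idl (I \<union> x ` U)" using lc r by (auto simp: limit_closed_def)
  moreover have "I \<union> x ` U \<subseteq> Idl (?I \<union> x ` (U - {j}))"
    using I1s I2s by auto
  then have "Idl (I \<union> x ` U) \<subseteq> Idl (?I \<union> x ` (U - {j}))" by (rule genideal_minimal[OF I2])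
  ultimately show "r \<in> Idl (?I \<union> x ` (U - {j}))" by blast
qed

lemma limit_closed_regular_sequence:
  assumes x: "\<And>i. i < n \<Longrightarrow> x i \<in> \<mm>" and lc: "limit_closed {\<zero>} {..<n} x"
  shows "regular_sequence R (map x [0..<n])"
proof -
  have xc: "x i \<in> carrier R" if "i < n" for i using x[OF that] ideal.Icarr[OF max_closed] by simp
  have tk: "set (take i (map x [0..<n])) = x ` {..<i}" if "i \<le> n" for i
    using that by (auto simp: take_map)
  have sub: "x ` {..<i} \<subseteq> carrier R" if "i \<le> n" for i using xc that by auto
  have lci: "limit_closed (Idl (x ` {..<i})) ({..<n} - {..<i}) x" if "i \<le> n" for i
    using that
  proof (induction i)
    case 0
    show ?case using lc by (simp add: Idl_empty)
  next
    case (Suc i)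
    have si: "x ` {..<i} \<subseteq> carrier R" using sub Suc by simp
    note Ii = genideal_ideal[OF si] and Is = genideal_self[OF si]
    have "limit_closed (Idl (insert (x i) (Idl (x ` {..<i})))) ({..<n} - {..<i} - {i}) x"
      by (rule limit_closed_descend[OF Ii]) (use xc Suc in auto)
    moreover have "{..<n} - {..<i} - {i} = {..<n} - {..<Suc i}" by auto
    moreover have "Idl (insert (x i) (Idl (x ` {..<i}))) = Idl (x ` {..<Suc i})"
    proof
      have s2: "x ` {..<Suc i} \<subseteq> carrier R" using sub Suc by simp
      note J = genideal_ideal[OF s2] and Js = genideal_self[OF s2]
      have "x ` {..<i} \<subseteq> Idl (x ` {..<Suc i})" using Js by (auto simp: lessThan_Suc)
      then have "Idl (x ` {..<i}) \<subseteq> Idl (x ` {..<Suc i})" by (rule genideal_minimal[OF J])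
      then show "Idl (insert (x i) (Idl (x ` {..<i}))) \<subseteq> Idl (x ` {..<Suc i})"
        using Js by (intro genideal_minimal[OF J]) (auto simp: lessThan_Suc)
      have s3: "insert (x i) (Idl (x ` {..<i})) \<subseteq> carrier R" using xc Suc ideal_subset[OF Ii] by auto
      show "Idl (x ` {..<Suc i}) \<subseteq> Idl (insert (x i) (Idl (x ` {..<i})))"
        using genideal_self[OF s3] Is by (intro genideal_minimal[OF genideal_ideal[OF s3]]) (auto simp: lessThan_Suc)
    qed
    ultimately show ?case by simp
  qed
  show ?thesis unfolding regular_sequence_def
  proof (intro conjI allI impI)
    show "set (map x [0..<n]) \<subseteq> carrier R" using xc by auto
    have "Idl (set (map x [0..<n])) \<subseteq> \<mm>" using x by (intro genideal_minimal max_closed) auto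
    then show "Idl (set (map x [0..<n])) \<noteq> carrier R" using prime_one[OF max_prime] by auto
    fix i assume i: "i < length (map x [0..<n])"
    then have "regular_mod (Idl (x ` {..<i})) (x i)"
      using x by (intro limit_closed_regular[OF genideal_ideal[OF sub] _ _ lci]) auto
    then show "regular_on_quotient R (Idl (set (take i (map x [0..<n])))) (map x [0..<n] ! i)"
      using i tk[of i] regular_on_quotient_iff[OF genideal_ideal[OF sub[of i]] xc[of i]] by simp
  qed
qed

end

section \<open>Koszul cochains\<close>

context cring begin

text \<open>
  A Koszul cochain of any degree is a function on finite sets of indices, the value at \<open>S\<close> being the coefficient of
  the basis element \<open>e\<^sub>S\<close> of the exterior algebra. One function may carry components of all degrees, and
  values outside the index set of interest are ignored; this spares all bookkeeping of domains.
  The operators \<open>kE i\<close> and \<open>kH i\<close> below are exterior multiplication by \<open>e\<^sub>i\<close> and the contraction adjoint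
  to it. They satisfy the Clifford relations, and everything about the differential \<open>kd z = \<Sum>i. z i kE i\<close> is
  derived from these.
\<close>

definition ksign :: "nat \<Rightarrow> nat set \<Rightarrow> 'a" where
  "ksign i S = (\<ominus> \<one>) [^] card {j \<in> S. j < i}"

definition kE :: "nat \<Rightarrow> (nat set \<Rightarrow> 'a) \<Rightarrow> nat set \<Rightarrow> 'a" where
  "kE i c S = (if i \<in> S then ksign i S \<otimes> c (S - {i}) else \<zero>)"

definition kH :: "nat \<Rightarrow> (nat set \<Rightarrow> 'a) \<Rightarrow> nat set \<Rightarrow> 'a" where
  "kH i c S = (if i \<in> S then \<zero> else ksign i S \<otimes> c (insert i S))"

definition kd :: "(nat \<Rightarrow> 'a) \<Rightarrow> (nat set \<Rightarrow> 'a) \<Rightarrow> nat set \<Rightarrow> 'a" where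
  "kd z c S = (\<Oplus>i\<in>S. z i \<otimes> kE i c S)"

lemma ksign_closed [simp]: "ksign i S \<in> carrier R" by (simp add: ksign_def)

lemma ksign_sq: "ksign i S \<otimes> ksign i S = \<one>"
proof -
  have "(\<ominus> \<one>) [^] n \<otimes> (\<ominus> \<one>) [^] n = \<one>" for n :: nat
  proof (induction n)
    case (Suc n)
    have c: "(\<ominus> \<one>) [^] n \<in> carrier R" by simp
    have "(\<ominus> \<one>) [^] Suc n \<otimes> (\<ominus> \<one>) [^] Suc n = (\<ominus> \<one>) [^] n \<otimes> (\<ominus> \<one>) [^] n"
      unfolding nat_pow_Suc using c by algebra
    then show ?case using Suc by simp
  qed simp
  then show ?thesis by (simp add: ksign_def)
qed

lemma ksign_insert:
  assumes "finite S" "j \<notin> S"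
  shows "ksign i (insert j S) = (if j < i then \<ominus> ksign i S else ksign i S)"
proof (cases "j < i")
  case True
  have "{l \<in> insert j S. l < i} = insert j {l \<in> S. l < i}" using True by auto
  then have "card {l \<in> insert j S. l < i} = Suc (card {l \<in> S. l < i})" using assms by simp
  moreover have "(\<ominus> \<one>) [^] card {l \<in> S. l < i} \<in> carrier R" by simp
  ultimately show ?thesis using True by (simp add: ksign_def r_minus)
next
  case False
  then have "{l \<in> insert j S. l < i} = {l \<in> S. l < i}" by auto
  then show ?thesis using False by (simp add: ksign_def)
qed

lemma ksign_remove:
  assumes "finite S" "j \<in> S"
  shows "ksign i (S - {j}) = (if j < i then \<ominus> ksign i S else ksign i S)"
proof -
  have "ksign i S = (if j < i then \<ominus> ksign i (S - {j}) else ksign i (S - {j}))"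
    using ksign_insert[of "S - {j}" j i] assms by (simp add: insert_absorb)
  then show ?thesis by auto
qed

lemma ksign_remove_self [simp]: "ksign i (S - {i}) = ksign i S"
proof -
  have "{l \<in> S - {i}. l < i} = {l \<in> S. l < i}" by auto
  then show ?thesis by (simp add: ksign_def)
qed

lemma ksign_insert_self [simp]: "ksign i (insert i S) = ksign i S"
proof -
  have "{l \<in> insert i S. l < i} = {l \<in> S. l < i}" by auto
  then show ?thesis by (simp add: ksign_def)
qed

abbreviation coch :: "(nat set \<Rightarrow> 'a) \<Rightarrow> bool" where "coch c \<equiv> \<forall>S. c S \<in> carrier R"
abbreviation seqR :: "(nat \<Rightarrow> 'a) \<Rightarrow> bool" where "seqR z \<equiv> \<forall>i. z i \<in> carrier R"

lemma kE_closed [simp]: "coch c \<Longrightarrow> kE i c S \<in> carrier R" by (simp add: kE_def)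
lemma kH_closed [simp]: "coch c \<Longrightarrow> kH i c S \<in> carrier R" by (simp add: kH_def)
lemma kd_closed [simp]: "coch c \<Longrightarrow> seqR z \<Longrightarrow> kd z c S \<in> carrier R"
  unfolding kd_def by (intro finsum_closed) auto

lemma kE_kE:
  assumes "coch c" "finite S" "i \<noteq> j" shows "kE i (kE j c) S = \<ominus> kE j (kE i c) S"
proof (cases "i \<in> S \<and> j \<in> S")
  case True
  have s: "S - {j} - {i} = S - {i} - {j}" by auto
  have c: "c (S - {i} - {j}) \<in> carrier R" "ksign i S \<in> carrier R" "ksign j S \<in> carrier R" using assms by auto
  show ?thesis
    using True assms(2,3) c by (auto simp: kE_def s ksign_remove l_minus r_minus m_ac)
next
  case False
  then show ?thesis by (auto simp: kE_def)
qed

lemma kE_self [simp]: "kE i (kE i c) S = \<zero>"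
  by (simp add: kE_def)

lemma kH_kE:
  assumes "coch c" "finite S" "i \<noteq> j" shows "kH i (kE j c) S = \<ominus> kE j (kH i c) S"
proof (cases "i \<notin> S \<and> j \<in> S")
  case True
  have s: "insert i S - {j} = insert i (S - {j})" using assms by auto
  have c: "c (insert i (S - {j})) \<in> carrier R" "ksign i S \<in> carrier R" "ksign j S \<in> carrier R" using assms by auto
  show ?thesis
    using True assms(2,3) c by (auto simp: kE_def kH_def s ksign_remove ksign_insert l_minus r_minus m_ac)
next
  case False
  then show ?thesis using assms by (auto simp: kE_def kH_def)
qed

lemma kH_kE_self:
  assumes "coch c" shows "kH i (kE i c) S = (if i \<in> S then \<zero> else c S)"
  using assms by (auto simp: kE_def kH_def m_assoc[symmetric] ksign_sq)

lemma kE_kH_self: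
  assumes "coch c" shows "kE i (kH i c) S = (if i \<in> S then c S else \<zero>)"
  using assms by (auto simp: kE_def kH_def m_assoc[symmetric] ksign_sq insert_absorb)

lemma kd_empty [simp]: "kd z c {} = \<zero>" by (simp add: kd_def)

lemma kd_cong:
  assumes "\<And>i. i \<in> S \<Longrightarrow> z i = z' i" "\<And>i. i \<in> S \<Longrightarrow> c (S - {i}) = c' (S - {i})" "coch c'" "seqR z'"
  shows "kd z c S = kd z' c' S"
  unfolding kd_def by (rule finsum_cong') (use assms in \<open>auto simp: kE_def\<close>)

lemma kE_add: "coch c \<Longrightarrow> coch c' \<Longrightarrow> kE i (\<lambda>S. c S \<oplus> c' S) S = kE i c S \<oplus> kE i c' S"
  by (simp add: kE_def r_distr)
lemma kE_smult: "coch c \<Longrightarrow> r \<in> carrier R \<Longrightarrow> kE i (\<lambda>S. r \<otimes> c S) S = r \<otimes> kE i c S"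
  by (simp add: kE_def m_lcomm)
lemma kH_smult: "coch c \<Longrightarrow> r \<in> carrier R \<Longrightarrow> kH i (\<lambda>S. r \<otimes> c S) S = r \<otimes> kH i c S"
  by (simp add: kH_def m_lcomm)
lemma kH_add: "coch c \<Longrightarrow> coch c' \<Longrightarrow> kH i (\<lambda>S. c S \<oplus> c' S) S = kH i c S \<oplus> kH i c' S"
  by (simp add: kH_def r_distr)

lemma kd_add: "coch c \<Longrightarrow> coch c' \<Longrightarrow> seqR z \<Longrightarrow> kd z (\<lambda>S. c S \<oplus> c' S) S = kd z c S \<oplus> kd z c' S"
proof -
  assume a: "coch c" "coch c'" "seqR z"
  have "kd z (\<lambda>S. c S \<oplus> c' S) S = (\<Oplus>i\<in>S. z i \<otimes> kE i c S \<oplus> z i \<otimes> kE i c' S)"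
    unfolding kd_def by (rule finsum_cong') (use a in \<open>auto simp: kE_add r_distr\<close>)
  also have "\<dots> = kd z c S \<oplus> kd z c' S" unfolding kd_def using a by (intro finsum_addf) auto
  finally show ?thesis .
qed

lemma kd_smult:
  assumes a: "coch c" "seqR z" "r \<in> carrier R" shows "kd z (\<lambda>S. r \<otimes> c S) S = r \<otimes> kd z c S"
proof (cases "finite S")
  case True
  have "kd z (\<lambda>S. r \<otimes> c S) S = (\<Oplus>i\<in>S. r \<otimes> (z i \<otimes> kE i c S))"
    unfolding kd_def by (rule finsum_cong') (use a in \<open>auto simp: kE_smult m_lcomm\<close>)
  also have "\<dots> = r \<otimes> kd z c S" unfolding kd_def using a True by (intro finsum_rdistr[symmetric]) auto
  finally show ?thesis .
next
  case False then show ?thesis using a by (simp add: kd_def finsum_infinite)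
qed

lemma kd_minus:
  assumes a: "coch c" "coch c'" "seqR z" shows "kd z (\<lambda>S. c S \<ominus> c' S) S = kd z c S \<ominus> kd z c' S"
proof -
  have "kd z (\<lambda>S. c S \<ominus> c' S) S = kd z (\<lambda>S. c S \<oplus> (\<ominus> \<one>) \<otimes> c' S) S"
    by (rule kd_cong) (use a in \<open>auto simp: minus_eq l_minus\<close>)
  also have "\<dots> = kd z c S \<oplus> (\<ominus> \<one>) \<otimes> kd z c' S" using a by (simp add: kd_add kd_smult)
  also have "\<dots> = kd z c S \<ominus> kd z c' S" using a by (simp add: minus_eq l_minus)
  finally show ?thesis .
qed

lemma kd_zero [simp]: "seqR z \<Longrightarrow> kd z (\<lambda>_. \<zero>) S = \<zero>"
proof -
  assume "seqR z"
  then have "kd z (\<lambda>_. \<zero>) S = (\<Oplus>i\<in>S. \<zero>)" unfolding kd_def by (intro finsum_cong') (auto simp: kE_def)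
  then show ?thesis by simp
qed

lemma kd_kE:
  assumes a: "coch c" "seqR z" "finite S" shows "kd z (kE i c) S = \<ominus> kE i (kd z c) S"
proof (cases "i \<in> S")
  case True
  define T where "T = S - {i}"
  have S: "S = insert i T" "i \<notin> T" "finite T" using True a by (auto simp: T_def)
  have "kd z (kE i c) S = z i \<otimes> kE i (kE i c) S \<oplus> (\<Oplus>j\<in>T. z j \<otimes> kE j (kE i c) S)"
    unfolding kd_def S(1) using a S by (intro finsum_insert) auto
  also have "\<dots> = (\<Oplus>j\<in>T. z j \<otimes> kE j (kE i c) S)" using a by (simp add: finsum_closed Pi_iff)
  also have "\<dots> = (\<Oplus>j\<in>T. (\<ominus> ksign i S) \<otimes> (z j \<otimes> kE j c T))"
  proof (rule finsum_cong')
    fix j assume j: "j \<in> T"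
    then have ne: "j \<noteq> i" using S by auto
    have "kE j (kE i c) S = \<ominus> kE i (kE j c) S" by (rule kE_kE) (use a ne in auto)
    also have "kE i (kE j c) S = ksign i S \<otimes> kE j c T" using True by (simp add: kE_def[of i] T_def)
    finally show "z j \<otimes> kE j (kE i c) S = (\<ominus> ksign i S) \<otimes> (z j \<otimes> kE j c T)"
      using a by (simp add: l_minus r_minus m_lcomm)
  qed (use a in auto)
  also have "\<dots> = (\<ominus> ksign i S) \<otimes> kd z c T" unfolding kd_def using a S by (intro finsum_rdistr[symmetric]) auto
  also have "\<dots> = \<ominus> kE i (kd z c) S" using True a by (simp add: kE_def[of i] T_def l_minus)
  finally show ?thesis .
next
  case False
  have "kd z (kE i c) S = (\<Oplus>j\<in>S. \<zero>)" unfolding kd_def by (rule finsum_cong') (use False a in \<open>auto simp: kE_def\<close>)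
  then show ?thesis using False by (simp add: kE_def)
qed

text \<open>
  The operator \<open>kH i\<close> is a homotopy between multiplication by \<open>z i\<close> and 0.
\<close>

lemma kd_kH:
  assumes a: "coch c" "seqR z" "finite S"
  shows "kd z (kH i c) S \<oplus> kH i (kd z c) S = z i \<otimes> c S"
proof (cases "i \<in> S")
  case True
  define T where "T = S - {i}"
  have S: "S = insert i T" "i \<notin> T" "finite T" using True a by (auto simp: T_def)
  have "kd z (kH i c) S = z i \<otimes> kE i (kH i c) S \<oplus> (\<Oplus>j\<in>T. z j \<otimes> kE j (kH i c) S)"
    unfolding kd_def S(1) using a S by (intro finsum_insert) auto
  also have "(\<Oplus>j\<in>T. z j \<otimes> kE j (kH i c) S) = (\<Oplus>j\<in>T. \<zero>)"
    by (rule finsum_cong') (use a S in \<open>auto simp: kE_def kH_def\<close>)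
  finally have "kd z (kH i c) S = z i \<otimes> c S" using a True by (simp add: kE_kH_self)
  then show ?thesis using True a by (simp add: kH_def)
next
  case False
  let ?S = "insert i S"
  have "kH i (kd z c) S = ksign i S \<otimes> (z i \<otimes> kE i c ?S \<oplus> (\<Oplus>j\<in>S. z j \<otimes> kE j c ?S))"
    unfolding kH_def kd_def using False a by (simp add: finsum_insert Pi_iff)
  also have "\<dots> = z i \<otimes> (ksign i S \<otimes> kE i c ?S) \<oplus> ksign i S \<otimes> (\<Oplus>j\<in>S. z j \<otimes> kE j c ?S)"
    using a by (subst r_distr) (auto simp: finsum_closed Pi_iff m_lcomm)
  also have "ksign i S \<otimes> kE i c ?S = c S" using kH_kE_self[OF a(1), of i S] False by (simp add: kH_def)
  also have "ksign i S \<otimes> (\<Oplus>j\<in>S. z j \<otimes> kE j c ?S) = (\<Oplus>j\<in>S. ksign i S \<otimes> (z j \<otimes> kE j c ?S))"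
    using a by (intro finsum_rdistr) auto
  also have "\<dots> = (\<Oplus>j\<in>S. (\<ominus> \<one>) \<otimes> (z j \<otimes> kE j (kH i c) S))"
  proof (rule finsum_cong')
    fix j assume j: "j \<in> S"
    then have ne: "i \<noteq> j" using False by auto
    have "ksign i S \<otimes> kE j c ?S = \<ominus> kE j (kH i c) S" using kH_kE[OF a(1,3) ne] False by (simp add: kH_def)
    then show "ksign i S \<otimes> (z j \<otimes> kE j c ?S) = (\<ominus> \<one>) \<otimes> (z j \<otimes> kE j (kH i c) S)"
      using a by (simp add: m_lcomm l_minus r_minus)
  qed (use a in auto)
  also have "\<dots> = (\<ominus> \<one>) \<otimes> kd z (kH i c) S" unfolding kd_def using a by (intro finsum_rdistr[symmetric]) auto
  finally have e: "kH i (kd z c) S = z i \<otimes> c S \<oplus> (\<ominus> \<one>) \<otimes> kd z (kH i c) S" .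
  have "kd z (kH i c) S \<in> carrier R" "z i \<otimes> c S \<in> carrier R" using a by auto
  then show ?thesis unfolding e by algebra
qed

lemma kH_kd: 
  assumes a: "coch c" "seqR z" "finite S"
  shows "kH i (kd z c) S = z i \<otimes> c S \<ominus> kd z (kH i c) S"
proof -
  have "kd z (kH i c) S \<in> carrier R" "kH i (kd z c) S \<in> carrier R" using a by auto
  then show ?thesis unfolding kd_kH[OF a, of i, symmetric] by algebra
qed

text \<open>
  Induction on the set at which the cochain is evaluated: by the homotopy formula, contraction by a new index \<open>i\<close>
  reduces \<open>kd z (kd z c)\<close> at \<open>insert i S\<close> to the same expression for \<open>kH i c\<close> at \<open>S\<close>.
\<close>

lemma kd_kd:
  assumes "coch c" "seqR z" "finite S" shows "kd z (kd z c) S = \<zero>"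
  using assms(3,1)
proof (induction S arbitrary: c)
  case empty then show ?case by simp
next
  case (insert i S)
  note c = insert.prems and z = assms(2)
  have k: "coch (kd z c)" "coch (kH i c)" "coch (kd z (kd z c))" "coch (kd z (kH i c))" using c z by auto
  have "kd z (kH i (kd z c)) S = kd z (\<lambda>S. z i \<otimes> c S \<ominus> kd z (kH i c) S) S"
    by (rule kd_cong) (use c z insert.hyps kH_kd[OF c z] in auto)
  also have "\<dots> = z i \<otimes> kd z c S \<ominus> kd z (kd z (kH i c)) S" using c z k by (simp add: kd_minus kd_smult)
  also have "\<dots> = z i \<otimes> kd z c S" using insert.IH[OF k(2)] c z by (simp add: minus_eq)
  finally have "kH i (kd z (kd z c)) S = \<zero>" using kH_kd[OF k(1) z insert.hyps(1), of i] c z by simp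
  then have "ksign i S \<otimes> kd z (kd z c) (insert i S) = \<zero>" using insert.hyps by (simp add: kH_def)
  then have "ksign i S \<otimes> (ksign i S \<otimes> kd z (kd z c) (insert i S)) = \<zero>" by simp
  then show ?case using k z by (simp add: m_assoc[symmetric] ksign_sq)
qed

lemma kd_update:
  assumes a: "coch c" "seqR z" "w \<in> carrier R" "finite S"
  shows "kd (z(i := z i \<oplus> w)) c S = kd z c S \<oplus> w \<otimes> kE i c S"
proof (cases "i \<in> S")
  case True
  define T where "T = S - {i}"
  have S: "S = insert i T" "i \<notin> T" "finite T" using True a by (auto simp: T_def)
  have z': "seqR (z(i := z i \<oplus> w))" using a by auto
  have 1: "kd y c S = y i \<otimes> kE i c S \<oplus> (\<Oplus>j\<in>T. y j \<otimes> kE j c S)" if "seqR y" for y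
    unfolding kd_def S(1) using a S that by (intro finsum_insert) auto
  have 2: "(\<Oplus>j\<in>T. (z(i := z i \<oplus> w)) j \<otimes> kE j c S) = (\<Oplus>j\<in>T. z j \<otimes> kE j c S)"
    by (rule finsum_cong') (use a S in auto)
  define q where "q = (\<Oplus>j\<in>T. z j \<otimes> kE j c S)"
  have q: "q \<in> carrier R" unfolding q_def using a by (intro finsum_closed) auto
  define f where "f = kE i c S"
  have f: "f \<in> carrier R" unfolding f_def using a by simp
  have zi: "z i \<in> carrier R" using a by simp
  have "(z i \<oplus> w) \<otimes> f \<oplus> q = z i \<otimes> f \<oplus> q \<oplus> w \<otimes> f" using q f zi a(3) by algebra
  moreover have "kd (z(i := z i \<oplus> w)) c S = (z i \<oplus> w) \<otimes> f \<oplus> q"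
    unfolding 1[OF z'] 2 q_def f_def by simp
  moreover have "kd z c S = z i \<otimes> f \<oplus> q" unfolding 1[OF a(2)] q_def f_def by simp
  ultimately show ?thesis unfolding f_def by simp
next
  case False
  have "kd (z(i := z i \<oplus> w)) c S = kd z c S" by (rule kd_cong) (use False a in auto)
  then show ?thesis using False a by (simp add: kE_def)
qed

lemma kE_kH_kE:
  assumes "coch f" "finite S" "i \<noteq> j" shows "kE i (kH j (kE i f)) S = \<zero>"
proof -
  have "kH j (kE i f) (S - {i}) = \<ominus> kE i (kH j f) (S - {i})" by (rule kH_kE) (use assms in auto)
  then show ?thesis by (simp add: kE_def)
qed

text \<open>
  Elementary operations on the sequence are realised by the automorphism \<open>1 + a kE i kH j\<close> of the exterior algebra, which
  intertwines the two differentials. The additional term \<open>a z j kE i\<close> of the new differential is, up to sign,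
  the commutator of \<open>kd z\<close> with \<open>a kE i kH j\<close>.
\<close>

lemma kd_elementary:
  assumes b: "coch b" "seqR z" "a \<in> carrier R" "finite S" "i \<noteq> j"
  shows "kd (z(i := z i \<oplus> a \<otimes> z j)) (\<lambda>S. b S \<oplus> a \<otimes> kE i (kH j b) S) S
    = kd z b S \<oplus> a \<otimes> kE i (kH j (kd z b)) S"
proof -
  let ?f = "\<lambda>S. b S \<oplus> a \<otimes> kE i (kH j b) S"
  have f: "coch ?f" using b by auto
  have "kd (z(i := z i \<oplus> a \<otimes> z j)) ?f S = kd z ?f S \<oplus> (a \<otimes> z j) \<otimes> kE i ?f S"
    using f b by (intro kd_update) auto
  also have "kE i ?f S = kE i b S" using b by (simp add: kE_add kE_smult)
  also have "kd z ?f S = kd z b S \<oplus> a \<otimes> kd z (kE i (kH j b)) S" using b by (simp add: kd_add kd_smult)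
  also have "kd z (kE i (kH j b)) S = \<ominus> kE i (kd z (kH j b)) S" using b by (intro kd_kE) auto
  also have "kE i (kd z (kH j b)) S = z j \<otimes> kE i b S \<ominus> kE i (kH j (kd z b)) S"
  proof (cases "i \<in> S")
    case True
    define p q s where "p = b (S - {i})" and "q = kd z (kH j b) (S - {i})" and "s = ksign i S"
    have c: "p \<in> carrier R" "q \<in> carrier R" "s \<in> carrier R" "z j \<in> carrier R" using b by (auto simp: p_def q_def s_def)
    have "kH j (kd z b) (S - {i}) = z j \<otimes> p \<ominus> q"
      unfolding p_def q_def by (rule kH_kd) (use b in auto)
    moreover have "s \<otimes> q = z j \<otimes> (s \<otimes> p) \<ominus> s \<otimes> (z j \<otimes> p \<ominus> q)" using c by algebra
    ultimately show ?thesis using True by (simp add: kE_def p_def q_def s_def)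
  qed (use b in \<open>simp add: kE_def minus_eq\<close>)
  finally have e: "kd (z(i := z i \<oplus> a \<otimes> z j)) ?f S =
     kd z b S \<oplus> a \<otimes> \<ominus> (z j \<otimes> kE i b S \<ominus> kE i (kH j (kd z b)) S) \<oplus> a \<otimes> z j \<otimes> kE i b S" .
  define p q r where "p = kd z b S" and "q = kE i b S" and "r = kE i (kH j (kd z b)) S"
  have "p \<in> carrier R" "q \<in> carrier R" "r \<in> carrier R" "z j \<in> carrier R" using b by (auto simp: p_def q_def r_def)
  then show ?thesis unfolding e p_def[symmetric] q_def[symmetric] r_def[symmetric] using b(3) by algebra
qed

text \<open>
  The chain map between the Koszul complexes of \<open>z\<close> and of the sequence in which every \<open>z i\<close> with \<open>i \<in> U\<close> is raised to the
  power \<open>k + 1\<close>. The limit of these maps over \<open>k\<close> is the map to the Cech complex. The exponents are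
  arranged so that \<open>k = 0\<close> gives the identity.
\<close>

definition pw :: "(nat \<Rightarrow> 'a) \<Rightarrow> nat \<Rightarrow> nat set \<Rightarrow> nat \<Rightarrow> 'a" where
  "pw z k U i = (if i \<in> U then z i [^] Suc k else z i)"

definition tau :: "(nat \<Rightarrow> 'a) \<Rightarrow> nat \<Rightarrow> nat set \<Rightarrow> (nat set \<Rightarrow> 'a) \<Rightarrow> nat set \<Rightarrow> 'a" where
  "tau z k U c S = (\<Otimes>i\<in>S \<inter> U. z i [^] k) \<otimes> c S"

lemma pw_closed: "seqR z \<Longrightarrow> seqR (pw z k U)" by (simp add: pw_def)
lemma tau_closed: "seqR z \<Longrightarrow> coch c \<Longrightarrow> coch (tau z k U c)"
  unfolding tau_def by (auto intro!: m_closed finprod_closed)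

lemma kd_tau:
  assumes a: "coch c" "seqR z" "finite S"
  shows "kd (pw z k U) (tau z k U c) S = tau z k U (kd z c) S"
proof -
  have pc: "(\<Otimes>i\<in>T. z i [^] k) \<in> carrier R" for T using a by (intro finprod_closed) auto
  have "kd (pw z k U) (tau z k U c) S = (\<Oplus>i\<in>S. (\<Otimes>i\<in>S \<inter> U. z i [^] k) \<otimes> (z i \<otimes> kE i c S))"
    unfolding kd_def
  proof (rule finsum_cong')
    fix i assume i: "i \<in> S"
    define s e p where "s = ksign i S" and "e = c (S - {i})" and "p = (\<Otimes>i\<in>(S - {i}) \<inter> U. z i [^] k)"
    have c: "s \<in> carrier R" "e \<in> carrier R" "p \<in> carrier R" "z i \<in> carrier R" "z i [^] k \<in> carrier R"
      using a pc by (auto simp: s_def e_def p_def)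
    have P: "(\<Otimes>i\<in>S \<inter> U. z i [^] k) = (if i \<in> U then z i [^] k \<otimes> p else p)"
    proof (cases "i \<in> U")
      case True
      then have "S \<inter> U = insert i ((S - {i}) \<inter> U)" using i by auto
      then show ?thesis using True a by (simp add: p_def finprod_insert Pi_iff)
    next
      case False
      then have "S \<inter> U = (S - {i}) \<inter> U" using i by auto
      then show ?thesis using False by (simp add: p_def)
    qed
    have "kE i (tau z k U c) S = s \<otimes> (p \<otimes> e)" "kE i c S = s \<otimes> e"
      using i by (auto simp: kE_def tau_def s_def e_def p_def)
    then show "pw z k U i \<otimes> kE i (tau z k U c) S = (\<Otimes>i\<in>S \<inter> U. z i [^] k) \<otimes> (z i \<otimes> kE i c S)"
      unfolding P pw_def using c by (simp add: m_ac)
  qed (use a pc in auto)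
  also have "\<dots> = tau z k U (kd z c) S" unfolding tau_def kd_def
    using a pc by (intro finsum_rdistr[symmetric]) auto
  finally show ?thesis .
qed

lemma tau_insert:
  assumes a: "coch c" "seqR z" "finite S" "u \<notin> U"
  shows "tau (pw z k U) k {u} (tau z k U c) S = tau z k (insert u U) c S"
proof -
  have pc: "(\<Otimes>i\<in>S \<inter> U. z i [^] k) \<in> carrier R" using a by (intro finprod_closed) auto
  show ?thesis
  proof (cases "u \<in> S")
    case True
    then have s: "S \<inter> {u} = {u}" "S \<inter> insert u U = insert u (S \<inter> U)" by auto
    have "(\<Otimes>i\<in>insert u (S \<inter> U). z i [^] k) = z u [^] k \<otimes> (\<Otimes>i\<in>S \<inter> U. z i [^] k)"
      using a by (intro finprod_insert) auto
    then show ?thesis unfolding tau_def s using a pc by (simp add: pw_def m_assoc)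
  next
    case False
    then have s: "S \<inter> {u} = {}" "S \<inter> insert u U = S \<inter> U" by auto
    show ?thesis unfolding tau_def s using a pc by simp
  qed
qed

end

section \<open>Koszul cohomology in the presence of a regular sequence\<close>

context cring begin

text \<open>
  Cocycles and coboundaries of degree \<open>n\<close> in the Koszul complex of the elements \<open>z i\<close>, \<open>i \<in> U\<close>, over \<open>R/I\<close>.
\<close>

definition kclosed :: "'a set \<Rightarrow> (nat \<Rightarrow> 'a) \<Rightarrow> nat set \<Rightarrow> nat \<Rightarrow> (nat set \<Rightarrow> 'a) \<Rightarrow> bool" where
  "kclosed I z U n c \<longleftrightarrow> (\<forall>S\<subseteq>U. card S = Suc n \<longrightarrow> kd z c S \<in> I)"

definition kexact :: "'a set \<Rightarrow> (nat \<Rightarrow> 'a) \<Rightarrow> nat set \<Rightarrow> nat \<Rightarrow> (nat set \<Rightarrow> 'a) \<Rightarrow> bool" where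
  "kexact I z U n c \<longleftrightarrow> (\<exists>b. coch b \<and> (\<forall>S\<subseteq>U. card S = n \<longrightarrow> c S \<ominus> kd z b S \<in> I))"

lemma kclosed_zero_iff: "kclosed {\<zero>} z U n c \<longleftrightarrow> (\<forall>S\<subseteq>U. card S = Suc n \<longrightarrow> kd z c S = \<zero>)"
  by (simp add: kclosed_def)

lemma minus_zero_iff: "a \<in> carrier R \<Longrightarrow> b \<in> carrier R \<Longrightarrow> a \<ominus> b = \<zero> \<longleftrightarrow> a = b"
  using r_right_minus_eq by blast

lemma kexact_zero_iff:
  assumes "coch c" "seqR z"
  shows "kexact {\<zero>} z U n c \<longleftrightarrow> (\<exists>b. coch b \<and> (\<forall>S\<subseteq>U. card S = n \<longrightarrow> c S = kd z b S))"
proof -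
  have "c S \<ominus> kd z b S = \<zero> \<longleftrightarrow> c S = kd z b S" if "coch b" for b S
    using that assms by (intro minus_zero_iff) auto
  then show ?thesis unfolding kexact_def by (simp cong: conj_cong)
qed

lemma kd_mem:
  assumes I: "ideal I R" and z: "seqR z" and c: "\<And>i. i \<in> S \<Longrightarrow> c (S - {i}) \<in> I"
  shows "kd z c S \<in> I"
  unfolding kd_def by (rule ideal_finsum[OF I]) (use c z I in \<open>auto simp: kE_def intro!: ideal_lmult\<close>)

lemma card_remove_Suc: "finite U \<Longrightarrow> S \<subseteq> U \<Longrightarrow> card S = Suc m \<Longrightarrow> i \<in> S \<Longrightarrow> S - {i} \<subseteq> U \<and> card (S - {i}) = m"
  by (auto dest: finite_subset)

lemma kd_cong_mod:
  assumes I: "ideal I R" and z: "seqR z" and U: "finite U" and c: "coch f" "coch g"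
    and fg: "\<forall>S\<subseteq>U. card S = m \<longrightarrow> f S \<ominus> g S \<in> I" and S: "S \<subseteq> U" "card S = Suc m"
  shows "kd z f S \<ominus> kd z g S \<in> I"
proof -
  have "kd z (\<lambda>S. f S \<ominus> g S) S \<in> I"
    by (rule kd_mem[OF I z]) (use fg card_remove_Suc[OF U S] in auto)
  then show ?thesis using c z by (simp add: kd_minus)
qed

text \<open>
  By the homotopy formula each \<open>z i\<close> kills cohomology, and the annihilator of a class is an ideal.
\<close>

lemma Idl_kills_koszul_cohomology:
  assumes I: "ideal I R" and z: "seqR z" and U: "finite U" and c: "coch c" and cl: "kclosed I z U n c"
    and y: "y \<in> Idl (I \<union> z ` U)"
  shows "kexact I z U n (\<lambda>S. y \<otimes> c S)"
proof -
  let ?A = "{y \<in> carrier R. kexact I z U n (\<lambda>S. y \<otimes> c S)}"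
  note Ic = ideal.Icarr[OF I]
  have "ideal ?A R"
  proof (rule idealI_closed)
    have "kexact I z U n (\<lambda>S. \<zero> \<otimes> c S)" unfolding kexact_def
      by (rule exI[of _ "\<lambda>_. \<zero>"]) (use c z ideal_zero[OF I] in \<open>simp add: minus_eq\<close>)
    then show "\<zero> \<in> ?A" by simp
    fix a b assume a: "a \<in> ?A" and b: "b \<in> ?A"
    obtain f where f: "coch f" "\<And>S. S \<subseteq> U \<Longrightarrow> card S = n \<Longrightarrow> a \<otimes> c S \<ominus> kd z f S \<in> I" using a unfolding kexact_def by auto
    obtain g where g: "coch g" "\<And>S. S \<subseteq> U \<Longrightarrow> card S = n \<Longrightarrow> b \<otimes> c S \<ominus> kd z g S \<in> I" using b unfolding kexact_def by auto
    have "kexact I z U n (\<lambda>S. (a \<oplus> b) \<otimes> c S)" unfolding kexact_def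
    proof (intro exI[of _ "\<lambda>S. f S \<oplus> g S"] conjI allI impI)
      show "f S \<oplus> g S \<in> carrier R" for S using f g by auto
      fix S assume S: "S \<subseteq> U" "card S = n"
      have k: "c S \<in> carrier R" "kd z f S \<in> carrier R" "kd z g S \<in> carrier R" "a \<in> carrier R" "b \<in> carrier R" using c f g z a b by auto
      have "(a \<oplus> b) \<otimes> c S \<ominus> (kd z f S \<oplus> kd z g S) = (a \<otimes> c S \<ominus> kd z f S) \<oplus> (b \<otimes> c S \<ominus> kd z g S)" using k by algebra
      then show "(a \<oplus> b) \<otimes> c S \<ominus> kd z (\<lambda>S. f S \<oplus> g S) S \<in> I"
        using f g z S ideal_add[OF I] by (simp add: kd_add)
    qed
    then show "a \<oplus> b \<in> ?A" using a b by simp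
  next
    fix a r assume a: "a \<in> ?A" and r: "r \<in> carrier R"
    obtain f where f: "coch f" "\<And>S. S \<subseteq> U \<Longrightarrow> card S = n \<Longrightarrow> a \<otimes> c S \<ominus> kd z f S \<in> I" using a unfolding kexact_def by auto
    have "kexact I z U n (\<lambda>S. (r \<otimes> a) \<otimes> c S)" unfolding kexact_def
    proof (intro exI[of _ "\<lambda>S. r \<otimes> f S"] conjI allI impI)
      show "r \<otimes> f S \<in> carrier R" for S using f r by auto
      fix S assume S: "S \<subseteq> U" "card S = n"
      have k: "c S \<in> carrier R" "kd z f S \<in> carrier R" "a \<in> carrier R" using c f z a by auto
      have "(r \<otimes> a) \<otimes> c S \<ominus> r \<otimes> kd z f S = r \<otimes> (a \<otimes> c S \<ominus> kd z f S)" using k r by algebra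
      then show "(r \<otimes> a) \<otimes> c S \<ominus> kd z (\<lambda>S. r \<otimes> f S) S \<in> I"
        using f z r S ideal_lmult[OF I] by (simp add: kd_smult)
    qed
    then show "r \<otimes> a \<in> ?A" using a r by simp
  qed auto
  moreover have "I \<union> z ` U \<subseteq> ?A"
  proof
    fix y assume "y \<in> I \<union> z ` U"
    then consider "y \<in> I" | i where "i \<in> U" "y = z i" by auto
    then show "y \<in> ?A"
    proof cases
      case 1
      have "kexact I z U n (\<lambda>S. y \<otimes> c S)" unfolding kexact_def
        by (rule exI[of _ "\<lambda>_. \<zero>"]) (use c z 1 Ic ideal_rmult[OF I] in \<open>simp add: minus_eq\<close>)
      then show ?thesis using 1 Ic by simp
    next
      case 2
      have "kexact I z U n (\<lambda>S. y \<otimes> c S)" unfolding kexact_def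
      proof (intro exI[of _ "kH i c"] conjI allI impI)
        show "kH i c S \<in> carrier R" for S using c by simp
        fix S assume S: "S \<subseteq> U" "card S = n"
        then have fS: "finite S" using U finite_subset by blast
        have "y \<otimes> c S \<ominus> kd z (kH i c) S = kH i (kd z c) S" using kH_kd[OF c z fS, of i] 2 by simp
        moreover have "kH i (kd z c) S \<in> I"
        proof (cases "i \<in> S")
          case True then show ?thesis using ideal_zero[OF I] by (simp add: kH_def)
        next
          case False
          then have "kd z c (insert i S) \<in> I" using cl S 2 fS unfolding kclosed_def by simp
          then show ?thesis using False ideal_lmult[OF I] by (simp add: kH_def)
        qed
        ultimately show "y \<otimes> c S \<ominus> kd z (kH i c) S \<in> I" by simp
      qed
      then show ?thesis using 2 z by simp
    qed
  qed
  ultimately have "Idl (I \<union> z ` U) \<subseteq> ?A" by (rule genideal_minimal)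
  then show ?thesis using y by blast
qed

text \<open>
  Reduce \<open>x c = d b\<close> modulo \<open>x\<close>.
\<close>

lemma kclosed_adjoin:
  assumes I: "ideal I R" and z: "seqR z" and c: "coch c" and x: "x \<in> carrier R"
    and b: "coch b" "\<And>S. S \<subseteq> U \<Longrightarrow> card S = Suc m \<Longrightarrow> x \<otimes> c S \<ominus> kd z b S \<in> I"
  shows "kclosed (adjoin I x) z U m b"
  unfolding kclosed_def
proof (intro allI impI)
  fix S assume S: "S \<subseteq> U" "card S = Suc m"
  note A = adjoin_ideal[OF I x]
  have k: "kd z b S \<in> carrier R" "c S \<in> carrier R" using b c z by auto
  have "kd z b S = c S \<otimes> x \<ominus> (x \<otimes> c S \<ominus> kd z b S)" using k x by algebra
  moreover have "x \<otimes> c S \<ominus> kd z b S \<in> adjoin I x" using b(2)[OF S] adjoin_superset[OF I x] by auto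
  moreover have "c S \<otimes> x \<in> adjoin I x" using ideal_lmult[OF A adjoin_self[OF I x]] k by simp
  ultimately show "kd z b S \<in> adjoin I x" using ideal_minus[OF A] by metis
qed

lemma power_kills_koszul_cohomology:
  assumes I: "ideal I R" and z: "seqR z" and U: "finite U" and c: "coch c" and cl: "kclosed I z U n c"
    and y: "\<exists>e::nat. y [^] e \<in> Idl (z ` U)"
  obtains e :: nat where "kexact I z U n (\<lambda>S. y [^] e \<otimes> c S)"
proof -
  have zU: "I \<union> z ` U \<subseteq> carrier R" using ideal_subset[OF I] z by auto
  have "Idl (z ` U) \<subseteq> Idl (I \<union> z ` U)" using zU genideal_self[OF zU] by (intro genideal_minimal genideal_ideal) auto
  then show ?thesis using Idl_kills_koszul_cohomology[OF I z U c cl] y that by blast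
qed

text \<open>
  Used in the following way: some power of \<open>x\<close> kills the class of \<open>c\<close>, and the predicate \<open>Q\<close> collects the properties
  of \<open>c\<close> under which one factor \<open>x\<close> can be removed.
\<close>

lemma kexact_power_descend:
  assumes step: "\<And>c. coch c \<Longrightarrow> Q c \<Longrightarrow> kexact I z U n (\<lambda>S. x \<otimes> c S) \<Longrightarrow> kexact I z U n c"
    and mult: "\<And>c. coch c \<Longrightarrow> Q c \<Longrightarrow> Q (\<lambda>S. x \<otimes> c S)" and x: "x \<in> carrier R"
    and c: "coch c" "Q c" "kexact I z U n (\<lambda>S. x [^] (e::nat) \<otimes> c S)"
  shows "kexact I z U n c"
  using c
proof (induction e arbitrary: c)
  case 0
  then have "(\<lambda>S. x [^] (0::nat) \<otimes> c S) = c" by auto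
  then show ?case using 0 by simp
next
  case (Suc e)
  have "(\<lambda>S. x [^] Suc e \<otimes> c S) = (\<lambda>S. x [^] e \<otimes> (x \<otimes> c S))" using Suc x by (auto simp: m_assoc)
  then have "kexact I z U n (\<lambda>S. x \<otimes> c S)" using Suc.IH[of "\<lambda>S. x \<otimes> c S"] Suc.prems mult x by simp
  then show ?case using step Suc.prems by blast
qed

text \<open>
  Part of the long exact sequence of \<open>0 \<rightarrow> R/I \<rightarrow> R/I \<rightarrow> R/(I + Rx) \<rightarrow> 0\<close>. If \<open>x c = d b\<close> modulo \<open>I\<close> and \<open>b\<close> is exact modulo
  \<open>x\<close>, say \<open>b = d a + x b'\<close>, then \<open>x c = x d b'\<close>, and \<open>x\<close> can be cancelled.
\<close>

lemma kexact_divide_regular: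
  assumes I: "ideal I R" and z: "seqR z" and U: "finite U" and c: "coch c" and x: "x \<in> carrier R" "regular_mod I x"
    and b: "coch b" "\<And>S. S \<subseteq> U \<Longrightarrow> card S = Suc m \<Longrightarrow> x \<otimes> c S \<ominus> kd z b S \<in> I"
    and ex: "kexact (adjoin I x) z U m b"
  shows "kexact I z U (Suc m) c"
proof -
  note Ic = ideal.Icarr[OF I]
  obtain a where a: "coch a" "\<And>S. S \<subseteq> U \<Longrightarrow> card S = m \<Longrightarrow> b S \<ominus> kd z a S \<in> adjoin I x"
    using ex unfolding kexact_def by blast
  have "\<exists>r. r \<in> carrier R \<and> (S \<subseteq> U \<and> card S = m \<longrightarrow> b S \<ominus> kd z a S \<ominus> x \<otimes> r \<in> I)" for S
  proof (cases "S \<subseteq> U \<and> card S = m")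
    case True
    then obtain e r where er: "b S \<ominus> kd z a S = e \<oplus> r \<otimes> x" "e \<in> I" "r \<in> carrier R"
      using a(2) unfolding adjoin_def by blast
    have "b S \<ominus> kd z a S \<ominus> x \<otimes> r = e" unfolding er(1) using Ic[OF er(2)] er(3) x(1) by algebra
    then show ?thesis using er by auto
  qed auto
  then obtain b' where b': "\<And>S. b' S \<in> carrier R" "\<And>S. S \<subseteq> U \<Longrightarrow> card S = m \<Longrightarrow> b S \<ominus> kd z a S \<ominus> x \<otimes> b' S \<in> I"
    by metis
  show ?thesis unfolding kexact_def
  proof (intro exI[of _ b'] conjI allI impI)
    show "b' S \<in> carrier R" for S by (rule b')
    fix S assume S: "S \<subseteq> U" "card S = Suc m"
    then have fS: "finite S" using U finite_subset by blast
    have "kd z (\<lambda>S. b S \<ominus> kd z a S) S \<ominus> kd z (\<lambda>S. x \<otimes> b' S) S \<in> I"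
      by (rule kd_cong_mod[OF I z U _ _ _ S]) (use b b' a x z in auto)
    moreover have "kd z (\<lambda>S. b S \<ominus> kd z a S) S = kd z b S"
      using b(1) a(1) z kd_kd[OF a(1) z fS] by (simp add: kd_minus, simp add: minus_eq)
    moreover have "kd z (\<lambda>S. x \<otimes> b' S) S = x \<otimes> kd z b' S" using b' z x by (simp add: kd_smult)
    ultimately have 1: "kd z b S \<ominus> x \<otimes> kd z b' S \<in> I" by simp
    have k: "kd z b S \<in> carrier R" "kd z b' S \<in> carrier R" "c S \<in> carrier R" using b b' z c by auto
    have "x \<otimes> (c S \<ominus> kd z b' S) = (x \<otimes> c S \<ominus> kd z b S) \<oplus> (kd z b S \<ominus> x \<otimes> kd z b' S)"
      using k x(1) by algebra
    also have "\<dots> \<in> I" using ideal_add[OF I] b(2)[OF S] 1 by simp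
    finally show "c S \<ominus> kd z b' S \<in> I" using x(2) k by (simp add: regular_mod_def)
  qed
qed

lemma kexact_0:
  assumes "coch c" "ideal I R" "finite U" shows "kexact I z U 0 c \<longleftrightarrow> c {} \<in> I"
proof -
  have "S = {}" if "S \<subseteq> U" "card S = 0" for S using that finite_subset[OF that(1) assms(3)] by simp
  then have *: "(\<forall>S\<subseteq>U. card S = 0 \<longrightarrow> c S \<ominus> kd z b S \<in> I) \<longleftrightarrow> c {} \<ominus> \<zero> \<in> I" for b
    by (metis card.empty empty_subsetI kd_empty)
  have "c {} \<ominus> \<zero> = c {}" using assms by (simp add: minus_eq)
  then show ?thesis unfolding kexact_def * by (auto intro!: exI[of _ "\<lambda>_. \<zero>"])
qed

text \<open>
  The ideals \<open>J r\<close> generated by the first \<open>r\<close> elements of a regular sequence \<open>x\<close> of length \<open>n\<close>, starting from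
  an arbitrary ideal \<open>J 0\<close>.
\<close>

definition adjoin_chain :: "nat \<Rightarrow> (nat \<Rightarrow> 'a) \<Rightarrow> (nat \<Rightarrow> 'a set) \<Rightarrow> bool" where
  "adjoin_chain n x J \<longleftrightarrow> (\<forall>r\<le>n. ideal (J r) R) \<and>
     (\<forall>r<n. x r \<in> carrier R \<and> J (Suc r) = adjoin (J r) (x r) \<and> regular_mod (J r) (x r))"

text \<open>
  Koszul cohomology vanishes below the depth, here for all the quotients \<open>R/J r\<close> at once, by induction on the degree.
  A cocycle \<open>c\<close> with \<open>x r \<otimes> c = d b\<close> gives a cocycle \<open>b\<close> of degree one less over \<open>R/J (r + 1)\<close>.
\<close>

lemma koszul_vanishing:
  assumes ch: "adjoin_chain n x J" and z: "seqR z" and U: "finite U"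
    and nil: "\<And>r. r < n \<Longrightarrow> \<exists>e::nat. x r [^] e \<in> Idl (z ` U)"
  shows "r + m < n \<Longrightarrow> coch c \<Longrightarrow> kclosed (J r) z U m c \<Longrightarrow> kexact (J r) z U m c"
proof (induction m arbitrary: r c)
  case 0
  have J: "ideal (J r) R" and x: "x r \<in> carrier R" "regular_mod (J r) (x r)" using ch 0 by (auto simp: adjoin_chain_def)
  have "\<exists>e::nat. x r [^] e \<in> Idl (z ` U)" using nil 0 by auto
  then obtain e :: nat where e: "kexact (J r) z U 0 (\<lambda>S. x r [^] e \<otimes> c S)"
    by (rule power_kills_koszul_cohomology[OF J z U 0(2,3)])
  show ?case
  proof (rule kexact_power_descend[where Q = "\<lambda>_. True", OF _ _ x(1) 0(2) _ e])
    fix c assume c: "coch c" "kexact (J r) z U 0 (\<lambda>S. x r \<otimes> c S)"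
    then show "kexact (J r) z U 0 c" using x J U by (simp add: kexact_0 regular_mod_def)
  qed auto
next
  case (Suc m)
  have J0: "ideal (J r) R" and x: "x r \<in> carrier R" "regular_mod (J r) (x r)"
    and Js: "J (Suc r) = adjoin (J r) (x r)" using ch Suc.prems(1) by (auto simp: adjoin_chain_def)
  have J: "ideal (J r) R" "ideal (J (Suc r)) R" using J0 adjoin_ideal[OF J0 x(1)] Js by auto
  have "\<exists>e::nat. x r [^] e \<in> Idl (z ` U)" using nil[of r] Suc.prems(1) by auto
  then obtain e :: nat where e: "kexact (J r) z U (Suc m) (\<lambda>S. x r [^] e \<otimes> c S)"
    by (rule power_kills_koszul_cohomology[OF J(1) z U Suc.prems(2,3)])
  show ?case
  proof (rule kexact_power_descend[where Q = "kclosed (J r) z U (Suc m)", OF _ _ x(1) Suc.prems(2) _ e])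
    fix c assume c: "coch c" "kclosed (J r) z U (Suc m) c"
    show "kclosed (J r) z U (Suc m) (\<lambda>S. x r \<otimes> c S)"
      using c z x ideal_lmult[OF J(1)] by (simp add: kclosed_def kd_smult)
    assume "kexact (J r) z U (Suc m) (\<lambda>S. x r \<otimes> c S)"
    then obtain b where b: "coch b" "\<And>S. S \<subseteq> U \<Longrightarrow> card S = Suc m \<Longrightarrow> x r \<otimes> c S \<ominus> kd z b S \<in> J r" unfolding kexact_def by blast
    have "kclosed (J (Suc r)) z U m b" unfolding Js by (rule kclosed_adjoin[OF J(1) z c(1) x(1) b])
    then have "kexact (J (Suc r)) z U m b" using Suc.IH[of "Suc r" b] Suc.prems(1) b by simp
    then show "kexact (J r) z U (Suc m) c" unfolding Js
      by (rule kexact_divide_regular[OF J(1) z U c(1) x b, rotated -1])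
  qed (use Suc.prems in auto)
qed

text \<open>
  Injectivity in the degree \<open>m = n - r\<close> of the depth of \<open>R/J r\<close>, by the same induction. Let \<open>x c = d b\<close>, with \<open>x = x r\<close>, and let
  the image \<open>\<tau> c\<close> in the complex of the powers be the coboundary \<open>d' f\<close>. Then \<open>d' (\<tau> b - x f) = 0\<close>,
  and by \<open>koszul_vanishing\<close>, applied to the sequence of powers, \<open>\<tau> b - x f\<close> is exact. So
  \<open>\<tau> b\<close> is exact modulo \<open>x\<close>, and the induction hypothesis shows that \<open>b\<close> is exact over \<open>R/J (r + 1)\<close>.
  In degree 0 the map \<open>\<tau>\<close> is the identity.
\<close>

lemma koszul_injective_mod:
  assumes ch: "adjoin_chain n x J" and z: "seqR z" and U: "finite U"
    and nil: "\<And>r j::nat. r < n \<Longrightarrow> \<exists>e::nat. x r [^] e \<in> Idl (pw z j U ` U)"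
  shows "r + m = n \<Longrightarrow> coch c \<Longrightarrow> kclosed (J r) z U m c \<Longrightarrow>
    kexact (J r) (pw z k U) U m (tau z k U c) \<Longrightarrow> kexact (J r) z U m c"
proof (induction m arbitrary: r c)
  case 0
  have J: "ideal (J r) R" using ch 0 by (auto simp: adjoin_chain_def)
  have "coch (tau z k U c)" using 0 z tau_closed by blast
  then have "tau z k U c {} \<in> J r" using 0 kexact_0[OF _ J U] by blast
  then show ?case using 0 kexact_0[OF _ J U] by (simp add: tau_def)
next
  case (Suc m)
  have J0: "ideal (J r) R" and x: "x r \<in> carrier R" "regular_mod (J r) (x r)"
    and Js: "J (Suc r) = adjoin (J r) (x r)" using ch Suc.prems(1) by (auto simp: adjoin_chain_def)
  have J: "ideal (J r) R" "ideal (J (Suc r)) R" using J0 adjoin_ideal[OF J0 x(1)] Js by auto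
  have "pw z 0 U = z" using z by (auto simp: pw_def fun_eq_iff)
  then have "\<exists>e::nat. x r [^] e \<in> Idl (z ` U)" using nil[of r 0] Suc.prems(1) by simp
  then obtain e :: nat where e: "kexact (J r) z U (Suc m) (\<lambda>S. x r [^] e \<otimes> c S)"
    by (rule power_kills_koszul_cohomology[OF J(1) z U Suc.prems(2,3)])
  let ?w = "pw z k U" and ?t = "tau z k U"
  have w: "seqR ?w" using z by (rule pw_closed)
  have tm: "?t (\<lambda>S. x r \<otimes> c S) S = x r \<otimes> ?t c S" if "coch c" for c S
    using that x z by (simp add: tau_def m_lcomm finprod_closed Pi_iff)
  show ?case
  proof (rule kexact_power_descend[where Q = "\<lambda>c. kclosed (J r) z U (Suc m) c \<and> kexact (J r) ?w U (Suc m) (?t c)", OF _ _ x(1) Suc.prems(2) _ e])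
    fix c assume c: "coch c" and Q: "kclosed (J r) z U (Suc m) c \<and> kexact (J r) ?w U (Suc m) (?t c)"
    have tc: "coch (?t c)" by (rule tau_closed[OF z c])
    obtain f where f: "coch f" "\<And>S. S \<subseteq> U \<Longrightarrow> card S = Suc m \<Longrightarrow> ?t c S \<ominus> kd ?w f S \<in> J r" using Q unfolding kexact_def by blast
    have cl: "kclosed (J r) z U (Suc m) (\<lambda>S. x r \<otimes> c S)"
      using c Q z x ideal_lmult[OF J(1)] by (simp add: kclosed_def kd_smult)
    have "kexact (J r) ?w U (Suc m) (?t (\<lambda>S. x r \<otimes> c S))" unfolding kexact_def
    proof (intro exI[of _ "\<lambda>S. x r \<otimes> f S"] conjI allI impI)
      show "x r \<otimes> f S \<in> carrier R" for S using f x by simp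
      fix S assume S: "S \<subseteq> U" "card S = Suc m"
      have k: "?t c S \<in> carrier R" "kd ?w f S \<in> carrier R" using tc f w by auto
      have "x r \<otimes> ?t c S \<ominus> x r \<otimes> kd ?w f S = x r \<otimes> (?t c S \<ominus> kd ?w f S)" using k x(1) by algebra
      then show "?t (\<lambda>S. x r \<otimes> c S) S \<ominus> kd ?w (\<lambda>S. x r \<otimes> f S) S \<in> J r"
        using f w x c S ideal_lmult[OF J(1)] by (simp add: tm kd_smult)
    qed
    with cl show "kclosed (J r) z U (Suc m) (\<lambda>S. x r \<otimes> c S) \<and> kexact (J r) ?w U (Suc m) (?t (\<lambda>S. x r \<otimes> c S))" ..
    assume "kexact (J r) z U (Suc m) (\<lambda>S. x r \<otimes> c S)"
    then obtain b where b: "coch b" "\<And>S. S \<subseteq> U \<Longrightarrow> card S = Suc m \<Longrightarrow> x r \<otimes> c S \<ominus> kd z b S \<in> J r" unfolding kexact_def by blast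
    have tb: "coch (?t b)" by (rule tau_closed[OF z b(1)])
    have clb: "kclosed (J (Suc r)) z U m b" unfolding Js by (rule kclosed_adjoin[OF J(1) z c x(1) b])
    let ?g = "\<lambda>S. ?t b S \<ominus> x r \<otimes> f S"
    have gc: "coch ?g" using tb f x by simp
    have "kclosed (J r) ?w U m ?g" unfolding kclosed_def
    proof (intro allI impI)
      fix S assume S: "S \<subseteq> U" "card S = Suc m"
      then have fS: "finite S" using U finite_subset by blast
      define P where "P = (\<Otimes>i\<in>S \<inter> U. z i [^] k)"
      have k: "kd z b S \<in> carrier R" "c S \<in> carrier R" "kd ?w f S \<in> carrier R" "P \<in> carrier R"
        using b c z f w by (auto simp: P_def intro!: finprod_closed)
      have "kd ?w (?t b) S = P \<otimes> kd z b S"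
        using kd_tau[OF b(1) z fS, of k U] by (simp add: tau_def[of z k U "kd z b" S] P_def)
      then have "kd ?w ?g S = P \<otimes> kd z b S \<ominus> x r \<otimes> kd ?w f S"
        using tb f x w by (simp add: kd_minus kd_smult)
      also have "\<dots> = x r \<otimes> (P \<otimes> c S \<ominus> kd ?w f S) \<ominus> P \<otimes> (x r \<otimes> c S \<ominus> kd z b S)"
        using k x(1) by algebra
      also have "\<dots> \<in> J r" using f(2)[OF S] b(2)[OF S] x k ideal_lmult[OF J(1)]
        by (intro ideal_minus[OF J(1)]) (auto simp: tau_def P_def)
      finally show "kd ?w ?g S \<in> J r" .
    qed
    then have "kexact (J r) ?w U m ?g"
      using koszul_vanishing[OF ch w U nil, of r m ?g] Suc.prems(1) gc by simp
    then obtain h where h: "coch h" "\<And>S. S \<subseteq> U \<Longrightarrow> card S = m \<Longrightarrow> ?g S \<ominus> kd ?w h S \<in> J r" unfolding kexact_def by blast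
    have "kexact (J (Suc r)) ?w U m (?t b)" unfolding kexact_def
    proof (intro exI[of _ h] conjI allI impI)
      show "h S \<in> carrier R" for S using h by simp
      fix S assume S: "S \<subseteq> U" "card S = m"
      have k: "?t b S \<in> carrier R" "f S \<in> carrier R" "kd ?w h S \<in> carrier R" using tb f h w by auto
      have "?t b S \<ominus> kd ?w h S = (?g S \<ominus> kd ?w h S) \<oplus> f S \<otimes> x r" using k x(1) by algebra
      moreover have "?g S \<ominus> kd ?w h S \<in> J (Suc r)" using h(2)[OF S] adjoin_superset[OF J(1) x(1)] Js by auto
      moreover have "f S \<otimes> x r \<in> J (Suc r)" unfolding Js using ideal_lmult[OF adjoin_ideal[OF J(1) x(1)] adjoin_self[OF J(1) x(1)]] k by simp
      ultimately show "?t b S \<ominus> kd ?w h S \<in> J (Suc r)" using ideal_add[OF J(2)] by auto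
    qed
    then have "kexact (J (Suc r)) z U m b" using Suc.IH[of "Suc r" b] Suc.prems(1) b clb by simp
    then show "kexact (J r) z U (Suc m) c" unfolding Js
      by (rule kexact_divide_regular[OF J(1) z U c x b, rotated -1])
  qed (use Suc.prems in auto)
qed

text \<open>
  The natural map in degree \<open>n\<close> from the Koszul cohomology of the \<open>z i\<close>, \<open>i \<in> U\<close>, to local cohomology is injective;
  see \<open>natural_map_inj_iff\<close>.
\<close>

definition koszul_injective :: "(nat \<Rightarrow> 'a) \<Rightarrow> nat set \<Rightarrow> nat \<Rightarrow> bool" where
  "koszul_injective z U n \<longleftrightarrow> (\<forall>c k. coch c \<longrightarrow> kclosed {\<zero>} z U n c \<longrightarrow>
     kexact {\<zero>} (pw z k U) U n (tau z k U c) \<longrightarrow> kexact {\<zero>} z U n c)"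

end

section \<open>Changing the generators\<close>

context cring begin

lemma kexact_zeroI:
  assumes "coch c" "seqR z" "coch b" "\<And>S. S \<subseteq> U \<Longrightarrow> card S = n \<Longrightarrow> c S = kd z b S"
  shows "kexact {\<zero>} z U n c"
  unfolding kexact_zero_iff[OF assms(1,2)] using assms(3,4) by (intro exI[of _ b]) simp

lemma koszul_injectiveD:
  assumes "koszul_injective z U n" "coch c" "kclosed {\<zero>} z U n c"
    "kexact {\<zero>} (pw z k U) U n (tau z k U c)"
  shows "kexact {\<zero>} z U n c"
  using assms unfolding koszul_injective_def by blast

lemma kclosed_tau:
  assumes "coch c" "seqR z" "finite V" "kclosed {\<zero>} z V n c"
  shows "kclosed {\<zero>} (pw z k U) V n (tau z k U c)"
  unfolding kclosed_zero_iff
proof (intro allI impI)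
  fix S assume S: "S \<subseteq> V" "card S = Suc n"
  then have "finite S" using assms finite_subset by blast
  then have "kd (pw z k U) (tau z k U c) S = tau z k U (kd z c) S" using assms kd_tau by blast
  also have "\<dots> = \<zero>" using assms(2,4) S by (simp add: kclosed_zero_iff tau_def)
  finally show "kd (pw z k U) (tau z k U c) S = \<zero>" .
qed

lemma kclosed_exact_zero_on_top:
  assumes z: "seqR z" and V: "finite V" "u \<notin> V" and e: "coch e" and cl: "kclosed {\<zero>} z (insert u V) (Suc m) e"
    and e0: "\<And>S. S \<subseteq> V \<Longrightarrow> card S = Suc m \<Longrightarrow> e S = \<zero>"
  shows "kclosed {\<zero>} z V m (kH u e)"
  unfolding kclosed_zero_iff
proof (intro allI impI)
  fix S assume S: "S \<subseteq> V" "card S = Suc m"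
  then have fS: "finite S" using V finite_subset by blast
  have uS: "u \<notin> S" using S V by auto
  have "kH u (kd z e) S = ksign u S \<otimes> kd z e (insert u S)" using uS by (simp add: kH_def)
  moreover have "kd z e (insert u S) = \<zero>" using cl S uS fS unfolding kclosed_zero_iff by (metis card_insert_disjoint insert_mono)
  ultimately have "kd z (kH u e) S \<oplus> \<zero> = z u \<otimes> e S" using kd_kH[OF e z fS, of u] by simp
  then show "kd z (kH u e) S = \<zero>" using e0[OF S] e z by simp
qed

text \<open>
  If the \<open>z i\<close> with \<open>i \<in> U\<close> are nilpotent modulo those with \<open>i \<in> W\<close>, then adjoining them does not change local
  cohomology. Concretely: a cocycle on \<open>U \<union> W\<close> that is exact on \<open>W\<close> becomes exact on all of \<open>U \<union> W\<close> after
  rescaling along \<open>U\<close>. The elements \<open>u\<close> of \<open>U\<close> are adjoined one at a time. After subtraction of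
  a coboundary the cocycle \<open>e\<close> vanishes on sets without \<open>u\<close>, so \<open>e = kE u h\<close> for the cocycle
  \<open>h = kH u e\<close> of degree one less. Rescaling along \<open>u\<close> multiplies \<open>h\<close> by \<open>(z u)\<^sup>k\<close>, which
  kills the class of \<open>h\<close>.
\<close>

lemma tau_exact_of_restriction_exact:
  assumes U: "finite U" and W: "finite W" "U \<inter> W = {}" and z: "seqR z" and c: "coch c"
    and cl: "kclosed {\<zero>} z (U \<union> W) n c" and ex: "kexact {\<zero>} z W n c"
    and pow: "\<And>i. i \<in> U \<Longrightarrow> z i [^] k \<in> Idl (z ` W)"
  shows "kexact {\<zero>} (pw z k U) (U \<union> W) n (tau z k U c)"
  using U W cl pow
proof (induction U)
  case empty
  have "pw z k {} = z" by (auto simp: pw_def)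
  moreover have "tau z k {} c = c" using c by (auto simp: tau_def)
  ultimately show ?case using ex by simp
next
  case (insert u U)
  let ?V = "U \<union> W" and ?y = "pw z k U" and ?c = "tau z k U c" and ?w = "pw z k (insert u U)"
  have uV: "u \<notin> ?V" and V: "finite ?V" using insert by auto
  have Vu: "insert u U \<union> W = insert u ?V" by auto
  have cl0: "kclosed {\<zero>} z (insert u ?V) n c" using insert.prems Vu by simp
  then have "kclosed {\<zero>} z ?V n c" unfolding kclosed_def by blast
  then have IH: "kexact {\<zero>} ?y ?V n ?c" using insert by auto
  have y: "seqR ?y" and w: "seqR ?w" using pw_closed z by auto
  have tc: "coch ?c" by (rule tau_closed[OF z c])
  have tc': "coch (tau z k (insert u U) c)" by (rule tau_closed[OF z c])
  obtain b where b: "coch b" "\<And>S. S \<subseteq> ?V \<Longrightarrow> card S = n \<Longrightarrow> ?c S = kd ?y b S"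
    using IH kexact_zero_iff[OF tc y] by blast
  define e where "e S = ?c S \<ominus> kd ?y b S" for S
  have e: "coch e" unfolding e_def using tc b y by simp
  have ecl: "kclosed {\<zero>} ?y (insert u ?V) n e" unfolding kclosed_zero_iff
  proof (intro allI impI)
    fix S assume S: "S \<subseteq> insert u ?V" "card S = Suc n"
    then have fS: "finite S" using V finite_subset by blast
    have "kd ?y ?c S = \<zero>" using kclosed_tau[OF c z _ cl0, of k U] V S unfolding kclosed_zero_iff by simp
    moreover have "kd ?y e S = kd ?y ?c S \<ominus> kd ?y (kd ?y b) S"
      unfolding e_def by (rule kd_minus) (use tc b(1) y in auto)
    ultimately show "kd ?y e S = \<zero>" using kd_kd[OF b(1) y fS] by (simp add: minus_eq)
  qed
  have e0: "e S = \<zero>" if "S \<subseteq> ?V" "card S = n" for S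
    unfolding e_def using b(2)[OF that] b(1) y by (simp add: minus_eq r_neg)
  have wy: "?w = pw ?y k {u}" using insert.hyps by (auto simp: pw_def)
  have zu: "?y u = z u" using insert.hyps by (simp add: pw_def)
  have main: "\<exists>g. coch g \<and> (\<forall>S\<subseteq>insert u ?V. card S = n \<longrightarrow> tau ?y k {u} e S = kd ?w g S)"
  proof (cases n)
    case 0
    have "tau ?y k {u} e S = kd ?w (\<lambda>_. \<zero>) S" if S: "S \<subseteq> insert u ?V" "card S = n" for S
    proof -
      have "S = {}" using S 0 V finite_subset[of S "insert u ?V"] by simp
      then show ?thesis using e0[of "{}"] 0 by (simp add: tau_def)
    qed
    then show ?thesis by (intro exI[of _ "\<lambda>_. \<zero>"]) auto
  next
    case (Suc m)
    have h: "kclosed {\<zero>} ?y ?V m (kH u e)"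
      by (rule kclosed_exact_zero_on_top[OF y V uV e]) (use ecl e0 Suc in auto)
    have hc: "coch (kH u e)" using e by simp
    have WV: "z ` W \<subseteq> {\<zero>} \<union> ?y ` ?V"
    proof
      fix q assume "q \<in> z ` W"
      then obtain i where i: "i \<in> W" "q = z i" by auto
      then have "q = ?y i" using insert.prems by (auto simp: pw_def)
      then show "q \<in> {\<zero>} \<union> ?y ` ?V" using i by auto
    qed
    have yV: "{\<zero>} \<union> ?y ` ?V \<subseteq> carrier R" using y by auto
    have "Idl (z ` W) \<subseteq> Idl ({\<zero>} \<union> ?y ` ?V)"
      using WV genideal_self[OF yV] by (intro genideal_minimal[OF genideal_ideal[OF yV]]) blast
    then have "z u [^] k \<in> Idl ({\<zero>} \<union> ?y ` ?V)" using insert.prems(4)[of u] by auto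
    then have ex: "kexact {\<zero>} ?y ?V m (\<lambda>S. z u [^] k \<otimes> kH u e S)"
      by (rule Idl_kills_koszul_cohomology[OF zeroideal y V hc h])
    have cc: "coch (\<lambda>S. z u [^] k \<otimes> kH u e S)" using z hc by simp
    obtain g where g: "coch g" "\<And>S. S \<subseteq> ?V \<Longrightarrow> card S = m \<Longrightarrow> z u [^] k \<otimes> kH u e S = kd ?y g S"
      using ex kexact_zero_iff[OF cc y] by blast
    let ?g = "\<lambda>S. (\<ominus> \<one>) \<otimes> kE u g S"
    have "tau ?y k {u} e S = kd ?w ?g S" if S: "S \<subseteq> insert u ?V" "card S = n" for S
    proof -
      have fS: "finite S" using S V finite_subset by blast
      have "kd ?w ?g S = (\<ominus> \<one>) \<otimes> kd ?w (kE u g) S" using g w by (intro kd_smult) auto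
      also have "\<dots> = kE u (kd ?w g) S" using kd_kE[OF g(1) w fS, of u] g w by (simp add: l_minus)
      also have "\<dots> = tau ?y k {u} e S"
      proof (cases "u \<in> S")
        case False
        then have "e S = \<zero>" using e0 S by auto
        then show ?thesis using False by (simp add: kE_def tau_def)
      next
        case True
        have S': "S - {u} \<subseteq> ?V" "card (S - {u}) = m" using S True Suc fS by auto
        have "kd ?w g (S - {u}) = kd ?y g (S - {u})" by (rule kd_cong) (use g y in \<open>auto simp: pw_def\<close>)
        also have "\<dots> = z u [^] k \<otimes> kH u e (S - {u})" using g(2)[OF S'] by simp
        also have "kH u e (S - {u}) = ksign u S \<otimes> e S" using True by (simp add: kH_def insert_absorb)
        finally have "kE u (kd ?w g) S = ksign u S \<otimes> (z u [^] k \<otimes> (ksign u S \<otimes> e S))" using True by (simp add: kE_def)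
        also have "\<dots> = (ksign u S \<otimes> ksign u S) \<otimes> (z u [^] k \<otimes> e S)" using e z by (simp add: m_ac)
        also have "\<dots> = tau ?y k {u} e S" using True e z zu by (simp add: ksign_sq tau_def)
        finally show ?thesis .
      qed
      finally show ?thesis by simp
    qed
    moreover have "coch ?g" using g by simp
    ultimately show ?thesis by (intro exI[of _ ?g] conjI allI impI) simp_all
  qed
  obtain g where g0: "coch g" "\<forall>S\<subseteq>insert u ?V. card S = n \<longrightarrow> tau ?y k {u} e S = kd ?w g S"
    using main by (elim exE conjE)
  then have g: "coch g" "\<And>S. S \<subseteq> insert u ?V \<Longrightarrow> card S = n \<Longrightarrow> tau ?y k {u} e S = kd ?w g S" by simp_all
  have tb: "coch (tau ?y k {u} b)" by (rule tau_closed[OF y b(1)])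
  have "tau z k (insert u U) c S = kd ?w (\<lambda>S. g S \<oplus> tau ?y k {u} b S) S" if S: "S \<subseteq> insert u ?V" "card S = n" for S
  proof -
    have fS: "finite S" using S V finite_subset by blast
    define P where "P = (\<Otimes>i\<in>S \<inter> {u}. ?y i [^] k)"
    define p q where "p = ?c S" and "q = kd ?y b S"
    have k: "P \<in> carrier R" "p \<in> carrier R" "q \<in> carrier R" using y b tc by (auto simp: P_def p_def q_def intro!: finprod_closed)
    have "tau z k (insert u U) c S = tau ?y k {u} ?c S" using tau_insert[OF c z fS] insert.hyps by simp
    also have "\<dots> = P \<otimes> p" by (simp add: tau_def P_def p_def)
    also have "\<dots> = P \<otimes> (p \<ominus> q) \<oplus> P \<otimes> q" using k by algebra
    also have "P \<otimes> (p \<ominus> q) = tau ?y k {u} e S" by (simp add: tau_def P_def p_def q_def e_def)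
    also have "\<dots> = kd ?w g S" by (rule g(2)[OF S])
    also have "P \<otimes> q = kd ?w (tau ?y k {u} b) S" unfolding wy using kd_tau[OF b(1) y fS, of k "{u}"] by (simp add: tau_def P_def q_def)
    also have "kd ?w g S \<oplus> kd ?w (tau ?y k {u} b) S = kd ?w (\<lambda>S. g S \<oplus> tau ?y k {u} b S) S"
      using g tb w by (simp add: kd_add)
    finally show ?thesis .
  qed
  then show ?case unfolding kexact_zero_iff[OF tc' w] Vu using g tb by (intro exI[of _ "\<lambda>S. g S \<oplus> tau ?y k {u} b S"]) auto
qed

text \<open>
  Equality of radicals in terms of primes, which is convenient for elementary operations.
\<close>

definition same_radical :: "(nat \<Rightarrow> 'a) \<Rightarrow> nat set \<Rightarrow> nat set \<Rightarrow> bool" where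
  "same_radical z U W \<longleftrightarrow> (\<forall>P. primeideal P R \<longrightarrow> (z ` U \<subseteq> P \<longleftrightarrow> z ` W \<subseteq> P))"

text \<open>
  A replacement for injectivity into local cohomology that mentions no powers of the \<open>z i\<close> with \<open>i \<in> U\<close>, and is
  therefore compatible with elementary operations on these. Only the restriction of \<open>z\<close> to \<open>U\<close> matters.
  The set \<open>W\<close> is a supply of indices for a second system of generators, up to radical, which
  varies together with \<open>c\<close>. A cocycle \<open>c\<close> on \<open>U \<union> W\<close> relates its restrictions to \<open>U\<close> and to \<open>W\<close>, which
  represent the same class in local cohomology.
\<close>

definition zigzag_injective :: "(nat \<Rightarrow> 'a) \<Rightarrow> nat set \<Rightarrow> nat set \<Rightarrow> nat \<Rightarrow> bool" where
  "zigzag_injective z U W n \<longleftrightarrow> (\<forall>y c. seqR y \<longrightarrow> (\<forall>i\<in>U. y i = z i) \<longrightarrow> same_radical y U W \<longrightarrow> coch c \<longrightarrow>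
     kclosed {\<zero>} y (U \<union> W) n c \<longrightarrow> kexact {\<zero>} y W n c \<longrightarrow> kexact {\<zero>} y U n c)"

lemma zigzag_injectiveD:
  assumes "zigzag_injective z U W n" "seqR y" "\<forall>i\<in>U. y i = z i" "same_radical y U W" "coch c"
    "kclosed {\<zero>} y (U \<union> W) n c" "kexact {\<zero>} y W n c"
  shows "kexact {\<zero>} y U n c"
  using assms unfolding zigzag_injective_def by simp

text \<open>
  If \<open>z v\<close> times the cocycle \<open>c\<close> is the coboundary of \<open>b\<close>, then \<open>c\<close> extends to a cocycle on \<open>insert v V\<close> with the
  component \<open>b\<close> in the direction of \<open>v\<close>.
\<close>

lemma kd_extend:
  assumes z: "seqR z" and V: "finite V" "v \<notin> V" and c: "coch c" and cl: "kclosed {\<zero>} z V n c"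
    and b: "coch b" "\<And>S. S \<subseteq> V \<Longrightarrow> card S = n \<Longrightarrow> z v \<otimes> c S = kd z b S"
  shows "kclosed {\<zero>} z (insert v V) n (\<lambda>S. if v \<in> S then kE v b S else c S)"
  unfolding kclosed_zero_iff
proof (intro allI impI)
  let ?e = "\<lambda>S. if v \<in> S then kE v b S else c S"
  have e: "coch ?e" using b c by simp
  fix S assume S: "S \<subseteq> insert v V" "card S = Suc n"
  then have fS: "finite S" using V finite_subset by blast
  show "kd z ?e S = \<zero>"
  proof (cases "v \<in> S")
    case False
    then have "kd z ?e S = kd z c S" by (intro kd_cong) (use c z in auto)
    then show ?thesis using cl S False unfolding kclosed_zero_iff by auto
  next
    case True
    let ?T = "S - {v}"
    have T: "?T \<subseteq> V" "card ?T = n" using S True fS by auto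
    have "kd z (kH v ?e) ?T = kd z b ?T"
    proof (rule kd_cong)
      fix i assume "i \<in> ?T"
      have "kH v ?e (?T - {i}) = kH v (kE v b) (?T - {i})" by (simp add: kH_def)
      then show "kH v ?e (?T - {i}) = b (?T - {i})" using b by (simp add: kH_kE_self)
    qed (use b z in auto)
    then have "kH v (kd z ?e) ?T = z v \<otimes> ?e ?T \<ominus> kd z b ?T" using kH_kd[OF e z, of ?T v] fS by simp
    also have "\<dots> = \<zero>" using b(2)[OF T] b z by (simp add: minus_eq r_neg)
    finally have "ksign v S \<otimes> kd z ?e S = \<zero>" using True by (simp add: kH_def insert_absorb)
    then have "ksign v S \<otimes> (ksign v S \<otimes> kd z ?e S) = \<zero>" by simp
    then show ?thesis using kd_closed[OF e z] by (simp add: m_assoc[symmetric] ksign_sq)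
  qed
qed

text \<open>
  In top degree the only component is at \<open>W\<close>, and the coboundaries fill the ideal of the \<open>z i\<close>.
\<close>

lemma kexact_top:
  assumes z: "seqR z" and W: "finite W" and c: "coch c" and cW: "c W \<in> Idl (z ` W)"
  shows "kexact {\<zero>} z W (card W) c"
proof -
  let ?A = "{y \<in> carrier R. \<exists>b. coch b \<and> y = kd z b W}"
  have "ideal ?A R"
  proof (rule idealI_closed)
    show "\<zero> \<in> ?A" using z by (auto intro!: exI[of _ "\<lambda>_. \<zero>"])
    show "a \<oplus> b \<in> ?A" if a: "a \<in> ?A" and b: "b \<in> ?A" for a b
    proof -
      obtain f g where f: "coch f" "a = kd z f W" and g: "coch g" "b = kd z g W" using a b by auto
      have fg: "coch (\<lambda>S. f S \<oplus> g S)" using f g by simp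
      have "a \<oplus> b = kd z (\<lambda>S. f S \<oplus> g S) W" using f g z by (simp add: kd_add)
      then show ?thesis using fg kd_closed[OF fg z, of W] by auto
    qed
    show "r \<otimes> a \<in> ?A" if a: "a \<in> ?A" and r: "r \<in> carrier R" for a r
    proof -
      obtain f where f: "coch f" "a = kd z f W" using a by auto
      have rf: "coch (\<lambda>S. r \<otimes> f S)" using f r by simp
      have "r \<otimes> a = kd z (\<lambda>S. r \<otimes> f S) W" using f z r by (simp add: kd_smult)
      then show ?thesis using rf kd_closed[OF rf z, of W] by auto
    qed
  qed auto
  moreover have "z ` W \<subseteq> ?A"
  proof
    fix y assume "y \<in> z ` W"
    then obtain i where i: "i \<in> W" "y = z i" by auto
    define b where "b T = (if T = W - {i} then ksign i W else \<zero>)" for T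
    have b: "coch b" by (simp add: b_def)
    have "kd z b W = (\<Oplus>j\<in>W. if i = j then z i else \<zero>)" unfolding kd_def
    proof (rule finsum_cong')
      fix j assume j: "j \<in> W"
      show "z j \<otimes> kE j b W = (if i = j then z i else \<zero>)"
      proof (cases "i = j")
        case True then show ?thesis using i z by (simp add: kE_def b_def ksign_sq)
      next
        case False
        then have "W - {j} \<noteq> W - {i}" using i j by blast
        then show ?thesis using False z by (simp add: kE_def b_def)
      qed
    qed (use z in auto)
    also have "\<dots> = z i" using i W z by (intro finsum_singleton) auto
    finally have "y = kd z b W" using i by simp
    then show "y \<in> ?A" using i z b by auto
  qed
  ultimately have "Idl (z ` W) \<subseteq> ?A" by (rule genideal_minimal)
  then obtain b where b: "coch b" "c W = kd z b W" using cW by auto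
  have "S = W" if "S \<subseteq> W" "card S = card W" for S using card_subset_eq[OF W that] .
  then show ?thesis using kexact_zero_iff[OF c z] b by metis
qed

lemma elementary_image_subset_prime:
  assumes P: "primeideal P R" and y: "seqR y" and a: "a \<in> carrier R" and ij: "i \<in> U" "j \<in> U" "i \<noteq> j"
  shows "(y(i := y i \<oplus> a \<otimes> y j)) ` U \<subseteq> P \<longleftrightarrow> y ` U \<subseteq> P"
proof -
  note Pi = prime_ideal[OF P]
  have c: "y i \<in> carrier R" "y j \<in> carrier R" using y by auto
  have "y i \<oplus> a \<otimes> y j \<in> P \<longleftrightarrow> y i \<in> P" if "y j \<in> P"
  proof
    assume "y i \<oplus> a \<otimes> y j \<in> P"
    then have "(y i \<oplus> a \<otimes> y j) \<ominus> a \<otimes> y j \<in> P" using ideal_minus[OF Pi] ideal_lmult[OF Pi that a] by simp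
    moreover have "(y i \<oplus> a \<otimes> y j) \<ominus> a \<otimes> y j = y i" using a c by algebra
    ultimately show "y i \<in> P" by simp
  qed (use ideal_add[OF Pi] ideal_lmult[OF Pi that a] in simp)
  then show ?thesis using ij by (auto simp: image_subset_iff split: if_splits)
qed

text \<open>
  Let \<open>y\<close> extend the new sequence on \<open>U\<close>. The sequence \<open>x\<close>, which differs from it in the index \<open>i\<close> only, extends the
  old one. The automorphism from \<open>kd_elementary\<close> carries the cocycle \<open>c\<close> for \<open>y\<close> to one for \<open>x\<close>. It does
  not change the components without \<open>i\<close>, hence none of those on \<open>W\<close>, and it preserves \<open>U\<close> because
  both \<open>i\<close> and \<open>j\<close> belong to \<open>U\<close>.
\<close>

lemma zigzag_injective_elementary:
  assumes inj: "zigzag_injective z U W n" and z: "seqR z" and a: "a \<in> carrier R" and ij: "i \<in> U" "j \<in> U" "i \<noteq> j"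
    and fin: "finite U" "finite W" and disj: "U \<inter> W = {}"
  shows "zigzag_injective (z(i := z i \<oplus> a \<otimes> z j)) U W n"
  unfolding zigzag_injective_def
proof (intro allI impI)
  fix y c
  assume y: "seqR y" and yz: "\<forall>l\<in>U. y l = (z(i := z i \<oplus> a \<otimes> z j)) l" and rad: "same_radical y U W" and c: "coch c"
    and cl: "kclosed {\<zero>} y (U \<union> W) n c" and ex: "kexact {\<zero>} y W n c"
  define x where "x = y(i := z i)"
  have x: "seqR x" using y z by (simp add: x_def)
  have xz: "\<forall>l\<in>U. x l = z l" using yz by (auto simp: x_def)
  have yi: "y i = z i \<oplus> a \<otimes> z j" and yj: "y j = z j" using yz ij by auto
  have zc: "z i \<in> carrier R" "z j \<in> carrier R" using z by auto
  have xj: "x j = z j" "x i = z i" using yj ij by (auto simp: x_def)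
  have x_y: "x = y(i := y i \<oplus> (\<ominus> a) \<otimes> y j)"
  proof -
    have "y i \<oplus> (\<ominus> a) \<otimes> y j = z i" unfolding yi yj using zc a by algebra
    then show ?thesis by (simp add: x_def)
  qed
  have y_x: "y = x(i := x i \<oplus> a \<otimes> x j)" using xj yi by (auto simp: x_def)
  have iW: "i \<notin> W" using ij disj by auto
  have xW: "x ` W = y ` W" using iW by (auto simp: x_def)
  have radx: "same_radical x U W" unfolding same_radical_def xW
  proof (intro allI impI)
    fix P assume P: "primeideal P R"
    have "y ` U \<subseteq> P \<longleftrightarrow> x ` U \<subseteq> P" unfolding y_x by (rule elementary_image_subset_prime[OF P x a ij])
    then show "x ` U \<subseteq> P \<longleftrightarrow> y ` W \<subseteq> P" using rad P by (simp add: same_radical_def)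
  qed
  let ?f = "\<lambda>S. c S \<oplus> (\<ominus> a) \<otimes> kE i (kH j c) S"
  have f: "coch ?f" using c a by simp
  have na: "\<ominus> a \<in> carrier R" using a by simp
  have "kclosed {\<zero>} x (U \<union> W) n ?f" unfolding kclosed_zero_iff
  proof (intro allI impI)
    fix S assume S: "S \<subseteq> U \<union> W" "card S = Suc n"
    then have fS: "finite S" using fin finite_subset[of S "U \<union> W"] by simp
    have 0: "kd y c S = \<zero>" using cl S unfolding kclosed_zero_iff by blast
    have "kE i (kH j (kd y c)) S = \<zero>"
    proof (cases "i \<in> S \<and> j \<notin> S")
      case True
      have sub: "insert j (S - {i}) \<subseteq> U \<union> W" using S ij by auto
      have "card S = Suc (card (S - {i}))" using True fS by (intro card.remove) auto
      moreover have "card (insert j (S - {i})) = Suc (card (S - {i}))" using True fS by (intro card_insert_disjoint) auto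
      ultimately have "card (insert j (S - {i})) = Suc n" using S by simp
      then have "kd y c (insert j (S - {i})) = \<zero>" using cl sub unfolding kclosed_zero_iff by blast
      then show ?thesis by (simp add: kE_def kH_def)
    next
      case False then show ?thesis using ij by (auto simp: kE_def kH_def)
    qed
    then show "kd x ?f S = \<zero>" unfolding x_y using kd_elementary[OF c y na fS ij(3)] 0 na by simp
  qed
  moreover have "kexact {\<zero>} x W n ?f"
  proof -
    obtain b where b: "coch b" "\<And>S. S \<subseteq> W \<Longrightarrow> card S = n \<Longrightarrow> c S = kd y b S"
      using ex kexact_zero_iff[OF c y] by blast
    have "?f S = kd x b S" if S: "S \<subseteq> W" "card S = n" for S
    proof -
      have "i \<notin> S" using S iW by auto
      then have "?f S = c S" using c na by (simp add: kE_def)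
      also have "\<dots> = kd y b S" by (rule b(2)[OF S])
      also have "\<dots> = kd x b S" by (rule kd_cong) (use \<open>i \<notin> S\<close> b x in \<open>auto simp: x_def\<close>)
      finally show ?thesis .
    qed
    then show ?thesis by (rule kexact_zeroI[OF f x b(1)])
  qed
  ultimately have "kexact {\<zero>} x U n ?f"
    by (rule zigzag_injectiveD[OF inj x xz radx f])
  then obtain b where b: "coch b" "\<And>S. S \<subseteq> U \<Longrightarrow> card S = n \<Longrightarrow> ?f S = kd x b S"
    using kexact_zero_iff[OF f x] by blast
  have res: "c S = kd y (\<lambda>S. b S \<oplus> a \<otimes> kE i (kH j b) S) S" if S: "S \<subseteq> U" "card S = n" for S
  proof -
    have fS: "finite S" using S fin finite_subset by blast
    have "kd y (\<lambda>S. b S \<oplus> a \<otimes> kE i (kH j b) S) S = kd x b S \<oplus> a \<otimes> kE i (kH j (kd x b)) S"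
      unfolding y_x by (rule kd_elementary[OF b(1) x a fS ij(3)])
    also have "kd x b S = ?f S" using b(2)[OF S] by simp
    also have "kE i (kH j (kd x b)) S = kE i (kH j ?f) S"
    proof (cases "i \<in> S \<and> j \<notin> S")
      case True
      have sub: "insert j (S - {i}) \<subseteq> U" using S ij by auto
      have "card S = Suc (card (S - {i}))" using True fS by (intro card.remove) auto
      moreover have "card (insert j (S - {i})) = Suc (card (S - {i}))" using True fS by (intro card_insert_disjoint) auto
      ultimately have "card (insert j (S - {i})) = n" using S by simp
      then have "kd x b (insert j (S - {i})) = ?f (insert j (S - {i}))" using b(2)[OF sub] by simp
      then show ?thesis by (simp add: kE_def kH_def)
    next
      case False then show ?thesis using ij by (auto simp: kE_def kH_def)
    qed
    also have "kE i (kH j ?f) S = kE i (kH j c) S"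
    proof -
      have "kH j ?f = (\<lambda>S. kH j c S \<oplus> (\<ominus> a) \<otimes> kH j (kE i (kH j c)) S)"
        using c na by (auto simp: fun_eq_iff kH_add kH_smult)
      then have "kE i (kH j ?f) S = kE i (kH j c) S \<oplus> (\<ominus> a) \<otimes> kE i (kH j (kE i (kH j c))) S"
        using c na by (simp add: kE_add kE_smult)
      also have "kE i (kH j (kE i (kH j c))) S = \<zero>" using c fS ij by (intro kE_kH_kE) auto
      finally show ?thesis using c na by simp
    qed
    finally have 1: "kd y (\<lambda>S. b S \<oplus> a \<otimes> kE i (kH j b) S) S = ?f S \<oplus> a \<otimes> kE i (kH j c) S" .
    define p q where "p = c S" and "q = kE i (kH j c) S"
    have "p \<in> carrier R" "q \<in> carrier R" using c by (auto simp: p_def q_def)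
    then have "(p \<oplus> (\<ominus> a) \<otimes> q) \<oplus> a \<otimes> q = p" using a by algebra
    then show ?thesis unfolding 1 by (simp add: p_def q_def)
  qed
  have "coch (\<lambda>S. b S \<oplus> a \<otimes> kE i (kH j b) S)" using b a by simp
  then show "kexact {\<zero>} y U n c" by (rule kexact_zeroI[OF c y _ res])
qed

end

context noetherian_cring begin

lemma same_radical_power:
  assumes z: "seqR z" and rad: "same_radical z U W" and U: "finite U"
  obtains k where "\<And>i. i \<in> U \<Longrightarrow> z i [^] (k::nat) \<in> Idl (z ` W)"
proof -
  have W: "z ` W \<subseteq> carrier R" using z by auto
  note I = genideal_ideal[OF W]
  have "\<exists>k::nat. z i [^] k \<in> Idl (z ` W)" if i: "i \<in> U" for i
  proof (rule radical_by_primes[OF I])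
    show "z i \<in> carrier R" using z by simp
    fix P assume P: "primeideal P R" "Idl (z ` W) \<subseteq> P"
    then have "z ` W \<subseteq> P" using genideal_self[OF W] by blast
    then have "z ` U \<subseteq> P" using rad P by (simp add: same_radical_def)
    then show "z i \<in> P" using i by auto
  qed
  then obtain f where f: "\<And>i. i \<in> U \<Longrightarrow> z i [^] (f i :: nat) \<in> Idl (z ` W)" by metis
  show ?thesis
  proof (rule that[of "\<Sum>i\<in>U. f i"])
    fix i assume i: "i \<in> U"
    then have le: "f i \<le> (\<Sum>i\<in>U. f i)" using U by (simp add: member_le_sum)
    have "z i [^] (\<Sum>i\<in>U. f i) = z i [^] f i \<otimes> z i [^] ((\<Sum>i\<in>U. f i) - f i)" using z le by (simp add: nat_pow_mult)
    then show "z i [^] (\<Sum>i\<in>U. f i) \<in> Idl (z ` W)" using ideal_rmult[OF I f[OF i]] z by simp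
  qed
qed

text \<open>
  By \<open>tau_exact_of_restriction_exact\<close> a cocycle that is exact on \<open>W\<close> becomes exact on \<open>U\<close> after rescaling, that
  is, its class on \<open>U\<close> maps to 0 in local cohomology.
\<close>

lemma koszul_injective_zigzag:
  assumes inj: "koszul_injective z U n" and fin: "finite U" "finite W" and disj: "U \<inter> W = {}" and z: "seqR z"
  shows "zigzag_injective z U W n"
  unfolding zigzag_injective_def
proof (intro allI impI)
  fix y c
  assume y: "seqR y" and yz: "\<forall>l\<in>U. y l = z l" and rad: "same_radical y U W" and c: "coch c"
    and cl: "kclosed {\<zero>} y (U \<union> W) n c" and ex: "kexact {\<zero>} y W n c"
  obtain k where k: "\<And>i. i \<in> U \<Longrightarrow> y i [^] (k::nat) \<in> Idl (y ` W)" using same_radical_power[OF y rad fin(1)] by blast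
  have E: "kexact {\<zero>} (pw y k U) (U \<union> W) n (tau y k U c)"
    by (rule tau_exact_of_restriction_exact[OF fin disj y c cl ex k])
  have kdy: "kd y b S = kd z b S" "kd (pw y k U) b S = kd (pw z k U) b S" if "S \<subseteq> U" "coch b" for b S
    using that yz z by (auto intro!: kd_cong simp: pw_def)
  have ty: "tau y k U c S = tau z k U c S" if "S \<subseteq> U" for S
  proof -
    have "(\<Otimes>i\<in>S \<inter> U. y i [^] k) = (\<Otimes>i\<in>S \<inter> U. z i [^] k)" by (rule finprod_cong') (use yz z in auto)
    then show ?thesis by (simp add: tau_def)
  qed
  have pz: "seqR (pw z k U)" and tz: "coch (tau z k U c)" and py: "seqR (pw y k U)" and tyc: "coch (tau y k U c)"
    using pw_closed tau_closed z y c by auto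
  have "kexact {\<zero>} (pw z k U) U n (tau z k U c)"
  proof -
    obtain b where b: "coch b" "\<And>S. S \<subseteq> U \<union> W \<Longrightarrow> card S = n \<Longrightarrow> tau y k U c S = kd (pw y k U) b S"
      using E kexact_zero_iff[OF tyc py] by blast
    have "tau z k U c S = kd (pw z k U) b S" if "S \<subseteq> U" "card S = n" for S
      using b(2)[of S] that ty[OF that(1)] kdy(2)[OF that(1) b(1)] by auto
    then show ?thesis by (rule kexact_zeroI[OF tz pz b(1)])
  qed
  moreover have "kclosed {\<zero>} z U n c" using cl kdy(1)[OF _ c] unfolding kclosed_zero_iff by auto
  ultimately have "kexact {\<zero>} z U n c" 
    by (intro koszul_injectiveD[OF inj c])
  then obtain b where b: "coch b" "\<And>S. S \<subseteq> U \<Longrightarrow> card S = n \<Longrightarrow> c S = kd z b S"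
    using kexact_zero_iff[OF c z] by blast
  show "kexact {\<zero>} y U n c" by (rule kexact_zeroI[OF c y b(1)]) (use b kdy in simp)
qed

text \<open>
  Let \<open>c\<close> be a cocycle on \<open>U \<union> W\<close> that is exact on \<open>W\<close>. Since a power of \<open>y v\<close> lies in the ideal of the \<open>y i\<close>
  with \<open>i \<in> U\<close>, it kills the class of \<open>c\<close> on \<open>U\<close>, and it suffices to remove one factor \<open>y v\<close> at a time:
  let \<open>y v \<otimes> c = d b\<close> on \<open>U\<close>. The cocycle \<open>f = y v \<otimes> c - d b\<close> on \<open>U \<union> W\<close> vanishes on \<open>U\<close>,
  so by \<open>tau_exact_of_restriction_exact\<close>, with the roles of \<open>U\<close> and \<open>W\<close> exchanged, it becomes exact after
  rescaling along \<open>W\<close>. Hence \<open>y v\<close> times the rescaled cocycle is a coboundary on \<open>U \<union> W\<close>, so that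
  \<open>kd_extend\<close> extends the rescaled cocycle to \<open>insert v U \<union> W\<close>, where the hypothesis applies. Rescaling
  along \<open>W\<close> changes nothing on \<open>U\<close>.
\<close>

lemma zigzag_injective_remove:
  assumes inj: "zigzag_injective z (insert v U) W n" and z: "seqR z" and fin: "finite U" "finite W"
    and disj: "U \<inter> W = {}" and v: "v \<notin> U \<union> W"
    and vr: "\<And>P. primeideal P R \<Longrightarrow> z ` U \<subseteq> P \<Longrightarrow> z v \<in> P"
  shows "zigzag_injective z U W n"
  unfolding zigzag_injective_def
proof (intro allI impI)
  fix y0 c
  assume y0: "seqR y0" and yz0: "\<forall>l\<in>U. y0 l = z l" and rad0: "same_radical y0 U W" and c: "coch c"
    and cl0: "kclosed {\<zero>} y0 (U \<union> W) n c" and ex0: "kexact {\<zero>} y0 W n c"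
  (* y0 v is arbitrary, while the hypothesis requires a sequence that agrees with z at v. *)
  define y where "y = y0(v := z v)"
  have y: "seqR y" using y0 z by (simp add: y_def)
  have yz: "\<forall>l\<in>insert v U. y l = z l" using yz0 by (auto simp: y_def)
  have yy: "kd y b S = kd y0 b S" if "S \<subseteq> U \<union> W" "coch b" for b S
    using that v y0 by (auto intro!: kd_cong simp: y_def)
  have im: "y ` U = y0 ` U" "y ` W = y0 ` W" "y0 ` U = z ` U" using v yz0 by (auto simp: y_def)
  have cl: "kclosed {\<zero>} y (U \<union> W) n c" using cl0 yy[OF _ c] unfolding kclosed_zero_iff by auto
  have ex: "kexact {\<zero>} y W n c"
    using ex0 yy unfolding kexact_zero_iff[OF c y] kexact_zero_iff[OF c y0] by (metis le_supI2)
  have rad: "same_radical y U W" using rad0 by (simp add: same_radical_def im)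
  have rad': "same_radical y (insert v U) W"
    using rad vr yz im unfolding same_radical_def by (metis image_insert insert_subset insertI1)
  have radW: "same_radical y W U" using rad by (simp add: same_radical_def)
  obtain k where k: "\<And>i. i \<in> W \<Longrightarrow> y i [^] (k::nat) \<in> Idl (y ` U)" using same_radical_power[OF y radW fin(2)] by blast
  have yU: "y ` U \<subseteq> carrier R" using y by auto
  obtain e where e: "y v [^] (e::nat) \<in> Idl (y ` U)"
  proof -
    have "\<exists>e::nat. y v [^] e \<in> Idl (y ` U)"
    proof (rule radical_by_primes[OF genideal_ideal[OF yU]])
      show "y v \<in> carrier R" using y by simp
      fix P assume P: "primeideal P R" "Idl (y ` U) \<subseteq> P"
      then have "z ` U \<subseteq> P" using genideal_self[OF yU] im by auto
      then show "y v \<in> P" using vr P yz by simp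
    qed
    then show ?thesis using that by blast
  qed
  have yU0: "Idl (y ` U) \<subseteq> Idl ({\<zero>} \<union> y ` U)"
    using genideal_self[of "{\<zero>} \<union> y ` U"] yU by (intro genideal_minimal genideal_ideal) auto
  have cU: "kclosed {\<zero>} y U n c" using cl unfolding kclosed_def by auto
  have E: "kexact {\<zero>} y U n (\<lambda>S. y v [^] e \<otimes> c S)"
    by (rule Idl_kills_koszul_cohomology[OF zeroideal y fin(1) c cU]) (use e yU0 in blast)
  let ?Q = "\<lambda>c. kclosed {\<zero>} y (U \<union> W) n c \<and> kexact {\<zero>} y W n c"
  have "kexact {\<zero>} y U n c"
  proof (rule kexact_power_descend[where Q = ?Q, OF _ _ _ c _ E])
    show vc: "y v \<in> carrier R" using y by simp
    show "?Q c" using cl ex by simp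
    fix c assume c: "coch c" and Q: "?Q c"
    obtain g where g: "coch g" "\<And>S. S \<subseteq> W \<Longrightarrow> card S = n \<Longrightarrow> c S = kd y g S"
      using Q kexact_zero_iff[OF c y] by blast
    have vcc: "coch (\<lambda>S. y v \<otimes> c S)" using c vc by simp
    show "?Q (\<lambda>S. y v \<otimes> c S)"
    proof
      show "kclosed {\<zero>} y (U \<union> W) n (\<lambda>S. y v \<otimes> c S)" using Q c vc y unfolding kclosed_zero_iff by (simp add: kd_smult)
      show "kexact {\<zero>} y W n (\<lambda>S. y v \<otimes> c S)" unfolding kexact_zero_iff[OF vcc y]
        by (rule exI[of _ "\<lambda>S. y v \<otimes> g S"]) (use g vc y in \<open>auto simp: kd_smult\<close>)
    qed
    assume "kexact {\<zero>} y U n (\<lambda>S. y v \<otimes> c S)"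
    then obtain b where b: "coch b" "\<And>S. S \<subseteq> U \<Longrightarrow> card S = n \<Longrightarrow> y v \<otimes> c S = kd y b S"
      using kexact_zero_iff[OF vcc y] by blast
    let ?f = "\<lambda>S. y v \<otimes> c S \<ominus> kd y b S"
    have f: "coch ?f" using vcc b y by simp
    have fcl: "kclosed {\<zero>} y (W \<union> U) n ?f" unfolding kclosed_zero_iff
    proof (intro allI impI)
      fix S assume S: "S \<subseteq> W \<union> U" "card S = Suc n"
      then have fS: "finite S" using fin finite_subset[of S "W \<union> U"] by simp
      have "kd y c S = \<zero>" using Q S unfolding kclosed_zero_iff by (simp add: Un_commute)
      moreover have "kd y ?f S = kd y (\<lambda>S. y v \<otimes> c S) S \<ominus> kd y (kd y b) S"
        by (rule kd_minus) (use vcc b(1) y in auto)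
      ultimately show "kd y ?f S = \<zero>" using kd_kd[OF b(1) y fS] kd_smult[OF c y vc] vc by (simp add: minus_eq)
    qed
    have fex: "kexact {\<zero>} y U n ?f" unfolding kexact_zero_iff[OF f y]
      by (rule exI[of _ "\<lambda>_. \<zero>"]) (use b y in \<open>auto simp: minus_eq r_neg\<close>)
    let ?p = "pw y k W"
    have p: "seqR ?p" by (rule pw_closed[OF y])
    have fE: "kexact {\<zero>} ?p (W \<union> U) n (tau y k W ?f)"
      by (rule tau_exact_of_restriction_exact[OF fin(2) fin(1) _ y f fcl fex k]) (use disj in auto)
    have tf: "coch (tau y k W ?f)" and tb: "coch (tau y k W b)" and tc: "coch (tau y k W c)" and tg: "coch (tau y k W g)"
      using tau_closed[OF y f] tau_closed[OF y b(1)] tau_closed[OF y c] tau_closed[OF y g(1)] .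
    obtain b' where b': "coch b'" "\<And>S. S \<subseteq> W \<union> U \<Longrightarrow> card S = n \<Longrightarrow> tau y k W ?f S = kd ?p b' S"
      using fE kexact_zero_iff[OF tf p] by blast
    let ?b = "\<lambda>S. b' S \<oplus> tau y k W b S"
    have bc: "coch ?b" using b' tb by simp
    have pv: "?p v = y v" using v by (simp add: pw_def)
    have key: "?p v \<otimes> tau y k W c S = kd ?p ?b S" if S: "S \<subseteq> U \<union> W" "card S = n" for S
    proof -
      have fS: "finite S" using S fin finite_subset[of S "U \<union> W"] by simp
      define P p1 p2 where "P = (\<Otimes>i\<in>S \<inter> W. y i [^] k)" and "p1 = c S" and "p2 = kd y b S"
      have k: "P \<in> carrier R" "p1 \<in> carrier R" "p2 \<in> carrier R" using y b c by (auto simp: P_def p1_def p2_def intro!: finprod_closed)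
      have "?p v \<otimes> tau y k W c S = y v \<otimes> (P \<otimes> p1)" by (simp add: pv tau_def P_def p1_def)
      also have "\<dots> = P \<otimes> (y v \<otimes> p1 \<ominus> p2) \<oplus> P \<otimes> p2" using k vc by algebra
      also have "P \<otimes> (y v \<otimes> p1 \<ominus> p2) = tau y k W ?f S" by (simp add: tau_def P_def p1_def p2_def)
      also have "\<dots> = kd ?p b' S" using b'(2) S by (simp add: Un_commute)
      also have "P \<otimes> p2 = kd ?p (tau y k W b) S" using kd_tau[OF b(1) y fS, of k W] by (simp add: tau_def P_def p2_def)
      also have "kd ?p b' S \<oplus> kd ?p (tau y k W b) S = kd ?p ?b S" using b' tb p by (simp add: kd_add)
      finally show ?thesis .
    qed
    let ?e = "\<lambda>S. if v \<in> S then kE v ?b S else tau y k W c S"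
    have ec: "coch ?e" using bc tc by simp
    have fUW: "finite (U \<union> W)" using fin by simp
    have "kclosed {\<zero>} ?p (insert v (U \<union> W)) n ?e"
    proof (rule kd_extend[OF p fUW v tc _ bc key])
      show "kclosed {\<zero>} ?p (U \<union> W) n (tau y k W c)" using kclosed_tau[OF c y fUW] Q by blast
    qed
    then have 1: "kclosed {\<zero>} ?p (insert v U \<union> W) n ?e" by simp
    have 2: "kexact {\<zero>} ?p W n ?e" unfolding kexact_zero_iff[OF ec p]
    proof (intro exI[of _ "tau y k W g"] conjI tg allI impI)
      fix S assume S: "S \<subseteq> W" "card S = n"
      then have fS: "finite S" using fin finite_subset by blast
      have "?e S = tau y k W c S" using S v by auto
      also have "\<dots> = tau y k W (kd y g) S" using g(2)[OF S] by (simp add: tau_def)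
      also have "\<dots> = kd ?p (tau y k W g) S" using kd_tau[OF g(1) y fS] by simp
      finally show "?e S = kd ?p (tau y k W g) S" .
    qed
    have 3: "\<forall>l\<in>insert v U. ?p l = z l" using yz disj v by (auto simp: pw_def)
    have 4: "same_radical ?p (insert v U) W" unfolding same_radical_def
    proof (intro allI impI)
      fix P assume P: "primeideal P R"
      have "?p ` insert v U = y ` insert v U" using v disj by (auto simp: pw_def)
      moreover have "?p ` W \<subseteq> P \<longleftrightarrow> y ` W \<subseteq> P"
      proof -
        have "?p i \<in> P \<longleftrightarrow> y i \<in> P" if "i \<in> W" for i
          using that prime_pow[OF P, of "y i" "Suc k"] ideal_lmult[OF prime_ideal[OF P], of "y i" "y i [^] k"] y by (auto simp: pw_def)
        then show ?thesis by auto
      qed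
      ultimately show "?p ` insert v U \<subseteq> P \<longleftrightarrow> ?p ` W \<subseteq> P" using rad' P by (simp add: same_radical_def)
    qed
    have "kexact {\<zero>} ?p (insert v U) n ?e" by (rule zigzag_injectiveD[OF inj p 3 4 ec 1 2])
    then obtain h where h: "coch h" "\<And>S. S \<subseteq> insert v U \<Longrightarrow> card S = n \<Longrightarrow> ?e S = kd ?p h S"
      using kexact_zero_iff[OF ec p] by blast
    have "c S = kd y h S" if S: "S \<subseteq> U" "card S = n" for S
    proof -
      have vS: "v \<notin> S" and SW: "S \<inter> W = {}" using S v disj by auto
      have "c S = tau y k W c S" using SW c by (simp add: tau_def)
      also have "\<dots> = ?e S" using vS by simp
      also have "\<dots> = kd ?p h S" by (rule h(2)) (use S in auto)
      also have "\<dots> = kd y h S" by (rule kd_cong) (use SW h y in \<open>auto simp: pw_def\<close>)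
      finally show ?thesis .
    qed
    then show "kexact {\<zero>} y U n c" by (rule kexact_zeroI[OF c y h(1)])
  qed
  then show "kexact {\<zero>} y0 U n c"
    using yy unfolding kexact_zero_iff[OF c y] kexact_zero_iff[OF c y0] by (metis le_supI1)
qed

end

context local_ring begin

text \<open>
  Take the powers \<open>(x i)\<^sup>k\<^sup>+\<^sup>1\<close> as the second system of generators. An element \<open>r\<close>, placed at the top set \<open>{..<n}\<close>, is a
  cocycle on \<open>{..<n}\<close>, exact if and only if \<open>r\<close> lies in the ideal of the \<open>x i\<close>. It extends to a cocycle on the
  union of the two index sets whose value at the second set is, up to sign, \<open>r\<close> times the \<open>k\<close>-th
  power of the product of the \<open>x i\<close>. The indices \<open>t + s\<close> are adjoined one at a time by \<open>kd_extend\<close>: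
  the new element \<open>(x s)\<^sup>k x s\<close> is a multiple of \<open>x s\<close>, and \<open>kH s\<close> is a homotopy for multiplication by
  \<open>x s\<close>.
\<close>

lemma zigzag_injective_limit_closed:
  assumes inj: "zigzag_injective x {..<n} {t..<t+n} n" and nt: "n \<le> t" and x: "seqR x"
  shows "limit_closed {\<zero>} {..<n} x"
  unfolding limit_closed_def
proof (intro allI ballI impI)
  fix k r
  let ?U = "{..<n}" and ?W = "{t..<t+n}"
  assume r: "r \<in> carrier R" and rk: "r \<otimes> (\<Otimes>i\<in>?U. x i [^] k) \<in> Idl ({\<zero>} \<union> (\<lambda>i. x i [^] Suc k) ` ?U)"
  define y where "y i = (if i \<in> ?W then x (i - t) [^] Suc k else x i)" for i
  have y: "seqR y" using x by (simp add: y_def)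
  have yW: "y ` ?W = (\<lambda>i. x i [^] Suc k) ` ?U"
  proof -
    have "i \<in> (\<lambda>i. i + t) ` ?U" if "i \<in> ?W" for i
      by (rule image_eqI[of _ _ "i - t"]) (use that in auto)
    then have "?W = (\<lambda>i. i + t) ` ?U" by auto
    then show ?thesis by (auto simp: y_def image_image)
  qed
  have yU: "\<forall>i\<in>?U. y i = x i" using nt by (auto simp: y_def)
  have yUi: "y ` ?U = x ` ?U" using yU by auto
  have rad: "same_radical y ?U ?W" unfolding same_radical_def yW yUi
  proof (intro allI impI)
    fix P assume P: "primeideal P R"
    have "x i [^] Suc k \<in> P \<longleftrightarrow> x i \<in> P" for i
      using prime_pow[OF P, of "x i" "Suc k"] ideal_lmult[OF prime_ideal[OF P], of "x i" "x i [^] k"] x by auto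
    then show "x ` ?U \<subseteq> P \<longleftrightarrow> (\<lambda>i. x i [^] Suc k) ` ?U \<subseteq> P" by auto
  qed
  define c0 where "c0 S = (if S = ?U then r else \<zero>)" for S :: "nat set"
  have c0: "coch c0" using r by (simp add: c0_def)
  (* After s steps the value at the set in which s..n-1 and the first s new indices take part
     is tracked; u collects the signs. *)
  have step: "\<exists>c. coch c \<and> kclosed {\<zero>} y (?U \<union> {t..<t+s}) n c \<and> (\<forall>S\<subseteq>?U. c S = c0 S) \<and>
     (\<exists>u\<in>carrier R. c ({s..<n} \<union> {t..<t+s}) = u \<otimes> (r \<otimes> (\<Otimes>i\<in>{..<s}. x i [^] k)))" if "s \<le> n" for s
    using that
  proof (induction s)
    case 0
    have "kclosed {\<zero>} y ?U n c0" unfolding kclosed_zero_iff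
    proof (intro allI impI)
      fix S assume S: "S \<subseteq> ?U" "card S = Suc n"
      then have "card S \<le> card ?U" by (intro card_mono) auto
      then show "kd y c0 S = \<zero>" using S by simp
    qed
    moreover have "{0..<n} = ?U" by auto
    moreover have "r = \<one> \<otimes> (r \<otimes> \<one>)" using r by simp
    moreover have "c0 ?U = r" by (simp add: c0_def)
    ultimately show ?case using c0 by (intro exI[of _ c0] conjI) (auto intro!: bexI[of _ \<one>])
  next
    case (Suc s)
    let ?V = "?U \<union> {t..<t+s}" and ?v = "t + s"
    obtain c u where c: "coch c" "kclosed {\<zero>} y ?V n c" "\<forall>S\<subseteq>?U. c S = c0 S" and u: "u \<in> carrier R"
      and cu: "c ({s..<n} \<union> {t..<t+s}) = u \<otimes> (r \<otimes> (\<Otimes>i\<in>{..<s}. x i [^] k))" using Suc by auto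
    have V: "finite ?V" "?v \<notin> ?V" using nt Suc.prems by auto
    have yv: "y ?v = x s [^] k \<otimes> y s" using Suc.prems nt x by (simp add: y_def)
    have xk: "x s [^] k \<in> carrier R" using x by simp
    let ?b = "\<lambda>S. x s [^] k \<otimes> kH s c S"
    have b: "coch ?b" using xk c by simp
    have key: "y ?v \<otimes> c S = kd y ?b S" if S: "S \<subseteq> ?V" "card S = n" for S
    proof -
      have fS: "finite S" using S V finite_subset by blast
      have "kH s (kd y c) S = \<zero>"
      proof (cases "s \<in> S")
        case False
        have "insert s S \<subseteq> ?V" "card (insert s S) = Suc n" using S False fS Suc.prems by auto
        then have "kd y c (insert s S) = \<zero>" using c(2) unfolding kclosed_zero_iff by blast
        then show ?thesis by (simp add: kH_def)
      qed (simp add: kH_def)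
      then have "kd y (kH s c) S = y s \<otimes> c S" using kd_kH[OF c(1) y fS, of s] c y by simp
      then have "kd y ?b S = x s [^] k \<otimes> (y s \<otimes> c S)" using kd_smult[OF _ y xk, of "kH s c" S] c by simp
      then show ?thesis unfolding yv using xk y c by (simp add: m_assoc)
    qed
    let ?c = "\<lambda>S. if ?v \<in> S then kE ?v ?b S else c S"
    have "kclosed {\<zero>} y (insert ?v ?V) n ?c" by (rule kd_extend[OF y V c(1,2) b key])
    moreover have "insert ?v ?V = ?U \<union> {t..<t + Suc s}" by auto
    moreover have "\<forall>S\<subseteq>?U. ?c S = c0 S" using c(3) nt V(2) by auto
    moreover have "coch ?c" using b c by simp
    moreover have "\<exists>u\<in>carrier R. ?c ({Suc s..<n} \<union> {t..<t + Suc s}) = u \<otimes> (r \<otimes> (\<Otimes>i\<in>{..<Suc s}. x i [^] k))"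
    proof -
      let ?S = "{Suc s..<n} \<union> {t..<t + Suc s}"
      have S1: "?S - {?v} = {Suc s..<n} \<union> {t..<t+s}" using V Suc.prems nt by auto
      have S2: "insert s ({Suc s..<n} \<union> {t..<t+s}) = {s..<n} \<union> {t..<t+s}" using Suc.prems by auto
      have s: "s \<notin> {Suc s..<n} \<union> {t..<t+s}" using Suc.prems nt by auto
      define s1 s2 where "s1 = ksign ?v ?S" and "s2 = ksign s ({Suc s..<n} \<union> {t..<t+s})"
      have sc: "s1 \<in> carrier R" "s2 \<in> carrier R" by (auto simp: s1_def s2_def)
      have pc: "(\<Otimes>i\<in>{..<s}. x i [^] k) \<in> carrier R" using x by (intro finprod_closed) auto
      have "?c ?S = s1 \<otimes> (x s [^] k \<otimes> (s2 \<otimes> c ({s..<n} \<union> {t..<t+s})))"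
      proof -
        have vS: "?v \<in> ?S" by simp
        have "?c ?S = kE ?v ?b ?S" using vS by (simp only: if_True)
        also have "\<dots> = s1 \<otimes> (x s [^] k \<otimes> kH s c ({Suc s..<n} \<union> {t..<t+s}))"
          using vS by (simp only: kE_def if_True S1 s1_def)
        also have "kH s c ({Suc s..<n} \<union> {t..<t+s}) = s2 \<otimes> c ({s..<n} \<union> {t..<t+s})"
          using s by (simp only: kH_def if_False S2 s2_def)
        finally show ?thesis .
      qed
      also have "\<dots> = (s1 \<otimes> s2 \<otimes> u) \<otimes> (r \<otimes> (x s [^] k \<otimes> (\<Otimes>i\<in>{..<s}. x i [^] k)))"
        unfolding cu using sc xk u r pc by (simp add: m_ac)
      also have "x s [^] k \<otimes> (\<Otimes>i\<in>{..<s}. x i [^] k) = (\<Otimes>i\<in>{..<Suc s}. x i [^] k)"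
        using x by (simp add: lessThan_Suc finprod_insert Pi_iff)
      finally show ?thesis using sc u by (intro bexI[of _ "s1 \<otimes> s2 \<otimes> u"]) auto
    qed
    ultimately show ?case by (intro exI[of _ ?c]) simp
  qed
  obtain c u where c: "coch c" "kclosed {\<zero>} y (?U \<union> ?W) n c" "\<forall>S\<subseteq>?U. c S = c0 S" and u: "u \<in> carrier R"
    and cu: "c ({n..<n} \<union> ?W) = u \<otimes> (r \<otimes> (\<Otimes>i\<in>?U. x i [^] k))" using step[of n] by auto
  have Wc: "(\<lambda>i. x i [^] Suc k) ` ?U \<subseteq> carrier R" using x by auto
  have "Idl ({\<zero>} \<union> (\<lambda>i. x i [^] Suc k) ` ?U) \<subseteq> Idl (y ` ?W)" unfolding yW
    using genideal_self[OF Wc] ideal_zero[OF genideal_ideal[OF Wc]] by (intro genideal_minimal[OF genideal_ideal[OF Wc]]) auto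
  then have "c ?W \<in> Idl (y ` ?W)" using cu rk u ideal_lmult[OF genideal_ideal[OF Wc]] unfolding yW by auto
  then have "kexact {\<zero>} y ?W n c" using kexact_top[OF y _ c(1), of ?W] by simp
  then have "kexact {\<zero>} y ?U n c" by (rule zigzag_injectiveD[OF inj y yU rad c(1,2)])
  then obtain b where b: "coch b" "c ?U = kd y b ?U" using kexact_zero_iff[OF c(1) y] by (metis card_lessThan order_refl)
  have Uc: "{\<zero>} \<union> x ` ?U \<subseteq> carrier R" using x by auto
  have "kd y b ?U \<in> Idl ({\<zero>} \<union> x ` ?U)" unfolding kd_def
  proof (rule ideal_finsum[OF genideal_ideal[OF Uc]])
    fix i assume i: "i \<in> ?U"
    then have "y i \<in> Idl ({\<zero>} \<union> x ` ?U)" using genideal_self[OF Uc] yU by auto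
    then show "y i \<otimes> kE i b ?U \<in> Idl ({\<zero>} \<union> x ` ?U)" using ideal_rmult[OF genideal_ideal[OF Uc]] b by simp
  qed
  then show "r \<in> Idl ({\<zero>} \<union> x ` ?U)" using b c(3) by (simp add: c0_def)
qed

end

section \<open>Generators in general position\<close>

context local_ring begin

text \<open>
  The property of sequences to be preserved is a parameter, so that the construction of generators in general
  position is independent of Koszul cohomology.
\<close>

definition elementary_closed :: "((nat \<Rightarrow> 'a) \<Rightarrow> bool) \<Rightarrow> nat \<Rightarrow> bool" where
  "elementary_closed Q t \<longleftrightarrow> (\<forall>z i j a. seqR z \<longrightarrow> Q z \<longrightarrow> i < t \<longrightarrow> j < t \<longrightarrow> i \<noteq> j \<longrightarrow> a \<in> carrier R \<longrightarrow>
     Q (z(i := z i \<oplus> a \<otimes> z j)))"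

lemma elementary_closed_combination:
  assumes Q: "elementary_closed Q t" and z: "seqR z" "Q z" and i: "i < t"
    and V: "finite V" "V \<subseteq> {..<t} - {i}" and c: "c \<in> V \<rightarrow> carrier R"
  shows "Q (z(i := z i \<oplus> (\<Oplus>j\<in>V. c j \<otimes> z j)))"
  using V c
proof (induction V)
  case empty
  then show ?case using z by (simp add: fun_upd_idem)
next
  case (insert v V)
  define s where "s = (\<Oplus>j\<in>V. c j \<otimes> z j)"
  let ?y = "z(i := z i \<oplus> s)"
  have cV: "c \<in> V \<rightarrow> carrier R" "c v \<in> carrier R" using insert.prems by auto
  have sc: "s \<in> carrier R" unfolding s_def using cV z by (intro finsum_closed) auto
  have "Q ?y" unfolding s_def using insert.IH insert.prems cV by blast
  then have y: "seqR ?y" "Q ?y" using z sc by auto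
  have vi: "v \<noteq> i" "v < t" using insert.prems by auto
  have "Q (?y(i := ?y i \<oplus> c v \<otimes> ?y v))" using Q y i vi cV unfolding elementary_closed_def by blast
  moreover have "?y(i := ?y i \<oplus> c v \<otimes> ?y v) = z(i := z i \<oplus> (\<Oplus>j\<in>insert v V. c j \<otimes> z j))"
  proof -
    have "(\<Oplus>j\<in>insert v V. c j \<otimes> z j) = c v \<otimes> z v \<oplus> s"
      unfolding s_def using insert.hyps cV z by (intro finsum_insert) auto
    moreover have "(z i \<oplus> s) \<oplus> c v \<otimes> z v = z i \<oplus> (c v \<otimes> z v \<oplus> s)" using sc cV z by (simp add: a_ac)
    ultimately show ?thesis using vi by (simp add: fun_eq_iff)
  qed
  ultimately show ?case by (simp only:)
qed

text \<open>
  The ideal generated by the \<open>z i\<close> with \<open>i \<in> U\<close> is primary to \<open>\<mm>\<close>.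
\<close>

definition max_radical :: "(nat \<Rightarrow> 'a) \<Rightarrow> nat set \<Rightarrow> bool" where
  "max_radical z U \<longleftrightarrow> (\<forall>P. primeideal P R \<longrightarrow> (z ` U \<subseteq> P \<longleftrightarrow> P = \<mm>))"

text \<open>
  The last claim is Krull's height theorem for \<open>\<mm>\<close>.
\<close>

lemma dim_le_generators:
  assumes z: "seqR z" "max_radical z U" "finite U" and n: "krull_dim R = enat n"
  shows "prime_chain_to \<mm> n" "\<not> prime_chain_to \<mm> (Suc n)" "n \<le> card U"
proof -
  note pc = prime_chain_krull_dim[OF n max_prime]
  obtain P where P: "prime_chain_to P n" using pc(1) by blast
  show mn: "prime_chain_to \<mm> n"
    by (rule prime_chain_to_mono[OF P max_prime prime_in_max[OF prime_chain_to_prime[OF P]]])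
  show "\<not> prime_chain_to \<mm> (Suc n)" by (rule pc(2))
  have "\<not> prime_chain_to \<mm> (Suc (card U))"
    by (rule krull_height[OF z(3) _ max_prime]) (use z max_prime in \<open>auto simp: max_radical_def\<close>)
  then show "n \<le> card U" using prime_chain_to_le[OF mn, of "Suc (card U)"] by linarith
qed

text \<open>
  One element at a time, arrange that every prime containing the first \<open>k\<close> elements has height at least \<open>k\<close>. To modify
  element \<open>k\<close>, consider the minimal primes of the ideal of the first \<open>k\<close> elements, other than \<open>\<mm>\<close>. None of
  them contains all the remaining elements, so by prime avoidance some \<open>y k \<oplus> w\<close>, with \<open>w\<close> a
  combination of the later elements, avoids them all, and a prime that contains it has larger
  height. For \<open>k = n\<close> only \<open>\<mm>\<close> is left.
\<close>

lemma general_position: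
  assumes Q: "elementary_closed Q t" and z: "seqR z" "Q z" "max_radical z {..<t}" and n: "krull_dim R = enat n"
  shows "\<exists>y. seqR y \<and> Q y \<and> max_radical y {..<n} \<and> y ` {..<t} \<subseteq> \<mm>"
proof -
  (* The bound n <= t ensures that each of the n steps has an element to modify. *)
  have mn: "prime_chain_to \<mm> n" and nn: "\<not> prime_chain_to \<mm> (Suc n)" and nt: "n \<le> t"
    using dim_le_generators[OF z(1,3) _ n] by auto
  define E where "E y \<longleftrightarrow> Q y \<and> max_radical y {..<t}" for y
  have E: "elementary_closed E t" unfolding elementary_closed_def
  proof (intro allI impI)
    fix y i j a assume y: "seqR y" "E y" and ij: "i < t" "j < t" "i \<noteq> j" and a: "a \<in> carrier R"
    let ?y = "y(i := y i \<oplus> a \<otimes> y j)"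
    have "Q ?y" using Q y ij a unfolding elementary_closed_def E_def by blast
    moreover have "y ` {..<t} \<subseteq> P \<longleftrightarrow> ?y ` {..<t} \<subseteq> P" if P: "primeideal P R" for P
      using elementary_image_subset_prime[OF P y(1) a, of i "{..<t}" j] ij by simp
    then have "max_radical ?y {..<t}" using y unfolding E_def max_radical_def by blast
    ultimately show "E ?y" by (simp add: E_def)
  qed
  have step: "\<exists>y. seqR y \<and> E y \<and> (\<forall>P. primeideal P R \<longrightarrow> y ` {..<k} \<subseteq> P \<longrightarrow> prime_chain_to P k)" if "k \<le> n" for k
    using that
  proof (induction k)
    case 0
    then show ?case using z prime_chain_to_0 by (intro exI[of _ z]) (auto simp: E_def)
  next
    case (Suc k)
    then obtain y where y: "seqR y" "E y" "\<And>P. primeideal P R \<Longrightarrow> y ` {..<k} \<subseteq> P \<Longrightarrow> prime_chain_to P k" by auto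
    have kt: "k < t" using Suc.prems nt by simp
    have yc: "y ` V \<subseteq> carrier R" for V using y by auto
    obtain A where A: "finite A" "\<And>Q. Q \<in> A \<Longrightarrow> primeideal Q R" "\<And>Q. Q \<in> A \<Longrightarrow> Idl (y ` {..<k}) \<subseteq> Q"
      "\<And>P. primeideal P R \<Longrightarrow> Idl (y ` {..<k}) \<subseteq> P \<Longrightarrow> \<exists>Q\<in>A. Q \<subseteq> P"
      "\<And>Q Q'. Q \<in> A \<Longrightarrow> Q' \<in> A \<Longrightarrow> Q \<subseteq> Q' \<Longrightarrow> Q = Q'"
      using finitely_many_minimal_primes[OF genideal_ideal[OF yc]] by blast
    let ?V = "{Suc k..<t}"
    have "\<exists>w\<in>Idl ({\<zero>} \<union> y ` ?V). \<forall>Q\<in>A - {\<mm>}. y k \<oplus> w \<notin> Q"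
    proof (rule coset_prime_avoidance)
      have zc: "{\<zero>} \<union> y ` ?V \<subseteq> carrier R" using yc by auto
      show "ideal (Idl ({\<zero>} \<union> y ` ?V)) R" by (rule genideal_ideal[OF zc])
      show "\<not> (Idl ({\<zero>} \<union> y ` ?V) \<subseteq> Q \<and> y k \<in> Q)" if Q: "Q \<in> A - {\<mm>}" for Q
      proof
        assume *: "Idl ({\<zero>} \<union> y ` ?V) \<subseteq> Q \<and> y k \<in> Q"
        have "y i \<in> Q" if i: "i < t" for i
        proof -
          consider "i < k" | "i = k" | "i \<in> ?V" using i by (metis atLeastLessThan_iff linorder_neqE_nat Suc_leI)
          then show ?thesis
          proof cases
            case 1
            then have "y i \<in> Idl (y ` {..<k})" using genideal_self[OF yc] by blast
            then show ?thesis using A(3) Q by blast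
          next
            case 3
            then have "y i \<in> Idl ({\<zero>} \<union> y ` ?V)" using genideal_self[OF zc] by blast
            then show ?thesis using * by blast
          qed (use * in simp)
        qed
        then have "y ` {..<t} \<subseteq> Q" by auto
        then show False using y(2) A(2) Q by (auto simp: E_def max_radical_def)
      qed
    qed (use A y in auto)
    then obtain w where w: "w \<in> Idl ({\<zero>} \<union> y ` ?V)" "\<And>Q. Q \<in> A - {\<mm>} \<Longrightarrow> y k \<oplus> w \<notin> Q" by blast
    obtain e c where c: "e \<in> {\<zero>}" "c \<in> ?V \<rightarrow> carrier R" "w = e \<oplus> (\<Oplus>i\<in>?V. c i \<otimes> y i)"
      using Idl_union_image_combination[OF zeroideal _ _ w(1)] y(1) by auto
    have wsum: "w = (\<Oplus>i\<in>?V. c i \<otimes> y i)" using c y(1) by (simp add: finsum_closed Pi_iff)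
    let ?y = "y(k := y k \<oplus> w)"
    have wc: "w \<in> carrier R" unfolding wsum using c y(1) by (intro finsum_closed) auto
    have sy: "seqR ?y" using y wc by simp
    have Ey: "E ?y" unfolding wsum
      by (rule elementary_closed_combination[OF E y(1,2) kt _ _ c(2)]) auto
    have "prime_chain_to P (Suc k)" if P: "primeideal P R" "?y ` {..<Suc k} \<subseteq> P" for P
    proof (cases "P = \<mm>")
      case True
      then show ?thesis using prime_chain_to_le[OF mn] Suc.prems by simp
    next
      case False
      have "y i \<in> P" if "i < k" for i
      proof -
        have "?y i \<in> P" using P(2) that by (metis image_subset_iff lessThan_iff less_SucI)
        then show ?thesis using that by simp
      qed
      then have "y ` {..<k} \<subseteq> P" by auto
      then have "Idl (y ` {..<k}) \<subseteq> P" using P by (intro genideal_minimal prime_ideal)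
      then obtain Q' where Q': "Q' \<in> A" "Q' \<subseteq> P" using A(4) P by blast
      have Qm: "Q' \<noteq> \<mm>" using Q' False prime_in_max[OF P(1)] by auto
      have "y k \<oplus> w \<in> P" using P(2) by (auto simp: image_subset_iff)
      then have "Q' \<subset> P" using w(2)[of Q'] Q' Qm by auto
      moreover have "prime_chain_to Q' k"
        using y(3) A(2,3) Q'(1) genideal_self[OF yc] by (meson order_trans)
      ultimately show ?thesis using prime_chain_to_Suc P(1) by blast
    qed
    then show ?case using sy Ey by blast
  qed
  obtain y where y: "seqR y" "E y" "\<And>P. primeideal P R \<Longrightarrow> y ` {..<n} \<subseteq> P \<Longrightarrow> prime_chain_to P n"
    using step[of n] by blast
  have m: "y ` {..<t} \<subseteq> \<mm>" using y(2) max_prime by (auto simp: E_def max_radical_def)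
  have "max_radical y {..<n}" unfolding max_radical_def
  proof (intro allI impI iffI)
    fix P assume P: "primeideal P R" "y ` {..<n} \<subseteq> P"
    show "P = \<mm>"
    proof (rule ccontr)
      assume "P \<noteq> \<mm>"
      then have "P \<subset> \<mm>" using prime_in_max[OF P(1)] by auto
      then have "prime_chain_to \<mm> (Suc n)" using prime_chain_to_Suc[OF y(3)[OF P] max_prime] by simp
      then show False using nn by simp
    qed
  next
    fix P assume "P = \<mm>"
    then show "y ` {..<n} \<subseteq> P" using m nt by auto
  qed
  then show ?thesis using y m by (auto simp: E_def)
qed

section \<open>The Cohen-Macaulay property in terms of Koszul cochains\<close>

text \<open>
  The second system of generators lives on the indices \<open>t, \<dots>, t + n - 1\<close>; there are \<open>n\<close> of them because in the end it
  consists of powers of the \<open>n\<close> elements that remain.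
\<close>

theorem koszul_injective_imp_regular_sequence:
  assumes inj: "koszul_injective z {..<t} n" and z: "seqR z" "max_radical z {..<t}" and n: "krull_dim R = enat n"
  shows "\<exists>xs. regular_sequence R xs \<and> set xs \<subseteq> \<mm> \<and> length xs = n"
proof -
  let ?W = "{t..<t+n}"
  have disj: "{..<s} \<inter> ?W = {}" if "s \<le> t" for s using that by auto
  have Qz: "zigzag_injective z {..<t} ?W n"
    by (rule koszul_injective_zigzag[OF inj _ _ disj z(1)]) auto
  have ec: "elementary_closed (\<lambda>z. zigzag_injective z {..<t} ?W n) t" unfolding elementary_closed_def
    by (intro allI impI zigzag_injective_elementary disj) auto
  then obtain y where y: "seqR y" "zigzag_injective y {..<t} ?W n" "max_radical y {..<n}" "y ` {..<t} \<subseteq> \<mm>"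
    using general_position[where Q = "\<lambda>z. zigzag_injective z {..<t} ?W n", OF ec z(1) Qz z(2) n] by blast
  have nt: "n \<le> t" using dim_le_generators[OF z _ n] by simp
  have "zigzag_injective y {..<s} ?W n" if "n \<le> s" "s \<le> t" for s
    using that(2,1)
  proof (induction rule: inc_induct)
    case base then show ?case using y by simp
  next
    case (step s)
    show ?case
    proof (rule zigzag_injective_remove[of y s])
      show "zigzag_injective y (insert s {..<s}) ?W n" using step by (simp add: lessThan_Suc)
      fix P assume P: "primeideal P R" "y ` {..<s} \<subseteq> P"
      then have "y ` {..<n} \<subseteq> P" using step by auto
      then have "P = \<mm>" using P y by (simp add: max_radical_def)
      then show "y s \<in> P" using y step by auto
    qed (use y step disj[of s] in auto)
  qed
  then have "zigzag_injective y {..<n} ?W n" using nt by simp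
  then have "limit_closed {\<zero>} {..<n} y" using zigzag_injective_limit_closed nt y by blast
  moreover have "y i \<in> \<mm>" if "i < n" for i using y(4) nt that by (auto simp: image_subset_iff)
  ultimately have "regular_sequence R (map y [0..<n])"
    using limit_closed_regular_sequence[of n y] by blast
  moreover have "set (map y [0..<n]) \<subseteq> \<mm>" using y nt by auto
  ultimately show ?thesis by (intro exI[of _ "map y [0..<n]"]) auto
qed

theorem regular_sequence_imp_koszul_injective:
  assumes xs: "regular_sequence R xs" "set xs \<subseteq> \<mm>" and z: "seqR z" "max_radical z U" and U: "finite U"
  shows "koszul_injective z U (length xs)"
proof -
  let ?n = "length xs"
  define J where "J r = Idl (set (take r xs))" for r
  have xc: "set xs \<subseteq> carrier R" using xs by (simp add: regular_sequence_def)
  have tk: "set (take r xs) \<subseteq> carrier R" for r using xc set_take_subset by (rule subset_trans[rotated])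
  have J: "ideal (J r) R" for r unfolding J_def by (rule genideal_ideal[OF tk])
  have ch: "adjoin_chain ?n ((!) xs) J" unfolding adjoin_chain_def
  proof (intro conjI allI impI J)
    fix r assume r: "r < ?n"
    show c: "xs ! r \<in> carrier R" using xc nth_mem[OF r] by blast
    have "set (take (Suc r) xs) = insert (xs ! r) (set (take r xs))" using r by (simp add: take_Suc_conv_app_nth)
    then show "J (Suc r) = adjoin (J r) (xs ! r)" unfolding J_def using Idl_insert[OF tk c] by simp
    have "regular_on_quotient R (J r) (xs ! r)"
      using xs(1) r unfolding regular_sequence_def J_def by blast
    then show "regular_mod (J r) (xs ! r)" using regular_on_quotient_iff[OF J c] by simp
  qed
  have J0: "J 0 = {\<zero>}" by (simp add: J_def Idl_empty)
  have nil: "\<exists>e::nat. xs ! r [^] e \<in> Idl (pw z j U ` U)" if r: "r < ?n" for r j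
  proof (rule radical_by_primes)
    have c: "pw z j U ` U \<subseteq> carrier R" using pw_closed[OF z(1)] by auto
    show "ideal (Idl (pw z j U ` U)) R" by (rule genideal_ideal[OF c])
    show "xs ! r \<in> carrier R" using xc nth_mem[OF r] by blast
    fix P assume P: "primeideal P R" "Idl (pw z j U ` U) \<subseteq> P"
    have "z i \<in> P" if i: "i \<in> U" for i
    proof -
      have "pw z j U i \<in> P" using genideal_self[OF c] P i by auto
      then show ?thesis using prime_pow[OF P(1), of "z i" "Suc j"] z(1) i by (simp add: pw_def)
    qed
    then have "P = \<mm>" using z(2) P by (auto simp: max_radical_def)
    then show "xs ! r \<in> P" using xs(2) nth_mem[OF r] by auto
  qed
  show ?thesis unfolding koszul_injective_def
  proof (intro allI impI)
    fix c k assume c: "coch c" "kclosed {\<zero>} z U ?n c" "kexact {\<zero>} (pw z k U) U ?n (tau z k U c)"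
    show "kexact {\<zero>} z U ?n c"
      using koszul_injective_mod[OF ch z(1) U nil, of 0 ?n c k] c J0 by simp
  qed
qed

lemma regular_sequence_length_le:
  assumes "regular_sequence R xs" "krull_dim R = enat n" shows "length xs \<le> n"
proof (rule ccontr)
  assume "\<not> length xs \<le> n"
  obtain P where P: "prime_chain_to P (length xs)" using regular_sequence_prime_chain[OF assms(1)] by blast
  have "prime_chain_to P (Suc n)" by (rule prime_chain_to_le[OF P]) (use \<open>\<not> length xs \<le> n\<close> in simp)
  then have "prime_chain_to \<mm> (Suc n)" using prime_chain_to_mono prime_in_max max_prime prime_chain_to_prime by blast
  then show False using prime_chain_krull_dim(2)[OF assms(2) max_prime] by blast
qed

text \<open>
  A regular sequence gives a chain of primes of the same length, so the supremum in the definition of depth is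
  attained.
\<close>

lemma Cohen_Macaulay_iff:
  assumes n: "krull_dim R = enat n"
  shows "Cohen_Macaulay R \<mm> \<longleftrightarrow> (\<exists>xs. regular_sequence R xs \<and> set xs \<subseteq> \<mm> \<and> length xs = n)"
proof -
  let ?A = "{enat (length xs) | xs. regular_sequence R xs \<and> set xs \<subseteq> \<mm>}"
  have le: "x \<le> enat n" if "x \<in> ?A" for x using that regular_sequence_length_le[OF _ n] by auto
  have fin: "finite ?A" by (rule finite_subset[of _ "enat ` {..n}"]) (use regular_sequence_length_le[OF _ n] in auto)
  have "regular_sequence R []" unfolding regular_sequence_def
  proof (intro conjI)
    have "\<one> \<noteq> \<zero>" using prime_one[OF max_prime] ideal_zero[OF max_closed] by auto
    then show "Idl (set []) \<noteq> carrier R" using Idl_empty one_closed by auto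
  qed auto
  then have ne: "?A \<noteq> {}" by force
  have mx: "Sup ?A \<in> ?A" using fin ne by (metis (no_types, lifting) Max_in Sup_enat_def)
  have "Cohen_Macaulay R \<mm> \<longleftrightarrow> Sup ?A = enat n" by (simp add: Cohen_Macaulay_def depth_def n)
  also have "\<dots> \<longleftrightarrow> enat n \<in> ?A"
  proof
    assume "Sup ?A = enat n"
    then show "enat n \<in> ?A" using mx by (simp only:)
  next
    assume a: "enat n \<in> ?A"
    show "Sup ?A = enat n" by (rule antisym[OF Sup_least[OF le] Sup_upper[OF a]])
  qed
  also have "\<dots> \<longleftrightarrow> (\<exists>xs. regular_sequence R xs \<and> set xs \<subseteq> \<mm> \<and> length xs = n)" by auto
  finally show ?thesis .
qed

theorem Cohen_Macaulay_iff_koszul_injective: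
  assumes "seqR z" "max_radical z {..<t}" "krull_dim R = enat n"
  shows "Cohen_Macaulay R \<mm> \<longleftrightarrow> koszul_injective z {..<t} n"
  using Cohen_Macaulay_iff[OF assms(3)] koszul_injective_imp_regular_sequence[OF _ assms]
    regular_sequence_imp_koszul_injective[OF _ _ assms(1,2)] by blast

text \<open>
  Outside the list the sequence is continued by 0, since total sequences are easier to update.
\<close>

lemma primary_to_max_radical:
  assumes "primary_to R \<mm> a" "minimal_generators R a zs"
  shows "max_radical (\<lambda>i. if i < length zs then zs ! i else \<zero>) {..<length zs}"
    and "set zs \<subseteq> carrier R"
  unfolding max_radical_def
proof (intro allI impI)
  show zc: "set zs \<subseteq> carrier R" using assms by (simp add: minimal_generators_def)
  have a: "a = Idl (set zs)" "radical_ideal R a = \<mm>" "ideal a R"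
    using assms by (auto simp: minimal_generators_def primary_to_def primary_ideal_def)
  have im: "(\<lambda>i. if i < length zs then zs ! i else \<zero>) ` {..<length zs} = set zs"
    by (auto simp: set_conv_nth image_iff)
  fix P assume P: "primeideal P R"
  have "set zs \<subseteq> P \<longleftrightarrow> P = \<mm>"
  proof
    assume "set zs \<subseteq> P"
    then have aP: "a \<subseteq> P" unfolding a(1) by (intro genideal_minimal prime_ideal P)
    have "\<mm> \<subseteq> P"
    proof
      fix x assume "x \<in> \<mm>"
      then obtain k where "x \<in> carrier R" "x [^] (k::nat) \<in> a" using a(2) by (auto simp: radical_ideal_def)
      then show "x \<in> P" using prime_pow[OF P] aP by blast
    qed
    then show "P = \<mm>" using prime_in_max[OF P] by auto
  next
    assume "P = \<mm>"
    have "set zs \<subseteq> \<mm>"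
    proof
      fix x assume x: "x \<in> set zs"
      then have "x \<in> a" unfolding a(1) using genideal_self[OF zc] by blast
      moreover have xc: "x \<in> carrier R" using x zc by auto
      ultimately have "x \<in> radical_ideal R a" unfolding radical_ideal_def by (auto intro!: exI[of _ "1::nat"])
      then show "x \<in> \<mm>" using a by simp
    qed
    then show "set zs \<subseteq> P" using \<open>P = \<mm>\<close> by simp
  qed
  then show "((\<lambda>i. if i < length zs then zs ! i else \<zero>) ` {..<length zs} \<subseteq> P) = (P = \<mm>)" unfolding im .
qed

lemma primary_to_max: "primary_to R \<mm> \<mm>"
proof -
  have "radical_ideal R \<mm> = \<mm>"
  proof
    show "radical_ideal R \<mm> \<subseteq> \<mm>" using prime_pow[OF max_prime] by (auto simp: radical_ideal_def)
    show "\<mm> \<subseteq> radical_ideal R \<mm>"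
      using ideal.Icarr[OF max_closed] by (auto simp: radical_ideal_def intro!: exI[of _ "1::nat"])
  qed
  moreover have "\<mm> \<noteq> carrier R" using prime_one[OF max_prime] by auto
  ultimately show ?thesis unfolding primary_to_def primary_ideal_def
    using max_closed primeideal.I_prime[OF max_prime] by auto
qed

text \<open>
  A minimal subset of a finite set of generators.
\<close>

lemma minimal_generators_exist:
  assumes "ideal I R" shows "\<exists>zs. minimal_generators R I zs"
proof -
  obtain X where X: "finite X" "X \<subseteq> carrier R" "I = Idl X" using finetely_gen[OF assms] by blast
  have "\<exists>Y. finite Y \<and> Y \<subseteq> carrier R \<and> Idl Y = I \<and> (\<forall>Z. Z \<subset> Y \<longrightarrow> Idl Z \<noteq> I)"
    using X
  proof (induction "card X" arbitrary: X rule: less_induct)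
    case less
    show ?case
    proof (cases "\<forall>Z. Z \<subset> X \<longrightarrow> Idl Z \<noteq> I")
      case True
      then show ?thesis using less.prems by blast
    next
      case False
      then obtain Z where Z: "Z \<subset> X" "Idl Z = I" by blast
      then show ?thesis using less.hyps[of Z] less.prems psubset_card_mono[of X Z] finite_subset[of Z X] by auto
    qed
  qed
  then obtain Y where Y: "finite Y" "Y \<subseteq> carrier R" "Idl Y = I" "\<forall>Z. Z \<subset> Y \<longrightarrow> Idl Z \<noteq> I" by blast
  obtain zs where "set zs = Y" "distinct zs" using finite_distinct_list[OF Y(1)] by (elim exE conjE)
  then show ?thesis using Y by (intro exI[of _ zs]) (auto simp: minimal_generators_def)
qed

end

lemma the_elem_image_singleton: "x \<in> X \<Longrightarrow> (\<And>y. y \<in> X \<Longrightarrow> f y = c) \<Longrightarrow> the_elem (f ` X) = c"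
proof -
  assume "x \<in> X" "\<And>y. y \<in> X \<Longrightarrow> f y = c"
  then have "f ` X = {c}" by auto
  then show "the_elem (f ` X) = c" by simp
qed

section \<open>Quotient modules\<close>

lemma (in module) smult_eq_imp_diff_annihilates:
  assumes "r \<in> carrier R" "s \<in> carrier R" "x \<in> carrier M" "r \<odot>\<^bsub>M\<^esub> x = s \<odot>\<^bsub>M\<^esub> x"
  shows "(r \<ominus> s) \<odot>\<^bsub>M\<^esub> x = \<zero>\<^bsub>M\<^esub>"
proof -
  have "(r \<ominus> s) \<odot>\<^bsub>M\<^esub> x = r \<odot>\<^bsub>M\<^esub> x \<oplus>\<^bsub>M\<^esub> \<ominus>\<^bsub>M\<^esub> (s \<odot>\<^bsub>M\<^esub> x)"
    unfolding a_minus_def using assms(1-3) by (simp only: smult_l_distr smult_l_minus R.a_inv_closed)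
  then show ?thesis using assms by (simp add: M.r_neg)
qed

lemma (in module) submodule_abelian_subgroup:
  assumes "submodule N R M" shows "abelian_subgroup N M"
  using assms abelian_subgroupI3[OF _ M.abelian_group_axioms] by (simp add: additive_subgroup.intro submodule_def)

lemma quot_module_carrier: "carrier (quot_module M N) = (\<lambda>m. N +>\<^bsub>M\<^esub> m) ` carrier M"
  by (auto simp: quot_module_def A_RCOSETS_def')

lemma quot_module_eq_iff:
  assumes M: "module R M" and N: "submodule N R M" and ab: "a \<in> carrier M" "b \<in> carrier M"
  shows "N +>\<^bsub>M\<^esub> a = N +>\<^bsub>M\<^esub> b \<longleftrightarrow> a \<ominus>\<^bsub>M\<^esub> b \<in> N"
proof -
  interpret module R M by (rule M)
  interpret N: abelian_subgroup N M by (rule submodule_abelian_subgroup[OF N])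
  have "a \<in> N +>\<^bsub>M\<^esub> b \<longleftrightarrow> a \<ominus>\<^bsub>M\<^esub> b \<in> N" using N.a_rcos_module[OF ab(2,1)] by (simp add: a_minus_def)
  moreover have "N +>\<^bsub>M\<^esub> a = N +>\<^bsub>M\<^esub> b \<longleftrightarrow> a \<in> N +>\<^bsub>M\<^esub> b"
    using N.a_repr_independence'[of a b] N.a_repr_independenceD[of a b] ab by auto
  ultimately show ?thesis by simp
qed

lemma quot_module_zero: 
  assumes M: "module R M" and N: "submodule N R M"
  shows "\<zero>\<^bsub>quot_module M N\<^esub> = N +>\<^bsub>M\<^esub> \<zero>\<^bsub>M\<^esub>"
proof -
  interpret module R M by (rule M)
  interpret N: abelian_subgroup N M by (rule submodule_abelian_subgroup[OF N])
  show ?thesis using N.a_rcos_const[OF N.zero_closed] by (simp add: quot_module_def)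
qed

lemma quot_module_add:
  assumes M: "module R M" and N: "submodule N R M" and ab: "a \<in> carrier M" "b \<in> carrier M"
  shows "(N +>\<^bsub>M\<^esub> a) \<oplus>\<^bsub>quot_module M N\<^esub> (N +>\<^bsub>M\<^esub> b) = N +>\<^bsub>M\<^esub> (a \<oplus>\<^bsub>M\<^esub> b)"
proof -
  interpret module R M by (rule M)
  interpret N: abelian_subgroup N M by (rule submodule_abelian_subgroup[OF N])
  show ?thesis using N.a_rcos_sum[OF ab] by (simp add: quot_module_def)
qed

lemma quot_module_smult:
  assumes M: "module R M" and N: "submodule N R M" and ra: "r \<in> carrier R" "a \<in> carrier M"
  shows "r \<odot>\<^bsub>quot_module M N\<^esub> (N +>\<^bsub>M\<^esub> a) = N +>\<^bsub>M\<^esub> (r \<odot>\<^bsub>M\<^esub> a)"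
proof -
  interpret module R M by (rule M)
  interpret N: abelian_subgroup N M by (rule submodule_abelian_subgroup[OF N])
  have eq: "N +>\<^bsub>M\<^esub> (r \<odot>\<^bsub>M\<^esub> x) = N +>\<^bsub>M\<^esub> (r \<odot>\<^bsub>M\<^esub> a)" if "x \<in> N +>\<^bsub>M\<^esub> a" for x
  proof -
    have xc: "x \<in> carrier M" by (rule N.a_elemrcos_carrier[OF ra(2) that])
    have "x \<oplus>\<^bsub>M\<^esub> \<ominus>\<^bsub>M\<^esub> a \<in> N" using N.a_rcos_module_imp[OF ra(2) that] .
    then have "r \<odot>\<^bsub>M\<^esub> (x \<oplus>\<^bsub>M\<^esub> \<ominus>\<^bsub>M\<^esub> a) \<in> N" by (rule submodule.smult_closed[OF N ra(1)])
    then have "r \<odot>\<^bsub>M\<^esub> x \<ominus>\<^bsub>M\<^esub> r \<odot>\<^bsub>M\<^esub> a \<in> N" 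
      using xc ra by (simp only: smult_r_distr smult_r_minus a_minus_def smult_closed M.a_inv_closed)
    then show ?thesis using quot_module_eq_iff[OF M N] xc ra by simp
  qed
  have "(\<Union>x\<in>N +>\<^bsub>M\<^esub> a. N +>\<^bsub>M\<^esub> (r \<odot>\<^bsub>M\<^esub> x)) = (\<Union>x\<in>N +>\<^bsub>M\<^esub> a. N +>\<^bsub>M\<^esub> (r \<odot>\<^bsub>M\<^esub> a))"
    by (rule SUP_cong[OF refl eq])
  also have "\<dots> = N +>\<^bsub>M\<^esub> (r \<odot>\<^bsub>M\<^esub> a)" using N.a_rcos_self[OF ra(2)] by (intro UN_constant_eq) auto
  finally show ?thesis by (simp add: quot_module_def)
qed

lemma quot_module_module:
  assumes M: "module R M" and N: "submodule N R M"
  shows "module R (quot_module M N)"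
proof -
  interpret module R M by (rule M)
  note add = quot_module_add[OF M N] and smult = quot_module_smult[OF M N] and zero = quot_module_zero[OF M N]
  let ?Q = "quot_module M N" and ?q = "\<lambda>m. N +>\<^bsub>M\<^esub> m"
  have E: "x \<in> carrier ?Q \<Longrightarrow> \<exists>m\<in>carrier M. x = ?q m" for x by (auto simp: quot_module_carrier)
  have I: "m \<in> carrier M \<Longrightarrow> ?q m \<in> carrier ?Q" for m by (auto simp: quot_module_carrier)
  show ?thesis
  proof (rule moduleI[OF R.is_cring])
    show "abelian_group ?Q"
    proof (rule abelian_groupI)
      show "\<zero>\<^bsub>?Q\<^esub> \<in> carrier ?Q" unfolding zero by (rule I) simp
      show "x \<oplus>\<^bsub>?Q\<^esub> y \<in> carrier ?Q" if "x \<in> carrier ?Q" "y \<in> carrier ?Q" for x y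
        using E[OF that(1)] E[OF that(2)] by (auto simp: add intro!: I)
      show "x \<oplus>\<^bsub>?Q\<^esub> y \<oplus>\<^bsub>?Q\<^esub> z = x \<oplus>\<^bsub>?Q\<^esub> (y \<oplus>\<^bsub>?Q\<^esub> z)" if "x \<in> carrier ?Q" "y \<in> carrier ?Q" "z \<in> carrier ?Q" for x y z
        using E[OF that(1)] E[OF that(2)] E[OF that(3)] by (auto simp: add M.a_assoc)
      show "x \<oplus>\<^bsub>?Q\<^esub> y = y \<oplus>\<^bsub>?Q\<^esub> x" if "x \<in> carrier ?Q" "y \<in> carrier ?Q" for x y
        using E[OF that(1)] E[OF that(2)] by (auto simp: add M.a_comm)
      show "\<zero>\<^bsub>?Q\<^esub> \<oplus>\<^bsub>?Q\<^esub> x = x" if "x \<in> carrier ?Q" for x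
        using E[OF that(1)] by (auto simp: add zero)
      show "\<exists>y\<in>carrier ?Q. y \<oplus>\<^bsub>?Q\<^esub> x = \<zero>\<^bsub>?Q\<^esub>" if x: "x \<in> carrier ?Q" for x
      proof -
        obtain m where m: "m \<in> carrier M" "x = ?q m" using E[OF x] by auto
        then have "?q (\<ominus>\<^bsub>M\<^esub> m) \<oplus>\<^bsub>?Q\<^esub> x = \<zero>\<^bsub>?Q\<^esub>" by (simp add: add zero M.l_neg)
        then show ?thesis using I[of "\<ominus>\<^bsub>M\<^esub> m"] m by blast
      qed
    qed
    show "a \<odot>\<^bsub>?Q\<^esub> x \<in> carrier ?Q" if "a \<in> carrier R" "x \<in> carrier ?Q" for a x
      using E[OF that(2)] that(1) by (auto simp: smult intro!: I)
    show "(a \<oplus>\<^bsub>R\<^esub> b) \<odot>\<^bsub>?Q\<^esub> x = a \<odot>\<^bsub>?Q\<^esub> x \<oplus>\<^bsub>?Q\<^esub> b \<odot>\<^bsub>?Q\<^esub> x" if "a \<in> carrier R" "b \<in> carrier R" "x \<in> carrier ?Q" for a b x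
      using E[OF that(3)] that by (auto simp: smult add smult_l_distr)
    show "a \<odot>\<^bsub>?Q\<^esub> (x \<oplus>\<^bsub>?Q\<^esub> y) = a \<odot>\<^bsub>?Q\<^esub> x \<oplus>\<^bsub>?Q\<^esub> a \<odot>\<^bsub>?Q\<^esub> y" if "a \<in> carrier R" "x \<in> carrier ?Q" "y \<in> carrier ?Q" for a x y
      using E[OF that(2)] E[OF that(3)] that by (auto simp: smult add smult_r_distr)
    show "(a \<otimes>\<^bsub>R\<^esub> b) \<odot>\<^bsub>?Q\<^esub> x = a \<odot>\<^bsub>?Q\<^esub> (b \<odot>\<^bsub>?Q\<^esub> x)" if "a \<in> carrier R" "b \<in> carrier R" "x \<in> carrier ?Q" for a b x
      using E[OF that(3)] that by (auto simp: smult smult_assoc1)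
    show "\<one>\<^bsub>R\<^esub> \<odot>\<^bsub>?Q\<^esub> x = x" if "x \<in> carrier ?Q" for x
      using E[OF that] by (auto simp: smult)
  qed
qed

section \<open>Free modules\<close>

context cring begin

lemma free_carrierI:
  assumes "\<And>x. \<phi> x \<in> carrier R" "finite B" "B \<subseteq> X" "\<And>x. x \<notin> B \<Longrightarrow> \<phi> x = \<zero>"
  shows "\<phi> \<in> carrier (free_module R X)"
proof -
  have "{x. \<phi> x \<noteq> \<zero>} \<subseteq> B" using assms(4) by auto
  then show ?thesis using assms(1-3) finite_subset by (auto simp: free_module_def)
qed

lemma free_carrierD:
  assumes "\<phi> \<in> carrier (free_module R X)"
  shows "\<And>x. \<phi> x \<in> carrier R" "finite {x. \<phi> x \<noteq> \<zero>}" "{x. \<phi> x \<noteq> \<zero>} \<subseteq> X"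
  using assms by (auto simp: free_module_def)

lemma free_simps:
  "\<phi> \<oplus>\<^bsub>free_module R X\<^esub> \<psi> = (\<lambda>x. \<phi> x \<oplus> \<psi> x)" "r \<odot>\<^bsub>free_module R X\<^esub> \<phi> = (\<lambda>x. r \<otimes> \<phi> x)"
  "\<zero>\<^bsub>free_module R X\<^esub> = (\<lambda>_. \<zero>)"
  by (auto simp: free_module_def)

lemma free_module_module: "module R (free_module R X)"
proof (rule moduleI[OF is_cring])
  let ?F = "free_module R X"
  have add: "\<phi> \<oplus>\<^bsub>?F\<^esub> \<psi> \<in> carrier ?F" if "\<phi> \<in> carrier ?F" "\<psi> \<in> carrier ?F" for \<phi> \<psi>
    by (rule free_carrierI[of _ "{x. \<phi> x \<noteq> \<zero>} \<union> {x. \<psi> x \<noteq> \<zero>}"])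
      (use free_carrierD[OF that(1)] free_carrierD[OF that(2)] in \<open>auto simp: free_simps\<close>)
  have smult: "r \<odot>\<^bsub>?F\<^esub> \<phi> \<in> carrier ?F" if "r \<in> carrier R" "\<phi> \<in> carrier ?F" for \<phi> r
    by (rule free_carrierI[of _ "{x. \<phi> x \<noteq> \<zero>}"])
      (use free_carrierD[OF that(2)] that(1) in \<open>auto simp: free_simps\<close>)
  note D = free_carrierD(1)[where X = X]
  show "r \<odot>\<^bsub>?F\<^esub> \<phi> \<in> carrier ?F" if "r \<in> carrier R" "\<phi> \<in> carrier ?F" for \<phi> r by (rule smult[OF that])
  show "abelian_group ?F"
  proof (rule abelian_groupI)
    show "\<zero>\<^bsub>?F\<^esub> \<in> carrier ?F" by (rule free_carrierI[of _ "{}"]) (auto simp: free_simps)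
    show "\<exists>\<psi>\<in>carrier ?F. \<psi> \<oplus>\<^bsub>?F\<^esub> \<phi> = \<zero>\<^bsub>?F\<^esub>" if p: "\<phi> \<in> carrier ?F" for \<phi>
      by (rule bexI[OF _ smult[of "\<ominus> \<one>" \<phi>]]) (use D[OF p] p in \<open>auto simp: free_simps l_minus l_neg\<close>)
  qed (use D add in \<open>auto simp: free_simps fun_eq_iff a_ac\<close>)
qed (use free_carrierD(1)[where X = X] in \<open>auto simp: free_simps fun_eq_iff l_distr r_distr m_assoc\<close>)

lemma free_basis_carrier: "x \<in> X \<Longrightarrow> free_basis R x \<in> carrier (free_module R X)"
  by (rule free_carrierI[of _ "{x}"]) (auto simp: free_basis_def)

text \<open>
  Every element of finite support is reached from the basis; the induction is on the support.
\<close>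

lemma free_module_induct:
  assumes \<phi>: "\<phi> \<in> carrier (free_module R X)"
    and z: "Q (\<lambda>_. \<zero>)" and b: "\<And>x. x \<in> X \<Longrightarrow> Q (free_basis R x)"
    and add: "\<And>\<phi> \<psi>. \<phi> \<in> carrier (free_module R X) \<Longrightarrow> \<psi> \<in> carrier (free_module R X) \<Longrightarrow> Q \<phi> \<Longrightarrow> Q \<psi> \<Longrightarrow> Q (\<phi> \<oplus>\<^bsub>free_module R X\<^esub> \<psi>)"
    and sm: "\<And>\<phi> r. \<phi> \<in> carrier (free_module R X) \<Longrightarrow> r \<in> carrier R \<Longrightarrow> Q \<phi> \<Longrightarrow> Q (r \<odot>\<^bsub>free_module R X\<^esub> \<phi>)"
  shows "Q \<phi>"
proof -
  let ?F = "free_module R X"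
  interpret F: module R ?F by (rule free_module_module)
  have "finite B \<Longrightarrow> \<forall>\<phi>. \<phi> \<in> carrier ?F \<longrightarrow> {x. \<phi> x \<noteq> \<zero>} \<subseteq> B \<longrightarrow> Q \<phi>" for B
  proof (induction B rule: finite_induct)
    case empty
    have "\<phi> = (\<lambda>_. \<zero>)" if "{x. \<phi> x \<noteq> \<zero>} \<subseteq> {}" for \<phi> :: "'c \<Rightarrow> 'a" using that by auto
    then show ?case using z by metis
  next
    case (insert x B)
    show ?case
    proof (intro allI impI)
      fix \<phi> assume p: "\<phi> \<in> carrier ?F" and s: "{x. \<phi> x \<noteq> \<zero>} \<subseteq> insert x B"
      note D = free_carrierD[OF p]
      show "Q \<phi>"
      proof (cases "\<phi> x = \<zero>")
        case True
        then have "{x. \<phi> x \<noteq> \<zero>} \<subseteq> B" using s by auto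
        then show ?thesis using insert.IH p by blast
      next
        case False
        then have x: "x \<in> X" using D by auto
        let ?\<psi> = "\<phi>(x := \<zero>)"
        have psi: "?\<psi> \<in> carrier ?F" by (rule free_carrierI[of _ "{x. \<phi> x \<noteq> \<zero>}"]) (use D in auto)
        have "{y. ?\<psi> y \<noteq> \<zero>} \<subseteq> B" using s by auto
        then have Qp: "Q ?\<psi>" using insert.IH psi by blast
        have fb: "free_basis R x \<in> carrier ?F" by (rule free_basis_carrier[OF x])
        have Qb: "Q (\<phi> x \<odot>\<^bsub>?F\<^esub> free_basis R x)" by (rule sm[OF fb D(1) b[OF x]])
        have "Q (?\<psi> \<oplus>\<^bsub>?F\<^esub> (\<phi> x \<odot>\<^bsub>?F\<^esub> free_basis R x))"
          by (rule add[OF psi _ Qp Qb]) (use fb D in simp)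
        moreover have "?\<psi> \<oplus>\<^bsub>?F\<^esub> (\<phi> x \<odot>\<^bsub>?F\<^esub> free_basis R x) = \<phi>"
          using D by (auto simp: free_simps free_basis_def fun_eq_iff)
        ultimately show ?thesis by simp
      qed
    qed
  qed
  then show ?thesis using free_carrierD[OF \<phi>] \<phi> by blast
qed

section \<open>Tensor products of modules\<close>

text \<open>
  What the construction of the tensor product requires of the factors.
\<close>

definition add_closed :: "'i set \<Rightarrow> ('i \<Rightarrow> ('a, 'd) module) \<Rightarrow> bool" where
  "add_closed I M \<longleftrightarrow> (\<forall>i\<in>I. (\<forall>u\<in>carrier (M i). \<forall>v\<in>carrier (M i). u \<oplus>\<^bsub>M i\<^esub> v \<in> carrier (M i)) \<and>
     (\<forall>r\<in>carrier R. \<forall>u\<in>carrier (M i). r \<odot>\<^bsub>M i\<^esub> u \<in> carrier (M i)))"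

lemma PiE_upd: "x \<in> (\<Pi>\<^sub>E i\<in>I. C i) \<Longrightarrow> i \<in> I \<Longrightarrow> u \<in> C i \<Longrightarrow> x(i := u) \<in> (\<Pi>\<^sub>E i\<in>I. C i)"
  by (auto simp: PiE_iff extensional_def)

lemma tensor_relations_subset:
  assumes "add_closed I M"
  shows "tensor_relations R I M \<subseteq> carrier (tensor_free R I M)"
proof -
  let ?X = "\<Pi>\<^sub>E i\<in>I. carrier (M i)"
  interpret F: module R "tensor_free R I M" unfolding tensor_free_def by (rule free_module_module)
  have b: "free_basis R x \<in> carrier (tensor_free R I M)" if "x \<in> ?X" for x
    unfolding tensor_free_def by (rule free_basis_carrier[OF that])
  have c: "u \<oplus>\<^bsub>M i\<^esub> v \<in> carrier (M i)" "r \<odot>\<^bsub>M i\<^esub> u \<in> carrier (M i)"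
    if "i \<in> I" "u \<in> carrier (M i)" "v \<in> carrier (M i)" "r \<in> carrier R" for i u v r
    using assms that by (auto simp: add_closed_def)
  show ?thesis unfolding tensor_relations_def Let_def
  proof (intro Un_least subsetI)
    fix \<phi> assume "\<phi> \<in> {free_basis R (x(i := u \<oplus>\<^bsub>M i\<^esub> v)) \<ominus>\<^bsub>tensor_free R I M\<^esub> (free_basis R (x(i := u)) \<oplus>\<^bsub>tensor_free R I M\<^esub> free_basis R (x(i := v)))
       | x i u v. x \<in> ?X \<and> i \<in> I \<and> u \<in> carrier (M i) \<and> v \<in> carrier (M i)}"
    then obtain x i u v where p: "\<phi> = free_basis R (x(i := u \<oplus>\<^bsub>M i\<^esub> v)) \<ominus>\<^bsub>tensor_free R I M\<^esub> (free_basis R (x(i := u)) \<oplus>\<^bsub>tensor_free R I M\<^esub> free_basis R (x(i := v)))"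
      "x \<in> ?X" "i \<in> I" "u \<in> carrier (M i)" "v \<in> carrier (M i)" by blast
    show "\<phi> \<in> carrier (tensor_free R I M)" unfolding p(1)
      using b[OF PiE_upd[OF p(2,3)]] c(1)[OF p(3,4,5) one_closed] p(4,5) by simp
  next
    fix \<phi> assume "\<phi> \<in> {free_basis R (x(i := r \<odot>\<^bsub>M i\<^esub> u)) \<ominus>\<^bsub>tensor_free R I M\<^esub> (r \<odot>\<^bsub>tensor_free R I M\<^esub> free_basis R (x(i := u)))
       | x i r u. x \<in> ?X \<and> i \<in> I \<and> r \<in> carrier R \<and> u \<in> carrier (M i)}"
    then obtain x i u r where p: "\<phi> = free_basis R (x(i := r \<odot>\<^bsub>M i\<^esub> u)) \<ominus>\<^bsub>tensor_free R I M\<^esub> (r \<odot>\<^bsub>tensor_free R I M\<^esub> free_basis R (x(i := u)))"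
      "x \<in> ?X" "i \<in> I" "r \<in> carrier R" "u \<in> carrier (M i)" by blast
    show "\<phi> \<in> carrier (tensor_free R I M)" unfolding p(1)
      using b[OF PiE_upd[OF p(2,3)]] c(2)[OF p(3,5,5,4)] p(4,5) by simp
  qed
qed

lemma tensor_rel_submodule:
  assumes "add_closed I M"
  shows "submodule (tensor_rel_module R I M) R (tensor_free R I M)"
proof -
  interpret F: module R "tensor_free R I M" unfolding tensor_free_def by (rule free_module_module)
  let ?A = "{H. submodule H R (tensor_free R I M) \<and> tensor_relations R I M \<subseteq> H}"
  have ne: "carrier (tensor_free R I M) \<in> ?A" using F.carrier_is_submodule tensor_relations_subset[OF assms] by auto
  show ?thesis unfolding tensor_rel_module_def
  proof (rule F.submoduleI)
    show "\<Inter>?A \<subseteq> carrier (tensor_free R I M)" using ne by blast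
    show "\<zero>\<^bsub>tensor_free R I M\<^esub> \<in> \<Inter>?A"
    proof
      fix H assume "H \<in> ?A"
      then have "subgroup H (add_monoid (tensor_free R I M))" by (auto simp: submodule_def)
      then show "\<zero>\<^bsub>tensor_free R I M\<^esub> \<in> H" using subgroup.one_closed by fastforce
    qed
  next
    fix a assume a: "a \<in> \<Inter>?A"
    show "\<ominus>\<^bsub>tensor_free R I M\<^esub> a \<in> \<Inter>?A"
    proof
      fix H assume H: "H \<in> ?A"
      then show "\<ominus>\<^bsub>tensor_free R I M\<^esub> a \<in> H" using F.submoduleE(3)[of H a] a by blast
    qed
  next
    fix a b assume ab: "a \<in> \<Inter>?A" "b \<in> \<Inter>?A"
    show "a \<oplus>\<^bsub>tensor_free R I M\<^esub> b \<in> \<Inter>?A"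
    proof
      fix H assume H: "H \<in> ?A"
      then show "a \<oplus>\<^bsub>tensor_free R I M\<^esub> b \<in> H" using F.submoduleE(5)[of H a b] ab by blast
    qed
  next
    fix r a assume ab: "r \<in> carrier R" "a \<in> \<Inter>?A"
    show "r \<odot>\<^bsub>tensor_free R I M\<^esub> a \<in> \<Inter>?A"
    proof
      fix H assume H: "H \<in> ?A"
      then show "r \<odot>\<^bsub>tensor_free R I M\<^esub> a \<in> H" using F.submoduleE(4)[of H r a] ab by blast
    qed
  qed
qed

lemma tensor_module:
  assumes "add_closed I M" shows "module R (tensor R I M)"
  unfolding tensor_def
  by (rule quot_module_module[OF _ tensor_rel_submodule[OF assms]]) (simp add: tensor_free_def free_module_module)

lemma pure_tensor_carrier:
  assumes "add_closed I M" "x \<in> (\<Pi>\<^sub>E i\<in>I. carrier (M i))"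
  shows "pure_tensor R I M x \<in> carrier (tensor R I M)"
  unfolding pure_tensor_def tensor_def quot_module_carrier
  using free_basis_carrier[OF assms(2)] by (auto simp: tensor_free_def)

lemma pure_tensor_add:
  assumes c: "add_closed I M" and x: "x \<in> (\<Pi>\<^sub>E i\<in>I. carrier (M i))" and i: "i \<in> I"
    and uv: "u \<in> carrier (M i)" "v \<in> carrier (M i)"
  shows "pure_tensor R I M (x(i := u \<oplus>\<^bsub>M i\<^esub> v)) =
    pure_tensor R I M (x(i := u)) \<oplus>\<^bsub>tensor R I M\<^esub> pure_tensor R I M (x(i := v))"
proof -
  let ?F = "tensor_free R I M" and ?K = "tensor_rel_module R I M"
  have F: "module R ?F" unfolding tensor_free_def by (rule free_module_module)
  interpret F: module R ?F by (rule F)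
  note K = tensor_rel_submodule[OF c]
  have b: "free_basis R (x(i := w)) \<in> carrier ?F" if "w \<in> carrier (M i)" for w
    unfolding tensor_free_def by (rule free_basis_carrier[OF PiE_upd[OF x i that]])
  have uvc: "u \<oplus>\<^bsub>M i\<^esub> v \<in> carrier (M i)" using c i uv by (auto simp: add_closed_def)
  have "free_basis R (x(i := u \<oplus>\<^bsub>M i\<^esub> v)) \<ominus>\<^bsub>?F\<^esub> (free_basis R (x(i := u)) \<oplus>\<^bsub>?F\<^esub> free_basis R (x(i := v))) \<in> tensor_relations R I M"
    unfolding tensor_relations_def Let_def using x i uv by blast
  then have "free_basis R (x(i := u \<oplus>\<^bsub>M i\<^esub> v)) \<ominus>\<^bsub>?F\<^esub> (free_basis R (x(i := u)) \<oplus>\<^bsub>?F\<^esub> free_basis R (x(i := v))) \<in> ?K"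
    unfolding tensor_rel_module_def by blast
  then show ?thesis unfolding pure_tensor_def tensor_def
    using quot_module_add[OF F K b[OF uv(1)] b[OF uv(2)]] quot_module_eq_iff[OF F K b[OF uvc]] b uv by simp
qed

lemma pure_tensor_smult:
  assumes c: "add_closed I M" and x: "x \<in> (\<Pi>\<^sub>E i\<in>I. carrier (M i))" and i: "i \<in> I"
    and uv: "r \<in> carrier R" "u \<in> carrier (M i)"
  shows "pure_tensor R I M (x(i := r \<odot>\<^bsub>M i\<^esub> u)) = r \<odot>\<^bsub>tensor R I M\<^esub> pure_tensor R I M (x(i := u))"
proof -
  let ?F = "tensor_free R I M" and ?K = "tensor_rel_module R I M"
  have F: "module R ?F" unfolding tensor_free_def by (rule free_module_module)
  interpret F: module R ?F by (rule F)
  note K = tensor_rel_submodule[OF c]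
  have b: "free_basis R (x(i := w)) \<in> carrier ?F" if "w \<in> carrier (M i)" for w
    unfolding tensor_free_def by (rule free_basis_carrier[OF PiE_upd[OF x i that]])
  have uvc: "r \<odot>\<^bsub>M i\<^esub> u \<in> carrier (M i)" using c i uv by (auto simp: add_closed_def)
  have "free_basis R (x(i := r \<odot>\<^bsub>M i\<^esub> u)) \<ominus>\<^bsub>?F\<^esub> (r \<odot>\<^bsub>?F\<^esub> free_basis R (x(i := u))) \<in> tensor_relations R I M"
    unfolding tensor_relations_def Let_def using x i uv by blast
  then have "free_basis R (x(i := r \<odot>\<^bsub>M i\<^esub> u)) \<ominus>\<^bsub>?F\<^esub> (r \<odot>\<^bsub>?F\<^esub> free_basis R (x(i := u))) \<in> ?K"
    unfolding tensor_rel_module_def by blast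
  then show ?thesis unfolding pure_tensor_def tensor_def
    using quot_module_smult[OF F K uv(1) b[OF uv(2)]] quot_module_eq_iff[OF F K b[OF uvc]] b uv by simp
qed

lemma tensor_induct:
  assumes c: "add_closed I M" and X: "X \<in> carrier (tensor R I M)"
    and z: "Q \<zero>\<^bsub>tensor R I M\<^esub>" and p: "\<And>x. x \<in> (\<Pi>\<^sub>E i\<in>I. carrier (M i)) \<Longrightarrow> Q (pure_tensor R I M x)"
    and add: "\<And>X Y. X \<in> carrier (tensor R I M) \<Longrightarrow> Y \<in> carrier (tensor R I M) \<Longrightarrow> Q X \<Longrightarrow> Q Y \<Longrightarrow> Q (X \<oplus>\<^bsub>tensor R I M\<^esub> Y)"
    and sm: "\<And>X r. X \<in> carrier (tensor R I M) \<Longrightarrow> r \<in> carrier R \<Longrightarrow> Q X \<Longrightarrow> Q (r \<odot>\<^bsub>tensor R I M\<^esub> X)"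
  shows "Q X"
proof -
  let ?F = "tensor_free R I M" and ?K = "tensor_rel_module R I M"
  have F: "module R ?F" unfolding tensor_free_def by (rule free_module_module)
  note K = tensor_rel_submodule[OF c]
  have cc: "\<phi> \<in> carrier ?F \<Longrightarrow> ?K +>\<^bsub>?F\<^esub> \<phi> \<in> carrier (tensor R I M)" for \<phi> unfolding tensor_def quot_module_carrier by auto
  obtain \<phi> where \<phi>: "\<phi> \<in> carrier ?F" "X = ?K +>\<^bsub>?F\<^esub> \<phi>" using X unfolding tensor_def quot_module_carrier by auto
  have "Q (?K +>\<^bsub>?F\<^esub> \<phi>)"
  proof (rule free_module_induct[OF \<phi>(1)[unfolded tensor_free_def], of "\<lambda>\<phi>. Q (?K +>\<^bsub>?F\<^esub> \<phi>)"], fold tensor_free_def)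
    show "Q (?K +>\<^bsub>?F\<^esub> (\<lambda>_. \<zero>))" using z quot_module_zero[OF F K] by (simp add: tensor_def tensor_free_def free_simps)
    show "Q (?K +>\<^bsub>?F\<^esub> free_basis R x)" if "x \<in> (\<Pi>\<^sub>E i\<in>I. carrier (M i))" for x using p[OF that] by (simp add: pure_tensor_def)
    show "Q (?K +>\<^bsub>?F\<^esub> (\<phi> \<oplus>\<^bsub>?F\<^esub> \<psi>))" if "\<phi> \<in> carrier ?F" "\<psi> \<in> carrier ?F" "Q (?K +>\<^bsub>?F\<^esub> \<phi>)" "Q (?K +>\<^bsub>?F\<^esub> \<psi>)" for \<phi> \<psi>
      using add[OF cc[OF that(1)] cc[OF that(2)] that(3,4)] quot_module_add[OF F K that(1,2)] by (simp add: tensor_def)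
    show "Q (?K +>\<^bsub>?F\<^esub> (r \<odot>\<^bsub>?F\<^esub> \<phi>))" if "\<phi> \<in> carrier ?F" "r \<in> carrier R" "Q (?K +>\<^bsub>?F\<^esub> \<phi>)" for \<phi> r
      using sm[OF cc[OF that(1)] that(2,3)] quot_module_smult[OF F K that(2,1)] by (simp add: tensor_def)
  qed
  then show ?thesis using \<phi> by simp
qed

definition multilinear_on :: "'i set \<Rightarrow> ('i \<Rightarrow> ('a, 'd) module) \<Rightarrow> ('a, 'c) module \<Rightarrow> (('i \<Rightarrow> 'd) \<Rightarrow> 'c) \<Rightarrow> bool" where
  "multilinear_on I M N g \<longleftrightarrow> (\<forall>x\<in>(\<Pi>\<^sub>E i\<in>I. carrier (M i)). g x \<in> carrier N \<and> (\<forall>i\<in>I. \<forall>u\<in>carrier (M i).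
     (\<forall>v\<in>carrier (M i). g (x(i := u \<oplus>\<^bsub>M i\<^esub> v)) = g (x(i := u)) \<oplus>\<^bsub>N\<^esub> g (x(i := v))) \<and>
     (\<forall>r\<in>carrier R. g (x(i := r \<odot>\<^bsub>M i\<^esub> u)) = r \<odot>\<^bsub>N\<^esub> g (x(i := u)))))"

text \<open>
  The universal property. The linear extension of \<open>g\<close> to the free module kills the relations, hence is constant on
  cosets, so the choice of \<open>the_elem\<close> in the definition of the lift is justified.
\<close>

lemma tensor_lift_linear:
  fixes M :: "'i \<Rightarrow> ('a, 'd) module" and N :: "('a, 'c) module"
  assumes c: "add_closed I M" and N: "module R N" and g: "multilinear_on I M N g"
  defines "L \<equiv> tensor_lift R N g"
  shows "x \<in> (\<Pi>\<^sub>E i\<in>I. carrier (M i)) \<Longrightarrow> L (pure_tensor R I M x) = g x"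
    and "X \<in> carrier (tensor R I M) \<Longrightarrow> L X \<in> carrier N"
    and "X \<in> carrier (tensor R I M) \<Longrightarrow> Y \<in> carrier (tensor R I M) \<Longrightarrow> L (X \<oplus>\<^bsub>tensor R I M\<^esub> Y) = L X \<oplus>\<^bsub>N\<^esub> L Y"
    and "r \<in> carrier R \<Longrightarrow> X \<in> carrier (tensor R I M) \<Longrightarrow> L (r \<odot>\<^bsub>tensor R I M\<^esub> X) = r \<odot>\<^bsub>N\<^esub> L X"
proof -
  let ?F = "tensor_free R I M" and ?K = "tensor_rel_module R I M" and ?X = "\<Pi>\<^sub>E i\<in>I. carrier (M i)"
  have F: "module R ?F" unfolding tensor_free_def by (rule free_module_module)
  interpret F: module R ?F by (rule F)
  interpret N: module R N by (rule N)
  note K = tensor_rel_submodule[OF c]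
  have gc: "g x \<in> carrier N" if "x \<in> ?X" for x using g that by (auto simp: multilinear_on_def)
  have gadd: "g (x(i := u \<oplus>\<^bsub>M i\<^esub> v)) = g (x(i := u)) \<oplus>\<^bsub>N\<^esub> g (x(i := v))"
    if "x \<in> ?X" "i \<in> I" "u \<in> carrier (M i)" "v \<in> carrier (M i)" for x i u v
    using g that unfolding multilinear_on_def by blast
  have gsm: "g (x(i := r \<odot>\<^bsub>M i\<^esub> u)) = r \<odot>\<^bsub>N\<^esub> g (x(i := u))"
    if "x \<in> ?X" "i \<in> I" "u \<in> carrier (M i)" "r \<in> carrier R" for x i u r
    using g that unfolding multilinear_on_def by blast
  define \<Phi> where "\<Phi> \<phi> = (\<Oplus>\<^bsub>N\<^esub>x\<in>{x. \<phi> x \<noteq> \<zero>}. \<phi> x \<odot>\<^bsub>N\<^esub> g x)" for \<phi>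
  have \<Phi>: "\<Phi> \<phi> = (\<Oplus>\<^bsub>N\<^esub>x\<in>B. \<phi> x \<odot>\<^bsub>N\<^esub> g x)" if "finite B" "{x. \<phi> x \<noteq> \<zero>} \<subseteq> B" "B \<subseteq> ?X" "\<And>x. \<phi> x \<in> carrier R" for \<phi> B
    unfolding \<Phi>_def
    by (rule N.add.finprod_mono_neutral_cong_left) (use that gc in \<open>auto simp: subset_iff\<close>)
  have FD: "\<And>x. \<phi> x \<in> carrier R" "finite {x. \<phi> x \<noteq> \<zero>}" "{x. \<phi> x \<noteq> \<zero>} \<subseteq> ?X" if "\<phi> \<in> carrier ?F" for \<phi>
    using free_carrierD[OF that[unfolded tensor_free_def]] by auto
  have \<Phi>c: "\<Phi> \<phi> \<in> carrier N" if "\<phi> \<in> carrier ?F" for \<phi>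
    unfolding \<Phi>_def using FD[OF that] gc by (intro N.finsum_closed) auto
  have \<Phi>add: "\<Phi> (\<phi> \<oplus>\<^bsub>?F\<^esub> \<psi>) = \<Phi> \<phi> \<oplus>\<^bsub>N\<^esub> \<Phi> \<psi>" if p: "\<phi> \<in> carrier ?F" "\<psi> \<in> carrier ?F" for \<phi> \<psi>
  proof -
    let ?B = "{x. \<phi> x \<noteq> \<zero>} \<union> {x. \<psi> x \<noteq> \<zero>}"
    have B: "finite ?B" "?B \<subseteq> ?X" using FD[OF p(1)] FD[OF p(2)] by auto
    have gB: "g x \<in> carrier N" if "x \<in> ?B" for x using gc B that by blast
    have sub: "{x. \<phi> x \<oplus> \<psi> x \<noteq> \<zero>} \<subseteq> ?B" by auto
    have "\<Phi> (\<phi> \<oplus>\<^bsub>?F\<^esub> \<psi>) = (\<Oplus>\<^bsub>N\<^esub>x\<in>?B. (\<phi> x \<oplus> \<psi> x) \<odot>\<^bsub>N\<^esub> g x)"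
      unfolding tensor_free_def free_simps by (rule \<Phi>[OF B(1) sub B(2)]) (use FD[OF p(1)] FD[OF p(2)] in auto)
    also have "\<dots> = (\<Oplus>\<^bsub>N\<^esub>x\<in>?B. \<phi> x \<odot>\<^bsub>N\<^esub> g x \<oplus>\<^bsub>N\<^esub> \<psi> x \<odot>\<^bsub>N\<^esub> g x)"
      by (rule N.finsum_cong') (use FD[OF p(1)] FD[OF p(2)] gB in \<open>auto simp: N.smult_l_distr\<close>)
    also have "\<dots> = (\<Oplus>\<^bsub>N\<^esub>x\<in>?B. \<phi> x \<odot>\<^bsub>N\<^esub> g x) \<oplus>\<^bsub>N\<^esub> (\<Oplus>\<^bsub>N\<^esub>x\<in>?B. \<psi> x \<odot>\<^bsub>N\<^esub> g x)"
      using FD[OF p(1)] FD[OF p(2)] gB by (intro N.finsum_addf) auto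
    also have "\<dots> = \<Phi> \<phi> \<oplus>\<^bsub>N\<^esub> \<Phi> \<psi>" using \<Phi>[OF B(1) _ B(2), of \<phi>] \<Phi>[OF B(1) _ B(2), of \<psi>] FD[OF p(1)] FD[OF p(2)] by auto
    finally show ?thesis .
  qed
  have \<Phi>sm: "\<Phi> (r \<odot>\<^bsub>?F\<^esub> \<phi>) = r \<odot>\<^bsub>N\<^esub> \<Phi> \<phi>" if p: "\<phi> \<in> carrier ?F" and r: "r \<in> carrier R" for \<phi> r
  proof -
    let ?B = "{x. \<phi> x \<noteq> \<zero>}"
    have B: "finite ?B" "?B \<subseteq> ?X" using FD[OF p(1)] by auto
    have gB: "g x \<in> carrier N" if "x \<in> ?B" for x using gc B that by blast
    have "\<Phi> (r \<odot>\<^bsub>?F\<^esub> \<phi>) = (\<Oplus>\<^bsub>N\<^esub>x\<in>?B. (r \<otimes> \<phi> x) \<odot>\<^bsub>N\<^esub> g x)"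
      unfolding tensor_free_def free_simps by (rule \<Phi>[OF B(1) _ B(2)]) (use FD[OF p(1)] r in auto)
    also have "\<dots> = (\<Oplus>\<^bsub>N\<^esub>x\<in>?B. r \<odot>\<^bsub>N\<^esub> (\<phi> x \<odot>\<^bsub>N\<^esub> g x))"
      by (rule N.finsum_cong') (use FD[OF p(1)] gB r in \<open>auto simp: N.smult_assoc1\<close>)
    also have "\<dots> = r \<odot>\<^bsub>N\<^esub> \<Phi> \<phi>" unfolding \<Phi>_def
      using FD[OF p(1)] gB r B by (intro N.finsum_smult_ldistr[symmetric]) auto
    finally show ?thesis .
  qed
  have b: "free_basis R x \<in> carrier ?F" if "x \<in> ?X" for x
    unfolding tensor_free_def by (rule free_basis_carrier[OF that])
  have \<Phi>b: "\<Phi> (free_basis R x) = g x" if "x \<in> ?X" for x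
  proof -
    have "\<Phi> (free_basis R x) = (\<Oplus>\<^bsub>N\<^esub>y\<in>{x}. free_basis R x y \<odot>\<^bsub>N\<^esub> g y)"
      by (rule \<Phi>) (use that in \<open>auto simp: free_basis_def\<close>)
    also have "\<dots> = g x" using gc[OF that] by (simp add: free_basis_def N.finsum_insert)
    finally show ?thesis .
  qed
  have \<Phi>minus: "\<Phi> (\<phi> \<ominus>\<^bsub>?F\<^esub> \<psi>) = \<Phi> \<phi> \<ominus>\<^bsub>N\<^esub> \<Phi> \<psi>" if p: "\<phi> \<in> carrier ?F" "\<psi> \<in> carrier ?F" for \<phi> \<psi>
  proof -
    have "\<ominus>\<^bsub>?F\<^esub> \<psi> = (\<ominus> \<one>) \<odot>\<^bsub>?F\<^esub> \<psi>" using p by (simp add: F.smult_l_minus)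
    then have "\<Phi> (\<phi> \<ominus>\<^bsub>?F\<^esub> \<psi>) = \<Phi> \<phi> \<oplus>\<^bsub>N\<^esub> (\<ominus> \<one>) \<odot>\<^bsub>N\<^esub> \<Phi> \<psi>"
      using p by (simp add: a_minus_def \<Phi>add \<Phi>sm)
    then show ?thesis using \<Phi>c p by (simp add: a_minus_def N.smult_l_minus)
  qed
  let ?Z = "{\<phi> \<in> carrier ?F. \<Phi> \<phi> = \<zero>\<^bsub>N\<^esub>}"
  have Z: "submodule ?Z R ?F"
  proof (rule F.submoduleI)
    show "\<zero>\<^bsub>?F\<^esub> \<in> ?Z" using \<Phi>sm[of "\<zero>\<^bsub>?F\<^esub>" \<zero>] \<Phi>c[of "\<zero>\<^bsub>?F\<^esub>"] by simp
    show "\<ominus>\<^bsub>?F\<^esub> a \<in> ?Z" if "a \<in> ?Z" for a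
      using that \<Phi>minus[of "\<zero>\<^bsub>?F\<^esub>" a] \<Phi>sm[of "\<zero>\<^bsub>?F\<^esub>" \<zero>] \<Phi>c[of "\<zero>\<^bsub>?F\<^esub>"] by (simp add: a_minus_def)
  qed (use \<Phi>add \<Phi>sm in auto)
  have "tensor_relations R I M \<subseteq> ?Z"
  proof
    fix \<phi> assume p: "\<phi> \<in> tensor_relations R I M"
    then have pc: "\<phi> \<in> carrier ?F" using tensor_relations_subset[OF c] by blast
    from p consider x i u v where "\<phi> = free_basis R (x(i := u \<oplus>\<^bsub>M i\<^esub> v)) \<ominus>\<^bsub>?F\<^esub> (free_basis R (x(i := u)) \<oplus>\<^bsub>?F\<^esub> free_basis R (x(i := v)))"
      "x \<in> ?X" "i \<in> I" "u \<in> carrier (M i)" "v \<in> carrier (M i)"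
    | x i u r where "\<phi> = free_basis R (x(i := r \<odot>\<^bsub>M i\<^esub> u)) \<ominus>\<^bsub>?F\<^esub> (r \<odot>\<^bsub>?F\<^esub> free_basis R (x(i := u)))"
      "x \<in> ?X" "i \<in> I" "r \<in> carrier R" "u \<in> carrier (M i)"
      unfolding tensor_relations_def Let_def by blast
    then have "\<Phi> \<phi> = \<zero>\<^bsub>N\<^esub>"
    proof cases
      case (1 x i u v)
      have s: "u \<oplus>\<^bsub>M i\<^esub> v \<in> carrier (M i)" using c 1 by (auto simp: add_closed_def)
      note X = PiE_upd[OF 1(2,3,4)] PiE_upd[OF 1(2,3,5)] PiE_upd[OF 1(2,3) s]
      have cN: "g (x(i := u)) \<oplus>\<^bsub>N\<^esub> g (x(i := v)) \<in> carrier N" using gc[OF X(1)] gc[OF X(2)] by simp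
      show ?thesis unfolding 1(1) using X b gadd[OF 1(2-5)] cN
        by (simp add: \<Phi>minus \<Phi>add \<Phi>b) (simp add: a_minus_def N.M.r_neg)
    next
      case (2 x i u r)
      have s: "r \<odot>\<^bsub>M i\<^esub> u \<in> carrier (M i)" using c 2 by (auto simp: add_closed_def)
      note X = PiE_upd[OF 2(2,3,5)] PiE_upd[OF 2(2,3) s]
      have cN: "r \<odot>\<^bsub>N\<^esub> g (x(i := u)) \<in> carrier N" using gc[OF X(1)] 2 by simp
      show ?thesis unfolding 2(1) using X b gsm[OF 2(2,3,5,4)] cN 2(4)
        by (simp add: \<Phi>minus \<Phi>sm \<Phi>b) (simp add: a_minus_def N.M.r_neg)
    qed
    then show "\<phi> \<in> ?Z" using pc by simp
  qed
  then have KZ: "?K \<subseteq> ?Z" using Z unfolding tensor_rel_module_def by blast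
  interpret K: abelian_subgroup ?K ?F by (rule F.submodule_abelian_subgroup[OF K])
  have L: "L (?K +>\<^bsub>?F\<^esub> \<phi>) = \<Phi> \<phi>" if p: "\<phi> \<in> carrier ?F" for \<phi>
  proof -
    have "\<Phi> \<psi> = \<Phi> \<phi>" if psi: "\<psi> \<in> ?K +>\<^bsub>?F\<^esub> \<phi>" for \<psi>
    proof -
      obtain h where h: "h \<in> ?K" "\<psi> = h \<oplus>\<^bsub>?F\<^esub> \<phi>" using psi by (auto simp: a_r_coset_def')
      then show ?thesis using KZ \<Phi>add[of h \<phi>] p \<Phi>c[OF p] by auto
    qed
    moreover have "\<phi> \<in> ?K +>\<^bsub>?F\<^esub> \<phi>" using K.a_rcos_self[OF p] .
    ultimately have "\<Phi> ` (?K +>\<^bsub>?F\<^esub> \<phi>) = {\<Phi> \<phi>}" by blast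
    then show ?thesis by (simp add: L_def tensor_lift_def \<Phi>_def)
  qed
  have E: "\<exists>\<phi>\<in>carrier ?F. X = ?K +>\<^bsub>?F\<^esub> \<phi>" if "X \<in> carrier (tensor R I M)" for X
    using that unfolding tensor_def quot_module_carrier by auto
  show "L (pure_tensor R I M x) = g x" if "x \<in> ?X" using L[OF b[OF that]] \<Phi>b[OF that] by (simp add: pure_tensor_def)
  show "L X \<in> carrier N" if "X \<in> carrier (tensor R I M)" using E[OF that] L \<Phi>c by auto
  show "L (X \<oplus>\<^bsub>tensor R I M\<^esub> Y) = L X \<oplus>\<^bsub>N\<^esub> L Y" if XY: "X \<in> carrier (tensor R I M)" "Y \<in> carrier (tensor R I M)"
  proof -
    obtain \<phi> \<psi> where p: "\<phi> \<in> carrier ?F" "X = ?K +>\<^bsub>?F\<^esub> \<phi>" "\<psi> \<in> carrier ?F" "Y = ?K +>\<^bsub>?F\<^esub> \<psi>" using E[OF XY(1)] E[OF XY(2)] by auto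
    then show ?thesis using L \<Phi>add quot_module_add[OF F K p(1,3)] by (simp add: tensor_def)
  qed
  show "L (r \<odot>\<^bsub>tensor R I M\<^esub> X) = r \<odot>\<^bsub>N\<^esub> L X" if r: "r \<in> carrier R" and X: "X \<in> carrier (tensor R I M)"
  proof -
    obtain \<phi> where p: "\<phi> \<in> carrier ?F" "X = ?K +>\<^bsub>?F\<^esub> \<phi>" using E[OF X] by auto
    then show ?thesis using L \<Phi>sm r quot_module_smult[OF F K r p(1)] by (simp add: tensor_def)
  qed
qed

text \<open>
  The map \<open>x \<mapsto> pure_tensor R I N (\<lambda>i\<in>I. h i (x i))\<close> is multilinear.
\<close>

lemma tensor_map_linear:
  fixes M :: "'i \<Rightarrow> ('a, 'd) module" and N :: "'i \<Rightarrow> ('a, 'c) module"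
  assumes c: "add_closed I M" "add_closed I N"
    and h: "\<And>i u. i \<in> I \<Longrightarrow> u \<in> carrier (M i) \<Longrightarrow> h i u \<in> carrier (N i)"
    "\<And>i u v. i \<in> I \<Longrightarrow> u \<in> carrier (M i) \<Longrightarrow> v \<in> carrier (M i) \<Longrightarrow> h i (u \<oplus>\<^bsub>M i\<^esub> v) = h i u \<oplus>\<^bsub>N i\<^esub> h i v"
    "\<And>i u r. i \<in> I \<Longrightarrow> u \<in> carrier (M i) \<Longrightarrow> r \<in> carrier R \<Longrightarrow> h i (r \<odot>\<^bsub>M i\<^esub> u) = r \<odot>\<^bsub>N i\<^esub> h i u"
  defines "L \<equiv> tensor_map R I N h"
  shows "x \<in> (\<Pi>\<^sub>E i\<in>I. carrier (M i)) \<Longrightarrow> L (pure_tensor R I M x) = pure_tensor R I N (\<lambda>i\<in>I. h i (x i))"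
    and "X \<in> carrier (tensor R I M) \<Longrightarrow> L X \<in> carrier (tensor R I N)"
    and "X \<in> carrier (tensor R I M) \<Longrightarrow> Y \<in> carrier (tensor R I M) \<Longrightarrow> L (X \<oplus>\<^bsub>tensor R I M\<^esub> Y) = L X \<oplus>\<^bsub>tensor R I N\<^esub> L Y"
    and "r \<in> carrier R \<Longrightarrow> X \<in> carrier (tensor R I M) \<Longrightarrow> L (r \<odot>\<^bsub>tensor R I M\<^esub> X) = r \<odot>\<^bsub>tensor R I N\<^esub> L X"
proof -
  let ?g = "\<lambda>x. pure_tensor R I N (\<lambda>i\<in>I. h i (x i))"
  have r: "(\<lambda>i\<in>I. h i (x i)) \<in> (\<Pi>\<^sub>E i\<in>I. carrier (N i))" if "x \<in> (\<Pi>\<^sub>E i\<in>I. carrier (M i))" for x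
    using that h(1) by auto
  have u: "(\<lambda>j\<in>I. h j ((x(i := w)) j)) = (\<lambda>j\<in>I. h j (x j))(i := h i w)" if "i \<in> I" for x i w
    using that by auto
  have m: "multilinear_on I M (tensor R I N) ?g" unfolding multilinear_on_def
    using r h u pure_tensor_carrier[OF c(2)] pure_tensor_add[OF c(2)] pure_tensor_smult[OF c(2)] by simp
  note T = tensor_lift_linear[OF c(1) tensor_module[OF c(2)] m]
  show "x \<in> (\<Pi>\<^sub>E i\<in>I. carrier (M i)) \<Longrightarrow> L (pure_tensor R I M x) = pure_tensor R I N (\<lambda>i\<in>I. h i (x i))"
    and "X \<in> carrier (tensor R I M) \<Longrightarrow> L X \<in> carrier (tensor R I N)"
    and "X \<in> carrier (tensor R I M) \<Longrightarrow> Y \<in> carrier (tensor R I M) \<Longrightarrow> L (X \<oplus>\<^bsub>tensor R I M\<^esub> Y) = L X \<oplus>\<^bsub>tensor R I N\<^esub> L Y"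
    and "r \<in> carrier R \<Longrightarrow> X \<in> carrier (tensor R I M) \<Longrightarrow> L (r \<odot>\<^bsub>tensor R I M\<^esub> X) = r \<odot>\<^bsub>tensor R I N\<^esub> L X"
    unfolding L_def tensor_map_def by (rule T; assumption)+
qed

end

context cring begin

section \<open>Localizations\<close>

definition mult_set :: "'a set \<Rightarrow> bool" where
  "mult_set S \<longleftrightarrow> S \<subseteq> carrier R \<and> \<one> \<in> S \<and> (\<forall>s\<in>S. \<forall>t\<in>S. s \<otimes> t \<in> S)"

lemma mult_setD: "mult_set S \<Longrightarrow> s \<in> S \<Longrightarrow> s \<in> carrier R" "mult_set S \<Longrightarrow> \<one> \<in> S"
  "mult_set S \<Longrightarrow> s \<in> S \<Longrightarrow> t \<in> S \<Longrightarrow> s \<otimes> t \<in> S"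
  by (auto simp: mult_set_def)

lemma frac_mem_iff:
  assumes S: "mult_set S" and a: "a \<in> carrier R" and s: "s \<in> S"
  shows "(b, t) \<in> frac R S a s \<longleftrightarrow> b \<in> carrier R \<and> t \<in> S \<and> (\<exists>u\<in>S. u \<otimes> (t \<otimes> a) = u \<otimes> (s \<otimes> b))"
proof -
  have "u \<otimes> (t \<otimes> a \<ominus> s \<otimes> b) = \<zero> \<longleftrightarrow> u \<otimes> (t \<otimes> a) = u \<otimes> (s \<otimes> b)" if "b \<in> carrier R" "t \<in> S" "u \<in> S" for u
  proof -
    have c: "b \<in> carrier R" "t \<in> carrier R" "u \<in> carrier R" "s \<in> carrier R" using that s mult_setD[OF S] by auto
    have "u \<otimes> (t \<otimes> a \<ominus> s \<otimes> b) = u \<otimes> (t \<otimes> a) \<ominus> u \<otimes> (s \<otimes> b)" using c a by algebra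
    then show ?thesis using minus_zero_iff[of "u \<otimes> (t \<otimes> a)" "u \<otimes> (s \<otimes> b)"] c a by simp
  qed
  then show ?thesis unfolding frac_def by auto
qed

lemma frac_self: "mult_set S \<Longrightarrow> a \<in> carrier R \<Longrightarrow> s \<in> S \<Longrightarrow> (a, s) \<in> frac R S a s"
  using frac_mem_iff mult_setD(2) by auto

text \<open>
  Fractions are defined as equivalence classes, and this is where transitivity of the equivalence enters.
\<close>

lemma frac_eqI:
  assumes S: "mult_set S" and a: "a \<in> carrier R" "b \<in> carrier R" and s: "s \<in> S" "t \<in> S" "u \<in> S"
    and e: "u \<otimes> (t \<otimes> a) = u \<otimes> (s \<otimes> b)"
  shows "frac R S a s = frac R S b t"
proof -
  have sub: "frac R S a s \<subseteq> frac R S b t"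
    if a: "a \<in> carrier R" "b \<in> carrier R" and s: "s \<in> S" "t \<in> S" and e: "u \<otimes> (t \<otimes> a) = u \<otimes> (s \<otimes> b)" for a b s t
  proof
    fix p assume p: "p \<in> frac R S a s"
    obtain c r where pc: "p = (c, r)" by (cases p)
    then obtain v where v: "c \<in> carrier R" "r \<in> S" "v \<in> S" "v \<otimes> (r \<otimes> a) = v \<otimes> (s \<otimes> c)"
      using p frac_mem_iff[OF S a(1) s(1)] by blast
    have k: "u \<in> carrier R" "v \<in> carrier R" "r \<in> carrier R" "s \<in> carrier R" "t \<in> carrier R"
      using v s \<open>u \<in> S\<close> mult_setD(1)[OF S] by auto
    let ?w = "(u \<otimes> v) \<otimes> s"
    have "?w \<otimes> (r \<otimes> b) = v \<otimes> (r \<otimes> (u \<otimes> (s \<otimes> b)))" using k a v(1) by algebra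
    also have "\<dots> = u \<otimes> (t \<otimes> (v \<otimes> (r \<otimes> a)))" unfolding e[symmetric] using k a v(1) by algebra
    also have "\<dots> = ?w \<otimes> (t \<otimes> c)" unfolding v(4) using k a v(1) by algebra
    finally have "?w \<otimes> (r \<otimes> b) = ?w \<otimes> (t \<otimes> c)" .
    moreover have "?w \<in> S" using v s \<open>u \<in> S\<close> mult_setD(3)[OF S] by auto
    ultimately show "p \<in> frac R S b t" unfolding pc frac_mem_iff[OF S a(2) s(2)] using v by blast
  qed
  show ?thesis using sub[OF a s(1,2) e] sub[OF a(2,1) s(2,1) e[symmetric]] by auto
qed

lemma frac_eq_iff:
  assumes S: "mult_set S" and a: "a \<in> carrier R" "b \<in> carrier R" and s: "s \<in> S" "t \<in> S"
  shows "frac R S a s = frac R S b t \<longleftrightarrow> (\<exists>u\<in>S. u \<otimes> (t \<otimes> a) = u \<otimes> (s \<otimes> b))"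
proof
  assume "frac R S a s = frac R S b t"
  then have "(b, t) \<in> frac R S a s" using frac_self[OF S a(2) s(2)] by simp
  then show "\<exists>u\<in>S. u \<otimes> (t \<otimes> a) = u \<otimes> (s \<otimes> b)" using frac_mem_iff[OF S a(1) s(1)] by blast
qed (use frac_eqI[OF S a s] in blast)

lemma frac_memD:
  assumes S: "mult_set S" and a: "a \<in> carrier R" "s \<in> S" and p: "(b, t) \<in> frac R S a s"
  shows "b \<in> carrier R" "t \<in> S" "\<exists>u\<in>S. u \<otimes> (t \<otimes> a) = u \<otimes> (s \<otimes> b)"
  using p unfolding frac_mem_iff[OF S a] by auto

lemma localization_add:
  assumes S: "mult_set S" and a: "a \<in> carrier R" "b \<in> carrier R" and s: "s \<in> S" "t \<in> S"
  shows "frac R S a s \<oplus>\<^bsub>localization R S\<^esub> frac R S b t = frac R S (t \<otimes> a \<oplus> s \<otimes> b) (s \<otimes> t)"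
proof -
  let ?f = "\<lambda>((a, s), (b, t)). frac R S (t \<otimes> a \<oplus> s \<otimes> b) (s \<otimes> t)"
  have "the_elem (?f ` (frac R S a s \<times> frac R S b t)) = frac R S (t \<otimes> a \<oplus> s \<otimes> b) (s \<otimes> t)"
  proof (rule the_elem_image_singleton[of "((a, s), (b, t))"])
    show "((a, s), (b, t)) \<in> frac R S a s \<times> frac R S b t" using frac_self[OF S] a s by auto
    fix y assume "y \<in> frac R S a s \<times> frac R S b t"
    then obtain a' s' b' t' where y: "y = ((a', s'), (b', t'))" "(a', s') \<in> frac R S a s" "(b', t') \<in> frac R S b t" by auto
    note A = frac_memD[OF S a(1) s(1) y(2)] and B = frac_memD[OF S a(2) s(2) y(3)]
    obtain u v where u: "u \<in> S" "u \<otimes> (s' \<otimes> a) = u \<otimes> (s \<otimes> a')" and v: "v \<in> S" "v \<otimes> (t' \<otimes> b) = v \<otimes> (t \<otimes> b')"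
      using A(3) B(3) by blast
    have k: "u \<in> carrier R" "v \<in> carrier R" "s \<in> carrier R" "t \<in> carrier R" "s' \<in> carrier R" "t' \<in> carrier R"
      using u v s A B mult_setD(1)[OF S] by auto
    have "(u \<otimes> v) \<otimes> ((s \<otimes> t) \<otimes> (t' \<otimes> a' \<oplus> s' \<otimes> b')) = (t \<otimes> t' \<otimes> v) \<otimes> (u \<otimes> (s \<otimes> a')) \<oplus> (s \<otimes> s' \<otimes> u) \<otimes> (v \<otimes> (t \<otimes> b'))"
      using k a A(1) B(1) by algebra
    also have "\<dots> = (u \<otimes> v) \<otimes> ((s' \<otimes> t') \<otimes> (t \<otimes> a \<oplus> s \<otimes> b))"
      unfolding u(2)[symmetric] v(2)[symmetric] using k a A(1) B(1) by algebra
    finally have "frac R S (t' \<otimes> a' \<oplus> s' \<otimes> b') (s' \<otimes> t') = frac R S (t \<otimes> a \<oplus> s \<otimes> b) (s \<otimes> t)"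
      by (intro frac_eqI[OF S, of _ _ _ _ "u \<otimes> v"]) (use u v s k a A B mult_setD(3)[OF S] in auto)
    then show "?f y = frac R S (t \<otimes> a \<oplus> s \<otimes> b) (s \<otimes> t)" by (simp add: y)
  qed
  then show ?thesis by (simp add: localization_def)
qed

lemma localization_smult:
  assumes S: "mult_set S" and a: "a \<in> carrier R" "r \<in> carrier R" and s: "s \<in> S"
  shows "r \<odot>\<^bsub>localization R S\<^esub> frac R S a s = frac R S (r \<otimes> a) s"
proof -
  have "the_elem ((\<lambda>(a, s). frac R S (r \<otimes> a) s) ` frac R S a s) = frac R S (r \<otimes> a) s"
  proof (rule the_elem_image_singleton[of "(a, s)"])
    show "(a, s) \<in> frac R S a s" using frac_self[OF S] a s by auto
    fix y assume y0: "y \<in> frac R S a s"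
    obtain a' s' where y: "y = (a', s')" by (cases y)
    note A = frac_memD[OF S a(1) s y0[unfolded y]]
    obtain u where u: "u \<in> S" "u \<otimes> (s' \<otimes> a) = u \<otimes> (s \<otimes> a')" using A(3) by blast
    have k: "u \<in> carrier R" "s \<in> carrier R" "s' \<in> carrier R" using u s A mult_setD(1)[OF S] by auto
    have "u \<otimes> (s \<otimes> (r \<otimes> a')) = r \<otimes> (u \<otimes> (s \<otimes> a'))" using k a A(1) by algebra
    also have "\<dots> = u \<otimes> (s' \<otimes> (r \<otimes> a))" unfolding u(2)[symmetric] using k a A(1) by algebra
    finally have "frac R S (r \<otimes> a') s' = frac R S (r \<otimes> a) s"
      by (intro frac_eqI[OF S, of _ _ _ _ u]) (use u s k a A in auto)
    then show "(\<lambda>(a, s). frac R S (r \<otimes> a) s) y = frac R S (r \<otimes> a) s" by (simp add: y)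
  qed
  then show ?thesis by (simp add: localization_def)
qed

lemma localization_carrierE:
  assumes "x \<in> carrier (localization R S)" obtains a s where "x = frac R S a s" "a \<in> carrier R" "s \<in> S"
  using assms by (auto simp: localization_def)

lemma localization_carrierI: "a \<in> carrier R \<Longrightarrow> s \<in> S \<Longrightarrow> frac R S a s \<in> carrier (localization R S)"
  by (auto simp: localization_def)

lemma localization_zero: "\<zero>\<^bsub>localization R S\<^esub> = frac R S \<zero> \<one>" by (simp add: localization_def)

lemma localization_module:
  assumes S: "mult_set S" shows "module R (localization R S)"
proof (rule moduleI[OF is_cring])
  let ?L = "localization R S"
  note add = localization_add[OF S] and smult = localization_smult[OF S] and I = localization_carrierI
    and Sc = mult_setD(1)[OF S] and S1 = mult_setD(2)[OF S] and Sm = mult_setD(3)[OF S]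
  have eqI: "frac R S a s = frac R S b t" if "a \<in> carrier R" "b \<in> carrier R" "s \<in> S" "t \<in> S" "t \<otimes> a = s \<otimes> b" for a b s t
    by (rule frac_eqI[OF S that(1-4) S1]) (simp add: that)
  show "abelian_group ?L"
  proof (rule abelian_groupI)
    fix x assume "x \<in> carrier ?L"
    then obtain a s where x: "x = frac R S a s" "a \<in> carrier R" "s \<in> S" by (rule localization_carrierE)
    have sc: "s \<in> carrier R" using Sc x by simp
    show "\<zero>\<^bsub>?L\<^esub> \<oplus>\<^bsub>?L\<^esub> x = x" unfolding localization_zero x(1) add[OF zero_closed x(2) S1 x(3)] using x sc by simp
    show "\<exists>y\<in>carrier ?L. y \<oplus>\<^bsub>?L\<^esub> x = \<zero>\<^bsub>?L\<^esub>"
    proof (rule bexI[OF _ I[of "\<ominus> a" s S]])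
      have nc: "\<ominus> a \<in> carrier R" using x by simp
      have 0: "s \<otimes> \<ominus> a \<oplus> s \<otimes> a = \<zero>" using sc x(2) by algebra
      show "frac R S (\<ominus> a) s \<oplus>\<^bsub>?L\<^esub> x = \<zero>\<^bsub>?L\<^esub>"
        unfolding localization_zero x(1) add[OF nc x(2) x(3) x(3)] 0 by (rule eqI) (use x sc S1 Sm in auto)
    qed (use x in auto)
    fix y assume "y \<in> carrier ?L"
    then obtain b t where y: "y = frac R S b t" "b \<in> carrier R" "t \<in> S" by (rule localization_carrierE)
    have tc: "t \<in> carrier R" using Sc y by simp
    note xy = add[OF x(2) y(2) x(3) y(3), folded x(1) y(1)]
    show "x \<oplus>\<^bsub>?L\<^esub> y \<in> carrier ?L" unfolding xy by (rule I) (use x y sc tc Sm in auto)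
    show "x \<oplus>\<^bsub>?L\<^esub> y = y \<oplus>\<^bsub>?L\<^esub> x" unfolding xy add[OF y(2) x(2) y(3) x(3), folded x(1) y(1)]
      using x(2) y(2) sc tc by (simp add: m_comm a_comm)
    fix z assume "z \<in> carrier ?L"
    then obtain c r where z: "z = frac R S c r" "c \<in> carrier R" "r \<in> S" by (rule localization_carrierE)
    have rc: "r \<in> carrier R" using Sc z by simp
    have 1: "x \<oplus>\<^bsub>?L\<^esub> y \<oplus>\<^bsub>?L\<^esub> z = frac R S (r \<otimes> (t \<otimes> a \<oplus> s \<otimes> b) \<oplus> (s \<otimes> t) \<otimes> c) ((s \<otimes> t) \<otimes> r)"
      unfolding xy z(1) by (rule add) (use x y z sc tc rc Sm in auto)
    have 2: "x \<oplus>\<^bsub>?L\<^esub> (y \<oplus>\<^bsub>?L\<^esub> z) = frac R S ((t \<otimes> r) \<otimes> a \<oplus> s \<otimes> (r \<otimes> b \<oplus> t \<otimes> c)) (s \<otimes> (t \<otimes> r))"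
      unfolding add[OF y(2) z(2) y(3) z(3), folded y(1) z(1)] unfolding x(1)
      by (rule add) (use x y z sc tc rc Sm in auto)
    have "r \<otimes> (t \<otimes> a \<oplus> s \<otimes> b) \<oplus> (s \<otimes> t) \<otimes> c = (t \<otimes> r) \<otimes> a \<oplus> s \<otimes> (r \<otimes> b \<oplus> t \<otimes> c)"
      using x(2) y(2) z(2) sc tc rc by algebra
    then show "x \<oplus>\<^bsub>?L\<^esub> y \<oplus>\<^bsub>?L\<^esub> z = x \<oplus>\<^bsub>?L\<^esub> (y \<oplus>\<^bsub>?L\<^esub> z)"
      unfolding 1 2 using sc tc rc by (simp add: m_assoc)
  next
    show "\<zero>\<^bsub>?L\<^esub> \<in> carrier ?L" unfolding localization_zero by (rule I) (use S1 in auto)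
  qed
  fix x q assume "x \<in> carrier ?L" and q: "q \<in> carrier R"
  then obtain a s where x: "x = frac R S a s" "a \<in> carrier R" "s \<in> S" using localization_carrierE by metis
  have sc: "s \<in> carrier R" using Sc x by simp
  note qx = smult[OF x(2) q x(3), folded x(1)]
  show "q \<odot>\<^bsub>?L\<^esub> x \<in> carrier ?L" unfolding qx by (rule I) (use x q in auto)
    fix p assume p: "p \<in> carrier R"
    note px = smult[OF x(2) p x(3), folded x(1)]
    have "(p \<oplus> q) \<odot>\<^bsub>?L\<^esub> x = frac R S ((p \<oplus> q) \<otimes> a) s" using smult[OF x(2) _ x(3)] p q x(1) by simp
    moreover have "p \<odot>\<^bsub>?L\<^esub> x \<oplus>\<^bsub>?L\<^esub> q \<odot>\<^bsub>?L\<^esub> x = frac R S (s \<otimes> (p \<otimes> a) \<oplus> s \<otimes> (q \<otimes> a)) (s \<otimes> s)"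
      unfolding px qx by (rule add) (use x p q in auto)
    moreover have "frac R S ((p \<oplus> q) \<otimes> a) s = frac R S (s \<otimes> (p \<otimes> a) \<oplus> s \<otimes> (q \<otimes> a)) (s \<otimes> s)"
    proof (rule eqI)
      show "(s \<otimes> s) \<otimes> ((p \<oplus> q) \<otimes> a) = s \<otimes> (s \<otimes> (p \<otimes> a) \<oplus> s \<otimes> (q \<otimes> a))" using x(2) sc p q by algebra
    qed (use x sc p q Sm in auto)
    ultimately show "(p \<oplus> q) \<odot>\<^bsub>?L\<^esub> x = p \<odot>\<^bsub>?L\<^esub> x \<oplus>\<^bsub>?L\<^esub> q \<odot>\<^bsub>?L\<^esub> x" by simp
    show "(p \<otimes> q) \<odot>\<^bsub>?L\<^esub> x = p \<odot>\<^bsub>?L\<^esub> (q \<odot>\<^bsub>?L\<^esub> x)"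
      unfolding qx using smult[OF x(2) _ x(3), of "p \<otimes> q"] smult[OF _ p x(3), of "q \<otimes> a"] p q x by (simp add: m_assoc)
next
  fix x assume "x \<in> carrier (localization R S)"
  then obtain a s where x: "x = frac R S a s" "a \<in> carrier R" "s \<in> S" using localization_carrierE by metis
  show "\<one> \<odot>\<^bsub>localization R S\<^esub> x = x" using localization_smult[OF S x(2) one_closed x(3)] x by simp
next
  let ?L = "localization R S"
  note add = localization_add[OF S] and smult = localization_smult[OF S] and I = localization_carrierI
    and Sc = mult_setD(1)[OF S] and S1 = mult_setD(2)[OF S] and Sm = mult_setD(3)[OF S]
  fix x q assume "x \<in> carrier ?L" and q: "q \<in> carrier R"
  then obtain a s where x: "x = frac R S a s" "a \<in> carrier R" "s \<in> S" using localization_carrierE by metis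
  have sc: "s \<in> carrier R" using Sc x by simp
  note qx = smult[OF x(2) q x(3), folded x(1)]
  fix y assume "y \<in> carrier ?L"
  then obtain b t where y: "y = frac R S b t" "b \<in> carrier R" "t \<in> S" by (rule localization_carrierE)
  have tc: "t \<in> carrier R" using Sc y by simp
  note qy = smult[OF y(2) q y(3), folded y(1)]
  have "q \<odot>\<^bsub>?L\<^esub> (x \<oplus>\<^bsub>?L\<^esub> y) = frac R S (q \<otimes> (t \<otimes> a \<oplus> s \<otimes> b)) (s \<otimes> t)"
    unfolding add[OF x(2) y(2) x(3) y(3), folded x(1) y(1)] by (rule smult) (use x y q sc tc Sm in auto)
  moreover have "q \<odot>\<^bsub>?L\<^esub> x \<oplus>\<^bsub>?L\<^esub> q \<odot>\<^bsub>?L\<^esub> y = frac R S (t \<otimes> (q \<otimes> a) \<oplus> s \<otimes> (q \<otimes> b)) (s \<otimes> t)"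
    unfolding qx qy by (rule add) (use x y q in auto)
  moreover have "q \<otimes> (t \<otimes> a \<oplus> s \<otimes> b) = t \<otimes> (q \<otimes> a) \<oplus> s \<otimes> (q \<otimes> b)" using x(2) y(2) q sc tc by algebra
  ultimately show "q \<odot>\<^bsub>?L\<^esub> (x \<oplus>\<^bsub>?L\<^esub> y) = q \<odot>\<^bsub>?L\<^esub> x \<oplus>\<^bsub>?L\<^esub> q \<odot>\<^bsub>?L\<^esub> y" by simp
qed

lemma frac_zero_iff:
  assumes S: "mult_set S" and a: "a \<in> carrier R" "s \<in> S"
  shows "frac R S a s = \<zero>\<^bsub>localization R S\<^esub> \<longleftrightarrow> (\<exists>u\<in>S. u \<otimes> a = \<zero>)"
proof -
  have "u \<otimes> (\<one> \<otimes> a) = u \<otimes> (s \<otimes> \<zero>) \<longleftrightarrow> u \<otimes> a = \<zero>" if "u \<in> S" for u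
    using that a mult_setD(1)[OF S] by simp
  then show ?thesis unfolding localization_zero using frac_eq_iff[OF S a(1) zero_closed a(2) mult_setD(2)[OF S]] by simp
qed

lemma powers_mult_set: "z \<in> carrier R \<Longrightarrow> mult_set (powers R z)"
proof -
  assume z: "z \<in> carrier R"
  have "\<one> \<in> powers R z" unfolding powers_def by (rule CollectI, rule exI[of _ "0::nat"]) simp
  moreover have "s \<otimes> t \<in> powers R z" if st: "s \<in> powers R z" "t \<in> powers R z" for s t
  proof -
    obtain k l where "s = z [^] (k::nat)" "t = z [^] (l::nat)" using st by (auto simp: powers_def)
    then have "s \<otimes> t = z [^] (k + l)" using z by (simp add: nat_pow_mult)
    then show ?thesis unfolding powers_def by blast
  qed
  ultimately show ?thesis using z unfolding mult_set_def by (auto simp: powers_def)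
qed

lemma powers_mem: "z [^] (k::nat) \<in> powers R z" by (auto simp: powers_def)

lemma powers_one: "powers R \<one> = {\<one>}" by (auto simp: powers_def)

text \<open>
  The assumption on \<open>M i\<close> says, in the situations at hand, that \<open>M i\<close> is a zero module.
\<close>

lemma tensor_zero_factor:
  assumes c: "add_closed I M" and i: "i \<in> I" and z: "\<And>u. u \<in> carrier (M i) \<Longrightarrow> \<zero> \<odot>\<^bsub>M i\<^esub> u = u"
    and X: "X \<in> carrier (tensor R I M)"
  shows "X = \<zero>\<^bsub>tensor R I M\<^esub>"
proof -
  let ?T = "tensor R I M"
  interpret T: module R "tensor R I M" by (rule tensor_module[OF c])
  show ?thesis
  proof (rule tensor_induct[OF c X])
    fix x assume x: "x \<in> (\<Pi>\<^sub>E i\<in>I. carrier (M i))"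
    then have xi: "x i \<in> carrier (M i)" using i by auto
    have "pure_tensor R I M (x(i := \<zero> \<odot>\<^bsub>M i\<^esub> x i)) = \<zero> \<odot>\<^bsub>?T\<^esub> pure_tensor R I M (x(i := x i))"
      by (rule pure_tensor_smult[OF c x i zero_closed xi])
    then show "pure_tensor R I M x = \<zero>\<^bsub>?T\<^esub>" using z[OF xi] pure_tensor_carrier[OF c x] by simp
  qed auto
qed

lemma pure_tensor_scale:
  assumes c: "add_closed I M" and fin: "finite I" and x: "x \<in> (\<Pi>\<^sub>E i\<in>I. carrier (M i))" and r: "\<And>i. i \<in> I \<Longrightarrow> r i \<in> carrier R"
    and one: "\<And>i u. i \<in> I \<Longrightarrow> u \<in> carrier (M i) \<Longrightarrow> \<one> \<odot>\<^bsub>M i\<^esub> u = u"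
  shows "pure_tensor R I M (\<lambda>i\<in>I. r i \<odot>\<^bsub>M i\<^esub> x i) = (\<Otimes>i\<in>I. r i) \<odot>\<^bsub>tensor R I M\<^esub> pure_tensor R I M x"
proof -
  let ?T = "tensor R I M"
  interpret T: module R "tensor R I M" by (rule tensor_module[OF c])
  let ?y = "\<lambda>J. \<lambda>i\<in>I. if i \<in> J then r i \<odot>\<^bsub>M i\<^esub> x i else x i"
  have cl: "r i \<odot>\<^bsub>M i\<^esub> x i \<in> carrier (M i)" "x i \<in> carrier (M i)" if "i \<in> I" for i
    using c PiE_mem[OF x that] r[OF that] that by (auto simp: add_closed_def)
  have "finite J \<Longrightarrow> J \<subseteq> I \<Longrightarrow> pure_tensor R I M (?y J) = (\<Otimes>i\<in>J. r i) \<odot>\<^bsub>?T\<^esub> pure_tensor R I M x" for J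
  proof (induction J rule: finite_induct)
    case empty
    have "?y {} = x" using x by (auto simp: fun_eq_iff PiE_iff extensional_def)
    then show ?case using pure_tensor_carrier[OF c x] by simp
  next
    case (insert j J)
    then have j: "j \<in> I" and J: "J \<subseteq> I" by auto
    have rJ: "r \<in> J \<rightarrow> carrier R" using r J by auto
    have yJ: "?y J \<in> (\<Pi>\<^sub>E i\<in>I. carrier (M i))" using cl by auto
    have e1: "?y (insert j J) = (?y J)(j := r j \<odot>\<^bsub>M j\<^esub> x j)" using j by (auto simp: fun_eq_iff)
    have e2: "(?y J)(j := x j) = ?y J" using j insert.hyps by (auto simp: fun_eq_iff)
    have "pure_tensor R I M (?y (insert j J)) = r j \<odot>\<^bsub>?T\<^esub> pure_tensor R I M (?y J)"
      using pure_tensor_smult[OF c yJ j r[OF j] cl(2)[OF j]] unfolding e1 e2 .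
    also have "r j \<odot>\<^bsub>?T\<^esub> pure_tensor R I M (?y J) = (\<Otimes>i\<in>insert j J. r i) \<odot>\<^bsub>?T\<^esub> pure_tensor R I M x"
      unfolding insert.IH[OF J] using insert.hyps rJ r[OF j] pure_tensor_carrier[OF c x]
      by (simp add: T.smult_assoc1 finprod_closed)
    finally show ?case .
  qed
  from this[OF fin] have "pure_tensor R I M (?y I) = (\<Otimes>i\<in>I. r i) \<odot>\<^bsub>?T\<^esub> pure_tensor R I M x" by simp
  moreover have "?y I = (\<lambda>i\<in>I. r i \<odot>\<^bsub>M i\<^esub> x i)" by auto
  ultimately show ?thesis by (simp only:)
qed

section \<open>Tensor products of copies of the ring and of its localizations\<close>

lemma self_module_simps [simp]: "carrier (self_module R) = carrier R" "\<zero>\<^bsub>self_module R\<^esub> = \<zero>"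
  "x \<oplus>\<^bsub>self_module R\<^esub> y = x \<oplus> y" "r \<odot>\<^bsub>self_module R\<^esub> x = r \<otimes> x"
  by (auto simp: self_module_def)

lemma self_module_module: "module R (self_module R)"
  by (rule moduleI[OF is_cring]) (auto intro!: abelian_groupI simp: a_ac l_distr r_distr m_assoc intro: r_neg bexI[of _ "\<ominus> x" for x])

lemma finprod_upd:
  assumes "finite I" "i \<in> I" "x \<in> I \<rightarrow> carrier R" "u \<in> carrier R"
  shows "(\<Otimes>j\<in>I. (x(i := u)) j) = u \<otimes> (\<Otimes>j\<in>I - {i}. x j)"
proof -
  have "(\<Otimes>j\<in>I. (x(i := u)) j) = (\<Otimes>j\<in>insert i (I - {i}). (x(i := u)) j)" using assms by (simp add: insert_absorb)
  also have "\<dots> = (x(i := u)) i \<otimes> (\<Otimes>j\<in>I - {i}. (x(i := u)) j)" using assms by (intro finprod_insert) (auto simp: Pi_iff)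
  also have "(\<Otimes>j\<in>I - {i}. (x(i := u)) j) = (\<Otimes>j\<in>I - {i}. x j)" by (rule finprod_cong') (use assms in auto)
  finally show ?thesis by simp
qed

text \<open>
  The tensor product of copies of \<open>R\<close> is free on the tensor of ones. Independence is tested by the linear map that
  multiplies all factors.
\<close>

lemma self_tensor:
  fixes M :: "'i \<Rightarrow> ('a, 'a) module"
  assumes fin: "finite I" and M: "\<And>i. i \<in> I \<Longrightarrow> M i = self_module R"
  defines "e \<equiv> pure_tensor R I M (\<lambda>i\<in>I. \<one>)"
  shows "e \<in> carrier (tensor R I M)"
    and "X \<in> carrier (tensor R I M) \<Longrightarrow> \<exists>r\<in>carrier R. X = r \<odot>\<^bsub>tensor R I M\<^esub> e"
    and "r \<in> carrier R \<Longrightarrow> r \<odot>\<^bsub>tensor R I M\<^esub> e = \<zero>\<^bsub>tensor R I M\<^esub> \<Longrightarrow> r = \<zero>"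
proof -
  let ?T = "tensor R I M"
  have c: "add_closed I M" using M by (simp add: add_closed_def)
  interpret T: module R "tensor R I M" by (rule tensor_module[OF c])
  have PX: "(\<Pi>\<^sub>E i\<in>I. carrier (M i)) = I \<rightarrow>\<^sub>E carrier R" using M by (auto simp: PiE_iff)
  have o: "(\<lambda>i\<in>I. \<one>) \<in> (\<Pi>\<^sub>E i\<in>I. carrier (M i))" unfolding PX by auto
  show ec: "e \<in> carrier ?T" unfolding e_def by (rule pure_tensor_carrier[OF c o])
  show "\<exists>r\<in>carrier R. X = r \<odot>\<^bsub>?T\<^esub> e" if X: "X \<in> carrier ?T"
  proof (rule tensor_induct[OF c X])
    show "\<exists>r\<in>carrier R. \<zero>\<^bsub>?T\<^esub> = r \<odot>\<^bsub>?T\<^esub> e" using ec by (intro bexI[of _ \<zero>]) auto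
    fix x assume x: "x \<in> (\<Pi>\<^sub>E i\<in>I. carrier (M i))"
    have "pure_tensor R I M (\<lambda>i\<in>I. x i \<odot>\<^bsub>M i\<^esub> (\<lambda>i\<in>I. \<one>) i) = (\<Otimes>i\<in>I. x i) \<odot>\<^bsub>?T\<^esub> e"
      unfolding e_def by (rule pure_tensor_scale[OF c fin o]) (use x M in \<open>auto simp: PX\<close>)
    moreover have "(\<lambda>i\<in>I. x i \<odot>\<^bsub>M i\<^esub> (\<lambda>i\<in>I. \<one>) i) = x" using x M unfolding PX by (auto simp: fun_eq_iff PiE_iff extensional_def)
    moreover have "(\<Otimes>i\<in>I. x i) \<in> carrier R" using x unfolding PX by (intro finprod_closed) auto
    ultimately show "\<exists>r\<in>carrier R. pure_tensor R I M x = r \<odot>\<^bsub>?T\<^esub> e" by auto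
  next
    fix X Y assume "\<exists>r\<in>carrier R. X = r \<odot>\<^bsub>?T\<^esub> e" "\<exists>r\<in>carrier R. Y = r \<odot>\<^bsub>?T\<^esub> e"
    then obtain r s where "r \<in> carrier R" "X = r \<odot>\<^bsub>?T\<^esub> e" "s \<in> carrier R" "Y = s \<odot>\<^bsub>?T\<^esub> e" by blast
    then show "\<exists>r\<in>carrier R. X \<oplus>\<^bsub>?T\<^esub> Y = r \<odot>\<^bsub>?T\<^esub> e" using ec by (intro bexI[of _ "r \<oplus> s"]) (auto simp: T.smult_l_distr)
  next
    fix X q assume "\<exists>r\<in>carrier R. X = r \<odot>\<^bsub>?T\<^esub> e" "q \<in> carrier R"
    then obtain r where "r \<in> carrier R" "X = r \<odot>\<^bsub>?T\<^esub> e" by blast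
    then show "\<exists>r\<in>carrier R. q \<odot>\<^bsub>?T\<^esub> X = r \<odot>\<^bsub>?T\<^esub> e" using ec \<open>q \<in> carrier R\<close> by (intro bexI[of _ "q \<otimes> r"]) (auto simp: T.smult_assoc1)
  qed
  have ml: "multilinear_on I M (self_module R) (\<lambda>x. \<Otimes>i\<in>I. x i)" unfolding multilinear_on_def PX
  proof (intro ballI conjI)
    fix x assume x: "x \<in> I \<rightarrow>\<^sub>E carrier R"
    then have xc: "x \<in> I \<rightarrow> carrier R" by auto
    then show "(\<Otimes>i\<in>I. x i) \<in> carrier (self_module R)" by (simp add: finprod_closed)
    fix i u assume i: "i \<in> I" and u: "u \<in> carrier (M i)"
    have q: "(\<Otimes>j\<in>I - {i}. x j) \<in> carrier R" using xc by (intro finprod_closed) auto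
    have uc: "u \<in> carrier R" using u M[OF i] by simp
    show "(\<Otimes>j\<in>I. (x(i := u \<oplus>\<^bsub>M i\<^esub> v)) j) = (\<Otimes>j\<in>I. (x(i := u)) j) \<oplus>\<^bsub>self_module R\<^esub> (\<Otimes>j\<in>I. (x(i := v)) j)"
      if v: "v \<in> carrier (M i)" for v
    proof -
      have vc: "v \<in> carrier R" using v M[OF i] by simp
      show ?thesis using finprod_upd[OF fin i xc] uc vc q M[OF i] by (simp del: fun_upd_apply add: l_distr)
    qed
    show "(\<Otimes>j\<in>I. (x(i := r \<odot>\<^bsub>M i\<^esub> u)) j) = r \<odot>\<^bsub>self_module R\<^esub> (\<Otimes>j\<in>I. (x(i := u)) j)"
      if r: "r \<in> carrier R" for r
      using finprod_upd[OF fin i xc] uc r q M[OF i] by (simp del: fun_upd_apply add: m_assoc)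
  qed
  note L = tensor_lift_linear[OF c self_module_module ml]
  show "r = \<zero>" if r: "r \<in> carrier R" "r \<odot>\<^bsub>?T\<^esub> e = \<zero>\<^bsub>?T\<^esub>"
  proof -
    have "finprod R (\<lambda>i\<in>I. \<one>) I = (\<Otimes>i\<in>I. \<one>)" by (rule finprod_cong') auto
    also have "\<dots> = \<one>" by simp
    finally have Le: "tensor_lift R (self_module R) (\<lambda>x. \<Otimes>i\<in>I. x i) e = \<one>" using L(1)[OF o] unfolding e_def by (simp only:)
    have L0: "tensor_lift R (self_module R) (\<lambda>x. \<Otimes>i\<in>I. x i) \<zero>\<^bsub>?T\<^esub> = \<zero>"
      using L(4)[of \<zero> e] L(2)[OF ec] ec by simp
    show ?thesis using L(4)[OF r(1) ec] Le L0 r by simp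
  qed
qed

lemma finprod_nat_pow_mono:
  assumes "finite I" "\<And>i. i \<in> I \<Longrightarrow> w i \<in> carrier R" "q \<in> carrier R" "(\<Otimes>i\<in>I. w i [^] (e i :: nat)) \<otimes> q = \<zero>"
    "\<And>i. i \<in> I \<Longrightarrow> e i \<le> l"
  shows "(\<Otimes>i\<in>I. w i [^] (l :: nat)) \<otimes> q = \<zero>"
proof -
  have 1: "(\<Otimes>i\<in>I. w i [^] e i) \<in> carrier R" "(\<Otimes>i\<in>I. w i [^] (l - e i)) \<in> carrier R" using assms by (auto intro!: finprod_closed)
  have "(\<Otimes>i\<in>I. w i [^] l) = (\<Otimes>i\<in>I. w i [^] (l - e i) \<otimes> w i [^] e i)"
    by (rule finprod_cong') (use assms in \<open>auto simp: nat_pow_mult\<close>)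
  also have "\<dots> = (\<Otimes>i\<in>I. w i [^] (l - e i)) \<otimes> (\<Otimes>i\<in>I. w i [^] e i)" using assms by (intro finprod_multf) auto
  finally have "(\<Otimes>i\<in>I. w i [^] l) \<otimes> q = (\<Otimes>i\<in>I. w i [^] (l - e i)) \<otimes> ((\<Otimes>i\<in>I. w i [^] e i) \<otimes> q)" using 1 assms(3) by (simp add: m_assoc)
  then show ?thesis using 1 assms(4) by simp
qed

text \<open>
  The tensor product of the localizations at the powers of \<open>w i\<close> is the localization at the products of powers. The
  elements \<open>e k\<close>, the fractions with numerator 1 and denominators \<open>(w i)\<^sup>k\<close>, serve as a basis whose index \<open>k\<close> may be
  enlarged. The annihilator of \<open>e k\<close> is found by mapping to the localization at the set \<open>D\<close> of
  products of denominators.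
\<close>

lemma localization_tensor:
  fixes M :: "'i \<Rightarrow> ('a, ('a \<times> 'a) set) module"
  assumes fin: "finite I" and w: "\<And>i. i \<in> I \<Longrightarrow> w i \<in> carrier R" and M: "\<And>i. i \<in> I \<Longrightarrow> M i = localization R (powers R (w i))"
  defines "e \<equiv> \<lambda>k::nat. pure_tensor R I M (\<lambda>i\<in>I. frac R (powers R (w i)) \<one> (w i [^] k))"
  shows "e k \<in> carrier (tensor R I M)"
    and "e k = (\<Otimes>i\<in>I. w i [^] l) \<odot>\<^bsub>tensor R I M\<^esub> e (k + l)"
    and "X \<in> carrier (tensor R I M) \<Longrightarrow> \<exists>k. \<exists>r\<in>carrier R. X = r \<odot>\<^bsub>tensor R I M\<^esub> e k"
    and "r \<in> carrier R \<Longrightarrow> r \<odot>\<^bsub>tensor R I M\<^esub> e k = \<zero>\<^bsub>tensor R I M\<^esub> \<longleftrightarrow> (\<exists>l. (\<Otimes>i\<in>I. w i [^] (l::nat)) \<otimes> r = \<zero>)"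
proof -
  let ?T = "tensor R I M"
  let ?S = "\<lambda>i. powers R (w i)"
  have S: "mult_set (?S i)" if "i \<in> I" for i using powers_mult_set w that by simp
  have Mm: "module R (M i)" if "i \<in> I" for i using M[OF that] localization_module[OF S[OF that]] by simp
  have c: "add_closed I M" unfolding add_closed_def
  proof (intro ballI conjI)
    fix i u assume i: "i \<in> I" "u \<in> carrier (M i)"
    interpret Mi: module R "M i" by (rule Mm[OF i(1)])
    show "u \<oplus>\<^bsub>M i\<^esub> v \<in> carrier (M i)" if "v \<in> carrier (M i)" for v using i that by simp
  next
    fix i r u assume i: "i \<in> I" "r \<in> carrier R" "u \<in> carrier (M i)"
    interpret Mi: module R "M i" by (rule Mm[OF i(1)])
    show "r \<odot>\<^bsub>M i\<^esub> u \<in> carrier (M i)" using i by simp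
  qed
  have one: "\<one> \<odot>\<^bsub>M i\<^esub> u = u" if "i \<in> I" "u \<in> carrier (M i)" for i u
    using module.smult_one[OF Mm[OF that(1)] that(2)] .
  interpret T: module R "tensor R I M" by (rule tensor_module[OF c])
  have fc: "frac R (?S i) a (w i [^] (k::nat)) \<in> carrier (M i)" if "i \<in> I" "a \<in> carrier R" for i a k
    unfolding M[OF that(1)] by (rule localization_carrierI[OF that(2) powers_mem])
  have o: "(\<lambda>i\<in>I. frac R (?S i) \<one> (w i [^] (k::nat))) \<in> (\<Pi>\<^sub>E i\<in>I. carrier (M i))" for k using fc by auto
  have ec: "e k \<in> carrier ?T" for k unfolding e_def by (rule pure_tensor_carrier[OF c o])
  then show "e k \<in> carrier ?T" .
  have scale: "pure_tensor R I M (\<lambda>i\<in>I. frac R (?S i) (a i) (w i [^] k)) = (\<Otimes>i\<in>I. a i) \<odot>\<^bsub>?T\<^esub> e k"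
    if a: "\<And>i. i \<in> I \<Longrightarrow> a i \<in> carrier R" for a k
  proof -
    have "a i \<odot>\<^bsub>M i\<^esub> frac R (?S i) \<one> (w i [^] k) = frac R (?S i) (a i) (w i [^] k)" if i: "i \<in> I" for i
      using localization_smult[OF S[OF i] one_closed a[OF i] powers_mem] a[OF i] M[OF i] by simp
    then have eq: "(\<lambda>i\<in>I. a i \<odot>\<^bsub>M i\<^esub> (\<lambda>i\<in>I. frac R (?S i) \<one> (w i [^] k)) i) = (\<lambda>i\<in>I. frac R (?S i) (a i) (w i [^] k))"
      by (auto simp: fun_eq_iff)
    have "pure_tensor R I M (\<lambda>i\<in>I. a i \<odot>\<^bsub>M i\<^esub> (\<lambda>i\<in>I. frac R (?S i) \<one> (w i [^] k)) i) = (\<Otimes>i\<in>I. a i) \<odot>\<^bsub>?T\<^esub> e k"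
      unfolding e_def by (rule pure_tensor_scale[OF c fin o a one])
    then show ?thesis unfolding eq .
  qed
  have shift: "frac R (?S i) a (w i [^] k) = frac R (?S i) (w i [^] l \<otimes> a) (w i [^] (k + l))" if i: "i \<in> I" and a: "a \<in> carrier R" for i a and k l :: nat
  proof (rule frac_eqI[OF S[OF i] _ _ powers_mem powers_mem mult_setD(2)[OF S[OF i]]])
    have "w i [^] (k + l) \<otimes> a = w i [^] k \<otimes> (w i [^] l \<otimes> a)" using w[OF i] a by (simp add: nat_pow_mult[symmetric] m_assoc)
    then show "\<one> \<otimes> (w i [^] (k + l) \<otimes> a) = \<one> \<otimes> (w i [^] k \<otimes> (w i [^] l \<otimes> a))" by simp
  qed (use a w[OF i] in auto)
  have eshift: "e k = (\<Otimes>i\<in>I. w i [^] l) \<odot>\<^bsub>?T\<^esub> e (k + l)" for k l :: nat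
  proof -
    have "(\<lambda>i\<in>I. frac R (?S i) \<one> (w i [^] k)) = (\<lambda>i\<in>I. frac R (?S i) (w i [^] l) (w i [^] (k + l)))"
      using shift[OF _ one_closed, of _ k l] w by (auto simp: fun_eq_iff)
    then show ?thesis using scale[of "\<lambda>i. w i [^] l" "k + l"] w by (simp add: e_def)
  qed
  then show "e k = (\<Otimes>i\<in>I. w i [^] l) \<odot>\<^bsub>?T\<^esub> e (k + l)" .
  have wp: "(\<Otimes>i\<in>I. w i [^] (l::nat)) \<in> carrier R" for l using w by (intro finprod_closed) auto
  show "\<exists>k. \<exists>r\<in>carrier R. X = r \<odot>\<^bsub>?T\<^esub> e k" if X: "X \<in> carrier ?T"
  proof (rule tensor_induct[OF c X])
    show "\<exists>k. \<exists>r\<in>carrier R. \<zero>\<^bsub>?T\<^esub> = r \<odot>\<^bsub>?T\<^esub> e k" using ec by (intro exI[of _ 0] bexI[of _ \<zero>]) auto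
    fix x assume x: "x \<in> (\<Pi>\<^sub>E i\<in>I. carrier (M i))"
    have "\<exists>a k. a \<in> carrier R \<and> x i = frac R (?S i) a (w i [^] (k::nat))" if i: "i \<in> I" for i
    proof -
      have "x i \<in> carrier (localization R (?S i))" using PiE_mem[OF x i] unfolding M[OF i] .
      then obtain a s where "x i = frac R (?S i) a s" "a \<in> carrier R" "s \<in> ?S i" by (rule localization_carrierE)
      then show ?thesis by (auto simp: powers_def)
    qed
    then obtain a k where ak: "\<And>i. i \<in> I \<Longrightarrow> a i \<in> carrier R" "\<And>i. i \<in> I \<Longrightarrow> x i = frac R (?S i) (a i) (w i [^] (k i :: nat))" by metis
    let ?K = "\<Sum>i\<in>I. k i"
    have "x = (\<lambda>i\<in>I. frac R (?S i) (w i [^] (?K - k i) \<otimes> a i) (w i [^] ?K))"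
    proof
      fix i show "x i = (\<lambda>i\<in>I. frac R (?S i) (w i [^] (?K - k i) \<otimes> a i) (w i [^] ?K)) i"
      proof (cases "i \<in> I")
        case True
        then have "k i \<le> ?K" using fin by (simp add: member_le_sum)
        then show ?thesis using True ak shift[OF True ak(1)[OF True], of "k i" "?K - k i"] by simp
      next
        case False then show ?thesis using x by (auto simp: PiE_iff extensional_def)
      qed
    qed
    then have "pure_tensor R I M x = (\<Otimes>i\<in>I. w i [^] (?K - k i) \<otimes> a i) \<odot>\<^bsub>?T\<^esub> e ?K"
      using scale[of "\<lambda>i. w i [^] (?K - k i) \<otimes> a i" ?K] ak w by simp
    moreover have "(\<Otimes>i\<in>I. w i [^] (?K - k i) \<otimes> a i) \<in> carrier R" using ak w by (intro finprod_closed) auto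
    ultimately show "\<exists>k. \<exists>r\<in>carrier R. pure_tensor R I M x = r \<odot>\<^bsub>?T\<^esub> e k" by blast
  next
    fix X Y assume "\<exists>k. \<exists>r\<in>carrier R. X = r \<odot>\<^bsub>?T\<^esub> e k" "\<exists>k. \<exists>r\<in>carrier R. Y = r \<odot>\<^bsub>?T\<^esub> e k"
    then obtain k r l s where rs: "r \<in> carrier R" "X = r \<odot>\<^bsub>?T\<^esub> e k" "s \<in> carrier R" "Y = s \<odot>\<^bsub>?T\<^esub> e l" by blast
    have "X = (r \<otimes> (\<Otimes>i\<in>I. w i [^] l)) \<odot>\<^bsub>?T\<^esub> e (k + l)"
      unfolding rs(2) eshift[of k l] using rs wp ec by (simp add: T.smult_assoc1)
    moreover have "Y = (s \<otimes> (\<Otimes>i\<in>I. w i [^] k)) \<odot>\<^bsub>?T\<^esub> e (k + l)"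
      unfolding rs(4) eshift[of l k] using rs wp ec by (simp add: T.smult_assoc1 add.commute)
    ultimately have "X \<oplus>\<^bsub>?T\<^esub> Y = (r \<otimes> (\<Otimes>i\<in>I. w i [^] l) \<oplus> s \<otimes> (\<Otimes>i\<in>I. w i [^] k)) \<odot>\<^bsub>?T\<^esub> e (k + l)"
      using rs wp ec by (simp add: T.smult_l_distr)
    then show "\<exists>k. \<exists>r\<in>carrier R. X \<oplus>\<^bsub>?T\<^esub> Y = r \<odot>\<^bsub>?T\<^esub> e k" using rs wp
      by (intro exI[of _ "k + l"] bexI[of _ "r \<otimes> (\<Otimes>i\<in>I. w i [^] l) \<oplus> s \<otimes> (\<Otimes>i\<in>I. w i [^] k)"]) auto
  next
    fix X q assume "\<exists>k. \<exists>r\<in>carrier R. X = r \<odot>\<^bsub>?T\<^esub> e k" "q \<in> carrier R"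
    then obtain k r where "r \<in> carrier R" "X = r \<odot>\<^bsub>?T\<^esub> e k" by blast
    then show "\<exists>k. \<exists>r\<in>carrier R. q \<odot>\<^bsub>?T\<^esub> X = r \<odot>\<^bsub>?T\<^esub> e k" using ec \<open>q \<in> carrier R\<close>
      by (intro exI[of _ k] bexI[of _ "q \<otimes> r"]) (auto simp: T.smult_assoc1)
  qed
  define D where "D = {\<Otimes>i\<in>I. s i | s. \<forall>i\<in>I. s i \<in> ?S i}"
  have Dm: "(\<Otimes>i\<in>I. s i) \<in> D" if "\<And>i. i \<in> I \<Longrightarrow> s i \<in> ?S i" for s using that unfolding D_def by blast
  have Sc: "s \<in> carrier R" if "s \<in> ?S i" "i \<in> I" for s i using mult_setD(1)[OF S] that by blast
  have D: "mult_set D" unfolding mult_set_def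
  proof (intro conjI ballI subsetI)
    show "d \<in> carrier R" if "d \<in> D" for d using that Sc by (auto simp: D_def intro!: finprod_closed)
    have "(\<Otimes>i\<in>I. \<one>) \<in> D" by (rule Dm) (use mult_setD(2)[OF S] in auto)
    then show "\<one> \<in> D" by simp
    fix d d' assume "d \<in> D" "d' \<in> D"
    then obtain s s' where s: "d = (\<Otimes>i\<in>I. s i)" "\<forall>i\<in>I. s i \<in> ?S i" "d' = (\<Otimes>i\<in>I. s' i)" "\<forall>i\<in>I. s' i \<in> ?S i" by (auto simp: D_def)
    have "d \<otimes> d' = (\<Otimes>i\<in>I. s i \<otimes> s' i)" unfolding s(1,3) using s Sc by (intro finprod_multf[symmetric]) auto
    then show "d \<otimes> d' \<in> D" using Dm[of "\<lambda>i. s i \<otimes> s' i"] s mult_setD(3)[OF S] by auto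
  qed
  (* Numerators and denominators are chosen once and for all; gI shows that the value of g
     does not depend on the choice. *)
  define num where "num i X = (SOME a. a \<in> carrier R \<and> (\<exists>s\<in>?S i. X = frac R (?S i) a s))" for i X
  define den where "den i X = (SOME s. s \<in> ?S i \<and> X = frac R (?S i) (num i X) s)" for i X
  have nd: "num i X \<in> carrier R" "den i X \<in> ?S i" "X = frac R (?S i) (num i X) (den i X)" if X: "X \<in> carrier (M i)" and i: "i \<in> I" for i X
  proof -
    have "\<exists>a. a \<in> carrier R \<and> (\<exists>s\<in>?S i. X = frac R (?S i) a s)"
      using X localization_carrierE unfolding M[OF i] by metis
    then have n: "num i X \<in> carrier R \<and> (\<exists>s\<in>?S i. X = frac R (?S i) (num i X) s)" unfolding num_def by (rule someI_ex)
    then show "num i X \<in> carrier R" by blast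
    from n have "\<exists>s. s \<in> ?S i \<and> X = frac R (?S i) (num i X) s" by blast
    then have "den i X \<in> ?S i \<and> X = frac R (?S i) (num i X) (den i X)" unfolding den_def by (rule someI_ex)
    then show "den i X \<in> ?S i" "X = frac R (?S i) (num i X) (den i X)" by blast+
  qed
  define g where "g x = frac R D (\<Otimes>i\<in>I. num i (x i)) (\<Otimes>i\<in>I. den i (x i))" for x
  have gI: "g x = frac R D (\<Otimes>i\<in>I. a i) (\<Otimes>i\<in>I. s i)"
    if x: "\<And>i. i \<in> I \<Longrightarrow> x i = frac R (?S i) (a i) (s i)" and a: "\<And>i. i \<in> I \<Longrightarrow> a i \<in> carrier R" and s: "\<And>i. i \<in> I \<Longrightarrow> s i \<in> ?S i" for x a s
  proof -
    have xc: "x i \<in> carrier (M i)" if "i \<in> I" for i unfolding x[OF that] M[OF that] by (rule localization_carrierI[OF a[OF that] s[OF that]])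
    let ?n = "\<lambda>i. num i (x i)" and ?d = "\<lambda>i. den i (x i)"
    note nd' = nd[OF xc]
    have "\<exists>u\<in>?S i. u \<otimes> (s i \<otimes> ?n i) = u \<otimes> (?d i \<otimes> a i)" if i: "i \<in> I" for i
      using frac_eq_iff[OF S[OF i] nd'(1)[OF i i] a[OF i] nd'(2)[OF i i] s[OF i]] nd'(3)[OF i i] x[OF i] by simp
    then obtain u where u: "\<And>i. i \<in> I \<Longrightarrow> u i \<in> ?S i" "\<And>i. i \<in> I \<Longrightarrow> u i \<otimes> (s i \<otimes> ?n i) = u i \<otimes> (?d i \<otimes> a i)" by metis
    have uc: "u i \<in> carrier R" "s i \<in> carrier R" "?n i \<in> carrier R" "?d i \<in> carrier R" if "i \<in> I" for i
      using Sc[OF u(1)[OF that] that] Sc[OF s[OF that] that] nd'(1)[OF that that] Sc[OF nd'(2)[OF that that] that] .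
    have prod3: "(\<Otimes>i\<in>I. p i) \<otimes> ((\<Otimes>i\<in>I. q i) \<otimes> (\<Otimes>i\<in>I. r i)) = (\<Otimes>i\<in>I. p i \<otimes> (q i \<otimes> r i))"
      if "\<And>i. i \<in> I \<Longrightarrow> p i \<in> carrier R" "\<And>i. i \<in> I \<Longrightarrow> q i \<in> carrier R" "\<And>i. i \<in> I \<Longrightarrow> r i \<in> carrier R" for p q r
    proof -
      have "(\<Otimes>i\<in>I. p i \<otimes> (q i \<otimes> r i)) = (\<Otimes>i\<in>I. p i) \<otimes> (\<Otimes>i\<in>I. q i \<otimes> r i)" using that by (intro finprod_multf) auto
      also have "(\<Otimes>i\<in>I. q i \<otimes> r i) = (\<Otimes>i\<in>I. q i) \<otimes> (\<Otimes>i\<in>I. r i)" using that by (intro finprod_multf) auto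
      finally show ?thesis by simp
    qed
    have "(\<Otimes>i\<in>I. u i) \<otimes> ((\<Otimes>i\<in>I. s i) \<otimes> (\<Otimes>i\<in>I. ?n i)) = (\<Otimes>i\<in>I. u i) \<otimes> ((\<Otimes>i\<in>I. ?d i) \<otimes> (\<Otimes>i\<in>I. a i))"
    proof -
      have "(\<Otimes>i\<in>I. u i) \<otimes> ((\<Otimes>i\<in>I. s i) \<otimes> (\<Otimes>i\<in>I. ?n i)) = (\<Otimes>i\<in>I. u i \<otimes> (s i \<otimes> ?n i))"
        by (rule prod3) (use uc in auto)
      also have "\<dots> = (\<Otimes>i\<in>I. u i \<otimes> (?d i \<otimes> a i))" by (rule finprod_cong') (use uc a u(2) in auto)
      also have "\<dots> = (\<Otimes>i\<in>I. u i) \<otimes> ((\<Otimes>i\<in>I. ?d i) \<otimes> (\<Otimes>i\<in>I. a i))"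
        by (rule prod3[symmetric]) (use uc a in auto)
      finally show ?thesis .
    qed
    then show ?thesis unfolding g_def
      by (intro frac_eqI[OF D _ _ _ _ Dm[of u]] Dm) (use uc a u(1) s nd'(2) in \<open>auto intro!: finprod_closed\<close>)
  qed
  have ml: "multilinear_on I M (localization R D) g" unfolding multilinear_on_def
  proof (intro ballI conjI)
    fix x assume x: "x \<in> (\<Pi>\<^sub>E i\<in>I. carrier (M i))"
    then have xc: "x i \<in> carrier (M i)" if "i \<in> I" for i using PiE_mem[OF _ that] by blast
    note N = nd[OF xc]
    have dc: "den i (x i) \<in> carrier R" if "i \<in> I" for i using N(2)[OF that that] Sc that by blast
    show "g x \<in> carrier (localization R D)" unfolding g_def
      by (rule localization_carrierI[OF _ Dm]) (use N in \<open>auto intro!: finprod_closed\<close>)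
    fix i u assume i: "i \<in> I" and u: "u \<in> carrier (M i)"
    let ?P = "\<Otimes>j\<in>I - {i}. num j (x j)" and ?Q = "\<Otimes>j\<in>I - {i}. den j (x j)"
    have P: "?P \<in> carrier R" and Q: "?Q \<in> carrier R" using N dc by (auto intro!: finprod_closed)
    have gu: "g (x(i := frac R (?S i) a s)) = frac R D (a \<otimes> ?P) (s \<otimes> ?Q)" "s \<otimes> ?Q \<in> D"
      if a: "a \<in> carrier R" and s: "s \<in> ?S i" for a s
    proof -
      let ?a = "(\<lambda>j. num j (x j))(i := a)" and ?s = "(\<lambda>j. den j (x j))(i := s)"
      have sc: "s \<in> carrier R" using Sc[OF s i] .
      have A: "(\<Otimes>j\<in>I. ?a j) = a \<otimes> ?P" by (rule finprod_upd[OF fin i _ a]) (use N in auto)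
      have B: "(\<Otimes>j\<in>I. ?s j) = s \<otimes> ?Q" by (rule finprod_upd[OF fin i _ sc]) (use dc in auto)
      show "s \<otimes> ?Q \<in> D" unfolding B[symmetric] by (rule Dm) (use N s in auto)
      have "g (x(i := frac R (?S i) a s)) = frac R D (\<Otimes>j\<in>I. ?a j) (\<Otimes>j\<in>I. ?s j)"
        by (rule gI) (use N a s in auto)
      then show "g (x(i := frac R (?S i) a s)) = frac R D (a \<otimes> ?P) (s \<otimes> ?Q)" unfolding A B .
    qed
    obtain a s where as: "u = frac R (?S i) a s" "a \<in> carrier R" "s \<in> ?S i" using u localization_carrierE unfolding M[OF i] by metis
    have sc: "s \<in> carrier R" using Sc[OF as(3) i] .
    show "g (x(i := r \<odot>\<^bsub>M i\<^esub> u)) = r \<odot>\<^bsub>localization R D\<^esub> g (x(i := u))" if r: "r \<in> carrier R" for r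
    proof -
      have "r \<odot>\<^bsub>M i\<^esub> u = frac R (?S i) (r \<otimes> a) s" unfolding as(1) M[OF i] by (rule localization_smult[OF S[OF i] as(2) r as(3)])
      then have "g (x(i := r \<odot>\<^bsub>M i\<^esub> u)) = frac R D ((r \<otimes> a) \<otimes> ?P) (s \<otimes> ?Q)" using gu(1)[of "r \<otimes> a" s] as r by simp
      also have "\<dots> = r \<odot>\<^bsub>localization R D\<^esub> frac R D (a \<otimes> ?P) (s \<otimes> ?Q)"
        using localization_smult[OF D _ r gu(2)[OF as(2,3)], of "a \<otimes> ?P"] as r P by (simp add: m_assoc)
      finally show ?thesis using gu(1)[OF as(2,3)] as(1) by simp
    qed
    fix v assume v: "v \<in> carrier (M i)"
    obtain b t where bt: "v = frac R (?S i) b t" "b \<in> carrier R" "t \<in> ?S i" using v localization_carrierE unfolding M[OF i] by metis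
    have tc: "t \<in> carrier R" using Sc[OF bt(3) i] .
    have st: "s \<otimes> t \<in> ?S i" using mult_setD(3)[OF S[OF i] as(3) bt(3)] .
    have abc: "t \<otimes> a \<oplus> s \<otimes> b \<in> carrier R" using as bt sc tc by simp
    have uv: "u \<oplus>\<^bsub>M i\<^esub> v = frac R (?S i) (t \<otimes> a \<oplus> s \<otimes> b) (s \<otimes> t)" unfolding as(1) bt(1) M[OF i]
      by (rule localization_add[OF S[OF i] as(2) bt(2) as(3) bt(3)])
    have aP: "a \<otimes> ?P \<in> carrier R" "b \<otimes> ?P \<in> carrier R" using as bt P by auto
    have "g (x(i := u)) \<oplus>\<^bsub>localization R D\<^esub> g (x(i := v)) = frac R D ((t \<otimes> ?Q) \<otimes> (a \<otimes> ?P) \<oplus> (s \<otimes> ?Q) \<otimes> (b \<otimes> ?P)) ((s \<otimes> ?Q) \<otimes> (t \<otimes> ?Q))"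
      unfolding as(1) bt(1) gu(1)[OF as(2,3)] gu(1)[OF bt(2,3)]
      by (rule localization_add[OF D aP gu(2)[OF as(2,3)] gu(2)[OF bt(2,3)]])
    also have "\<dots> = frac R D ((t \<otimes> a \<oplus> s \<otimes> b) \<otimes> ?P) ((s \<otimes> t) \<otimes> ?Q)"
    proof (rule frac_eqI[OF D _ _ _ gu(2)[OF abc st] mult_setD(2)[OF D]])
      define p q where "p = ?P" and "q = ?Q"
      have pq: "p \<in> carrier R" "q \<in> carrier R" using P Q by (auto simp: p_def q_def)
      show "\<one> \<otimes> ((s \<otimes> t \<otimes> ?Q) \<otimes> ((t \<otimes> ?Q) \<otimes> (a \<otimes> ?P) \<oplus> (s \<otimes> ?Q) \<otimes> (b \<otimes> ?P))) = \<one> \<otimes> (((s \<otimes> ?Q) \<otimes> (t \<otimes> ?Q)) \<otimes> ((t \<otimes> a \<oplus> s \<otimes> b) \<otimes> ?P))"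
        unfolding p_def[symmetric] q_def[symmetric] using pq as(2) bt(2) sc tc by algebra
    qed (use aP P Q sc tc abc gu(2)[OF as(2,3)] gu(2)[OF bt(2,3)] mult_setD(3)[OF D] in auto)
    also have "\<dots> = g (x(i := u \<oplus>\<^bsub>M i\<^esub> v))" unfolding uv using gu(1)[OF abc st] by simp
    finally show "g (x(i := u \<oplus>\<^bsub>M i\<^esub> v)) = g (x(i := u)) \<oplus>\<^bsub>localization R D\<^esub> g (x(i := v))" by simp
  qed
  note L = tensor_lift_linear[OF c localization_module[OF D] ml]
  interpret LD: module R "localization R D" by (rule localization_module[OF D])
  show "r \<odot>\<^bsub>?T\<^esub> e k = \<zero>\<^bsub>?T\<^esub> \<longleftrightarrow> (\<exists>l. (\<Otimes>i\<in>I. w i [^] (l::nat)) \<otimes> r = \<zero>)" if r: "r \<in> carrier R"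
  proof
    assume 0: "r \<odot>\<^bsub>?T\<^esub> e k = \<zero>\<^bsub>?T\<^esub>"
    let ?L = "tensor_lift R (localization R D) g"
    have dD: "(\<Otimes>i\<in>I. w i [^] k) \<in> D" by (rule Dm) (rule powers_mem)
    have "g (\<lambda>i\<in>I. frac R (?S i) \<one> (w i [^] k)) = frac R D (\<Otimes>i\<in>I. \<one>) (\<Otimes>i\<in>I. w i [^] k)"
      by (rule gI) (use powers_mem in auto)
    then have Le: "?L (e k) = frac R D \<one> (\<Otimes>i\<in>I. w i [^] k)" unfolding e_def L(1)[OF o] by simp
    have L0: "?L \<zero>\<^bsub>?T\<^esub> = \<zero>\<^bsub>localization R D\<^esub>" using L(4)[of \<zero> "e k"] L(2)[OF ec] ec by simp
    have "frac R D r (\<Otimes>i\<in>I. w i [^] k) = \<zero>\<^bsub>localization R D\<^esub>"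
      using L(4)[OF r ec[of k]] localization_smult[OF D one_closed r dD] r unfolding 0 L0 Le by simp
    then obtain u where u: "u \<in> D" "u \<otimes> r = \<zero>" using frac_zero_iff[OF D r dD] by blast
    then obtain s where s: "u = (\<Otimes>i\<in>I. s i)" "\<forall>i\<in>I. s i \<in> ?S i" by (auto simp: D_def)
    then obtain m where m: "\<And>i. i \<in> I \<Longrightarrow> s i = w i [^] (m i :: nat)" unfolding powers_def by (auto, metis)
    have "(\<Otimes>i\<in>I. s i) = (\<Otimes>i\<in>I. w i [^] m i)" by (rule finprod_cong') (use m w in auto)
    then have 1: "(\<Otimes>i\<in>I. w i [^] m i) \<otimes> r = \<zero>" using u s by simp
    have "m i \<le> (\<Sum>i\<in>I. m i)" if "i \<in> I" for i using fin that by (simp add: member_le_sum)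
    then have "(\<Otimes>i\<in>I. w i [^] (\<Sum>i\<in>I. m i)) \<otimes> r = \<zero>"
      using finprod_nat_pow_mono[of I w r m "\<Sum>i\<in>I. m i"] fin w r 1 by blast
    then show "\<exists>l. (\<Otimes>i\<in>I. w i [^] (l::nat)) \<otimes> r = \<zero>" by blast
  next
    assume "\<exists>l. (\<Otimes>i\<in>I. w i [^] (l::nat)) \<otimes> r = \<zero>"
    then obtain l where l: "(\<Otimes>i\<in>I. w i [^] (l::nat)) \<otimes> r = \<zero>" by blast
    have "r \<odot>\<^bsub>?T\<^esub> e k = (r \<otimes> (\<Otimes>i\<in>I. w i [^] l)) \<odot>\<^bsub>?T\<^esub> e (k + l)"
      unfolding eshift[of k l] using r wp ec by (simp add: T.smult_assoc1)
    also have "\<dots> = \<zero>\<^bsub>?T\<^esub>" using l r wp ec by (simp add: m_comm)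
    finally show "r \<odot>\<^bsub>?T\<^esub> e k = \<zero>\<^bsub>?T\<^esub>" .
  qed
qed

end

section \<open>Additive maps and maps on quotients\<close>

definition additive_map :: "('a, 'b) module \<Rightarrow> ('a, 'c) module \<Rightarrow> ('b \<Rightarrow> 'c) \<Rightarrow> bool" where
  "additive_map K D h \<longleftrightarrow> (\<forall>x\<in>carrier K. h x \<in> carrier D) \<and>
     (\<forall>x\<in>carrier K. \<forall>y\<in>carrier K. h (x \<oplus>\<^bsub>K\<^esub> y) = h x \<oplus>\<^bsub>D\<^esub> h y)"

lemma additive_map_group:
  assumes K: "abelian_group K" and D: "abelian_group D" and h: "additive_map K D h"
  shows "h \<zero>\<^bsub>K\<^esub> = \<zero>\<^bsub>D\<^esub>"
    and "x \<in> carrier K \<Longrightarrow> h (\<ominus>\<^bsub>K\<^esub> x) = \<ominus>\<^bsub>D\<^esub> h x"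
    and "x \<in> carrier K \<Longrightarrow> y \<in> carrier K \<Longrightarrow> h (x \<ominus>\<^bsub>K\<^esub> y) = h x \<ominus>\<^bsub>D\<^esub> h y"
proof -
  interpret K: abelian_group K by (rule K)
  interpret D: abelian_group D by (rule D)
  have c: "h x \<in> carrier D" if "x \<in> carrier K" for x using h that by (auto simp: additive_map_def)
  have a: "h (x \<oplus>\<^bsub>K\<^esub> y) = h x \<oplus>\<^bsub>D\<^esub> h y" if "x \<in> carrier K" "y \<in> carrier K" for x y using h that by (auto simp: additive_map_def)
  show 0: "h \<zero>\<^bsub>K\<^esub> = \<zero>\<^bsub>D\<^esub>" using a[of "\<zero>\<^bsub>K\<^esub>" "\<zero>\<^bsub>K\<^esub>"] c[of "\<zero>\<^bsub>K\<^esub>"] by simp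
  show m: "h (\<ominus>\<^bsub>K\<^esub> x) = \<ominus>\<^bsub>D\<^esub> h x" if x: "x \<in> carrier K" for x
  proof (rule D.minus_equality[symmetric])
    show "h (\<ominus>\<^bsub>K\<^esub> x) \<oplus>\<^bsub>D\<^esub> h x = \<zero>\<^bsub>D\<^esub>" using a[of "\<ominus>\<^bsub>K\<^esub> x" x] x 0 by (simp add: K.l_neg)
  qed (use c x in auto)
  show "h (x \<ominus>\<^bsub>K\<^esub> y) = h x \<ominus>\<^bsub>D\<^esub> h y" if "x \<in> carrier K" "y \<in> carrier K"
    using that by (simp add: a_minus_def a m)
qed

lemma additive_map_image_subgroup:
  assumes K: "abelian_group K" and D: "abelian_group D" and h: "additive_map K D h"
  shows "abelian_subgroup (h ` carrier K) D"
proof (rule abelian_subgroupI3[OF _ D])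
  interpret K: abelian_group K by (rule K)
  interpret D: abelian_group D by (rule D)
  note H = additive_map_group[OF K D h]
  have c: "h x \<in> carrier D" if "x \<in> carrier K" for x using h that by (auto simp: additive_map_def)
  show "additive_subgroup (h ` carrier K) D"
  proof (rule additive_subgroup.intro, rule group.subgroupI[OF D.a_group])
    show "h ` carrier K \<noteq> {}" using K.zero_closed by blast
    show "inv\<^bsub>add_monoid D\<^esub> a \<in> h ` carrier K" if a: "a \<in> h ` carrier K" for a
    proof -
      obtain x where "x \<in> carrier K" "a = h x" using a by auto
      then have "\<ominus>\<^bsub>D\<^esub> a = h (\<ominus>\<^bsub>K\<^esub> x)" using H(2) by simp
      then show ?thesis using \<open>x \<in> carrier K\<close> by (auto simp: a_inv_def[symmetric])
    qed
    show "a \<otimes>\<^bsub>add_monoid D\<^esub> b \<in> h ` carrier K" if ab: "a \<in> h ` carrier K" "b \<in> h ` carrier K" for a b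
    proof -
      obtain x y where "x \<in> carrier K" "a = h x" "y \<in> carrier K" "b = h y" using ab by auto
      then have "a \<oplus>\<^bsub>D\<^esub> b = h (x \<oplus>\<^bsub>K\<^esub> y)" using h by (simp add: additive_map_def)
      then show ?thesis using \<open>x \<in> carrier K\<close> \<open>y \<in> carrier K\<close> by auto
    qed
  qed (use c in auto)
qed

lemma zero_abelian_subgroup:
  assumes D: "abelian_group D" shows "abelian_subgroup {\<zero>\<^bsub>D\<^esub>} D"
proof (rule abelian_subgroupI3[OF _ D])
  interpret D: abelian_group D by (rule D)
  show "additive_subgroup {\<zero>\<^bsub>D\<^esub>} D"
    by (rule additive_subgroup.intro, rule group.subgroupI[OF D.a_group]) (auto simp: a_inv_def[symmetric])
qed

lemma coset_eq_iff:
  assumes B: "abelian_subgroup B K" and xy: "x \<in> carrier K" "y \<in> carrier K"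
  shows "B +>\<^bsub>K\<^esub> x = B +>\<^bsub>K\<^esub> y \<longleftrightarrow> x \<ominus>\<^bsub>K\<^esub> y \<in> B"
proof -
  interpret B: abelian_subgroup B K by (rule B)
  have "x \<in> B +>\<^bsub>K\<^esub> y \<longleftrightarrow> x \<ominus>\<^bsub>K\<^esub> y \<in> B" using B.a_rcos_module[OF xy(2,1)] by (simp add: a_minus_def)
  moreover have "B +>\<^bsub>K\<^esub> x = B +>\<^bsub>K\<^esub> y \<longleftrightarrow> x \<in> B +>\<^bsub>K\<^esub> y"
    using B.a_repr_independence'[of x y] B.a_repr_independenceD[of x y] xy by auto
  ultimately show ?thesis by simp
qed

text \<open>
  Applied with \<open>Z\<close> the cocycles, \<open>B\<close> and \<open>C\<close> the coboundaries.
\<close>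

lemma quotient_map_inj_iff:
  fixes K :: "('a, 'b) module" and D :: "('a, 'c) module"
  assumes K: "abelian_group K" and D: "abelian_group D" and h: "additive_map K D h"
    and B: "abelian_subgroup B K" and C: "abelian_subgroup C D" and hB: "\<And>x. x \<in> B \<Longrightarrow> h x \<in> C"
    and Z: "Z \<subseteq> carrier K" "\<zero>\<^bsub>K\<^esub> \<in> Z" "\<And>x y. x \<in> Z \<Longrightarrow> y \<in> Z \<Longrightarrow> x \<ominus>\<^bsub>K\<^esub> y \<in> Z"
  shows "inj_on (\<lambda>X. the_elem ((\<lambda>x. C +>\<^bsub>D\<^esub> h x) ` X)) ((\<lambda>x. B +>\<^bsub>K\<^esub> x) ` Z) \<longleftrightarrow> (\<forall>x\<in>Z. h x \<in> C \<longrightarrow> x \<in> B)"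
proof -
  interpret K: abelian_group K by (rule K)
  interpret D: abelian_group D by (rule D)
  interpret B: abelian_subgroup B K by (rule B)
  interpret C: abelian_subgroup C D by (rule C)
  note H = additive_map_group[OF K D h]
  let ?m = "\<lambda>X. the_elem ((\<lambda>x. C +>\<^bsub>D\<^esub> h x) ` X)"
  have c: "h x \<in> carrier D" if "x \<in> carrier K" for x using h that by (auto simp: additive_map_def)
  have val: "?m (B +>\<^bsub>K\<^esub> x) = C +>\<^bsub>D\<^esub> h x" if x: "x \<in> carrier K" for x
  proof (rule the_elem_image_singleton)
    show "x \<in> B +>\<^bsub>K\<^esub> x" by (rule B.a_rcos_self[OF x])
    fix y assume y: "y \<in> B +>\<^bsub>K\<^esub> x"
    have yc: "y \<in> carrier K" by (rule B.a_elemrcos_carrier[OF x y])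
    have "y \<ominus>\<^bsub>K\<^esub> x \<in> B" using B.a_rcos_module_imp[OF x y] by (simp add: a_minus_def)
    then have "h y \<ominus>\<^bsub>D\<^esub> h x \<in> C" using hB H(3)[OF yc x] by metis
    then show "C +>\<^bsub>D\<^esub> h y = C +>\<^bsub>D\<^esub> h x" using coset_eq_iff[OF C c[OF yc] c[OF x]] by simp
  qed
  show ?thesis
  proof
    assume inj: "inj_on ?m ((\<lambda>x. B +>\<^bsub>K\<^esub> x) ` Z)"
    show "\<forall>x\<in>Z. h x \<in> C \<longrightarrow> x \<in> B"
    proof (intro ballI impI)
      fix x assume x: "x \<in> Z" "h x \<in> C"
      have xc: "x \<in> carrier K" using x Z by auto
      have "h x \<ominus>\<^bsub>D\<^esub> h \<zero>\<^bsub>K\<^esub> \<in> C" using x c[OF xc] H(1) by (simp add: a_minus_def)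
      then have "C +>\<^bsub>D\<^esub> h x = C +>\<^bsub>D\<^esub> h \<zero>\<^bsub>K\<^esub>" using coset_eq_iff[OF C c[OF xc] c[OF K.zero_closed]] by simp
      then have "?m (B +>\<^bsub>K\<^esub> x) = ?m (B +>\<^bsub>K\<^esub> \<zero>\<^bsub>K\<^esub>)" using val xc by simp
      then have "B +>\<^bsub>K\<^esub> x = B +>\<^bsub>K\<^esub> \<zero>\<^bsub>K\<^esub>" using inj x Z(2) by (auto dest: inj_onD)
      then have "x \<ominus>\<^bsub>K\<^esub> \<zero>\<^bsub>K\<^esub> \<in> B" using coset_eq_iff[OF B xc K.zero_closed] by simp
      moreover have "\<ominus>\<^bsub>K\<^esub> \<zero>\<^bsub>K\<^esub> = \<zero>\<^bsub>K\<^esub>" by (rule K.minus_equality) auto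
      ultimately show "x \<in> B" using xc by (simp add: a_minus_def)
    qed
  next
    assume *: "\<forall>x\<in>Z. h x \<in> C \<longrightarrow> x \<in> B"
    show "inj_on ?m ((\<lambda>x. B +>\<^bsub>K\<^esub> x) ` Z)"
    proof (rule inj_onI)
      fix X Y assume "X \<in> (\<lambda>x. B +>\<^bsub>K\<^esub> x) ` Z" "Y \<in> (\<lambda>x. B +>\<^bsub>K\<^esub> x) ` Z" and e: "?m X = ?m Y"
      then obtain x y where x: "x \<in> Z" "X = B +>\<^bsub>K\<^esub> x" and y: "y \<in> Z" "Y = B +>\<^bsub>K\<^esub> y" by auto
      have xc: "x \<in> carrier K" and yc: "y \<in> carrier K" using x y Z by auto
      have "C +>\<^bsub>D\<^esub> h x = C +>\<^bsub>D\<^esub> h y" using e val xc yc x y by simp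
      then have "h (x \<ominus>\<^bsub>K\<^esub> y) \<in> C" using coset_eq_iff[OF C c[OF xc] c[OF yc]] H(3)[OF xc yc] by simp
      then have "x \<ominus>\<^bsub>K\<^esub> y \<in> B" using * Z(3)[OF x(1) y(1)] by blast
      then show "X = Y" using coset_eq_iff[OF B xc yc] x y by simp
    qed
  qed
qed

lemma prod_module_abelian_group:
  assumes M: "\<And>j. j \<in> J \<Longrightarrow> abelian_group (M j)"
  shows "abelian_group (prod_module J M)"
proof (rule abelian_groupI)
  let ?P = "prod_module J M"
  have G: "abelian_group (M j)" if "j \<in> J" for j by (rule M[OF that])
  note clo = abelian_monoid.a_closed[OF abelian_group.axioms(1)[OF G]]
  show "x \<oplus>\<^bsub>?P\<^esub> y \<in> carrier ?P" if "x \<in> carrier ?P" "y \<in> carrier ?P" for x y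
    using that clo by (auto simp: prod_module_def PiE_iff)
  show "\<zero>\<^bsub>?P\<^esub> \<in> carrier ?P"
    using abelian_monoid.zero_closed[OF abelian_group.axioms(1)[OF G]] by (auto simp: prod_module_def)
  show "x \<oplus>\<^bsub>?P\<^esub> y \<oplus>\<^bsub>?P\<^esub> z = x \<oplus>\<^bsub>?P\<^esub> (y \<oplus>\<^bsub>?P\<^esub> z)" if "x \<in> carrier ?P" "y \<in> carrier ?P" "z \<in> carrier ?P" for x y z
    using that abelian_monoid.a_assoc[OF abelian_group.axioms(1)[OF G]] by (auto simp: prod_module_def PiE_iff fun_eq_iff)
  show "x \<oplus>\<^bsub>?P\<^esub> y = y \<oplus>\<^bsub>?P\<^esub> x" if "x \<in> carrier ?P" "y \<in> carrier ?P" for x y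
    using that abelian_monoid.a_comm[OF abelian_group.axioms(1)[OF G]] by (auto simp: prod_module_def PiE_iff fun_eq_iff)
  show "\<zero>\<^bsub>?P\<^esub> \<oplus>\<^bsub>?P\<^esub> x = x" if "x \<in> carrier ?P" for x
    using that abelian_monoid.l_zero[OF abelian_group.axioms(1)[OF G]] by (auto simp: prod_module_def PiE_iff fun_eq_iff extensional_def)
  show "\<exists>y\<in>carrier ?P. y \<oplus>\<^bsub>?P\<^esub> x = \<zero>\<^bsub>?P\<^esub>" if "x \<in> carrier ?P" for x
    by (rule bexI[of _ "\<lambda>j\<in>J. \<ominus>\<^bsub>M j\<^esub> x j"])
      (use that abelian_group.l_neg[OF G] abelian_group.a_inv_closed[OF G] in \<open>auto simp: prod_module_def PiE_iff fun_eq_iff\<close>)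
qed

lemma zero_module_module:
  assumes "module R M" shows "module R (zero_module M)"
proof -
  interpret module R M by (rule assms)
  have "submodule {\<zero>\<^bsub>M\<^esub>} R M" by (rule submoduleI) auto
  then show ?thesis unfolding zero_module_def using submodule.submodule_is_module assms by blast
qed

lemma zero_module_simps [simp]: "carrier (zero_module M) = {\<zero>\<^bsub>M\<^esub>}" "\<zero>\<^bsub>zero_module M\<^esub> = \<zero>\<^bsub>M\<^esub>"
  "x \<oplus>\<^bsub>zero_module M\<^esub> y = x \<oplus>\<^bsub>M\<^esub> y" "r \<odot>\<^bsub>zero_module M\<^esub> x = r \<odot>\<^bsub>M\<^esub> x"
  by (auto simp: zero_module_def)

section \<open>Squarefree multidegrees\<close>

text \<open>
  The Koszul and Cech terms of multidegree \<open>f\<close> vanish unless \<open>f\<close> takes only the values 0 and 1, that is, unless \<open>f\<close> is the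
  indicator function of a set of indices. The next definitions translate between the two.
\<close>

definition supp1 :: "nat \<Rightarrow> (nat \<Rightarrow> nat) \<Rightarrow> nat set" where
  "supp1 t f = {i. i < t \<and> f i = 1}"

definition chi :: "nat \<Rightarrow> nat set \<Rightarrow> nat \<Rightarrow> nat" where
  "chi t S = (\<lambda>i\<in>{..<t}. if i \<in> S then 1 else 0)"

definition sqfree :: "nat \<Rightarrow> (nat \<Rightarrow> nat) \<Rightarrow> bool" where
  "sqfree t f \<longleftrightarrow> (\<forall>i<t. f i \<le> 1)"

lemma sqfree_sum: "sqfree t f \<Longrightarrow> (\<Sum>i<t. f i) = card (supp1 t f)"
proof -
  assume "sqfree t f"
  then have "(\<Sum>i<t. f i) = (\<Sum>i<t. if i \<in> supp1 t f then 1 else 0)"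
    by (intro sum.cong) (auto simp: sqfree_def supp1_def le_Suc_eq)
  also have "\<dots> = card ({..<t} \<inter> supp1 t f)" by (simp add: sum.inter_restrict[symmetric])
  also have "{..<t} \<inter> supp1 t f = supp1 t f" by (auto simp: supp1_def)
  finally show ?thesis .
qed

lemma chi_props:
  assumes "S \<subseteq> {..<t}"
  shows "sqfree t (chi t S)" "supp1 t (chi t S) = S" "chi t S \<in> multidegrees t (card S)"
proof -
  show 1: "sqfree t (chi t S)" by (auto simp: sqfree_def chi_def)
  show 2: "supp1 t (chi t S) = S" using assms by (auto simp: supp1_def chi_def)
  have "chi t S \<in> {..<t} \<rightarrow>\<^sub>E UNIV" by (auto simp: chi_def)
  then show "chi t S \<in> multidegrees t (card S)" using sqfree_sum[OF 1] 2 by (simp add: multidegrees_def)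
qed

lemma chi_supp1: "f \<in> multidegrees t m \<Longrightarrow> sqfree t f \<Longrightarrow> chi t (supp1 t f) = f"
  by (auto simp: multidegrees_def sqfree_def chi_def supp1_def fun_eq_iff PiE_iff extensional_def le_Suc_eq)

lemma supp1_card: "f \<in> multidegrees t m \<Longrightarrow> sqfree t f \<Longrightarrow> card (supp1 t f) = m"
  using sqfree_sum by (auto simp: multidegrees_def)

lemma supp1_subset: "supp1 t f \<subseteq> {..<t}" by (auto simp: supp1_def)

lemma multidegrees_lower:
  assumes g: "g \<in> multidegrees t (Suc m)" and i: "i < t" "0 < g i"
  shows "g(i := g i - 1) \<in> multidegrees t m"
proof -
  have s: "(\<Sum>j<t. g j) = Suc m" and e: "g \<in> {..<t} \<rightarrow>\<^sub>E UNIV" using g by (auto simp: multidegrees_def)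
  have "(\<Sum>j<t. (g(i := g i - 1)) j) = (g i - 1) + (\<Sum>j\<in>{..<t} - {i}. g j)" using i by (subst sum.remove[of _ i]) auto
  moreover have "(\<Sum>j<t. g j) = g i + (\<Sum>j\<in>{..<t} - {i}. g j)" using i by (subst sum.remove[of _ i]) auto
  ultimately have "(\<Sum>j<t. (g(i := g i - 1)) j) = m" using s i by simp
  moreover have "g(i := g i - 1) \<in> {..<t} \<rightarrow>\<^sub>E UNIV" using e i by (auto simp: PiE_iff extensional_def)
  ultimately show ?thesis by (simp add: multidegrees_def)
qed

lemma sqfree_lower: "sqfree t g \<Longrightarrow> sqfree t (g(i := g i - 1))"
  by (auto simp: sqfree_def intro: le_trans[OF diff_le_self])

context cring begin

section \<open>Tensor products of complexes\<close>

definition linear_cochain :: "('a, 'd) cochain \<Rightarrow> bool" where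
  "linear_cochain C \<longleftrightarrow> (\<forall>p. module R (cterm C p) \<and> (\<forall>u\<in>carrier (cterm C p). cdiff C p u \<in> carrier (cterm C (Suc p)) \<and>
     (\<forall>v\<in>carrier (cterm C p). cdiff C p (u \<oplus>\<^bsub>cterm C p\<^esub> v) = cdiff C p u \<oplus>\<^bsub>cterm C (Suc p)\<^esub> cdiff C p v) \<and>
     (\<forall>r\<in>carrier R. cdiff C p (r \<odot>\<^bsub>cterm C p\<^esub> u) = r \<odot>\<^bsub>cterm C (Suc p)\<^esub> cdiff C p u)))"

lemma add_closed_modules: "(\<And>i. i \<in> I \<Longrightarrow> module R (M i)) \<Longrightarrow> add_closed I M"
proof -
  assume M: "\<And>i. i \<in> I \<Longrightarrow> module R (M i)"
  show ?thesis unfolding add_closed_def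
  proof (intro ballI conjI)
    fix i u v assume i: "i \<in> I" "u \<in> carrier (M i)" "v \<in> carrier (M i)"
    interpret Mi: module R "M i" by (rule M[OF i(1)])
    show "u \<oplus>\<^bsub>M i\<^esub> v \<in> carrier (M i)" using i by simp
  next
    fix i r u assume i: "i \<in> I" "r \<in> carrier R" "u \<in> carrier (M i)"
    interpret Mi: module R "M i" by (rule M[OF i(1)])
    show "r \<odot>\<^bsub>M i\<^esub> u \<in> carrier (M i)" using i by simp
  qed
qed

text \<open>
  The element \<open>p f\<close> plays the part of a generator of the term of multidegree \<open>f\<close>. If it is only a fraction in a
  localization, then not every cochain has coordinates, and they need not be unique.
\<close>

definition has_coords where
  "has_coords t C p m \<omega> c \<longleftrightarrow> coch c \<and>
     (\<forall>S\<subseteq>{..<t}. card S = m \<longrightarrow> \<omega> (chi t S) = c S \<odot>\<^bsub>tensor_term R t C (chi t S)\<^esub> p (chi t S))"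

context
  fixes t :: nat and C :: "nat \<Rightarrow> ('a, 'd) cochain"
  assumes C: "\<And>i. i < t \<Longrightarrow> linear_cochain (C i)"
begin

lemma cterm_module: "i < t \<Longrightarrow> module R (cterm (C i) p)"
  using C by (auto simp: linear_cochain_def)

lemma tensor_term_add_closed: "add_closed {..<t} (\<lambda>i. cterm (C i) (f i))"
  by (rule add_closed_modules) (use cterm_module in auto)

lemma tensor_term_module: "module R (tensor_term R t C f)"
  unfolding tensor_term_def by (rule tensor_module[OF tensor_term_add_closed])

abbreviation "T \<equiv> tensor_term R t C"
abbreviation "TX \<equiv> tensor_complex R t C"

abbreviation diff_at :: "nat \<Rightarrow> (nat \<Rightarrow> nat) \<Rightarrow> ((nat \<Rightarrow> 'd) \<Rightarrow> 'a) set \<Rightarrow> ((nat \<Rightarrow> 'd) \<Rightarrow> 'a) set" where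
  "diff_at i g \<equiv> tensor_map R {..<t} (\<lambda>j. cterm (C j) (g j)) (\<lambda>j. if j = i then cdiff (C i) (g i - 1) else id)"

lemma diff_at_linear:
  assumes i: "i < t" "0 < g i"
  defines "f \<equiv> g(i := g i - 1)"
  shows "x \<in> (\<Pi>\<^sub>E j\<in>{..<t}. carrier (cterm (C j) (f j))) \<Longrightarrow> diff_at i g (pure_tensor R {..<t} (\<lambda>j. cterm (C j) (f j)) x) =
      pure_tensor R {..<t} (\<lambda>j. cterm (C j) (g j)) (\<lambda>j\<in>{..<t}. (if j = i then cdiff (C i) (g i - 1) else id) (x j))"
    and "X \<in> carrier (T f) \<Longrightarrow> diff_at i g X \<in> carrier (T g)"
    and "X \<in> carrier (T f) \<Longrightarrow> Y \<in> carrier (T f) \<Longrightarrow>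
      diff_at i g (X \<oplus>\<^bsub>T f\<^esub> Y) = diff_at i g X \<oplus>\<^bsub>T g\<^esub> diff_at i g Y"
    and "r \<in> carrier R \<Longrightarrow> X \<in> carrier (T f) \<Longrightarrow>
      diff_at i g (r \<odot>\<^bsub>T f\<^esub> X) = r \<odot>\<^bsub>T g\<^esub> diff_at i g X"
proof -
  let ?h = "\<lambda>j. if j = i then cdiff (C i) (g i - 1) else id"
  have Ci: "linear_cochain (C i)" using C i by simp
  have h: "?h j u \<in> carrier (cterm (C j) (g j))" "?h j (u \<oplus>\<^bsub>cterm (C j) (f j)\<^esub> v) = ?h j u \<oplus>\<^bsub>cterm (C j) (g j)\<^esub> ?h j v"
    "?h j (r \<odot>\<^bsub>cterm (C j) (f j)\<^esub> u) = r \<odot>\<^bsub>cterm (C j) (g j)\<^esub> ?h j u"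
    if "u \<in> carrier (cterm (C j) (f j))" "v \<in> carrier (cterm (C j) (f j))" "r \<in> carrier R" for j u v r
  proof -
    have gi: "Suc (g i - 1) = g i" using i by simp
    show "?h j u \<in> carrier (cterm (C j) (g j))" "?h j (u \<oplus>\<^bsub>cterm (C j) (f j)\<^esub> v) = ?h j u \<oplus>\<^bsub>cterm (C j) (g j)\<^esub> ?h j v"
    "?h j (r \<odot>\<^bsub>cterm (C j) (f j)\<^esub> u) = r \<odot>\<^bsub>cterm (C j) (g j)\<^esub> ?h j u"
      using that Ci[unfolded linear_cochain_def, rule_format, of "g i - 1"] gi by (auto simp: f_def)
  qed
  note L = tensor_map_linear[where M = "\<lambda>j. cterm (C j) (f j)" and N = "\<lambda>j. cterm (C j) (g j)" and h = ?h,
      OF tensor_term_add_closed tensor_term_add_closed h(1)[OF _ _ zero_closed] h(2)[OF _ _ zero_closed] h(3)]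
  show "x \<in> (\<Pi>\<^sub>E j\<in>{..<t}. carrier (cterm (C j) (f j))) \<Longrightarrow> diff_at i g (pure_tensor R {..<t} (\<lambda>j. cterm (C j) (f j)) x) =
      pure_tensor R {..<t} (\<lambda>j. cterm (C j) (g j)) (\<lambda>j\<in>{..<t}. ?h j (x j))"
    by (rule L(1)) auto
  show "X \<in> carrier (T f) \<Longrightarrow> diff_at i g X \<in> carrier (T g)"
    unfolding tensor_term_def by (rule L(2)) auto
  show "X \<in> carrier (T f) \<Longrightarrow> Y \<in> carrier (T f) \<Longrightarrow>
      diff_at i g (X \<oplus>\<^bsub>T f\<^esub> Y) = diff_at i g X \<oplus>\<^bsub>T g\<^esub> diff_at i g Y"
    unfolding tensor_term_def by (rule L(3)) auto
  show "r \<in> carrier R \<Longrightarrow> X \<in> carrier (T f) \<Longrightarrow>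
      diff_at i g (r \<odot>\<^bsub>T f\<^esub> X) = r \<odot>\<^bsub>T g\<^esub> diff_at i g X"
    unfolding tensor_term_def by (rule L(4)) auto
qed

lemma sign_closed: "(\<ominus> \<one>) [^] (k::nat) \<in> carrier R" by simp

lemma tensor_diff_additive:
  "additive_map (cterm TX m) (cterm TX (Suc m)) (cdiff TX m)"
proof -
  let ?T = "T"
  have T: "module R (?T f)" for f by (rule tensor_term_module)
  have car: "\<omega> f \<in> carrier (?T f)" if "\<omega> \<in> carrier (cterm TX m)" "f \<in> multidegrees t m" for \<omega> f
    using that by (auto simp: tensor_complex_def prod_module_def)
  have cl: "(\<ominus> \<one>) [^] (\<Sum>j<i. g j) \<odot>\<^bsub>?T g\<^esub> diff_at i g (\<omega> (g(i := g i - 1))) \<in> carrier (?T g)"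
    if "\<omega> \<in> carrier (cterm TX m)" "g \<in> multidegrees t (Suc m)" "i < t" "0 < g i" for \<omega> g i
  proof -
    interpret module R "?T g" by (rule T)
    show ?thesis using diff_at_linear(2)[where g = g, OF that(3,4) car[OF that(1) multidegrees_lower[OF that(2-4)]]] by simp
  qed
  show ?thesis unfolding additive_map_def
  proof (intro conjI ballI)
    fix \<omega> assume w: "\<omega> \<in> carrier (cterm TX m)"
    have "tensor_diff R t C m \<omega> g \<in> carrier (?T g)" if g: "g \<in> multidegrees t (Suc m)" for g
    proof -
      interpret module R "?T g" by (rule T)
      have "tensor_diff R t C m \<omega> g = (\<Oplus>\<^bsub>?T g\<^esub>i\<in>{i. i < t \<and> 0 < g i}.
          (\<ominus> \<one>) [^] (\<Sum>j<i. g j) \<odot>\<^bsub>?T g\<^esub> diff_at i g (\<omega> (g(i := g i - 1))))"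
        unfolding tensor_diff_def using g by simp
      also have "\<dots> \<in> carrier (?T g)" by (rule M.finsum_closed) (use cl[OF w g] in auto)
      finally show ?thesis .
    qed
    then show "cdiff TX m \<omega> \<in> carrier (cterm TX (Suc m))"
      by (auto simp: tensor_complex_def prod_module_def tensor_diff_def)
    fix \<eta> assume e: "\<eta> \<in> carrier (cterm TX m)"
    let ?s = "\<lambda>g. \<lambda>\<omega>. \<lambda>i. (\<ominus> \<one>) [^] (\<Sum>j<i. g j) \<odot>\<^bsub>?T g\<^esub> diff_at i g (\<omega> (g(i := g i - 1)))"
    have "tensor_diff R t C m (\<omega> \<oplus>\<^bsub>cterm TX m\<^esub> \<eta>) g = tensor_diff R t C m \<omega> g \<oplus>\<^bsub>?T g\<^esub> tensor_diff R t C m \<eta> g"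
      if g: "g \<in> multidegrees t (Suc m)" for g
    proof -
      interpret module R "?T g" by (rule T)
      let ?J = "{i. i < t \<and> 0 < g i}"
      have "(\<Oplus>\<^bsub>?T g\<^esub>i\<in>?J. ?s g (\<omega> \<oplus>\<^bsub>cterm TX m\<^esub> \<eta>) i) = (\<Oplus>\<^bsub>?T g\<^esub>i\<in>?J. ?s g \<omega> i \<oplus>\<^bsub>?T g\<^esub> ?s g \<eta> i)"
      proof (rule M.finsum_cong')
        fix i assume i: "i \<in> ?J"
        let ?f = "g(i := g i - 1)"
        have f: "?f \<in> multidegrees t m" using multidegrees_lower[OF g] i by simp
        have "(\<omega> \<oplus>\<^bsub>cterm TX m\<^esub> \<eta>) ?f = \<omega> ?f \<oplus>\<^bsub>?T ?f\<^esub> \<eta> ?f" using f by (simp add: tensor_complex_def prod_module_def)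
        moreover have "diff_at i g (\<omega> ?f \<oplus>\<^bsub>?T ?f\<^esub> \<eta> ?f) = diff_at i g (\<omega> ?f) \<oplus>\<^bsub>?T g\<^esub> diff_at i g (\<eta> ?f)"
          by (rule diff_at_linear(3)) (use i car[OF w f] car[OF e f] in auto)
        moreover have "diff_at i g (\<omega> ?f) \<in> carrier (?T g)" "diff_at i g (\<eta> ?f) \<in> carrier (?T g)"
          using diff_at_linear(2)[of i g] i car[OF w f] car[OF e f] by auto
        ultimately show "?s g (\<omega> \<oplus>\<^bsub>cterm TX m\<^esub> \<eta>) i = ?s g \<omega> i \<oplus>\<^bsub>?T g\<^esub> ?s g \<eta> i"
          by (simp only: smult_r_distr sign_closed)
      qed (use cl[OF w g] cl[OF e g] in auto)
      also have "\<dots> = (\<Oplus>\<^bsub>?T g\<^esub>i\<in>?J. ?s g \<omega> i) \<oplus>\<^bsub>?T g\<^esub> (\<Oplus>\<^bsub>?T g\<^esub>i\<in>?J. ?s g \<eta> i)"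
        by (rule M.finsum_addf) (use cl[OF w g] cl[OF e g] in auto)
      finally show ?thesis unfolding tensor_diff_def using g by simp
    qed
    then show "cdiff TX m (\<omega> \<oplus>\<^bsub>cterm TX m\<^esub> \<eta>) =
      cdiff TX m \<omega> \<oplus>\<^bsub>cterm TX (Suc m)\<^esub> cdiff TX m \<eta>"
      by (auto simp: tensor_complex_def prod_module_def tensor_diff_def fun_eq_iff)
  qed
qed

text \<open>
  In a squarefree multidegree the signs of the tensor differential are those of Koszul cochains.
\<close>

lemma tensor_diff_coord:
  assumes g: "g \<in> multidegrees t (Suc m)" "sqfree t g" and p: "p \<in> carrier (T g)"
    and r: "\<And>i. i \<in> supp1 t g \<Longrightarrow> r i \<in> carrier R"
      "\<And>i. i \<in> supp1 t g \<Longrightarrow> diff_at i g (\<omega> (g(i := g i - 1))) = r i \<odot>\<^bsub>T g\<^esub> p"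
  shows "tensor_diff R t C m \<omega> g = (\<Oplus>i\<in>supp1 t g. ksign i (supp1 t g) \<otimes> r i) \<odot>\<^bsub>T g\<^esub> p"
proof -
  let ?T = "T g" and ?S = "supp1 t g"
  note R_insert = finsum_insert and R_closed = finsum_closed
  interpret module R ?T by (rule tensor_term_module)
  have J: "{i. i < t \<and> 0 < g i} = ?S" using g(2) by (auto simp: supp1_def sqfree_def le_Suc_eq)
  have fin: "finite ?S" using finite_subset[OF supp1_subset] by blast
  have sgn: "(\<ominus> \<one>) [^] (\<Sum>j<i. g j) = ksign i ?S" if i: "i \<in> ?S" for i
  proof -
    have it: "i < t" using i by (simp add: supp1_def)
    have "(\<Sum>j<i. g j) = (\<Sum>j<i. if j \<in> ?S then 1 else 0)"
    proof (rule sum.cong[OF refl])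
      fix j assume "j \<in> {..<i}"
      then have "j < t" using it by simp
      then show "g j = (if j \<in> ?S then 1 else 0)" using g(2) by (auto simp: supp1_def sqfree_def le_Suc_eq)
    qed
    also have "\<dots> = card ({..<i} \<inter> ?S)" by (simp add: sum.inter_restrict[symmetric])
    also have "{..<i} \<inter> ?S = {j \<in> ?S. j < i}" by auto
    finally show ?thesis by (simp add: ksign_def)
  qed
  have "tensor_diff R t C m \<omega> g = (\<Oplus>\<^bsub>?T\<^esub>i\<in>?S. (\<ominus> \<one>) [^] (\<Sum>j<i. g j) \<odot>\<^bsub>?T\<^esub> diff_at i g (\<omega> (g(i := g i - 1))))"
    unfolding tensor_diff_def using g(1) by (simp add: J)
  also have "\<dots> = (\<Oplus>\<^bsub>?T\<^esub>i\<in>?S. (ksign i ?S \<otimes> r i) \<odot>\<^bsub>?T\<^esub> p)"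
    by (rule M.finsum_cong') (use r p sgn in \<open>auto simp: smult_assoc1\<close>)
  also have "\<dots> = (\<Oplus>i\<in>?S. ksign i ?S \<otimes> r i) \<odot>\<^bsub>?T\<^esub> p"
  proof -
    have "finite B \<Longrightarrow> B \<subseteq> ?S \<Longrightarrow> (\<Oplus>\<^bsub>?T\<^esub>i\<in>B. (ksign i ?S \<otimes> r i) \<odot>\<^bsub>?T\<^esub> p) = (\<Oplus>i\<in>B. ksign i ?S \<otimes> r i) \<odot>\<^bsub>?T\<^esub> p" for B
    proof (induction B rule: finite_induct)
      case empty then show ?case using p by simp
    next
      case (insert b B)
      then have rb: "r b \<in> carrier R" and rB: "(\<lambda>i. ksign i ?S \<otimes> r i) \<in> B \<rightarrow> carrier R" using r by auto
      have "(\<Oplus>\<^bsub>?T\<^esub>i\<in>insert b B. (ksign i ?S \<otimes> r i) \<odot>\<^bsub>?T\<^esub> p) =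
        (ksign b ?S \<otimes> r b) \<odot>\<^bsub>?T\<^esub> p \<oplus>\<^bsub>?T\<^esub> (\<Oplus>\<^bsub>?T\<^esub>i\<in>B. (ksign i ?S \<otimes> r i) \<odot>\<^bsub>?T\<^esub> p)"
        using insert.hyps rb rB p by (intro M.finsum_insert) auto
      also have "\<dots> = (ksign b ?S \<otimes> r b \<oplus> (\<Oplus>i\<in>B. ksign i ?S \<otimes> r i)) \<odot>\<^bsub>?T\<^esub> p"
        using insert rb rB p by (simp add: smult_l_distr R_closed)
      also have "ksign b ?S \<otimes> r b \<oplus> (\<Oplus>i\<in>B. ksign i ?S \<otimes> r i) = (\<Oplus>i\<in>insert b B. ksign i ?S \<otimes> r i)"
        using insert.hyps rb rB by (intro R_insert[symmetric]) auto
      finally show ?case .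
    qed
    then show ?thesis using fin by blast
  qed
  finally show ?thesis .
qed

lemma tensor_complex_term: "cterm TX m = prod_module (multidegrees t m) (T)"
  and tensor_complex_diff: "cdiff TX m = tensor_diff R t C m"
  by (auto simp: tensor_complex_def)

lemma tensor_complex_abelian_group: "abelian_group (cterm TX m)"
  unfolding tensor_complex_term by (rule prod_module_abelian_group, rule module.axioms(2)[OF tensor_term_module])

lemma tensor_cochain_eqI:
  assumes triv: "\<And>f X. \<not> sqfree t f \<Longrightarrow> X \<in> carrier (T f) \<Longrightarrow> X = \<zero>\<^bsub>T f\<^esub>"
    and car: "\<omega> \<in> carrier (cterm TX m)" "\<eta> \<in> carrier (cterm TX m)"
    and eq: "\<And>S. S \<subseteq> {..<t} \<Longrightarrow> card S = m \<Longrightarrow> \<omega> (chi t S) = \<eta> (chi t S)"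
  shows "\<omega> = \<eta>"
proof (rule PiE_ext[of _ "multidegrees t m" "\<lambda>f. carrier (T f)"])
  show w: "\<omega> \<in> (\<Pi>\<^sub>E f\<in>multidegrees t m. carrier (T f))"
    "\<eta> \<in> (\<Pi>\<^sub>E f\<in>multidegrees t m. carrier (T f))"
    using car by (auto simp: tensor_complex_term prod_module_def)
  fix f assume f: "f \<in> multidegrees t m"
  show "\<omega> f = \<eta> f"
  proof (cases "sqfree t f")
    case True
    then show ?thesis using eq[OF supp1_subset supp1_card[OF f True]] chi_supp1[OF f True] by simp
  next
    case False then show ?thesis using triv[OF False] PiE_mem[OF w(1) f] PiE_mem[OF w(2) f] by metis
  qed
qed

lemma has_coords_realize:
  assumes p: "\<And>f. sqfree t f \<Longrightarrow> p f \<in> carrier (T f)" and c: "coch c"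
  shows "\<exists>\<omega>\<in>carrier (cterm TX m). has_coords t C p m \<omega> c"
proof -
  let ?T = "T"
  let ?w = "\<lambda>f\<in>multidegrees t m. if sqfree t f then c (supp1 t f) \<odot>\<^bsub>?T f\<^esub> p f else \<zero>\<^bsub>?T f\<^esub>"
  have "(if sqfree t f then c (supp1 t f) \<odot>\<^bsub>?T f\<^esub> p f else \<zero>\<^bsub>?T f\<^esub>) \<in> carrier (?T f)" for f
  proof -
    interpret module R "?T f" by (rule tensor_term_module)
    show ?thesis using p c by auto
  qed
  then have "?w \<in> carrier (cterm TX m)" by (simp add: tensor_complex_term prod_module_def)
  moreover have "has_coords t C p m ?w c" unfolding has_coords_def using c chi_props by auto
  ultimately show ?thesis by blast
qed

text \<open>
  If the factor in direction \<open>i\<close> multiplies by \<open>z i\<close> with respect to the \<open>p f\<close>, then the differential is the Koszul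
  differential of \<open>z\<close>.
\<close>

lemma has_coords_diff:
  assumes p: "\<And>f. sqfree t f \<Longrightarrow> p f \<in> carrier (T f)" and z: "seqR z"
    and step: "\<And>g i r. sqfree t g \<Longrightarrow> i \<in> supp1 t g \<Longrightarrow> r \<in> carrier R \<Longrightarrow>
      diff_at i g (r \<odot>\<^bsub>T (g(i := g i - 1))\<^esub> p (g(i := g i - 1))) = (r \<otimes> z i) \<odot>\<^bsub>T g\<^esub> p g"
    and c: "has_coords t C p m \<omega> c"
  shows "has_coords t C p (Suc m) (tensor_diff R t C m \<omega>) (kd z c)"
  unfolding has_coords_def
proof (intro conjI allI impI)
  have cc: "coch c" using c by (simp add: has_coords_def)
  show "kd z c S \<in> carrier R" for S using cc z by simp
  fix S assume S: "S \<subseteq> {..<t}" "card S = Suc m"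
  let ?g = "chi t S"
  note g = chi_props[OF S(1)]
  have "tensor_diff R t C m \<omega> ?g = (\<Oplus>i\<in>supp1 t ?g. ksign i (supp1 t ?g) \<otimes> (c (S - {i}) \<otimes> z i)) \<odot>\<^bsub>T ?g\<^esub> p ?g"
  proof (rule tensor_diff_coord[OF _ g(1) p[OF g(1)]])
    show "?g \<in> multidegrees t (Suc m)" using g(3) S by simp
    fix i assume i: "i \<in> supp1 t ?g"
    then have iS: "i \<in> S" "i < t" using g S by auto
    show "c (S - {i}) \<otimes> z i \<in> carrier R" using cc z by simp
    let ?f = "?g(i := ?g i - 1)"
    have f: "?f = chi t (S - {i})" using iS by (auto simp: chi_def fun_eq_iff)
    have fS: "finite S" using S(1) finite_subset by blast
    have "S - {i} \<subseteq> {..<t}" "card (S - {i}) = m" using S iS fS by auto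
    then have "\<omega> ?f = c (S - {i}) \<odot>\<^bsub>T ?f\<^esub> p ?f" using c unfolding has_coords_def f by blast
    then show "diff_at i ?g (\<omega> ?f) = (c (S - {i}) \<otimes> z i) \<odot>\<^bsub>T ?g\<^esub> p ?g"
      using step[OF g(1) i, of "c (S - {i})"] cc by simp
  qed
  also have "(\<Oplus>i\<in>supp1 t ?g. ksign i (supp1 t ?g) \<otimes> (c (S - {i}) \<otimes> z i)) = kd z c S" unfolding kd_def g(2)
    by (rule finsum_cong') (use cc z in \<open>auto simp: kE_def m_ac\<close>)
  finally show "tensor_diff R t C m \<omega> ?g = kd z c S \<odot>\<^bsub>T ?g\<^esub> p ?g" .
qed

end

end

section \<open>The Koszul and Cech complexes of a single element\<close>

context cring begin

lemma koszul1_linear: "z \<in> carrier R \<Longrightarrow> linear_cochain (koszul1 R z)"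
  unfolding linear_cochain_def
  by (auto simp: koszul1_def r_distr m_lcomm self_module_module zero_module_module)

lemma singleton_mult_set: "mult_set {\<one>}"
  using powers_mult_set[OF one_closed] powers_one by simp

lemma cech_diff0:
  assumes z: "z \<in> carrier R" and a: "a \<in> carrier R"
  shows "cdiff (cech1 R z) 0 (frac R {\<one>} a \<one>) = frac R (powers R z) a \<one>"
proof -
  have "the_elem ((\<lambda>(a, s). frac R (powers R z) a s) ` frac R {\<one>} a \<one>) = frac R (powers R z) a \<one>"
  proof (rule the_elem_image_singleton[of "(a, \<one>)"])
    show "(a, \<one>) \<in> frac R {\<one>} a \<one>" using frac_self[OF singleton_mult_set a] by simp
    fix p assume p: "p \<in> frac R {\<one>} a \<one>"
    obtain b s where bs: "p = (b, s)" by (cases p)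
    have "b \<in> carrier R" "s \<in> {\<one>}" "\<exists>u\<in>{\<one>}. u \<otimes> (s \<otimes> a) = u \<otimes> (\<one> \<otimes> b)"
      using frac_memD[OF singleton_mult_set a _ p[unfolded bs]] by auto
    then show "(\<lambda>(a, s). frac R (powers R z) a s) p = frac R (powers R z) a \<one>" using a bs by simp
  qed
  then show ?thesis by (simp add: cech1_def)
qed

lemma cech_denoms_mult_set: "z \<in> carrier R \<Longrightarrow> mult_set (cech_denoms R z p)"
  using singleton_mult_set powers_mult_set by (simp add: cech_denoms_def)

lemma cech1_term_module: "z \<in> carrier R \<Longrightarrow> module R (cterm (cech1 R z) p)"
  by (simp add: cech1_def localization_module[OF cech_denoms_mult_set] zero_module_module)

lemma cech1_linear:
  assumes z: "z \<in> carrier R" shows "linear_cochain (cech1 R z)"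
  unfolding linear_cochain_def
proof (intro allI conjI ballI)
  fix p
  show M: "module R (cterm (cech1 R z) p)" for p by (rule cech1_term_module[OF z])
  have P: "mult_set (powers R z)" by (rule powers_mult_set[OF z])
  note S1 = singleton_mult_set
  have zero: "\<zero>\<^bsub>cterm (cech1 R z) (Suc (Suc q))\<^esub> = \<zero>\<^bsub>localization R (powers R z)\<^esub>" for q
    by (simp add: cech1_def cech_denoms_def)
  have d: "cdiff (cech1 R z) (Suc q) u = \<zero>\<^bsub>cterm (cech1 R z) (Suc (Suc q))\<^esub>" for q u
    unfolding zero by (simp add: cech1_def)
  have E: "\<exists>a\<in>carrier R. u = frac R {\<one>} a \<one>" if "u \<in> carrier (cterm (cech1 R z) 0)" for u
    using that by (auto simp: cech1_def cech_denoms_def elim: localization_carrierE)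
  have t0: "cterm (cech1 R z) 0 = localization R {\<one>}" "cterm (cech1 R z) (Suc 0) = localization R (powers R z)"
    by (auto simp: cech1_def cech_denoms_def)
  have m1: "\<one> \<in> powers R z" by (rule mult_setD(2)[OF P])
  fix u assume u: "u \<in> carrier (cterm (cech1 R z) p)"
  show "cdiff (cech1 R z) p u \<in> carrier (cterm (cech1 R z) (Suc p))"
  proof (cases p)
    case 0
    then obtain a where "a \<in> carrier R" "u = frac R {\<one>} a \<one>" using E u by auto
    then show ?thesis using cech_diff0[OF z] localization_carrierI[OF _ m1] unfolding 0 t0 by simp
  next
    case (Suc q)
    interpret module R "cterm (cech1 R z) (Suc (Suc q))" by (rule M)
    show ?thesis unfolding Suc d by simp
  qed
  { fix v assume v: "v \<in> carrier (cterm (cech1 R z) p)"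
    show "cdiff (cech1 R z) p (u \<oplus>\<^bsub>cterm (cech1 R z) p\<^esub> v) = cdiff (cech1 R z) p u \<oplus>\<^bsub>cterm (cech1 R z) (Suc p)\<^esub> cdiff (cech1 R z) p v"
    proof (cases p)
      case 0
      then obtain a b where a: "a \<in> carrier R" "u = frac R {\<one>} a \<one>" and b: "b \<in> carrier R" "v = frac R {\<one>} b \<one>" using E u v by metis
      have "u \<oplus>\<^bsub>localization R {\<one>}\<^esub> v = frac R {\<one>} (a \<oplus> b) \<one>"
        unfolding a(2) b(2) using localization_add[OF S1 a(1) b(1), of \<one> \<one>] a b by simp
      moreover have "frac R (powers R z) a \<one> \<oplus>\<^bsub>localization R (powers R z)\<^esub> frac R (powers R z) b \<one> = frac R (powers R z) (a \<oplus> b) \<one>"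
        using localization_add[OF P a(1) b(1) m1 m1] a b by simp
      ultimately show ?thesis unfolding 0 t0 using cech_diff0[OF z] a b by simp
    next
      case (Suc q)
      interpret module R "cterm (cech1 R z) (Suc (Suc q))" by (rule M)
      show ?thesis unfolding Suc d by simp
    qed }
  { fix r assume r: "r \<in> carrier R"
    show "cdiff (cech1 R z) p (r \<odot>\<^bsub>cterm (cech1 R z) p\<^esub> u) = r \<odot>\<^bsub>cterm (cech1 R z) (Suc p)\<^esub> cdiff (cech1 R z) p u"
    proof (cases p)
      case 0
      then obtain a where a: "a \<in> carrier R" "u = frac R {\<one>} a \<one>" using E u by metis
      have "r \<odot>\<^bsub>localization R {\<one>}\<^esub> u = frac R {\<one>} (r \<otimes> a) \<one>"
        unfolding a(2) using localization_smult[OF S1 a(1) r, of \<one>] by simp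
      moreover have "r \<odot>\<^bsub>localization R (powers R z)\<^esub> frac R (powers R z) a \<one> = frac R (powers R z) (r \<otimes> a) \<one>"
        by (rule localization_smult[OF P a(1) r m1])
      ultimately show ?thesis unfolding 0 t0 using cech_diff0[OF z] a r by simp
    next
      case (Suc q)
      interpret module R "cterm (cech1 R z) (Suc (Suc q))" by (rule M)
      show ?thesis unfolding Suc d using r by simp
    qed }
qed

lemma koszul1_to_cech1_linear:
  assumes z: "z \<in> carrier R"
  shows "u \<in> carrier (cterm (koszul1 R z) p) \<Longrightarrow> koszul1_to_cech1 R z p u \<in> carrier (cterm (cech1 R z) p)"
    and "u \<in> carrier (cterm (koszul1 R z) p) \<Longrightarrow> v \<in> carrier (cterm (koszul1 R z) p) \<Longrightarrow>
      koszul1_to_cech1 R z p (u \<oplus>\<^bsub>cterm (koszul1 R z) p\<^esub> v) = koszul1_to_cech1 R z p u \<oplus>\<^bsub>cterm (cech1 R z) p\<^esub> koszul1_to_cech1 R z p v"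
    and "u \<in> carrier (cterm (koszul1 R z) p) \<Longrightarrow> r \<in> carrier R \<Longrightarrow>
      koszul1_to_cech1 R z p (r \<odot>\<^bsub>cterm (koszul1 R z) p\<^esub> u) = r \<odot>\<^bsub>cterm (cech1 R z) p\<^esub> koszul1_to_cech1 R z p u"
proof -
  have P: "mult_set (powers R z)" by (rule powers_mult_set[OF z])
  have zP: "z \<in> powers R z" using powers_mem[of z 1] z by simp
  note S1 = singleton_mult_set
  consider "p = 0" | "p = 1" | "p \<ge> 2" by linarith
  then have "(u \<in> carrier (cterm (koszul1 R z) p) \<longrightarrow> koszul1_to_cech1 R z p u \<in> carrier (cterm (cech1 R z) p)) \<and>
    (u \<in> carrier (cterm (koszul1 R z) p) \<longrightarrow> v \<in> carrier (cterm (koszul1 R z) p) \<longrightarrow>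
      koszul1_to_cech1 R z p (u \<oplus>\<^bsub>cterm (koszul1 R z) p\<^esub> v) = koszul1_to_cech1 R z p u \<oplus>\<^bsub>cterm (cech1 R z) p\<^esub> koszul1_to_cech1 R z p v) \<and>
    (u \<in> carrier (cterm (koszul1 R z) p) \<longrightarrow> r \<in> carrier R \<longrightarrow>
      koszul1_to_cech1 R z p (r \<odot>\<^bsub>cterm (koszul1 R z) p\<^esub> u) = r \<odot>\<^bsub>cterm (cech1 R z) p\<^esub> koszul1_to_cech1 R z p u)"
  proof cases
    case 1
    then show ?thesis
      using localization_add[OF S1, of u v \<one> \<one>] localization_smult[OF S1, of u r \<one>]
      by (auto simp: koszul1_def cech1_def koszul1_to_cech1_def cech_denoms_def intro: localization_carrierI)
  next
    case 2
    have "frac R (powers R z) (z \<otimes> u \<oplus> z \<otimes> v) (z \<otimes> z) = frac R (powers R z) (u \<oplus> v) z" if uv: "u \<in> carrier R" "v \<in> carrier R"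
    proof (rule frac_eqI[OF P _ _ _ zP mult_setD(2)[OF P]])
      have "z \<otimes> (z \<otimes> u \<oplus> z \<otimes> v) = (z \<otimes> z) \<otimes> (u \<oplus> v)" using uv z by algebra
      then show "\<one> \<otimes> (z \<otimes> (z \<otimes> u \<oplus> z \<otimes> v)) = \<one> \<otimes> ((z \<otimes> z) \<otimes> (u \<oplus> v))" by simp
    qed (use uv z zP mult_setD(3)[OF P] in auto)
    then show ?thesis using 2
      localization_add[OF P, of u v z z] localization_smult[OF P, of u r z] zP
      by (auto simp: koszul1_def cech1_def koszul1_to_cech1_def cech_denoms_def intro: localization_carrierI)
  next
    case 3
    interpret L: module R "localization R (powers R z)" by (rule localization_module[OF P])
    show ?thesis using 3 by (auto simp: koszul1_def cech1_def koszul1_to_cech1_def cech_denoms_def)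
  qed
  then show "u \<in> carrier (cterm (koszul1 R z) p) \<Longrightarrow> koszul1_to_cech1 R z p u \<in> carrier (cterm (cech1 R z) p)"
    and "u \<in> carrier (cterm (koszul1 R z) p) \<Longrightarrow> v \<in> carrier (cterm (koszul1 R z) p) \<Longrightarrow>
      koszul1_to_cech1 R z p (u \<oplus>\<^bsub>cterm (koszul1 R z) p\<^esub> v) = koszul1_to_cech1 R z p u \<oplus>\<^bsub>cterm (cech1 R z) p\<^esub> koszul1_to_cech1 R z p v"
    and "u \<in> carrier (cterm (koszul1 R z) p) \<Longrightarrow> r \<in> carrier R \<Longrightarrow>
      koszul1_to_cech1 R z p (r \<odot>\<^bsub>cterm (koszul1 R z) p\<^esub> u) = r \<odot>\<^bsub>cterm (cech1 R z) p\<^esub> koszul1_to_cech1 R z p u"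
    by blast+
qed

end

section \<open>The terms and differentials of the Koszul and Cech complexes of a sequence\<close>

locale koszul_cech = cring R for R (structure) +
  fixes y :: "nat \<Rightarrow> 'a" and t :: nat
  assumes y_closed: "i < t \<Longrightarrow> y i \<in> carrier R"
begin

abbreviation K where "K \<equiv> \<lambda>i. koszul1 R (y i)"
abbreviation C where "C \<equiv> \<lambda>i. cech1 R (y i)"
abbreviation U where "U \<equiv> {..<t}"

text \<open>
  Extended by 0 to all indices, since Koszul cochains are formed for total sequences.
\<close>

definition z where "z i = (if i < t then y i else \<zero>)"

lemma z_seq: "seqR z" using y_closed by (simp add: z_def)

lemma K_linear: "i < t \<Longrightarrow> linear_cochain (K i)" using koszul1_linear y_closed by simp
lemma C_linear: "i < t \<Longrightarrow> linear_cochain (C i)" using cech1_linear y_closed by simp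

text \<open>
  The term of the Cech complex at \<open>f\<close> is the tensor product of the localizations at the powers of \<open>wt f i\<close>: the powers
  of 1 form the set \<open>{1}\<close>, so the factors of degree 0 fit the same description.
\<close>

definition wt where "wt f i = (if f i = (0::nat) then \<one> else y i)"

text \<open>
  The generator of the Koszul term, and the fractions \<open>1/y\<^sub>S\<^sup>k\<close> of which the Cech term consists of multiples.
\<close>

definition iota where "iota f = pure_tensor R U (\<lambda>i. cterm (K i) (f i)) (\<lambda>i\<in>U. \<one>)"
definition kappa where
  "kappa f k = pure_tensor R U (\<lambda>i. cterm (C i) (f i)) (\<lambda>i\<in>U. frac R (powers R (wt f i)) \<one> (wt f i [^] (k::nat)))"

abbreviation TK where "TK \<equiv> tensor_term R t K"
abbreviation TC where "TC \<equiv> tensor_term R t C"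

lemma TK_module: "module R (TK f)" by (rule tensor_term_module) (rule K_linear)
lemma TC_module: "module R (TC f)" by (rule tensor_term_module) (rule C_linear)

lemma K_term: "sqfree t f \<Longrightarrow> i \<in> U \<Longrightarrow> cterm (K i) (f i) = self_module R"
  by (auto simp: sqfree_def koszul1_def)

lemma C_term: "sqfree t f \<Longrightarrow> i \<in> U \<Longrightarrow> cterm (C i) (f i) = localization R (powers R (wt f i))"
  by (auto simp: sqfree_def cech1_def cech_denoms_def wt_def powers_one le_Suc_eq)

lemma wt_closed: "i \<in> U \<Longrightarrow> wt f i \<in> carrier R" using y_closed by (simp add: wt_def)

lemma iota_props:
  assumes "sqfree t f"
  shows "iota f \<in> carrier (TK f)"
    and "X \<in> carrier (TK f) \<Longrightarrow> \<exists>r\<in>carrier R. X = r \<odot>\<^bsub>TK f\<^esub> iota f"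
    and "r \<in> carrier R \<Longrightarrow> r \<odot>\<^bsub>TK f\<^esub> iota f = \<zero>\<^bsub>TK f\<^esub> \<Longrightarrow> r = \<zero>"
proof -
  note T = self_tensor[where M = "\<lambda>i. cterm (K i) (f i)", OF finite_lessThan K_term[OF assms]]
  show "iota f \<in> carrier (TK f)" unfolding tensor_term_def iota_def by (rule T(1))
  show "\<exists>r\<in>carrier R. X = r \<odot>\<^bsub>TK f\<^esub> iota f" if "X \<in> carrier (TK f)" unfolding tensor_term_def iota_def by (rule T(2)[OF _ that[unfolded tensor_term_def iota_def]])
  show "r = \<zero>" if "r \<in> carrier R" "r \<odot>\<^bsub>TK f\<^esub> iota f = \<zero>\<^bsub>TK f\<^esub>" unfolding tensor_term_def iota_def by (rule T(3)[OF _ that[unfolded tensor_term_def iota_def]])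
qed

lemma iota_inj:
  assumes "sqfree t f" "r \<in> carrier R" "s \<in> carrier R" "r \<odot>\<^bsub>TK f\<^esub> iota f = s \<odot>\<^bsub>TK f\<^esub> iota f"
  shows "r = s"
proof -
  have "(r \<ominus> s) \<odot>\<^bsub>TK f\<^esub> iota f = \<zero>\<^bsub>TK f\<^esub>"
    by (rule module.smult_eq_imp_diff_annihilates[OF TK_module assms(2,3) iota_props(1)[OF assms(1)] assms(4)])
  then have "r \<ominus> s = \<zero>" using iota_props(3)[OF assms(1), of "r \<ominus> s"] assms by simp
  then show ?thesis using minus_zero_iff assms by simp
qed

lemma wt_prod:
  assumes "sqfree t f" shows "(\<Otimes>i\<in>U. wt f i [^] (l::nat)) = (\<Otimes>i\<in>supp1 t f. z i [^] l)"
proof (rule finprod_mono_neutral_cong_right)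
  show "supp1 t f \<subseteq> U" by (rule supp1_subset)
  show "wt f i [^] l = \<one>" if "i \<in> U - supp1 t f" for i
    using that assms by (auto simp: wt_def supp1_def sqfree_def le_Suc_eq)
  show "wt f i [^] l = z i [^] l" if "i \<in> supp1 t f" for i
    using that by (auto simp: wt_def supp1_def z_def)
qed (use wt_closed in auto)

abbreviation zp where "zp S l \<equiv> (\<Otimes>i\<in>S. z i [^] (l::nat))"

lemma zp_closed: "zp S l \<in> carrier R" using z_seq by (intro finprod_closed) auto

lemma zp_add:
  "zp S (k + l) = zp S k \<otimes> zp S l"
proof (cases "finite S")
  case True
  have "zp S (k + l) = (\<Otimes>i\<in>S. z i [^] k \<otimes> z i [^] l)"
    by (rule finprod_cong') (use z_seq in \<open>auto simp: nat_pow_mult\<close>)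
  also have "\<dots> = zp S k \<otimes> zp S l" using z_seq by (intro finprod_multf) auto
  finally show ?thesis .
qed (simp add: finprod_infinite)

text \<open>
  A multiple \<open>r\<close> of the fraction vanishes if and only if \<open>r\<close> is killed by a power of the product of the \<open>z i\<close> over the
  support of \<open>f\<close>.
\<close>

lemma kappa_props:
  assumes "sqfree t f"
  shows "kappa f k \<in> carrier (TC f)"
    and "kappa f k = zp (supp1 t f) l \<odot>\<^bsub>TC f\<^esub> kappa f (k + l)"
    and "X \<in> carrier (TC f) \<Longrightarrow> \<exists>k. \<exists>r\<in>carrier R. X = r \<odot>\<^bsub>TC f\<^esub> kappa f k"
    and "r \<in> carrier R \<Longrightarrow> r \<odot>\<^bsub>TC f\<^esub> kappa f k = \<zero>\<^bsub>TC f\<^esub> \<longleftrightarrow> (\<exists>l. zp (supp1 t f) l \<otimes> r = \<zero>)"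
proof -
  note T = localization_tensor[where w = "wt f" and M = "\<lambda>i. cterm (C i) (f i)", OF finite_lessThan wt_closed C_term[OF assms]]
  show "kappa f k \<in> carrier (TC f)" unfolding tensor_term_def kappa_def wt_prod[OF assms, symmetric] by (rule T(1))
  show "kappa f k = zp (supp1 t f) l \<odot>\<^bsub>TC f\<^esub> kappa f (k + l)" unfolding tensor_term_def kappa_def wt_prod[OF assms, symmetric] by (rule T(2))
  show "\<exists>k. \<exists>r\<in>carrier R. X = r \<odot>\<^bsub>TC f\<^esub> kappa f k" if "X \<in> carrier (TC f)" unfolding tensor_term_def kappa_def wt_prod[OF assms, symmetric] by (rule T(3)[OF _ _ that[unfolded tensor_term_def]])
  show "r \<odot>\<^bsub>TC f\<^esub> kappa f k = \<zero>\<^bsub>TC f\<^esub> \<longleftrightarrow> (\<exists>l. zp (supp1 t f) l \<otimes> r = \<zero>)" if "r \<in> carrier R" unfolding tensor_term_def kappa_def wt_prod[OF assms, symmetric] by (rule T(4)[OF _ _ that[unfolded tensor_term_def]])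
qed

lemma TK_trivial:
  assumes "\<not> sqfree t f" "X \<in> carrier (TK f)" shows "X = \<zero>\<^bsub>TK f\<^esub>"
proof -
  obtain i where i: "i < t" "\<not> f i \<le> 1" using assms by (auto simp: sqfree_def)
  show ?thesis unfolding tensor_term_def
    by (rule tensor_zero_factor[OF tensor_term_add_closed[where C = K, OF K_linear], where i = i])
      (use i assms in \<open>auto simp: koszul1_def tensor_term_def\<close>)
qed

lemma TC_trivial:
  assumes "\<not> sqfree t f" "X \<in> carrier (TC f)" shows "X = \<zero>\<^bsub>TC f\<^esub>"
proof -
  obtain i where i: "i < t" "\<not> f i \<le> 1" using assms by (auto simp: sqfree_def)
  interpret L: module R "localization R (cech_denoms R (y i) (f i))"
    by (rule localization_module[OF cech_denoms_mult_set[OF y_closed[OF i(1)]]])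
  show ?thesis unfolding tensor_term_def
    by (rule tensor_zero_factor[OF tensor_term_add_closed[where C = C, OF C_linear], where i = i])
      (use i assms in \<open>auto simp: cech1_def tensor_term_def\<close>)
qed

abbreviation dK where "dK i g \<equiv> tensor_map R U (\<lambda>j. cterm (K j) (g j)) (\<lambda>j. if j = i then cdiff (K i) (g i - 1) else id)"
abbreviation dC where "dC i g \<equiv> tensor_map R U (\<lambda>j. cterm (C j) (g j)) (\<lambda>j. if j = i then cdiff (C i) (g i - 1) else id)"

lemma one_factor_prod:
  assumes "i < t" "a \<in> carrier R" shows "(\<Otimes>j\<in>U. if j = i then a else \<one>) = a"
  using finprod_singleton_swap[of i U "\<lambda>_. a"] assms by auto

lemma koszul_step:
  assumes g: "sqfree t g" and i: "i \<in> supp1 t g" and r: "r \<in> carrier R"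
  defines "f \<equiv> g(i := g i - 1)"
  shows "dK i g (r \<odot>\<^bsub>TK f\<^esub> iota f) = (r \<otimes> y i) \<odot>\<^bsub>TK g\<^esub> iota g"
proof -
  interpret T: module R "TK g" by (rule TK_module)
  have it: "i < t" "0 < g i" "g i = 1" using i by (auto simp: supp1_def)
  have f: "sqfree t f" unfolding f_def by (rule sqfree_lower[OF g])
  note L = diff_at_linear[where C = K and t = t and i = i and g = g, OF K_linear it(1,2), folded f_def]
  have o: "(\<lambda>i\<in>U. \<one>) \<in> (\<Pi>\<^sub>E j\<in>U. carrier (cterm (K j) (h j)))" if "sqfree t h" for h
    using K_term[OF that] by (auto simp: PiE_iff)
  have "dK i g (iota f) = pure_tensor R U (\<lambda>j. cterm (K j) (g j))
      (\<lambda>j\<in>U. (if j = i then cdiff (K i) (g i - 1) else id) ((\<lambda>i\<in>U. \<one>) j))"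
    unfolding iota_def by (rule L(1)[OF _ o[OF f]])
  also have "(\<lambda>j\<in>U. (if j = i then cdiff (K i) (g i - 1) else id) ((\<lambda>i\<in>U. \<one>) j)) =
     (\<lambda>j\<in>U. (if j = i then y i else \<one>) \<odot>\<^bsub>cterm (K j) (g j)\<^esub> (\<lambda>i\<in>U. \<one>) j)"
    using K_term[OF g] it y_closed[OF it(1)] by (auto simp: fun_eq_iff koszul1_def)
  also have "pure_tensor R U (\<lambda>j. cterm (K j) (g j)) \<dots> = (\<Otimes>j\<in>U. if j = i then y i else \<one>) \<odot>\<^bsub>TK g\<^esub> iota g"
    unfolding iota_def tensor_term_def
    by (rule pure_tensor_scale[OF tensor_term_add_closed[where C = K, OF K_linear] _ o[OF g]])
      (use y_closed it K_term[OF g] in auto)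
  finally have "dK i g (iota f) = y i \<odot>\<^bsub>TK g\<^esub> iota g" using one_factor_prod y_closed it by simp
  then show ?thesis using L(4)[OF _ r iota_props(1)[OF f]] iota_props(1)[OF g] y_closed it r by (simp add: T.smult_assoc1)
qed

lemma kappa_arg:
  assumes "sqfree t f"
  shows "(\<lambda>i\<in>U. frac R (powers R (wt f i)) \<one> (wt f i [^] (k::nat))) \<in> (\<Pi>\<^sub>E j\<in>U. carrier (cterm (C j) (f j)))"
  using C_term[OF assms] localization_carrierI[OF one_closed powers_mem] by (auto simp: PiE_iff)

lemma C_term_one: "sqfree t f \<Longrightarrow> i \<in> U \<Longrightarrow> u \<in> carrier (cterm (C i) (f i)) \<Longrightarrow> \<one> \<odot>\<^bsub>cterm (C i) (f i)\<^esub> u = u"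
  using module.smult_one[OF cech1_term_module[OF y_closed]] by simp

lemma cech_step:
  assumes g: "sqfree t g" and i: "i \<in> supp1 t g" and r: "r \<in> carrier R"
  defines "f \<equiv> g(i := g i - 1)"
  shows "dC i g (r \<odot>\<^bsub>TC f\<^esub> kappa f k) = (r \<otimes> y i [^] k) \<odot>\<^bsub>TC g\<^esub> kappa g k"
proof -
  interpret T: module R "TC g" by (rule TC_module)
  have it: "i < t" "0 < g i" "g i = 1" using i by (auto simp: supp1_def)
  have yi: "y i \<in> carrier R" using y_closed it by simp
  have f: "sqfree t f" unfolding f_def by (rule sqfree_lower[OF g])
  note L = diff_at_linear[where C = C and t = t and i = i and g = g, OF C_linear it(1,2), folded f_def]
  let ?x = "\<lambda>f. \<lambda>i\<in>U. frac R (powers R (wt f i)) \<one> (wt f i [^] k)"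
  have P: "mult_set (powers R (y i))" by (rule powers_mult_set[OF yi])
  have "dC i g (kappa f k) = pure_tensor R U (\<lambda>j. cterm (C j) (g j))
      (\<lambda>j\<in>U. (if j = i then cdiff (C i) (g i - 1) else id) (?x f j))"
    unfolding kappa_def by (rule L(1)[OF _ kappa_arg[OF f]])
  also have "(\<lambda>j\<in>U. (if j = i then cdiff (C i) (g i - 1) else id) (?x f j)) =
     (\<lambda>j\<in>U. (if j = i then y i [^] k else \<one>) \<odot>\<^bsub>cterm (C j) (g j)\<^esub> ?x g j)"
  proof
    fix j
    show "(\<lambda>j\<in>U. (if j = i then cdiff (C i) (g i - 1) else id) (?x f j)) j =
       (\<lambda>j\<in>U. (if j = i then y i [^] k else \<one>) \<odot>\<^bsub>cterm (C j) (g j)\<^esub> ?x g j) j"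
    proof (cases "j \<in> U")
      case True
      show ?thesis
      proof (cases "j = i")
        case False
        then have "?x f j = ?x g j" by (simp add: f_def wt_def)
        moreover have "\<one> \<odot>\<^bsub>cterm (C j) (g j)\<^esub> ?x g j = ?x g j" by (rule C_term_one[OF g True PiE_mem[OF kappa_arg[OF g] True]])
        ultimately show ?thesis using True False by simp
      next
        case ji: True
        have wf: "wt f i = \<one>" "wt g i = y i" using it by (auto simp: f_def wt_def)
        have "?x f i = frac R {\<one>} \<one> \<one>" using it wf by (simp add: powers_one)
        then have "cdiff (C i) (g i - 1) (?x f i) = frac R (powers R (y i)) \<one> \<one>"
          using cech_diff0[OF yi one_closed] it by simp
        also have "\<dots> = frac R (powers R (y i)) (y i [^] k) (y i [^] k)"
          by (rule frac_eqI[OF P _ _ mult_setD(2)[OF P] powers_mem mult_setD(2)[OF P]]) (use yi in auto)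
        also have "\<dots> = y i [^] k \<odot>\<^bsub>cterm (C i) (g i)\<^esub> ?x g i"
          using localization_smult[OF P one_closed _ powers_mem, of "y i [^] k" k] C_term[OF g, of i] it yi wf by simp
        finally show ?thesis using True ji by simp
      qed
    qed simp
  qed
  also have "pure_tensor R U (\<lambda>j. cterm (C j) (g j)) \<dots> = (\<Otimes>j\<in>U. if j = i then y i [^] k else \<one>) \<odot>\<^bsub>TC g\<^esub> kappa g k"
    unfolding kappa_def tensor_term_def
    by (rule pure_tensor_scale[OF tensor_term_add_closed[where C = C, OF C_linear] _ kappa_arg[OF g]])
      (use yi C_term_one[OF g] in auto)
  finally have "dC i g (kappa f k) = y i [^] k \<odot>\<^bsub>TC g\<^esub> kappa g k" using one_factor_prod yi it by simp
  then show ?thesis using L(4)[OF _ r kappa_props(1)[OF f]] kappa_props(1)[OF g] yi r by (simp add: T.smult_assoc1)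
qed

abbreviation phi where "phi f \<equiv> tensor_map R U (\<lambda>i. cterm (C i) (f i)) (\<lambda>i. koszul1_to_cech1 R (y i) (f i))"

lemma phi_linear:
  shows "x \<in> (\<Pi>\<^sub>E i\<in>U. carrier (cterm (K i) (f i))) \<Longrightarrow> phi f (pure_tensor R U (\<lambda>i. cterm (K i) (f i)) x) =
      pure_tensor R U (\<lambda>i. cterm (C i) (f i)) (\<lambda>i\<in>U. koszul1_to_cech1 R (y i) (f i) (x i))"
    and "X \<in> carrier (TK f) \<Longrightarrow> phi f X \<in> carrier (TC f)"
    and "X \<in> carrier (TK f) \<Longrightarrow> Y \<in> carrier (TK f) \<Longrightarrow> phi f (X \<oplus>\<^bsub>TK f\<^esub> Y) = phi f X \<oplus>\<^bsub>TC f\<^esub> phi f Y"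
    and "r \<in> carrier R \<Longrightarrow> X \<in> carrier (TK f) \<Longrightarrow> phi f (r \<odot>\<^bsub>TK f\<^esub> X) = r \<odot>\<^bsub>TC f\<^esub> phi f X"
  unfolding tensor_term_def
  by (rule tensor_map_linear[OF tensor_term_add_closed[where C = K, OF K_linear] tensor_term_add_closed[where C = C, OF C_linear]
        koszul1_to_cech1_linear(1) koszul1_to_cech1_linear(2) koszul1_to_cech1_linear(3)]; (simp add: y_closed)?)+

lemma phi_step:
  assumes f: "sqfree t f" and r: "r \<in> carrier R"
  shows "phi f (r \<odot>\<^bsub>TK f\<^esub> iota f) = r \<odot>\<^bsub>TC f\<^esub> kappa f 1"
proof -
  have o: "(\<lambda>i\<in>U. \<one>) \<in> (\<Pi>\<^sub>E j\<in>U. carrier (cterm (K j) (f j)))"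
    using K_term[OF f] by (auto simp: PiE_iff)
  have e: "(\<lambda>i\<in>U. koszul1_to_cech1 R (y i) (f i) ((\<lambda>i\<in>U. \<one>) i)) = (\<lambda>i\<in>U. frac R (powers R (wt f i)) \<one> (wt f i [^] (1::nat)))"
  proof
    fix i show "(\<lambda>i\<in>U. koszul1_to_cech1 R (y i) (f i) ((\<lambda>i\<in>U. \<one>) i)) i = (\<lambda>i\<in>U. frac R (powers R (wt f i)) \<one> (wt f i [^] (1::nat))) i"
    proof (cases "i \<in> U")
      case True
      then have "f i = 0 \<or> f i = 1" using f by (auto simp: sqfree_def le_Suc_eq)
      then show ?thesis using True y_closed[of i] by (auto simp: koszul1_to_cech1_def wt_def powers_one)
    qed simp
  qed
  have "phi f (iota f) = kappa f 1" unfolding iota_def kappa_def using phi_linear(1)[OF o] e by simp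
  then show ?thesis using phi_linear(4)[OF r iota_props(1)[OF f]] by simp
qed

section \<open>Coordinates of Koszul and Cech cochains\<close>

abbreviation KC where "KC \<equiv> tensor_complex R t K"
abbreviation CC where "CC \<equiv> tensor_complex R t C"

lemma KC_term: "cterm KC m = prod_module (multidegrees t m) TK" and CC_term: "cterm CC m = prod_module (multidegrees t m) TC"
  by (auto simp: tensor_complex_def)

lemma prod_carrier: "\<omega> \<in> carrier (prod_module J M) \<longleftrightarrow> \<omega> \<in> (\<Pi>\<^sub>E j\<in>J. carrier (M j))"
  by (simp add: prod_module_def)

abbreviation "Kcoord \<equiv> has_coords t K iota"
abbreviation "Ccoord m k \<equiv> has_coords t C (\<lambda>f. kappa f k) m"

lemma KC_eqI:
  assumes "\<omega> \<in> carrier (cterm KC m)" "\<eta> \<in> carrier (cterm KC m)" "\<And>S. S \<subseteq> U \<Longrightarrow> card S = m \<Longrightarrow> \<omega> (chi t S) = \<eta> (chi t S)"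
  shows "\<omega> = \<eta>"
  by (rule tensor_cochain_eqI[OF K_linear TK_trivial assms])
lemma CC_eqI:
  assumes "\<omega> \<in> carrier (cterm CC m)" "\<eta> \<in> carrier (cterm CC m)" "\<And>S. S \<subseteq> U \<Longrightarrow> card S = m \<Longrightarrow> \<omega> (chi t S) = \<eta> (chi t S)"
  shows "\<omega> = \<eta>"
  by (rule tensor_cochain_eqI[OF C_linear TC_trivial assms])

lemma Kcoord_exists:
  assumes w: "\<omega> \<in> carrier (cterm KC m)" shows "\<exists>c. Kcoord m \<omega> c"
proof -
  have "\<exists>r\<in>carrier R. S \<subseteq> U \<and> card S = m \<longrightarrow> \<omega> (chi t S) = r \<odot>\<^bsub>TK (chi t S)\<^esub> iota (chi t S)" for S
  proof (cases "S \<subseteq> U \<and> card S = m")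
    case True
    then have "\<omega> (chi t S) \<in> carrier (TK (chi t S))" using w chi_props(3)[of S t] by (auto simp: KC_term prod_carrier)
    then show ?thesis using iota_props(2)[OF chi_props(1)] True by blast
  qed auto
  then obtain c where "\<And>S. c S \<in> carrier R" "\<And>S. S \<subseteq> U \<and> card S = m \<longrightarrow> \<omega> (chi t S) = c S \<odot>\<^bsub>TK (chi t S)\<^esub> iota (chi t S)" by metis
  then have "Kcoord m \<omega> c" by (simp add: has_coords_def)
  then show ?thesis by (intro exI)
qed

lemma Kcoord_realize: "coch c \<Longrightarrow> \<exists>\<omega>\<in>carrier (cterm KC m). Kcoord m \<omega> c"
  by (rule has_coords_realize[OF K_linear iota_props(1)])
lemma Ccoord_realize: "coch c \<Longrightarrow> \<exists>\<omega>\<in>carrier (cterm CC m). Ccoord m k \<omega> c"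
  by (rule has_coords_realize[OF C_linear kappa_props(1)])

lemma kappa_shift:
  assumes f: "sqfree t f" and r: "r \<in> carrier R"
  shows "r \<odot>\<^bsub>TC f\<^esub> kappa f k = (zp (supp1 t f) l \<otimes> r) \<odot>\<^bsub>TC f\<^esub> kappa f (k + l)"
proof -
  interpret module R "TC f" by (rule TC_module)
  have "r \<odot>\<^bsub>TC f\<^esub> kappa f k = r \<odot>\<^bsub>TC f\<^esub> (zp (supp1 t f) l \<odot>\<^bsub>TC f\<^esub> kappa f (k + l))" using kappa_props(2)[OF f, of k l] by simp
  also have "\<dots> = (r \<otimes> zp (supp1 t f) l) \<odot>\<^bsub>TC f\<^esub> kappa f (k + l)" using r zp_closed kappa_props(1)[OF f] by (simp add: smult_assoc1)
  finally show ?thesis using r zp_closed by (simp add: m_comm)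
qed

text \<open>
  Since there are finitely many sets of indices, a common exponent can be chosen for all components. It is chosen
  positive, because Koszul cochains map to Cech cochains with exponent 1.
\<close>

lemma Ccoord_exists:
  assumes w: "\<omega> \<in> carrier (cterm CC m)" shows "\<exists>k>0. \<exists>c. Ccoord m k \<omega> c"
proof -
  have "\<exists>k. \<exists>r\<in>carrier R. S \<subseteq> U \<and> card S = m \<longrightarrow> \<omega> (chi t S) = r \<odot>\<^bsub>TC (chi t S)\<^esub> kappa (chi t S) k" for S
  proof (cases "S \<subseteq> U \<and> card S = m")
    case True
    then have "\<omega> (chi t S) \<in> carrier (TC (chi t S))" using w chi_props(3)[of S t] by (auto simp: CC_term prod_carrier)
    then show ?thesis using kappa_props(3)[OF chi_props(1)] True by blast
  qed auto
  then obtain k c where c: "\<And>S. c S \<in> carrier R" "\<And>S. S \<subseteq> U \<Longrightarrow> card S = m \<Longrightarrow> \<omega> (chi t S) = c S \<odot>\<^bsub>TC (chi t S)\<^esub> kappa (chi t S) (k S)" by metis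
  let ?k = "Suc (\<Sum>S\<in>Pow U. k S)"
  have "Ccoord m ?k \<omega> (\<lambda>S. zp S (?k - k S) \<otimes> c S)" unfolding has_coords_def
  proof (intro conjI allI impI)
    show "zp S (?k - k S) \<otimes> c S \<in> carrier R" for S using c zp_closed by simp
    fix S assume S: "S \<subseteq> U" "card S = m"
    have "k S \<le> (\<Sum>S\<in>Pow U. k S)" by (rule member_le_sum) (use S in auto)
    then have "k S + (?k - k S) = ?k" by simp
    then show "\<omega> (chi t S) = (zp S (?k - k S) \<otimes> c S) \<odot>\<^bsub>TC (chi t S)\<^esub> kappa (chi t S) ?k"
      using kappa_shift[OF chi_props(1)[OF S(1)] c(1)[of S], of "k S" "?k - k S"] c(2)[OF S] chi_props(2)[OF S(1)] by simp
  qed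
  then show ?thesis by blast
qed

lemma K_diff_coord:
  assumes "Kcoord m \<omega> c" shows "Kcoord (Suc m) (tensor_diff R t K m \<omega>) (kd z c)"
  by (rule has_coords_diff[OF K_linear iota_props(1) z_seq _ assms])
    (use koszul_step in \<open>auto simp: z_def supp1_def\<close>)

text \<open>
  In the coordinates with exponent \<open>k\<close>, the Cech differential is the Koszul differential of the sequence of \<open>k\<close>-th
  powers.
\<close>

lemma C_diff_coord:
  assumes "Ccoord m k \<omega> c" shows "Ccoord (Suc m) k (tensor_diff R t C m \<omega>) (kd (\<lambda>i. z i [^] k) c)"
  by (rule has_coords_diff[OF C_linear kappa_props(1) _ _ assms])
    (use z_seq cech_step in \<open>auto simp: z_def supp1_def\<close>)

abbreviation PHI where "PHI \<equiv> tensor_complex_map R t C (\<lambda>i. koszul1_to_cech1 R (y i))"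

lemma PHI_coord: "Kcoord m \<omega> c \<Longrightarrow> Ccoord m 1 (PHI m \<omega>) c"
  unfolding has_coords_def tensor_complex_map_def
  using chi_props phi_step by auto

lemma PHI_additive: "additive_map (cterm KC m) (cterm CC m) (PHI m)"
  unfolding additive_map_def
proof (intro conjI ballI)
  fix \<omega> assume w: "\<omega> \<in> carrier (cterm KC m)"
  show "PHI m \<omega> \<in> carrier (cterm CC m)"
    using w phi_linear(2) by (auto simp: KC_term CC_term prod_carrier tensor_complex_map_def PiE_iff)
  fix \<eta> assume e: "\<eta> \<in> carrier (cterm KC m)"
  show "PHI m (\<omega> \<oplus>\<^bsub>cterm KC m\<^esub> \<eta>) = PHI m \<omega> \<oplus>\<^bsub>cterm CC m\<^esub> PHI m \<eta>"
    using w e phi_linear(3) by (auto simp: KC_term CC_term prod_carrier tensor_complex_map_def PiE_iff prod_module_def fun_eq_iff)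
qed

section \<open>The natural map in coordinates\<close>

lemmas KC_group = tensor_complex_abelian_group[where C = K, OF K_linear]
lemmas CC_group = tensor_complex_abelian_group[where C = C, OF C_linear]
lemmas KC_additive = tensor_diff_additive[where C = K and t = t, OF K_linear]
lemmas CC_additive = tensor_diff_additive[where C = C and t = t, OF C_linear]

lemma KC_diff: "cdiff KC m = tensor_diff R t K m" and CC_diff: "cdiff CC m = tensor_diff R t C m"
  by (auto simp: tensor_complex_def)

lemma chi_zero_K: "S \<subseteq> U \<Longrightarrow> card S = m \<Longrightarrow> \<zero>\<^bsub>cterm KC m\<^esub> (chi t S) = \<zero>\<^bsub>TK (chi t S)\<^esub>"
  using chi_props(3)[of S t] by (auto simp: KC_term prod_module_def)
lemma chi_zero_C: "S \<subseteq> U \<Longrightarrow> card S = m \<Longrightarrow> \<zero>\<^bsub>cterm CC m\<^esub> (chi t S) = \<zero>\<^bsub>TC (chi t S)\<^esub>"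
  using chi_props(3)[of S t] by (auto simp: CC_term prod_module_def)

lemma KC_zero_iff:
  assumes w: "\<omega> \<in> carrier (cterm KC m)" and c: "Kcoord m \<omega> c"
  shows "\<omega> = \<zero>\<^bsub>cterm KC m\<^esub> \<longleftrightarrow> (\<forall>S\<subseteq>U. card S = m \<longrightarrow> c S = \<zero>)"
proof -
  have cc: "coch c" using c by (simp add: has_coords_def)
  have "\<omega> (chi t S) = \<zero>\<^bsub>TK (chi t S)\<^esub> \<longleftrightarrow> c S = \<zero>" if S: "S \<subseteq> U" "card S = m" for S
  proof -
    interpret module R "TK (chi t S)" by (rule TK_module)
    have "\<omega> (chi t S) = c S \<odot>\<^bsub>TK (chi t S)\<^esub> iota (chi t S)" using c S by (simp add: has_coords_def)
    then show ?thesis using iota_props(1,3)[OF chi_props(1)[OF S(1)]] cc by auto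
  qed
  moreover have "\<omega> = \<zero>\<^bsub>cterm KC m\<^esub> \<longleftrightarrow> (\<forall>S\<subseteq>U. card S = m \<longrightarrow> \<omega> (chi t S) = \<zero>\<^bsub>TK (chi t S)\<^esub>)"
    using KC_eqI[OF w abelian_monoid.zero_closed[OF abelian_group.axioms(1)[OF KC_group]]] chi_zero_K by auto
  ultimately show ?thesis by simp
qed

lemma cocycle_iff:
  assumes w: "\<omega> \<in> carrier (cterm KC n)" and c: "Kcoord n \<omega> c"
  shows "\<omega> \<in> cocycles KC n \<longleftrightarrow> kclosed {\<zero>} z U n c"
proof -
  have "cdiff KC n \<omega> \<in> carrier (cterm KC (Suc n))" using KC_additive w by (auto simp: additive_map_def)
  then show ?thesis using KC_zero_iff[of "cdiff KC n \<omega>" "Suc n" "kd z c"] K_diff_coord[OF c] w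
    by (simp add: cocycles_def kclosed_zero_iff KC_diff)
qed

lemma coboundary_iff:
  assumes w: "\<omega> \<in> carrier (cterm KC n)" and c: "Kcoord n \<omega> c"
  shows "\<omega> \<in> coboundaries KC n \<longleftrightarrow> kexact {\<zero>} z U n c"
proof (cases n)
  case 0
  have cc: "coch c" using c by (simp add: has_coords_def)
  have "(\<forall>S\<subseteq>U. card S = 0 \<longrightarrow> c S = \<zero>) \<longleftrightarrow> c {} = \<zero>" using finite_subset[OF _ finite_lessThan[of t]] by auto
  then show ?thesis using KC_zero_iff[OF w c] kexact_0[OF cc zeroideal finite_lessThan] 0 by (simp add: coboundaries_def)
next
  case (Suc m)
  have cc: "coch c" using c by (simp add: has_coords_def)
  show ?thesis
  proof
    assume "\<omega> \<in> coboundaries KC n"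
    then obtain \<eta> where e: "\<eta> \<in> carrier (cterm KC m)" "\<omega> = tensor_diff R t K m \<eta>" using Suc by (auto simp: coboundaries_def KC_diff)
    obtain b where b: "Kcoord m \<eta> b" using Kcoord_exists[OF e(1)] by blast
    have bc: "coch b" using b by (simp add: has_coords_def)
    have "c S = kd z b S" if S: "S \<subseteq> U" "card S = n" for S
    proof (rule iota_inj[OF chi_props(1)[OF S(1)]])
      show "c S \<odot>\<^bsub>TK (chi t S)\<^esub> iota (chi t S) = kd z b S \<odot>\<^bsub>TK (chi t S)\<^esub> iota (chi t S)"
        using c K_diff_coord[OF b] S e Suc unfolding has_coords_def by metis
    qed (use cc bc z_seq in auto)
    then show "kexact {\<zero>} z U n c" by (rule kexact_zeroI[OF cc z_seq bc])
  next
    assume "kexact {\<zero>} z U n c"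
    then obtain b where b: "coch b" "\<And>S. S \<subseteq> U \<Longrightarrow> card S = n \<Longrightarrow> c S = kd z b S" using kexact_zero_iff[OF cc z_seq] by blast
    obtain \<eta> where e: "\<eta> \<in> carrier (cterm KC m)" "Kcoord m \<eta> b" using Kcoord_realize[OF b(1)] by blast
    have d: "cdiff KC m \<eta> \<in> carrier (cterm KC n)" using KC_additive e Suc by (auto simp: additive_map_def)
    have "\<omega> = cdiff KC m \<eta>"
    proof (rule KC_eqI[OF w d])
      fix S assume S: "S \<subseteq> U" "card S = n"
      show "\<omega> (chi t S) = cdiff KC m \<eta> (chi t S)"
        using c K_diff_coord[OF e(2)] S Suc b(2)[OF S] unfolding has_coords_def KC_diff by simp
    qed
    then show "\<omega> \<in> coboundaries KC n" using e Suc by (auto simp: coboundaries_def)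
  qed
qed

text \<open>
  If the image of \<open>\<omega>\<close> is the coboundary of a Cech cochain with coordinates \<open>b\<close> and exponent \<open>k\<close>, then
  \<open>z\<^sub>S\<^sup>k\<^sup>-\<^sup>1 c S\<close> and \<open>d b S\<close>, with \<open>d\<close> the differential for the \<open>k\<close>-th powers, agree up to a factor
  \<open>z\<^sub>S\<^sup>l\<close>. One \<open>l\<close> serves for all \<open>S\<close>. Rescaling \<open>b\<close> absorbs this factor and leads to the exponent
  \<open>k (l + 1)\<close>, hence to the parameter \<open>k l + (k - 1)\<close> of \<open>pw\<close> and \<open>tau\<close>, which is one less.
\<close>

lemma image_coboundary_iff:
  assumes w: "\<omega> \<in> carrier (cterm KC n)" and c: "Kcoord n \<omega> c"
  shows "PHI n \<omega> \<in> coboundaries CC n \<longleftrightarrow> (\<exists>k. kexact {\<zero>} (pw z k U) U n (tau z k U c))"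
proof -
  have cc: "coch c" using c by (simp add: has_coords_def)
  have pc: "Ccoord n 1 (PHI n \<omega>) c" by (rule PHI_coord[OF c])
  have pw': "PHI n \<omega> \<in> carrier (cterm CC n)" using PHI_additive w by (auto simp: additive_map_def)
  have tc: "coch (tau z k U c)" "seqR (pw z k U)" for k using tau_closed[OF z_seq cc] pw_closed[OF z_seq] by auto
  have tS: "tau z k U b S = zp S k \<otimes> b S" if "S \<subseteq> U" for k S b using that by (simp add: tau_def Int_absorb2)
  show ?thesis
  proof (cases n)
    case 0
    have sub: "S \<subseteq> U \<Longrightarrow> card S = 0 \<longleftrightarrow> S = {}" for S using finite_subset[OF _ finite_lessThan[of t]] by auto
    have "PHI n \<omega> = \<zero>\<^bsub>cterm CC n\<^esub> \<longleftrightarrow> PHI n \<omega> (chi t {}) = \<zero>\<^bsub>TC (chi t {})\<^esub>"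
      using CC_eqI[OF pw' abelian_monoid.zero_closed[OF abelian_group.axioms(1)[OF CC_group]]] chi_zero_C[of _ n] 0 sub by auto
    also have "\<dots> \<longleftrightarrow> c {} \<odot>\<^bsub>TC (chi t {})\<^esub> kappa (chi t {}) 1 = \<zero>\<^bsub>TC (chi t {})\<^esub>" using pc 0 by (simp add: has_coords_def)
    also have "\<dots> \<longleftrightarrow> c {} = \<zero>" using kappa_props(4)[OF chi_props(1), of "{}" "c {}" 1] chi_props(2)[of "{}" t] cc by simp
    also have "\<dots> \<longleftrightarrow> (\<exists>k. kexact {\<zero>} (pw z k U) U n (tau z k U c))"
    proof -
      have "kexact {\<zero>} (pw z k U) U 0 (tau z k U c) \<longleftrightarrow> tau z k U c {} \<in> {\<zero>}" for k
        by (rule kexact_0[OF tc(1) zeroideal finite_lessThan])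
      moreover have "tau z k U c {} = c {}" for k using cc by (simp add: tau_def)
      ultimately show ?thesis using 0 by simp
    qed
    finally show ?thesis using 0 by (simp add: coboundaries_def)
  next
    case (Suc m)
    show ?thesis
    proof
      assume "PHI n \<omega> \<in> coboundaries CC n"
      then obtain \<eta> where e: "\<eta> \<in> carrier (cterm CC m)" "PHI n \<omega> = tensor_diff R t C m \<eta>" using Suc by (auto simp: coboundaries_def CC_diff)
      obtain k b where k: "k > 0" and b: "Ccoord m k \<eta> b" using Ccoord_exists[OF e(1)] by blast
      have bc: "coch b" using b by (simp add: has_coords_def)
      let ?y = "\<lambda>i. z i [^] k"
      have ys: "seqR ?y" using z_seq by simp
      have "\<exists>l. S \<subseteq> U \<and> card S = n \<longrightarrow> zp S l \<otimes> (zp S (k - 1) \<otimes> c S \<ominus> kd ?y b S) = \<zero>" for S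
      proof (cases "S \<subseteq> U \<and> card S = n")
        case True
        then have S: "S \<subseteq> U" "card S = n" by auto
        note g = chi_props[OF S(1)] and kc = kappa_props(1)[OF chi_props(1)[OF S(1)]]
        let ?a = "zp S (k - 1) \<otimes> c S" and ?b = "kd ?y b S"
        have ab: "?a \<in> carrier R" "?b \<in> carrier R" using zp_closed cc kd_closed[OF bc ys] by auto
        have "?a \<odot>\<^bsub>TC (chi t S)\<^esub> kappa (chi t S) k = c S \<odot>\<^bsub>TC (chi t S)\<^esub> kappa (chi t S) 1"
          using kappa_shift[OF g(1), of "c S" 1 "k - 1"] cc g(2) k by simp
        also have "\<dots> = ?b \<odot>\<^bsub>TC (chi t S)\<^esub> kappa (chi t S) k"
          using pc C_diff_coord[OF b] e S Suc unfolding has_coords_def by metis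
        finally have eq: "?a \<odot>\<^bsub>TC (chi t S)\<^esub> kappa (chi t S) k = ?b \<odot>\<^bsub>TC (chi t S)\<^esub> kappa (chi t S) k" .
        have "(?a \<ominus> ?b) \<odot>\<^bsub>TC (chi t S)\<^esub> kappa (chi t S) k = \<zero>\<^bsub>TC (chi t S)\<^esub>"
          by (rule module.smult_eq_imp_diff_annihilates[OF TC_module ab kc eq])
        then show ?thesis using kappa_props(4)[OF g(1), of "?a \<ominus> ?b" k] ab g(2) by simp
      qed auto
      then obtain l where l: "\<And>S. S \<subseteq> U \<Longrightarrow> card S = n \<Longrightarrow> zp S (l S) \<otimes> (zp S (k - 1) \<otimes> c S \<ominus> kd ?y b S) = \<zero>" by metis
      let ?l = "\<Sum>S\<in>Pow U. l S"
      let ?k = "k * ?l + (k - 1)"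
      have k': "Suc ?k = k * Suc ?l" using k by simp
      have "tau z ?k U c S = kd (pw z ?k U) (tau ?y ?l U b) S" if S: "S \<subseteq> U" "card S = n" for S
      proof -
        have fS: "finite S" using S finite_subset by blast
        have ll: "l S \<le> ?l" by (rule member_le_sum) (use S in auto)
        then have lk: "l S \<le> k * ?l" using k by (metis One_nat_def Suc_leI le_trans mult_le_mono1 nat_mult_1)
        define p q w where "p = zp S (k - 1) \<otimes> c S" and "q = kd ?y b S" and "w = zp S (k * ?l)"
        have pq: "p \<in> carrier R" "q \<in> carrier R" "w \<in> carrier R" using zp_closed cc kd_closed[OF bc ys] by (auto simp: p_def q_def w_def)
        have "w \<otimes> (p \<ominus> q) = \<zero>" unfolding w_def
          by (rule finprod_nat_pow_mono[where e = "\<lambda>_. l S"]) (use fS z_seq pq l[OF S] lk in \<open>auto simp: p_def q_def\<close>)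
        moreover have "w \<otimes> (p \<ominus> q) = w \<otimes> p \<ominus> w \<otimes> q" using pq by algebra
        ultimately have wpq: "w \<otimes> p = w \<otimes> q" using minus_zero_iff pq by simp
        have "tau z ?k U c S = (w \<otimes> zp S (k - 1)) \<otimes> c S" unfolding tS[OF S(1)] zp_add w_def ..
        also have "\<dots> = w \<otimes> p" using pq zp_closed cc by (simp add: p_def m_assoc)
        also have "\<dots> = w \<otimes> q" by (rule wpq)
        also have "\<dots> = tau ?y ?l U (kd ?y b) S"
        proof -
          have "(\<Otimes>i\<in>S. (z i [^] k) [^] ?l) = w" unfolding w_def
            by (rule finprod_cong') (use z_seq in \<open>auto simp: nat_pow_pow\<close>)
          moreover have "S \<inter> U = S" using S by auto
          ultimately show ?thesis by (simp add: tau_def q_def)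
        qed
        also have "\<dots> = kd (pw ?y ?l U) (tau ?y ?l U b) S" by (rule kd_tau[OF bc ys fS, symmetric])
        also have "\<dots> = kd (pw z ?k U) (tau ?y ?l U b) S"
        proof (rule kd_cong)
          fix i assume "i \<in> S"
          then have iU: "i \<in> U" using S by auto
          have "(z i [^] k) [^] Suc ?l = z i [^] (k * Suc ?l)" using z_seq nat_pow_pow by blast
          then show "pw ?y ?l U i = pw z ?k U i" unfolding pw_def k' using iU by simp
        qed (use tau_closed[OF ys bc] tc in auto)
        finally show ?thesis .
      qed
      then have "kexact {\<zero>} (pw z ?k U) U n (tau z ?k U c)" by (rule kexact_zeroI[OF tc tau_closed[OF ys bc]])
      then show "\<exists>k. kexact {\<zero>} (pw z k U) U n (tau z k U c)" by blast
    next
      assume "\<exists>k. kexact {\<zero>} (pw z k U) U n (tau z k U c)"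
      then obtain k where k: "kexact {\<zero>} (pw z k U) U n (tau z k U c)" ..
      obtain b where b': "coch b \<and> (\<forall>S\<subseteq>U. card S = n \<longrightarrow> tau z k U c S = kd (pw z k U) b S)"
        using k[unfolded kexact_zero_iff[OF tc]] ..
      then have b: "coch b" "\<And>S. S \<subseteq> U \<Longrightarrow> card S = n \<Longrightarrow> tau z k U c S = kd (pw z k U) b S"
        by auto
      obtain \<eta> where e: "\<eta> \<in> carrier (cterm CC m)" "Ccoord m (Suc k) \<eta> b" using Ccoord_realize[OF b(1)] by blast
      have d: "cdiff CC m \<eta> \<in> carrier (cterm CC n)" using CC_additive e Suc by (auto simp: additive_map_def)
      have "PHI n \<omega> = cdiff CC m \<eta>"
      proof (rule CC_eqI[OF pw' d])
        fix S assume S: "S \<subseteq> U" "card S = n"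
        note g = chi_props[OF S(1)]
        have 1: "PHI n \<omega> (chi t S) = (zp S k \<otimes> c S) \<odot>\<^bsub>TC (chi t S)\<^esub> kappa (chi t S) (Suc k)"
          using pc S kappa_shift[OF g(1), of "c S" 1 k] cc g(2) by (simp add: has_coords_def)
        have "kd (\<lambda>i. z i [^] Suc k) b S = kd (pw z k U) b S"
          by (rule kd_cong) (use S b tc in \<open>auto simp: pw_def\<close>)
        then have 2: "kd (\<lambda>i. z i [^] Suc k) b S = zp S k \<otimes> c S" using b(2)[OF S] tS[OF S(1)] by simp
        have "cdiff CC m \<eta> (chi t S) = kd (\<lambda>i. z i [^] Suc k) b S \<odot>\<^bsub>TC (chi t S)\<^esub> kappa (chi t S) (Suc k)"
          using C_diff_coord[OF e(2)] S Suc unfolding has_coords_def CC_diff by blast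
        then show "PHI n \<omega> (chi t S) = cdiff CC m \<eta> (chi t S)" unfolding 1 2 ..
      qed
      then show "PHI n \<omega> \<in> coboundaries CC n" using e Suc by (auto simp: coboundaries_def)
    qed
  qed
qed

lemma coboundaries_K_subgroup: "abelian_subgroup (coboundaries KC n) (cterm KC n)"
  using zero_abelian_subgroup[OF KC_group] additive_map_image_subgroup[OF KC_group KC_group KC_additive]
  by (cases n) (auto simp: coboundaries_def)

lemma coboundaries_C_subgroup: "abelian_subgroup (coboundaries CC n) (cterm CC n)"
  using zero_abelian_subgroup[OF CC_group] additive_map_image_subgroup[OF CC_group CC_group CC_additive]
  by (cases n) (auto simp: coboundaries_def)

lemma cohomology_carrier: "carrier (cohomology D n) = (\<lambda>x. coboundaries D n +>\<^bsub>cterm D n\<^esub> x) ` cocycles D n"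
  unfolding cohomology_def quot_module_carrier by (simp add: a_r_coset_def')

text \<open>
  By additivity only the classes that map to 0 have to be tested, and \<open>image_coboundary_iff\<close> describes these in coordinates.
\<close>

theorem natural_map_inj_iff:
  "inj_on (cohomology_map CC PHI n) (carrier (cohomology KC n)) \<longleftrightarrow> koszul_injective z U n"
proof -
  interpret KG: abelian_group "cterm KC n" by (rule KC_group)
  interpret CG: abelian_group "cterm KC (Suc n)" by (rule KC_group)
  have Zc: "cocycles KC n \<subseteq> carrier (cterm KC n)" by (auto simp: cocycles_def)
  note A = additive_map_group[OF KC_group KC_group KC_additive[where m = n]]
  have hB: "PHI n x \<in> coboundaries CC n" if x: "x \<in> coboundaries KC n" for x
  proof -
    have xc: "x \<in> carrier (cterm KC n)" 
      by (rule additive_subgroup.a_Hcarr[OF abelian_subgroup.axioms(1)[OF coboundaries_K_subgroup] x])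
    obtain c where c: "Kcoord n x c" using Kcoord_exists[OF xc] by blast
    have cc: "coch c" using c by (simp add: has_coords_def)
    have "pw z 0 U = z" using z_seq by (auto simp: pw_def fun_eq_iff)
    moreover have "tau z 0 U c = c" using z_seq cc by (auto simp: tau_def fun_eq_iff)
    ultimately have "kexact {\<zero>} (pw z 0 U) U n (tau z 0 U c)" using coboundary_iff[OF xc c] x by simp
    then show ?thesis using image_coboundary_iff[OF xc c] by blast
  qed
  have Z0: "\<zero>\<^bsub>cterm KC n\<^esub> \<in> cocycles KC n" using A(1) by (simp add: cocycles_def)
  have Zm: "x \<ominus>\<^bsub>cterm KC n\<^esub> y \<in> cocycles KC n" if "x \<in> cocycles KC n" "y \<in> cocycles KC n" for x y
    using that A(3)[of x y] by (simp add: cocycles_def a_minus_def CG.r_neg)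
  have "inj_on (cohomology_map CC PHI n) (carrier (cohomology KC n)) \<longleftrightarrow>
     (\<forall>x\<in>cocycles KC n. PHI n x \<in> coboundaries CC n \<longrightarrow> x \<in> coboundaries KC n)"
    unfolding cohomology_carrier cohomology_map_def[abs_def]
    by (rule quotient_map_inj_iff[OF KC_group CC_group PHI_additive coboundaries_K_subgroup coboundaries_C_subgroup hB Zc Z0 Zm])
  also have "\<dots> \<longleftrightarrow> koszul_injective z U n"
  proof
    assume *: "\<forall>x\<in>cocycles KC n. PHI n x \<in> coboundaries CC n \<longrightarrow> x \<in> coboundaries KC n"
    show "koszul_injective z U n" unfolding koszul_injective_def
    proof (intro allI impI)
      fix c k assume c: "coch c" "kclosed {\<zero>} z U n c" "kexact {\<zero>} (pw z k U) U n (tau z k U c)"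
      obtain \<omega> where w: "\<omega> \<in> carrier (cterm KC n)" "Kcoord n \<omega> c" using Kcoord_realize[OF c(1)] by blast
      show "kexact {\<zero>} z U n c"
        using * cocycle_iff[OF w] image_coboundary_iff[OF w] coboundary_iff[OF w] c by blast
    qed
  next
    assume inj: "koszul_injective z U n"
    show "\<forall>x\<in>cocycles KC n. PHI n x \<in> coboundaries CC n \<longrightarrow> x \<in> coboundaries KC n"
    proof (intro ballI impI)
      fix x assume x: "x \<in> cocycles KC n" "PHI n x \<in> coboundaries CC n"
      have xc: "x \<in> carrier (cterm KC n)" using x Zc by auto
      obtain c where c: "Kcoord n x c" using Kcoord_exists[OF xc] by blast
      have cc: "coch c" using c by (simp add: has_coords_def)
      obtain k where "kexact {\<zero>} (pw z k U) U n (tau z k U c)" using image_coboundary_iff[OF xc c] x by blast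
      then have "kexact {\<zero>} z U n c" using koszul_injectiveD[OF inj cc] cocycle_iff[OF xc c] x by blast
      then show "x \<in> coboundaries KC n" using coboundary_iff[OF xc c] by blast
    qed
  qed
  finally show ?thesis .
qed

end

text \<open>
  For every \<open>\<mm>\<close>-primary ideal the injectivity of the natural map characterizes the Cohen-Macaulay property, so it holds
  for all of them or for none.
\<close>

lemma (in local_ring) natural_map_inj_iff_Cohen_Macaulay:
  assumes "primary_to R \<mm> a" "minimal_generators R a zs" "krull_dim R = enat n"
  shows "inj_on (natural_map R zs n) (carrier (koszul_cohomology R zs n)) \<longleftrightarrow> Cohen_Macaulay R \<mm>"
proof -
  note m = primary_to_max_radical[OF assms(1,2)]
  interpret koszul_cech R "\<lambda>i. zs ! i" "length zs"
    by unfold_locales (use m(2) nth_mem in blast)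
  have z: "z = (\<lambda>i. if i < length zs then zs ! i else \<zero>)" by (simp add: z_def fun_eq_iff)
  have "inj_on (natural_map R zs n) (carrier (koszul_cohomology R zs n)) \<longleftrightarrow> koszul_injective z {..<length zs} n"
    using natural_map_inj_iff[of n]
    unfolding natural_map_def koszul_cohomology_def koszul_complex_def cech_complex_def koszul_to_cech_def .
  then show ?thesis using Cohen_Macaulay_iff_koszul_injective[OF z_seq _ assms(3)] m(1) z by simp
qed

theorem theorem3p1:
  fixes A :: "('a, 'm) ring_scheme" and \<mm> :: "'a set" and n :: nat
  assumes "local_ring A \<mm>" and "krull_dim A = enat n"
  shows
    "(Cohen_Macaulay A \<mm> \<longleftrightarrow>
       (\<forall>\<aa>. primary_to A \<mm> \<aa> \<longrightarrow>
          (\<forall>zs. minimal_generators A \<aa> zs \<longrightarrow>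
             inj_on (natural_map A zs n) (carrier (koszul_cohomology A zs n))))) \<and>
     (Cohen_Macaulay A \<mm> \<longleftrightarrow>
       (\<exists>\<aa>. primary_to A \<mm> \<aa> \<and>
          (\<exists>zs. minimal_generators A \<aa> zs \<and>
             inj_on (natural_map A zs n) (carrier (koszul_cohomology A zs n)))))"
proof -
  interpret local_ring A \<mm> by (rule assms(1))
  note iff = natural_map_inj_iff_Cohen_Macaulay[OF _ _ assms(2)]
  (* The ideal m itself is m-primary and has minimal generators, so there is something to test. *)
  obtain zs where "minimal_generators A \<mm> zs" using minimal_generators_exist[OF max_closed] by blast
  then show ?thesis using iff primary_to_max by blast
qed

end
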